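(* Let $k$ be a commutative ring, let $\mathbf{U}$ be a complete and cartesian closed category, and let $\mathbb{R}$ be a commutative $k$-algebra object in $\mathbf{U}$. Then the quadruple $$\left(\mathcal{K}_{\mathbf{U}},\ \mathbb{R}_{\mathbf{U}},\ \mathbf{T}_{\mathbf{U}},\ \alpha^{\mathbf{U}}\right)$$ is a DG-category.
   Context: Weil algebras. A Weil $k$-algebra is a commutative $k$-algebra $W$ with a given $k$-module decomposition $W=k\cdot 1\oplus\mathfrak{m}$, where $\mathfrak m$ is a nilpotent ideal, and whose underlying module is $k^n$ for some $n\ge 1$, with unit $1=(1,0,\dots,0)$ and $\mathfrak m$ the set of elements with first coordinate $0$. Morphisms are $k$-algebra homomorphisms compatible with the augmentations $W\to k$. The category is denoted $\mathbf{Weil}_k$; $\otimes_k$ is the tensor product of $k$-algebras (again a Weil $k$-algebra, using the tensor basis). The functor $\mathbb{A}\,\underline{\otimes}_k\,\cdot$. If $\mathcal{K}$ is a category with finite limits and $\mathbb{A}$ is a commutative $k$-algebra object in $\mathcal{K}$, then $\mathbb{A}\,\underline{\otimes}_k\,\cdot$ is the canonical functor from $\mathbf{Weil}_k$ to the category of $k$-algebra objects in $\mathcal K$ sending $W$ with underlying module $k^n$ to $\mathbb{A}^n$ with the multiplication given by the structure constants of $W$, and sending $\varphi:W_1\to W_2$ to the morphism $\mathbb{A}^{n_1}\to\mathbb{A}^{n_2}$ given by the matrix of $\varphi$. DG-category. A DG-category is a quadruple $(\mathcal{K},\mathbb{A},\mathbf{T},\alpha)$ where: (1) $\mathcal{K}$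 is a category which is left exact (has finite limits) and cartesian closed. (2) $\mathbb{A}$ is a commutative $k$-algebra object in $\mathcal{K}$. (3) For each Weil $k$-algebra $W$, $\mathbf{T}^W:\mathcal{K}\to\mathcal{K}$ is a left exact functor, such that $\mathbf{T}^k$ is the identity functor and $\mathbf{T}^{W_2}\circ\mathbf{T}^{W_1}=\mathbf{T}^{W_1\otimes_k W_2}$ for all Weil $k$-algebras $W_1,W_2$. (4) $\mathbf{T}^W\mathbb{A}=\mathbb{A}\,\underline{\otimes}_k\,W$ for every Weil $k$-algebra $W$. (5) For each morphism $\varphi:W_1\to W_2$ in $\mathbf{Weil}_k$, $\alpha_\varphi:\mathbf{T}^{W_1}\to\mathbf{T}^{W_2}$ is a natural transformation, with $\alpha_\psi\cdot\alpha_\varphi=\alpha_{\psi\circ\varphi}$ for all $\varphi:W_1\to W_2$, $\psi:W_2\to W_3$, and $\alpha_{\mathrm{id}_W}=\mathrm{id}_{\mathbf{T}^W}$ for every $W$. (6) $\alpha_\varphi(\mathbb{A})=\mathbb{A}\,\underline{\otimes}_k\,\varphi$ for every morphism $\varphi:W_1\to W_2$ in $\mathbf{Weil}_k$. Equalities of functors and objects in (3), (4), (6) are understood modulo the canonical isomorphisms coming from the unit, associativity and symmetry of $\otimes_k$ (e.g. $W\otimes_k k\cong W$, $(W\otimes_k W_1)\otimes_k W_2\cong W\otimes_k(W_1\otimes_k W_2)$) and the canonical $(\mathbb{A}\,\underline{\otimes}_k W)\,\underline{\otimes}_k W'\cong\mathbb{A}\,\underline{\otimes}_k(W\otimes_k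 W')$. The specific data. $\mathcal{K}_{\mathbf{U}}$ is the category of functors $\mathbf{Weil}_k\to\mathbf{U}$ and natural transformations. $\mathbb{R}_{\mathbf{U}}$ is the functor $\mathbb{R}\,\underline{\otimes}_k\,\_:\mathbf{Weil}_k\to\mathbf{U}$, with its objectwise $k$-algebra structure making it a $k$-algebra object in $\mathcal{K}_{\mathbf U}$. For a Weil $k$-algebra $W$, $\mathbf{T}_{\mathbf{U}}^W:\mathcal{K}_{\mathbf{U}}\to\mathcal{K}_{\mathbf{U}}$ is precomposition with $\_\otimes_k W$, i.e. $\mathbf{T}_{\mathbf{U}}^W(M)=M(\_\otimes_k W)$; $\mathbf{T}_{\mathbf U}$ denotes the assignment $W\mapsto \mathbf{T}_{\mathbf U}^W$. For $\varphi:W_1\to W_2$ in $\mathbf{Weil}_k$, $\alpha^{\mathbf{U}}_\varphi:\mathbf{T}_{\mathbf{U}}^{W_1}\Rightarrow\mathbf{T}_{\mathbf{U}}^{W_2}$ is the natural transformation whose component at $M$ is the morphism $\alpha^{\mathbf{U}}_\varphi(M)$ of $\mathcal K_{\mathbf U}$ with components $M(W\otimes_k\varphi):M(W\otimes_k W_1)\to M(W\otimes_k W_2)$ for $W$ in $\mathbf{Weil}_k$, where $W\otimes_k\varphi=\mathrm{id}_W\otimes_k\varphi$; $\alpha^{\mathbf U}$ denotes the assignment $\varphi\mapsto\alpha^{\mathbf U}_\varphi$. *)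

theory Defs
  imports Main "HOL-Library.FuncSet"
begin

section \<open>Categories, functors, natural transformations\<close>

record ('o, 'm) cat =
  Ob :: "'o set"
  Ar :: "'m set"
  Dom :: "'m \<Rightarrow> 'o"
  Cod :: "'m \<Rightarrow> 'o"
  Ident :: "'o \<Rightarrow> 'm"
  Cmp :: "'m \<Rightarrow> 'm \<Rightarrow> 'm"  \<comment> \<open>\<open>Cmp C g f\<close> is \<open>g\<close> after \<open>f\<close>\<close>

definition hom :: "('o, 'm) cat \<Rightarrow> 'o \<Rightarrow> 'o \<Rightarrow> 'm set" where
  "hom C a b = {f \<in> Ar C. Dom C f = a \<and> Cod C f = b}"

locale category =
  fixes C :: "('o, 'm) cat"
  assumes dom_ob: "f \<in> Ar C \<Longrightarrow> Dom C f \<in> Ob C"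
    and cod_ob: "f \<in> Ar C \<Longrightarrow> Cod C f \<in> Ob C"
    and ident_hom: "a \<in> Ob C \<Longrightarrow> Ident C a \<in> hom C a a"
    and cmp_hom: "\<lbrakk>f \<in> hom C a b; g \<in> hom C b c\<rbrakk> \<Longrightarrow> Cmp C g f \<in> hom C a c"
    and cmp_assoc: "\<lbrakk>f \<in> hom C a b; g \<in> hom C b c; h \<in> hom C c d\<rbrakk>
      \<Longrightarrow> Cmp C h (Cmp C g f) = Cmp C (Cmp C h g) f"
    and cmp_ident_left: "f \<in> hom C a b \<Longrightarrow> Cmp C (Ident C b) f = f"
    and cmp_ident_right: "f \<in> hom C a b \<Longrightarrow> Cmp C f (Ident C a) = f"

definition iso_hom :: "('o, 'm) cat \<Rightarrow> 'o \<Rightarrow> 'o \<Rightarrow> 'm set" where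
  "iso_hom C a b = {f \<in> hom C a b.
     \<exists>g \<in> hom C b a. Cmp C g f = Ident C a \<and> Cmp C f g = Ident C b}"

record ('a, 'b, 'c, 'd) fctr =
  fob :: "'a \<Rightarrow> 'c"
  far :: "'b \<Rightarrow> 'd"

text \<open>Functors and natural transformations are required to be extensional (\<open>undefined\<close>
  outside the objects and arrows of the source), so that equality in HOL is equality of
  functors and of natural transformations.\<close>

definition is_functor ::
  "('a, 'b) cat \<Rightarrow> ('c, 'd) cat \<Rightarrow> ('a, 'b, 'c, 'd) fctr \<Rightarrow> bool" where
  "is_functor C D F \<longleftrightarrow>
     fob F \<in> Ob C \<rightarrow>\<^sub>E Ob D \<and>
     far F \<in> Ar C \<rightarrow>\<^sub>E Ar D \<and>
     (\<forall>f \<in> Ar C. far F f \<in> hom D (fob F (Dom C f)) (fob F (Cod C f))) \<and>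
     (\<forall>a \<in> Ob C. far F (Ident C a) = Ident D (fob F a)) \<and>
     (\<forall>f \<in> Ar C. \<forall>g \<in> Ar C. Cod C f = Dom C g \<longrightarrow>
        far F (Cmp C g f) = Cmp D (far F g) (far F f))"

definition fid :: "('a, 'b) cat \<Rightarrow> ('a, 'b, 'a, 'b) fctr" where
  "fid C = \<lparr>fob = (\<lambda>a \<in> Ob C. a), far = (\<lambda>f \<in> Ar C. f)\<rparr>"

text \<open>\<open>fcomp C G F\<close> is \<open>G\<close> after \<open>F\<close>, where \<open>C\<close> is the source of \<open>F\<close>.\<close>

definition fcomp ::
  "('a, 'b) cat \<Rightarrow> ('c, 'd, 'e, 'f) fctr \<Rightarrow> ('a, 'b, 'c, 'd) fctr \<Rightarrow> ('a, 'b, 'e, 'f) fctr" where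
  "fcomp C G F = \<lparr>fob = (\<lambda>a \<in> Ob C. fob G (fob F a)), far = (\<lambda>f \<in> Ar C. far G (far F f))\<rparr>"

record ('a, 'b, 'c, 'd) ntrans =
  nsrc :: "('a, 'b, 'c, 'd) fctr"
  ntgt :: "('a, 'b, 'c, 'd) fctr"
  ncmp :: "'a \<Rightarrow> 'd"

definition is_ntrans ::
  "('a, 'b) cat \<Rightarrow> ('c, 'd) cat \<Rightarrow> ('a, 'b, 'c, 'd) ntrans \<Rightarrow> bool" where
  "is_ntrans C D t \<longleftrightarrow>
     is_functor C D (nsrc t) \<and> is_functor C D (ntgt t) \<and>
     ncmp t \<in> extensional (Ob C) \<and>
     (\<forall>a \<in> Ob C. ncmp t a \<in> hom D (fob (nsrc t) a) (fob (ntgt t) a)) \<and>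
     (\<forall>f \<in> Ar C. Cmp D (ncmp t (Cod C f)) (far (nsrc t) f)
                = Cmp D (far (ntgt t) f) (ncmp t (Dom C f)))"

definition functor_cat ::
  "('a, 'b) cat \<Rightarrow> ('c, 'd) cat \<Rightarrow> (('a, 'b, 'c, 'd) fctr, ('a, 'b, 'c, 'd) ntrans) cat" where
  "functor_cat C D = \<lparr>
     Ob = {F. is_functor C D F},
     Ar = {t. is_ntrans C D t},
     Dom = nsrc,
     Cod = ntgt,
     Ident = (\<lambda>F. \<lparr>nsrc = F, ntgt = F, ncmp = (\<lambda>a \<in> Ob C. Ident D (fob F a))\<rparr>),
     Cmp = (\<lambda>s t. \<lparr>nsrc = nsrc t, ntgt = ntgt s,
                  ncmp = (\<lambda>a \<in> Ob C. Cmp D (ncmp s a) (ncmp t a))\<rparr>)\<rparr>"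


section \<open>Limits and cartesian closedness\<close>

definition is_cone ::
  "('i, 'j) cat \<Rightarrow> ('o, 'm) cat \<Rightarrow> ('i, 'j, 'o, 'm) fctr \<Rightarrow> 'o \<Rightarrow> ('i \<Rightarrow> 'm) \<Rightarrow> bool" where
  "is_cone J C D L c \<longleftrightarrow>
     L \<in> Ob C \<and> (\<forall>j \<in> Ob J. c j \<in> hom C L (fob D j)) \<and>
     (\<forall>u \<in> Ar J. Cmp C (far D u) (c (Dom J u)) = c (Cod J u))"

definition is_limit ::
  "('i, 'j) cat \<Rightarrow> ('o, 'm) cat \<Rightarrow> ('i, 'j, 'o, 'm) fctr \<Rightarrow> 'o \<Rightarrow> ('i \<Rightarrow> 'm) \<Rightarrow> bool" where
  "is_limit J C D L c \<longleftrightarrow>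
     is_cone J C D L c \<and>
     (\<forall>X d. is_cone J C D X d \<longrightarrow>
        (\<exists>!h. h \<in> hom C X L \<and> (\<forall>j \<in> Ob J. Cmp C (c j) h = d j)))"

definition has_limits_of_shape :: "('i, 'j) cat \<Rightarrow> ('o, 'm) cat \<Rightarrow> bool" where
  "has_limits_of_shape J C \<longleftrightarrow> (\<forall>D. is_functor J C D \<longrightarrow> (\<exists>L c. is_limit J C D L c))"

text \<open>Completeness refers to a notion of smallness: here the small categories are those whose
  objects and arrows are drawn from the index type \<open>'i\<close>.\<close>

definition complete_cat :: "'i itself \<Rightarrow> ('o, 'm) cat \<Rightarrow> bool" where
  "complete_cat I C \<longleftrightarrow>
     (\<forall>J :: ('i, 'i) cat. category J \<longrightarrow> has_limits_of_shape J C)"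

text \<open>Every finite category is isomorphic to one whose objects and arrows are natural numbers.\<close>

definition finite_shape :: "(nat, nat) cat \<Rightarrow> bool" where
  "finite_shape J \<longleftrightarrow> category J \<and> finite (Ob J) \<and> finite (Ar J)"

definition left_exact_cat :: "('o, 'm) cat \<Rightarrow> bool" where
  "left_exact_cat C \<longleftrightarrow> (\<forall>J. finite_shape J \<longrightarrow> has_limits_of_shape J C)"

definition left_exact_functor ::
  "('a, 'b) cat \<Rightarrow> ('c, 'd) cat \<Rightarrow> ('a, 'b, 'c, 'd) fctr \<Rightarrow> bool" where
  "left_exact_functor C D F \<longleftrightarrow>
     is_functor C D F \<and>
     (\<forall>J G L c. finite_shape J \<longrightarrow> is_functor J C G \<longrightarrow> is_limit J C G L c \<longrightarrow>
        is_limit J D (fcomp J F G) (fob F L) (\<lambda>j. far F (c j)))"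

definition is_terminal :: "('o, 'm) cat \<Rightarrow> 'o \<Rightarrow> bool" where
  "is_terminal C t \<longleftrightarrow> t \<in> Ob C \<and> (\<forall>X \<in> Ob C. \<exists>!h. h \<in> hom C X t)"

definition is_product :: "('o, 'm) cat \<Rightarrow> 'o \<Rightarrow> 'o \<Rightarrow> 'o \<Rightarrow> 'm \<Rightarrow> 'm \<Rightarrow> bool" where
  "is_product C A B P p q \<longleftrightarrow>
     p \<in> hom C P A \<and> q \<in> hom C P B \<and>
     (\<forall>X \<in> Ob C. \<forall>f \<in> hom C X A. \<forall>g \<in> hom C X B.
        \<exists>!h. h \<in> hom C X P \<and> Cmp C p h = f \<and> Cmp C q h = g)"

text \<open>\<open>E\<close> with \<open>ev : E \<times> A \<rightarrow> B\<close> is an exponential: every \<open>g : X \<times> A \<rightarrow> B\<close> is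
  \<open>ev \<circ> (h \<times> A)\<close> for a unique \<open>h : X \<rightarrow> E\<close>. Here \<open>P\<close> and \<open>Q\<close> are products \<open>E \<times> A\<close> and
  \<open>X \<times> A\<close>, and \<open>u\<close> is \<open>h \<times> A\<close>.\<close>

definition is_exponential ::
  "('o, 'm) cat \<Rightarrow> 'o \<Rightarrow> 'o \<Rightarrow> 'o \<Rightarrow> 'o \<Rightarrow> 'm \<Rightarrow> 'm \<Rightarrow> 'm \<Rightarrow> bool" where
  "is_exponential C A B E P p q ev \<longleftrightarrow>
     E \<in> Ob C \<and> is_product C E A P p q \<and> ev \<in> hom C P B \<and>
     (\<forall>X Q r s g. X \<in> Ob C \<longrightarrow> is_product C X A Q r s \<longrightarrow> g \<in> hom C Q B \<longrightarrow>
        (\<exists>!h. h \<in> hom C X E \<and>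
           (\<exists>u \<in> hom C Q P. Cmp C p u = Cmp C h r \<and> Cmp C q u = s \<and> Cmp C ev u = g)))"

definition cartesian_closed :: "('o, 'm) cat \<Rightarrow> bool" where
  "cartesian_closed C \<longleftrightarrow>
     (\<exists>t. is_terminal C t) \<and>
     (\<forall>A \<in> Ob C. \<forall>B \<in> Ob C. \<exists>P p q. is_product C A B P p q) \<and>
     (\<forall>A \<in> Ob C. \<forall>B \<in> Ob C. \<exists>E P p q ev. is_exponential C A B E P p q ev)"


section \<open>Finite powers and \<open>k\<close>-algebra objects\<close>

definition is_power :: "('o, 'm) cat \<Rightarrow> 'o \<Rightarrow> nat \<Rightarrow> 'o \<Rightarrow> (nat \<Rightarrow> 'm) \<Rightarrow> bool" where
  "is_power C A n P p \<longleftrightarrow>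
     P \<in> Ob C \<and> (\<forall>i<n. p i \<in> hom C P A) \<and>
     (\<forall>X \<in> Ob C. \<forall>f. (\<forall>i<n. f i \<in> hom C X A) \<longrightarrow>
        (\<exists>!h. h \<in> hom C X P \<and> (\<forall>i<n. Cmp C (p i) h = f i)))"

text \<open>A choice of the power \<open>A\<^sup>n\<close> and of its projections; \<open>A\<^sup>0\<close> is a terminal object.\<close>

definition pow :: "('o, 'm) cat \<Rightarrow> 'o \<Rightarrow> nat \<Rightarrow> 'o \<times> (nat \<Rightarrow> 'm)" where
  "pow C A n = (SOME (P, p). is_power C A n P p)"

definition pow_ob :: "('o, 'm) cat \<Rightarrow> 'o \<Rightarrow> nat \<Rightarrow> 'o" where
  "pow_ob C A n = fst (pow C A n)"

definition pow_pr :: "('o, 'm) cat \<Rightarrow> 'o \<Rightarrow> nat \<Rightarrow> nat \<Rightarrow> 'm" where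
  "pow_pr C A n = snd (pow C A n)"

text \<open>The arrow \<open>\<langle>f 0, \<dots>, f (n - 1)\<rangle> : X \<rightarrow> A\<^sup>n\<close>.\<close>

definition tup :: "('o, 'm) cat \<Rightarrow> 'o \<Rightarrow> nat \<Rightarrow> 'o \<Rightarrow> (nat \<Rightarrow> 'm) \<Rightarrow> 'm" where
  "tup C A n X f =
     (THE h. h \<in> hom C X (pow_ob C A n) \<and> (\<forall>i<n. Cmp C (pow_pr C A n i) h = f i))"

text \<open>The operations of an algebra object are arrows \<open>A\<^sup>2 \<rightarrow> A\<close>, \<open>A\<^sup>0 \<rightarrow> A\<close>, \<open>A \<rightarrow> A\<close>; the last
  field is multiplication by each scalar of \<open>k\<close>, the ring carried by the type \<open>'k\<close>.\<close>

record ('k, 'o, 'm) kalg =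
  acar :: 'o
  aadd :: 'm
  amul :: 'm
  azero :: 'm
  aone :: 'm
  aneg :: 'm
  ascal :: "'k \<Rightarrow> 'm"

text \<open>The value of a binary operation at generalised elements \<open>f, g : X \<rightarrow> A\<close>, and of a constant at
  stage \<open>X\<close>.\<close>

definition ap2 :: "('o, 'm) cat \<Rightarrow> 'o \<Rightarrow> 'm \<Rightarrow> 'm \<Rightarrow> 'm \<Rightarrow> 'm" where
  "ap2 C A w f g = Cmp C w (tup C A 2 (Dom C f) (\<lambda>i. if i = 0 then f else g))"

definition ap0 :: "('o, 'm) cat \<Rightarrow> 'o \<Rightarrow> 'm \<Rightarrow> 'o \<Rightarrow> 'm" where
  "ap0 C A w X = Cmp C w (tup C A 0 X (\<lambda>_. undefined))"

text \<open>The sum of \<open>f 0, \<dots>, f (n - 1) : X \<rightarrow> A\<close>.\<close>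

primrec asum :: "('o, 'm) cat \<Rightarrow> ('k, 'o, 'm) kalg \<Rightarrow> 'o \<Rightarrow> nat \<Rightarrow> (nat \<Rightarrow> 'm) \<Rightarrow> 'm" where
  "asum C A X 0 f = ap0 C (acar A) (azero A) X"
| "asum C A X (Suc n) f = ap2 C (acar A) (aadd A) (asum C A X n f) (f n)"

text \<open>Coefficient rings \<open>k\<close> are types of sort \<open>{comm_ring, comm_monoid_mult}\<close>: these are the
  commutative rings with unit, including the zero ring, which \<open>comm_ring_1\<close> would exclude.

  The axioms of commutative \<open>k\<close>-algebras are commuting diagrams \<open>A\<^sup>3 \<rightarrow> A\<close>, written in terms of
  the three projections \<open>x\<close>, \<open>y\<close>, \<open>z\<close>.\<close>

definition kalg_object ::
  "('o, 'm) cat \<Rightarrow> ('k::{comm_ring, comm_monoid_mult}, 'o, 'm) kalg \<Rightarrow> bool" where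
  "kalg_object C A \<longleftrightarrow>
    (let a = acar A; X = pow_ob C a 3;
         x = pow_pr C a 3 0; y = pow_pr C a 3 1; z = pow_pr C a 3 2;
         add = ap2 C a (aadd A); mul = ap2 C a (amul A);
         zero = ap0 C a (azero A) X; one = ap0 C a (aone A) X;
         neg = Cmp C (aneg A); scal = (\<lambda>c. Cmp C (ascal A c))
     in
      a \<in> Ob C \<and>
      aadd A \<in> hom C (pow_ob C a 2) a \<and> amul A \<in> hom C (pow_ob C a 2) a \<and>
      azero A \<in> hom C (pow_ob C a 0) a \<and> aone A \<in> hom C (pow_ob C a 0) a \<and>
      aneg A \<in> hom C a a \<and> (\<forall>c. ascal A c \<in> hom C a a) \<and>
      add (add x y) z = add x (add y z) \<and> add x y = add y x \<and>
      add zero x = x \<and> add (neg x) x = zero \<and>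
      mul (mul x y) z = mul x (mul y z) \<and> mul x y = mul y x \<and>
      mul one x = x \<and> mul (add x y) z = add (mul x z) (mul y z) \<and>
      (\<forall>c. scal c (add x y) = add (scal c x) (scal c y)) \<and>
      (\<forall>c d. scal (c + d) x = add (scal c x) (scal d x)) \<and>
      (\<forall>c d. scal (c * d) x = scal c (scal d x)) \<and>
      scal 1 x = x \<and>
      (\<forall>c. scal c (mul x y) = mul (scal c x) y))"

definition kalg_hom ::
  "('o, 'm) cat \<Rightarrow> ('k, 'o, 'm) kalg \<Rightarrow> ('k, 'o, 'm) kalg \<Rightarrow> 'm \<Rightarrow> bool" where
  "kalg_hom C A B f \<longleftrightarrow>
    (let a = acar A; b = acar B;
         x = pow_pr C a 2 0; y = pow_pr C a 2 1
     in
      f \<in> hom C a b \<and>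
      Cmp C f (aadd A) = ap2 C b (aadd B) (Cmp C f x) (Cmp C f y) \<and>
      Cmp C f (amul A) = ap2 C b (amul B) (Cmp C f x) (Cmp C f y) \<and>
      Cmp C f (azero A) = ap0 C b (azero B) (pow_ob C a 0) \<and>
      Cmp C f (aone A) = ap0 C b (aone B) (pow_ob C a 0) \<and>
      Cmp C f (aneg A) = Cmp C (aneg B) f \<and>
      (\<forall>c. Cmp C f (ascal A c) = Cmp C (ascal B c) f))"

definition kalg_iso ::
  "('o, 'm) cat \<Rightarrow> ('k, 'o, 'm) kalg \<Rightarrow> ('k, 'o, 'm) kalg \<Rightarrow> 'm \<Rightarrow> bool" where
  "kalg_iso C A B f \<longleftrightarrow> kalg_hom C A B f \<and> f \<in> iso_hom C (acar A) (acar B)"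

text \<open>The image of an algebra object under a functor \<open>F : C \<rightarrow> D\<close> preserving finite products. The
  arrow \<open>pow_cmp C D F a n : (F a)\<^sup>n \<rightarrow> F (a\<^sup>n)\<close> is the comparison between the chosen powers.\<close>

definition pow_cmp ::
  "('a, 'b) cat \<Rightarrow> ('c, 'd) cat \<Rightarrow> ('a, 'b, 'c, 'd) fctr \<Rightarrow> 'a \<Rightarrow> nat \<Rightarrow> 'd" where
  "pow_cmp C D F a n =
     (THE h. h \<in> hom D (pow_ob D (fob F a) n) (fob F (pow_ob C a n)) \<and>
        (\<forall>i<n. Cmp D (far F (pow_pr C a n i)) h = pow_pr D (fob F a) n i))"

definition map_kalg ::
  "('a, 'b) cat \<Rightarrow> ('c, 'd) cat \<Rightarrow> ('a, 'b, 'c, 'd) fctr \<Rightarrow> ('k, 'a, 'b) kalg \<Rightarrow>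
    ('k, 'c, 'd) kalg" where
  "map_kalg C D F A =
    (let cmp = pow_cmp C D F (acar A)
     in \<lparr>acar = fob F (acar A),
         aadd = Cmp D (far F (aadd A)) (cmp 2),
         amul = Cmp D (far F (amul A)) (cmp 2),
         azero = Cmp D (far F (azero A)) (cmp 0),
         aone = Cmp D (far F (aone A)) (cmp 0),
         aneg = far F (aneg A),
         ascal = (\<lambda>c. far F (ascal A c))\<rparr>)"


section \<open>Weil algebras\<close>

text \<open>An algebra structure on \<open>k\<^sup>n\<close> is given by its structure constants,
  \<open>e\<^sub>i e\<^sub>j = (\<Sum>l<n. sc i j l \<cdot> e\<^sub>l)\<close>, and vectors of \<open>k\<^sup>n\<close> are functions on \<open>nat\<close> vanishing from \<open>n\<close>
  on. The augmentation \<open>W \<rightarrow> k\<close> is the coordinate \<open>0\<close>.\<close>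

record 'k weil =
  dim :: nat
  sc :: "nat \<Rightarrow> nat \<Rightarrow> nat \<Rightarrow> 'k"

definition wvec :: "'k::{comm_ring, comm_monoid_mult} weil \<Rightarrow> (nat \<Rightarrow> 'k) set" where
  "wvec W = {x. \<forall>i \<ge> dim W. x i = 0}"

definition wmul ::
  "'k::{comm_ring, comm_monoid_mult} weil \<Rightarrow> (nat \<Rightarrow> 'k) \<Rightarrow> (nat \<Rightarrow> 'k) \<Rightarrow> nat \<Rightarrow> 'k" where
  "wmul W x y = (\<lambda>l. \<Sum>i<dim W. \<Sum>j<dim W. x i * y j * sc W i j l)"

definition wone :: "nat \<Rightarrow> 'k::{comm_ring, comm_monoid_mult}" where
  "wone = (\<lambda>i. if i = 0 then 1 else 0)"

definition wmax :: "'k::{comm_ring, comm_monoid_mult} weil \<Rightarrow> (nat \<Rightarrow> 'k) set" where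
  "wmax W = {x \<in> wvec W. x 0 = 0}"

text \<open>The set \<open>wmax W\<close> is a \<open>k\<close>-submodule, complementary to \<open>k \<cdot> 1\<close>, by its very form. It is
  nilpotent if, for some \<open>N\<close>, all products of \<open>N\<close> of its elements vanish.\<close>

definition is_weil :: "'k::{comm_ring, comm_monoid_mult} weil \<Rightarrow> bool" where
  "is_weil W \<longleftrightarrow>
     dim W \<ge> 1 \<and>
     (\<forall>i j l. i \<ge> dim W \<or> j \<ge> dim W \<or> l \<ge> dim W \<longrightarrow> sc W i j l = 0) \<and>
     (\<forall>x \<in> wvec W. \<forall>y \<in> wvec W. wmul W x y = wmul W y x) \<and>
     (\<forall>x \<in> wvec W. \<forall>y \<in> wvec W. \<forall>z \<in> wvec W.
        wmul W (wmul W x y) z = wmul W x (wmul W y z)) \<and>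
     (\<forall>x \<in> wvec W. wmul W wone x = x) \<and>
     (\<forall>x \<in> wvec W. \<forall>y \<in> wmax W. wmul W x y \<in> wmax W) \<and>
     (\<exists>N. \<forall>xs. length xs = N \<and> set xs \<subseteq> wmax W \<longrightarrow> foldr (wmul W) xs wone = (\<lambda>_. 0))"

text \<open>A \<open>k\<close>-linear map between underlying modules, given by its matrix:
  \<open>e\<^sub>j \<mapsto> (\<Sum>i. mat i j \<cdot> e\<^sub>i)\<close>.\<close>

record 'k wmap =
  src :: "'k weil"
  tgt :: "'k weil"
  mat :: "nat \<Rightarrow> nat \<Rightarrow> 'k"

definition wapp ::
  "'k::{comm_ring, comm_monoid_mult} wmap \<Rightarrow> (nat \<Rightarrow> 'k) \<Rightarrow> nat \<Rightarrow> 'k" where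
  "wapp \<phi> x = (\<lambda>i. \<Sum>j<dim (src \<phi>). mat \<phi> i j * x j)"

definition is_weil_hom :: "'k::{comm_ring, comm_monoid_mult} wmap \<Rightarrow> bool" where
  "is_weil_hom \<phi> \<longleftrightarrow>
     is_weil (src \<phi>) \<and> is_weil (tgt \<phi>) \<and>
     (\<forall>i j. i \<ge> dim (tgt \<phi>) \<or> j \<ge> dim (src \<phi>) \<longrightarrow> mat \<phi> i j = 0) \<and>
     wapp \<phi> wone = wone \<and>
     (\<forall>x \<in> wvec (src \<phi>). \<forall>y \<in> wvec (src \<phi>).
        wapp \<phi> (wmul (src \<phi>) x y) = wmul (tgt \<phi>) (wapp \<phi> x) (wapp \<phi> y)) \<and>
     (\<forall>x \<in> wvec (src \<phi>). wapp \<phi> x 0 = x 0)"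

definition wid :: "'k::{comm_ring, comm_monoid_mult} weil \<Rightarrow> 'k wmap" where
  "wid W = \<lparr>src = W, tgt = W, mat = (\<lambda>i j. if i = j \<and> i < dim W then 1 else 0)\<rparr>"

definition wcomp ::
  "'k::{comm_ring, comm_monoid_mult} wmap \<Rightarrow> 'k wmap \<Rightarrow> 'k wmap" where
  "wcomp \<psi> \<phi> = \<lparr>src = src \<phi>, tgt = tgt \<psi>,
     mat = (\<lambda>i l. \<Sum>j<dim (tgt \<phi>). mat \<psi> i j * mat \<phi> j l)\<rparr>"

definition Weil :: "('k::{comm_ring, comm_monoid_mult} weil, 'k wmap) cat" where
  "Weil = \<lparr>Ob = {W. is_weil W}, Ar = {\<phi>. is_weil_hom \<phi>}, Dom = src, Cod = tgt,
     Ident = wid, Cmp = wcomp\<rparr>"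

definition ground :: "'k::{comm_ring, comm_monoid_mult} weil" where
  "ground = \<lparr>dim = 1, sc = (\<lambda>i j l. if i = 0 \<and> j = 0 \<and> l = 0 then 1 else 0)\<rparr>"

text \<open>The tensor basis is ordered lexicographically: \<open>e\<^sub>i \<otimes> e\<^sub>j\<close> has index \<open>i * dim W\<^sub>2 + j\<close>. With
  this convention the canonical isomorphisms \<open>W \<otimes> k \<cong> W \<cong> k \<otimes> W\<close> and
  \<open>(W\<^sub>1 \<otimes> W\<^sub>2) \<otimes> W\<^sub>3 \<cong> W\<^sub>1 \<otimes> (W\<^sub>2 \<otimes> W\<^sub>3)\<close> are identities.\<close>

definition wtens ::
  "'k::{comm_ring, comm_monoid_mult} weil \<Rightarrow> 'k weil \<Rightarrow> 'k weil" (infixr \<open>\<otimes>\<^sub>W\<close> 70) where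
  "W\<^sub>1 \<otimes>\<^sub>W W\<^sub>2 = (let n = dim W\<^sub>2 in
     \<lparr>dim = dim W\<^sub>1 * n,
      sc = (\<lambda>i j l. sc W\<^sub>1 (i div n) (j div n) (l div n) * sc W\<^sub>2 (i mod n) (j mod n) (l mod n))\<rparr>)"

definition mtens ::
  "'k::{comm_ring, comm_monoid_mult} wmap \<Rightarrow> 'k wmap \<Rightarrow> 'k wmap" (infixr \<open>\<otimes>\<^sub>M\<close> 70) where
  "\<phi> \<otimes>\<^sub>M \<psi> =
     \<lparr>src = src \<phi> \<otimes>\<^sub>W src \<psi>, tgt = tgt \<phi> \<otimes>\<^sub>W tgt \<psi>,
      mat = (\<lambda>i j. mat \<phi> (i div dim (tgt \<psi>)) (j div dim (src \<psi>))
                 * mat \<psi> (i mod dim (tgt \<psi>)) (j mod dim (src \<psi>)))\<rparr>"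

text \<open>The symmetry \<open>W\<^sub>1 \<otimes> W\<^sub>2 \<rightarrow> W\<^sub>2 \<otimes> W\<^sub>1\<close>, \<open>e\<^sub>i \<otimes> e\<^sub>j \<mapsto> e\<^sub>j \<otimes> e\<^sub>i\<close>.\<close>

definition wswap ::
  "'k::{comm_ring, comm_monoid_mult} weil \<Rightarrow> 'k weil \<Rightarrow> 'k wmap" where
  "wswap W\<^sub>1 W\<^sub>2 = \<lparr>src = W\<^sub>1 \<otimes>\<^sub>W W\<^sub>2, tgt = W\<^sub>2 \<otimes>\<^sub>W W\<^sub>1,
     mat = (\<lambda>r c. if r < dim W\<^sub>2 * dim W\<^sub>1 \<and> c < dim W\<^sub>1 * dim W\<^sub>2 \<and>
                     r div dim W\<^sub>1 = c mod dim W\<^sub>2 \<and> r mod dim W\<^sub>1 = c div dim W\<^sub>2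
                  then 1 else 0)\<rparr>"

text \<open>The \<open>j\<close>-th coordinate function \<open>W \<rightarrow> k\<close>, in general only a \<open>k\<close>-linear map.\<close>

definition wcoord :: "'k::{comm_ring, comm_monoid_mult} weil \<Rightarrow> nat \<Rightarrow> 'k wmap" where
  "wcoord W j = \<lparr>src = W, tgt = ground, mat = (\<lambda>r c. if r = 0 \<and> c = j then 1 else 0)\<rparr>"


section \<open>The functor \<open>A \<otimes> _\<close>\<close>

definition tensor_alg ::
  "('o, 'm) cat \<Rightarrow> ('k::{comm_ring, comm_monoid_mult}, 'o, 'm) kalg \<Rightarrow> 'k weil \<Rightarrow>
    ('k, 'o, 'm) kalg" where
  "tensor_alg C A W =
    (let a = acar A; n = dim W; B = pow_ob C a n; pr = pow_pr C a n;
         B2 = pow_ob C B 2; x = pow_pr C B 2 0; y = pow_pr C B 2 1; B0 = pow_ob C B 0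
     in \<lparr>acar = B,
         aadd = tup C a n B2 (\<lambda>l. ap2 C a (aadd A) (Cmp C (pr l) x) (Cmp C (pr l) y)),
         amul = tup C a n B2 (\<lambda>l. asum C A B2 n (\<lambda>i. asum C A B2 n (\<lambda>j.
                  Cmp C (ascal A (sc W i j l))
                    (ap2 C a (amul A) (Cmp C (pr i) x) (Cmp C (pr j) y))))),
         azero = tup C a n B0 (\<lambda>l. ap0 C a (azero A) B0),
         aone = tup C a n B0 (\<lambda>l. ap0 C a (if l = 0 then aone A else azero A) B0),
         aneg = tup C a n B (\<lambda>l. Cmp C (aneg A) (pr l)),
         ascal = (\<lambda>c. tup C a n B (\<lambda>l. Cmp C (ascal A c) (pr l)))\<rparr>)"

definition tensor_map ::
  "('o, 'm) cat \<Rightarrow> ('k::{comm_ring, comm_monoid_mult}, 'o, 'm) kalg \<Rightarrow> 'k wmap \<Rightarrow> 'm" where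
  "tensor_map C A \<phi> =
    (let a = acar A; n = dim (src \<phi>); B = pow_ob C a n
     in tup C a (dim (tgt \<phi>)) B
          (\<lambda>i. asum C A B n (\<lambda>j. Cmp C (ascal A (mat \<phi> i j)) (pow_pr C a n j))))"


section \<open>DG-categories\<close>

text \<open>The equalities in the axioms of a DG-category hold up to canonical isomorphisms. These
  identifications are recorded by
  \<open>\<upsilon> : T\<^sup>k \<cong> Id\<close>, \<open>\<mu> W\<^sub>1 W\<^sub>2 : T\<^bsup>W\<^sub>2\<^esup> \<circ> T\<^bsup>W\<^sub>1\<^esup> \<cong> T\<^bsup>W\<^sub>1 \<otimes> W\<^sub>2\<^esup>\<close> and \<open>\<theta> W : T\<^sup>W A \<cong> A \<otimes> W\<close>;
  the predicate below says that \<open>(K, A, T, \<alpha>)\<close> is a DG-category with respect to them. They are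
  required to be coherent, as they would automatically be if they were identities: \<open>\<upsilon>\<close> and \<open>\<mu>\<close>
  with the unit and associativity of \<open>\<otimes>\<close>, and \<open>\<theta>\<close> with the canonical \<open>A \<otimes> k \<cong> A\<close> and
  \<open>(A \<otimes> W\<^sub>1) \<otimes> W\<^sub>2 \<cong> A \<otimes> (W\<^sub>1 \<otimes> W\<^sub>2)\<close>, which in terms of projections matches the pair \<open>(i, j)\<close>
  with the index \<open>i * dim W\<^sub>2 + j\<close>. The coherence axioms for \<open>\<mu>\<close> use that \<open>\<otimes>\<^sub>W\<close> is strictly unital and
  associative.\<close>

locale dg_category =
  fixes K :: "('o, 'm) cat"
    and A :: "('k::{comm_ring, comm_monoid_mult}, 'o, 'm) kalg"
    and T :: "'k weil \<Rightarrow> ('o, 'm, 'o, 'm) fctr"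
    and \<alpha> :: "'k wmap \<Rightarrow> ('o, 'm, 'o, 'm) ntrans"
    and \<upsilon> :: "('o, 'm, 'o, 'm) ntrans"
    and \<mu> :: "'k weil \<Rightarrow> 'k weil \<Rightarrow> ('o, 'm, 'o, 'm) ntrans"
    and \<theta> :: "'k weil \<Rightarrow> 'm"
  assumes category: "category K"
    and left_exact: "left_exact_cat K"
    and closed: "cartesian_closed K"
    and algebra: "kalg_object K A"
    and T_left_exact: "is_weil W \<Longrightarrow> left_exact_functor K K (T W)"
    and T_unit: "\<upsilon> \<in> iso_hom (functor_cat K K) (T ground) (fid K)"
    and T_tensor: "\<lbrakk>is_weil W\<^sub>1; is_weil W\<^sub>2\<rbrakk> \<Longrightarrow>
      \<mu> W\<^sub>1 W\<^sub>2 \<in> iso_hom (functor_cat K K) (fcomp K (T W\<^sub>2) (T W\<^sub>1)) (T (W\<^sub>1 \<otimes>\<^sub>W W\<^sub>2))"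
    and T_algebra: "is_weil W \<Longrightarrow>
      kalg_iso K (map_kalg K K (T W) A) (tensor_alg K A W) (\<theta> W)"
    and \<alpha>_natural: "is_weil_hom \<phi> \<Longrightarrow> \<alpha> \<phi> \<in> hom (functor_cat K K) (T (src \<phi>)) (T (tgt \<phi>))"
    and \<alpha>_comp: "\<lbrakk>is_weil_hom \<phi>; is_weil_hom \<psi>; tgt \<phi> = src \<psi>\<rbrakk> \<Longrightarrow>
      Cmp (functor_cat K K) (\<alpha> \<psi>) (\<alpha> \<phi>) = \<alpha> (wcomp \<psi> \<phi>)"
    and \<alpha>_id: "is_weil W \<Longrightarrow> \<alpha> (wid W) = Ident (functor_cat K K) (T W)"
    and \<alpha>_algebra: "is_weil_hom \<phi> \<Longrightarrow>
      Cmp K (\<theta> (tgt \<phi>)) (ncmp (\<alpha> \<phi>) (acar A)) = Cmp K (tensor_map K A \<phi>) (\<theta> (src \<phi>))"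
    and coh_unit_left: "\<lbrakk>is_weil W; M \<in> Ob K\<rbrakk> \<Longrightarrow>
      ncmp (\<mu> ground W) M = far (T W) (ncmp \<upsilon> M)"
    and coh_unit_right: "\<lbrakk>is_weil W; M \<in> Ob K\<rbrakk> \<Longrightarrow>
      ncmp (\<mu> W ground) M = ncmp \<upsilon> (fob (T W) M)"
    and coh_assoc: "\<lbrakk>is_weil W\<^sub>1; is_weil W\<^sub>2; is_weil W\<^sub>3; M \<in> Ob K\<rbrakk> \<Longrightarrow>
      Cmp K (ncmp (\<mu> (W\<^sub>1 \<otimes>\<^sub>W W\<^sub>2) W\<^sub>3) M) (far (T W\<^sub>3) (ncmp (\<mu> W\<^sub>1 W\<^sub>2) M)) =
      Cmp K (ncmp (\<mu> W\<^sub>1 (W\<^sub>2 \<otimes>\<^sub>W W\<^sub>3)) M) (ncmp (\<mu> W\<^sub>2 W\<^sub>3) (fob (T W\<^sub>1) M))"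
    and coh_algebra_unit: "Cmp K (pow_pr K (acar A) 1 0) (\<theta> ground) = ncmp \<upsilon> (acar A)"
    and coh_algebra_tensor: "\<lbrakk>is_weil W\<^sub>1; is_weil W\<^sub>2; i < dim W\<^sub>1; j < dim W\<^sub>2\<rbrakk> \<Longrightarrow>
      Cmp K (Cmp K (pow_pr K (acar A) (dim (W\<^sub>1 \<otimes>\<^sub>W W\<^sub>2)) (i * dim W\<^sub>2 + j)) (\<theta> (W\<^sub>1 \<otimes>\<^sub>W W\<^sub>2)))
        (ncmp (\<mu> W\<^sub>1 W\<^sub>2) (acar A)) =
      Cmp K (Cmp K (pow_pr K (acar A) (dim W\<^sub>2) j) (\<theta> W\<^sub>2))
        (far (T W\<^sub>2) (Cmp K (pow_pr K (acar A) (dim W\<^sub>1) i) (\<theta> W\<^sub>1)))"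


section \<open>The quadruple associated with \<open>U\<close> and \<open>R\<close>\<close>

type_synonym ('k, 'o, 'm) wfctr = "('k weil, 'k wmap, 'o, 'm) fctr"
type_synonym ('k, 'o, 'm) wntrans = "('k weil, 'k wmap, 'o, 'm) ntrans"

definition KU :: "('o, 'm) cat \<Rightarrow>
    (('k::{comm_ring, comm_monoid_mult}, 'o, 'm) wfctr, ('k, 'o, 'm) wntrans) cat" where
  "KU U = functor_cat Weil U"

definition RU_functor ::
  "('o, 'm) cat \<Rightarrow> ('k::{comm_ring, comm_monoid_mult}, 'o, 'm) kalg \<Rightarrow> ('k, 'o, 'm) wfctr" where
  "RU_functor U R = \<lparr>fob = (\<lambda>W \<in> Ob Weil. acar (tensor_alg U R W)),
                     far = (\<lambda>\<phi> \<in> Ar Weil. tensor_map U R \<phi>)\<rparr>"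

definition RU ::
  "('o, 'm) cat \<Rightarrow> ('k::{comm_ring, comm_monoid_mult}, 'o, 'm) kalg \<Rightarrow>
    ('k, ('k, 'o, 'm) wfctr, ('k, 'o, 'm) wntrans) kalg" where
  "RU U R =
    (let F = RU_functor U R;
         P2 = pow_ob (KU U) F 2; x = pow_pr (KU U) F 2 0; y = pow_pr (KU U) F 2 1;
         P0 = pow_ob (KU U) F 0;
         op2 = (\<lambda>w. \<lparr>nsrc = P2, ntgt = F, ncmp = (\<lambda>W \<in> Ob Weil.
                  ap2 U (fob F W) (w (tensor_alg U R W)) (ncmp x W) (ncmp y W))\<rparr>);
         op1 = (\<lambda>w. \<lparr>nsrc = F, ntgt = F, ncmp = (\<lambda>W \<in> Ob Weil. w (tensor_alg U R W))\<rparr>);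
         op0 = (\<lambda>w. \<lparr>nsrc = P0, ntgt = F, ncmp = (\<lambda>W \<in> Ob Weil.
                  ap0 U (fob F W) (w (tensor_alg U R W)) (fob P0 W))\<rparr>)
     in \<lparr>acar = F, aadd = op2 aadd, amul = op2 amul, azero = op0 azero, aone = op0 aone,
         aneg = op1 aneg, ascal = (\<lambda>c. op1 (\<lambda>B. ascal B c))\<rparr>)"

definition tens_right ::
  "'k::{comm_ring, comm_monoid_mult} weil \<Rightarrow> ('k, 'k weil, 'k wmap) wfctr" where
  "tens_right W = \<lparr>fob = (\<lambda>V \<in> Ob Weil. V \<otimes>\<^sub>W W), far = (\<lambda>\<phi> \<in> Ar Weil. \<phi> \<otimes>\<^sub>M wid W)\<rparr>"

definition TU ::
  "('o, 'm) cat \<Rightarrow> 'k::{comm_ring, comm_monoid_mult} weil \<Rightarrow>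
    (('k, 'o, 'm) wfctr, ('k, 'o, 'm) wntrans, ('k, 'o, 'm) wfctr, ('k, 'o, 'm) wntrans) fctr" where
  "TU U W =
     \<lparr>fob = (\<lambda>M \<in> Ob (KU U). fcomp Weil M (tens_right W)),
      far = (\<lambda>t \<in> Ar (KU U).
        \<lparr>nsrc = fcomp Weil (nsrc t) (tens_right W),
         ntgt = fcomp Weil (ntgt t) (tens_right W),
         ncmp = (\<lambda>V \<in> Ob Weil. ncmp t (V \<otimes>\<^sub>W W))\<rparr>)\<rparr>"

definition alphaU ::
  "('o, 'm) cat \<Rightarrow> 'k::{comm_ring, comm_monoid_mult} wmap \<Rightarrow>
    (('k, 'o, 'm) wfctr, ('k, 'o, 'm) wntrans, ('k, 'o, 'm) wfctr, ('k, 'o, 'm) wntrans) ntrans" where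
  "alphaU U \<phi> =
     \<lparr>nsrc = TU U (src \<phi>), ntgt = TU U (tgt \<phi>),
      ncmp = (\<lambda>M \<in> Ob (KU U).
        \<lparr>nsrc = fob (TU U (src \<phi>)) M, ntgt = fob (TU U (tgt \<phi>)) M,
         ncmp = (\<lambda>V \<in> Ob Weil. far M (wid V \<otimes>\<^sub>M \<phi>))\<rparr>)\<rparr>"

text \<open>The canonical identifications. Since \<open>W \<otimes> k = W\<close> strictly, the first one is an identity.\<close>

definition upsilonU ::
  "('o, 'm) cat \<Rightarrow>
    (('k::{comm_ring, comm_monoid_mult}, 'o, 'm) wfctr, ('k, 'o, 'm) wntrans,
      ('k, 'o, 'm) wfctr, ('k, 'o, 'm) wntrans) ntrans" where
  "upsilonU U = Ident (functor_cat (KU U) (KU U)) (fid (KU U))"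

text \<open>At \<open>M\<close> and \<open>V\<close>, the second one is \<open>M (V \<otimes> \<sigma>) : M ((V \<otimes> W\<^sub>2) \<otimes> W\<^sub>1) \<rightarrow> M (V \<otimes> (W\<^sub>1 \<otimes> W\<^sub>2))\<close>,
  where \<open>\<sigma>\<close> is the symmetry.\<close>

definition muU ::
  "('o, 'm) cat \<Rightarrow> 'k::{comm_ring, comm_monoid_mult} weil \<Rightarrow> 'k weil \<Rightarrow>
    (('k, 'o, 'm) wfctr, ('k, 'o, 'm) wntrans, ('k, 'o, 'm) wfctr, ('k, 'o, 'm) wntrans) ntrans" where
  "muU U W\<^sub>1 W\<^sub>2 =
     \<lparr>nsrc = fcomp (KU U) (TU U W\<^sub>2) (TU U W\<^sub>1), ntgt = TU U (W\<^sub>1 \<otimes>\<^sub>W W\<^sub>2),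
      ncmp = (\<lambda>M \<in> Ob (KU U).
        \<lparr>nsrc = fob (TU U W\<^sub>2) (fob (TU U W\<^sub>1) M), ntgt = fob (TU U (W\<^sub>1 \<otimes>\<^sub>W W\<^sub>2)) M,
         ncmp = (\<lambda>V \<in> Ob Weil. far M (wid V \<otimes>\<^sub>M wswap W\<^sub>2 W\<^sub>1))\<rparr>)\<rparr>"

text \<open>At \<open>V\<close>, the third one is the canonical \<open>R \<otimes> (V \<otimes> W) \<cong> (R \<otimes> V)\<^sup>n\<close>, \<open>n = dim W\<close>, whose \<open>j\<close>-th
  component is induced by the linear map \<open>V \<otimes> W \<rightarrow> V\<close>, the \<open>j\<close>-th coordinate in \<open>W\<close>.\<close>

definition thetaU ::
  "('o, 'm) cat \<Rightarrow> ('k::{comm_ring, comm_monoid_mult}, 'o, 'm) kalg \<Rightarrow> 'k weil \<Rightarrow>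
    ('k, 'o, 'm) wntrans" where
  "thetaU U R W =
    (let F = RU_functor U R; G = fob (TU U W) F
     in tup (KU U) F (dim W) G (\<lambda>j.
          \<lparr>nsrc = G, ntgt = F,
           ncmp = (\<lambda>V \<in> Ob Weil. tensor_map U R (wid V \<otimes>\<^sub>M wcoord W j))\<rparr>))"

end

theory Submission imports Defs begin

text \<open>
  Let \<open>K\<close> be the category of functors \<open>Weil \<rightarrow> U\<close>. Two of its properties have nothing to do with
  Weil algebras. Limits in \<open>K\<close> are computed pointwise (\<open>pointwise_imp_limit\<close>,
  \<open>limit_imp_pointwise\<close>), so \<open>K\<close> has the limits that \<open>U\<close> has, and \<open>T\<^sup>W\<close>, being precomposition with
  \<open>_ \<otimes> W\<close>, preserves them (\<open>T_limit\<close>). And \<open>K\<close> is cartesian closed, as are functors from any small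
  category to \<open>U\<close> (\<open>functor_cat_cartesian_closed\<close>): an element of \<open>G\<^sup>F\<close> at \<open>V\<close> is a family of elements
  of \<open>(G W)\<^bsup>F W\<^esup>\<close>, indexed by the arrows \<open>V \<rightarrow> W\<close> and natural in \<open>W\<close>, and these families are represented
  by a limit in \<open>U\<close>. The limit is small because an arrow of \<open>Weil\<close> is determined by finitely many
  scalars, so that the arrows of \<open>Weil\<close> can be injected into the index type (\<open>Weil_small\<close>).

  The algebra objects are handled by generalised elements. By the Yoneda lemma \<open>A\<close> is an algebra object
  if and only if the arrows \<open>X \<rightarrow> A\<close> form an algebra, for every \<open>X\<close> (\<open>kalg_object_imp_hom_alg\<close>,
  \<open>kalg_objectI\<close>). An arrow \<open>X \<rightarrow> R \<otimes> W\<close> is a tuple of elements of the algebra \<open>hom X R\<close>; tuples are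
  multiplied by means of the structure constants of \<open>W\<close>, and a linear map \<open>\<phi>\<close> acts by its matrix. So the
  properties of \<open>R \<otimes> W\<close> and \<open>R \<otimes> \<phi>\<close> (\<open>talg_kalg_object\<close>, \<open>tensor_map_op2\<close>, \<open>tensor_map_wcomp\<close>) are
  statements about sums in an ordinary commutative algebra (\<open>tmul_assoc\<close>, \<open>tlin_tmul\<close>,
  \<open>tlin_comp\<close>). Since the operations of the \<open>R \<otimes> W\<close> are natural in \<open>W\<close>, they make \<open>R \<otimes> _\<close> an algebra
  object of \<open>K\<close> (\<open>RU_kalg_object\<close>).

  The transformations \<open>\<alpha>\<^sub>\<phi>\<close> and \<open>\<mu>\<close> are given at \<open>M\<close> and \<open>V\<close> by \<open>M (V \<otimes> \<phi>)\<close> and \<open>M (V \<otimes> \<sigma>)\<close>, where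
  \<open>\<sigma>\<close> is the symmetry. Their naturality is the interchange law for \<open>\<otimes>\<close> (\<open>apply_natural_hom\<close>), and \<open>\<alpha>\<close> is
  functorial because \<open>V \<otimes> _\<close> is. As \<open>\<otimes>\<close> is strictly unital and associative, \<open>T\<^sup>k\<close> is the identity, and
  the coherence of \<open>\<mu>\<close> with associativity is the equality of two permutations of the basis of a triple
  tensor product (\<open>wswap_hexagon\<close>).

  Finally, the coordinates of \<open>R \<otimes> (V \<otimes> W)\<close> are indexed by pairs \<open>(i, j)\<close>, the pair having the index
  \<open>i * dim W + j\<close>. Keeping \<open>j\<close> fixed gives an arrow to \<open>R \<otimes> V\<close>, and these arrows exhibit
  \<open>T\<^sup>W (R \<otimes> _)\<close> as a power of \<open>R \<otimes> _\<close> (\<open>theta_power\<close>); so \<open>\<theta>\<close> is an isomorphism. Its compatibilities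
  become statements about pairs of indices: with the algebra structures, that the structure constants
  of \<open>V \<otimes> W\<close> are products (\<open>tmul_tensor\<close>, \<open>theta_kalg_hom\<close>); with \<open>\<alpha>\<close>, that \<open>V \<otimes> \<phi>\<close> acts on \<open>j\<close> alone
  (\<open>theta_natural\<close>); with \<open>\<mu>\<close>, that \<open>\<sigma>\<close> exchanges two indices (\<open>theta_tensor\<close>).
\<close>

section \<open>Categories, functors and natural transformations\<close>

context category begin

lemma ar_hom: "f \<in> Ar C \<Longrightarrow> f \<in> hom C (Dom C f) (Cod C f)"
  by (simp add: hom_def)

lemma hom_ob: "f \<in> hom C a b \<Longrightarrow> a \<in> Ob C" "f \<in> hom C a b \<Longrightarrow> b \<in> Ob C"
  using dom_ob cod_ob by (auto simp: hom_def)

text \<open>The axioms in terms of domains and codomains: these side conditions can be discharged by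
  simplification, whereas the intermediate object of a composite \<open>a \<rightarrow> b \<rightarrow> c\<close> cannot be found by
  matching. Composites are normalised to be nested to the right.\<close>

lemma cmp_simps [simp]:
  assumes "f \<in> Ar C" "g \<in> Ar C" "Cod C f = Dom C g"
  shows "Cmp C g f \<in> Ar C" "Dom C (Cmp C g f) = Dom C f" "Cod C (Cmp C g f) = Cod C g"
  using cmp_hom[of f "Dom C f" "Cod C f" g "Cod C g"] assms by (auto simp: hom_def)

lemma cmp_assoc_right [simp]:
  assumes "f \<in> Ar C" "g \<in> Ar C" "h \<in> Ar C" "Cod C f = Dom C g" "Cod C g = Dom C h"
  shows "Cmp C (Cmp C h g) f = Cmp C h (Cmp C g f)"
  using cmp_assoc[of f "Dom C f" "Cod C f" g "Cod C g" h "Cod C h"] assms by (auto simp: hom_def)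

lemma ident_simps [simp]:
  assumes "a \<in> Ob C"
  shows "Ident C a \<in> Ar C" "Dom C (Ident C a) = a" "Cod C (Ident C a) = a"
  using ident_hom[OF assms] by (auto simp: hom_def)

lemma cmp_ident [simp]:
  shows "f \<in> Ar C \<Longrightarrow> Cod C f = b \<Longrightarrow> Cmp C (Ident C b) f = f"
    and "f \<in> Ar C \<Longrightarrow> Dom C f = a \<Longrightarrow> Cmp C f (Ident C a) = f"
  using cmp_ident_left cmp_ident_right by (auto simp: hom_def)

text \<open>Commutative squares, commutative triangles and inverse arrows inside a composite that is nested to
  the right.\<close>

lemma cmp_reassoc:
  assumes "Cmp C g f = Cmp C g' f'" "f \<in> hom C a b" "g \<in> hom C b c" "f' \<in> hom C a b'" "g' \<in> hom C b' c"
    "t \<in> hom C x a"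
  shows "Cmp C g (Cmp C f t) = Cmp C g' (Cmp C f' t)"
  using assms(1) cmp_assoc[OF assms(6,2,3)] cmp_assoc[OF assms(6,4,5)] by simp

lemma cmp_reassoc1:
  assumes "Cmp C g f = e" "f \<in> hom C a b" "g \<in> hom C b c" "t \<in> hom C x a"
  shows "Cmp C g (Cmp C f t) = Cmp C e t"
  using assms(1) cmp_assoc[OF assms(4,2,3)] by simp

lemma cmp_cancel:
  assumes "Cmp C g f = Ident C a" "f \<in> hom C a b" "g \<in> hom C b a" "t \<in> hom C x a"
  shows "Cmp C g (Cmp C f t) = t"
  using assms(1) cmp_assoc[OF assms(4,2,3)] cmp_ident_left[OF assms(4)] by simp

lemma iso_ident: "a \<in> Ob C \<Longrightarrow> Ident C a \<in> iso_hom C a a"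
  by (auto simp: iso_hom_def hom_def intro!: exI[of _ "Ident C a"] bexI[of _ "Ident C a"])

lemma iso_homI:
  "\<lbrakk>f \<in> hom C a b; g \<in> hom C b a; Cmp C g f = Ident C a; Cmp C f g = Ident C b\<rbrakk>
    \<Longrightarrow> f \<in> iso_hom C a b"
  by (auto simp: iso_hom_def)

lemma iso_homE:
  assumes "f \<in> iso_hom C a b"
  obtains g where "f \<in> hom C a b" "g \<in> hom C b a" "g \<in> iso_hom C b a"
    "Cmp C g f = Ident C a" "Cmp C f g = Ident C b"
  using assms by (auto simp: iso_hom_def)

end

lemma functor_simps:
  assumes "is_functor C D F"
  shows "a \<in> Ob C \<Longrightarrow> fob F a \<in> Ob D"
    and "f \<in> Ar C \<Longrightarrow> far F f \<in> Ar D"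
    and "f \<in> Ar C \<Longrightarrow> Dom D (far F f) = fob F (Dom C f)"
    and "f \<in> Ar C \<Longrightarrow> Cod D (far F f) = fob F (Cod C f)"
    and "a \<in> Ob C \<Longrightarrow> far F (Ident C a) = Ident D (fob F a)"
    and "\<lbrakk>f \<in> Ar C; g \<in> Ar C; Cod C f = Dom C g\<rbrakk>
      \<Longrightarrow> far F (Cmp C g f) = Cmp D (far F g) (far F f)"
  using assms by (auto simp: is_functor_def hom_def PiE_def Pi_def)

lemma functor_hom: "is_functor C D F \<Longrightarrow> f \<in> hom C a b \<Longrightarrow> far F f \<in> hom D (fob F a) (fob F b)"
  by (auto simp: hom_def functor_simps)

lemma functor_cmp:
  "\<lbrakk>is_functor C D F; f \<in> hom C a b; g \<in> hom C b c\<rbrakk> \<Longrightarrow> far F (Cmp C g f) = Cmp D (far F g) (far F f)"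
  by (auto simp: hom_def functor_simps)

lemma is_functorI:
  assumes "fob F \<in> extensional (Ob C)" "far F \<in> extensional (Ar C)"
    and "\<And>a. a \<in> Ob C \<Longrightarrow> fob F a \<in> Ob D"
    and "\<And>f. f \<in> Ar C \<Longrightarrow> far F f \<in> hom D (fob F (Dom C f)) (fob F (Cod C f))"
    and "\<And>a. a \<in> Ob C \<Longrightarrow> far F (Ident C a) = Ident D (fob F a)"
    and "\<And>f g. \<lbrakk>f \<in> Ar C; g \<in> Ar C; Cod C f = Dom C g\<rbrakk>
      \<Longrightarrow> far F (Cmp C g f) = Cmp D (far F g) (far F f)"
  shows "is_functor C D F"
  using assms by (auto simp: is_functor_def PiE_def Pi_def hom_def)

lemma functor_eqI:
  assumes "is_functor C D F" "is_functor C D G"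
    and "\<And>a. a \<in> Ob C \<Longrightarrow> fob F a = fob G a" "\<And>f. f \<in> Ar C \<Longrightarrow> far F f = far G f"
  shows "F = (G :: ('a, 'b, 'c, 'd) fctr)"
proof (rule fctr.equality)
  show "fob F = fob G" using assms by (intro extensionalityI[of _ "Ob C"]) (auto simp: is_functor_def PiE_def)
  show "far F = far G" using assms by (intro extensionalityI[of _ "Ar C"]) (auto simp: is_functor_def PiE_def)
qed simp

lemma fcomp_simps [simp]:
  "a \<in> Ob C \<Longrightarrow> fob (fcomp C G F) a = fob G (fob F a)"
  "f \<in> Ar C \<Longrightarrow> far (fcomp C G F) f = far G (far F f)"
  by (auto simp: fcomp_def)

lemma fid_simps [simp]:
  "a \<in> Ob C \<Longrightarrow> fob (fid C) a = a" "f \<in> Ar C \<Longrightarrow> far (fid C) f = f"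
  by (auto simp: fid_def)

lemma fcomp_functor:
  assumes "category C" "is_functor C D F" "is_functor D E G"
  shows "is_functor C E (fcomp C G F)"
proof -
  interpret category C by fact
  show ?thesis
    by (rule is_functorI)
      (use assms(2,3) in \<open>auto simp: fcomp_def dom_ob cod_ob functor_simps hom_def\<close>)
qed

lemma fid_functor:
  assumes "category C" shows "is_functor C C (fid C)"
proof -
  interpret category C by fact
  show ?thesis by (rule is_functorI) (auto simp: fid_def dom_ob cod_ob hom_def)
qed

lemma ntrans_simps:
  assumes "is_ntrans C D t"
  shows "is_functor C D (nsrc t)" "is_functor C D (ntgt t)"
    and "a \<in> Ob C \<Longrightarrow> ncmp t a \<in> hom D (fob (nsrc t) a) (fob (ntgt t) a)"
    and "a \<in> Ob C \<Longrightarrow> ncmp t a \<in> Ar D"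
    and "a \<in> Ob C \<Longrightarrow> Dom D (ncmp t a) = fob (nsrc t) a"
    and "a \<in> Ob C \<Longrightarrow> Cod D (ncmp t a) = fob (ntgt t) a"
    and "f \<in> Ar C \<Longrightarrow> Cmp D (ncmp t (Cod C f)) (far (nsrc t) f)
                  = Cmp D (far (ntgt t) f) (ncmp t (Dom C f))"
  using assms by (auto simp: is_ntrans_def hom_def)

lemma ntrans_eqI:
  assumes "is_ntrans C D s" "is_ntrans C D t" "nsrc s = nsrc t" "ntgt s = ntgt t"
    and "\<And>a. a \<in> Ob C \<Longrightarrow> ncmp s a = ncmp t a"
  shows "s = (t :: ('a, 'b, 'c, 'd) ntrans)"
proof (rule ntrans.equality)
  show "ncmp s = ncmp t" using assms by (intro extensionalityI[of _ "Ob C"]) (auto simp: is_ntrans_def)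
qed (use assms in auto)

lemma functor_cat_simps [simp]:
  "F \<in> Ob (functor_cat C D) \<longleftrightarrow> is_functor C D F"
  "t \<in> Ar (functor_cat C D) \<longleftrightarrow> is_ntrans C D t"
  "Dom (functor_cat C D) = nsrc" "Cod (functor_cat C D) = ntgt"
  by (auto simp: functor_cat_def)

lemma functor_cat_ncmp [simp]:
  "a \<in> Ob C \<Longrightarrow> ncmp (Cmp (functor_cat C D) s t) a = Cmp D (ncmp s a) (ncmp t a)"
  "a \<in> Ob C \<Longrightarrow> ncmp (Ident (functor_cat C D) F) a = Ident D (fob F a)"
  "nsrc (Cmp (functor_cat C D) s t) = nsrc t" "ntgt (Cmp (functor_cat C D) s t) = ntgt s"
  "nsrc (Ident (functor_cat C D) F) = F" "ntgt (Ident (functor_cat C D) F) = F"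
  by (auto simp: functor_cat_def)

lemma functor_cat_hom:
  "t \<in> hom (functor_cat C D) F G \<longleftrightarrow> is_ntrans C D t \<and> nsrc t = F \<and> ntgt t = G"
  by (auto simp: hom_def)

lemma functor_cat_hom_ncmp:
  "t \<in> hom (functor_cat C D) F G \<Longrightarrow> a \<in> Ob C \<Longrightarrow> ncmp t a \<in> hom D (fob F a) (fob G a)"
  by (auto simp: functor_cat_hom ntrans_simps)

lemma functor_cat_hom_nat:
  "t \<in> hom (functor_cat C D) F G \<Longrightarrow> f \<in> Ar C \<Longrightarrow>
    Cmp D (ncmp t (Cod C f)) (far F f) = Cmp D (far G f) (ncmp t (Dom C f))"
  by (auto simp: functor_cat_hom ntrans_simps)

lemma functor_cat_homI:
  assumes "is_functor C D F" "is_functor C D G"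
    and "\<And>a. a \<in> Ob C \<Longrightarrow> c a \<in> hom D (fob F a) (fob G a)"
    and "\<And>f. f \<in> Ar C \<Longrightarrow> Cmp D (c (Cod C f)) (far F f) = Cmp D (far G f) (c (Dom C f))"
    and "category C"
  shows "\<lparr>nsrc = F, ntgt = G, ncmp = (\<lambda>a \<in> Ob C. c a)\<rparr> \<in> hom (functor_cat C D) F G"
  using assms by (auto simp: functor_cat_hom is_ntrans_def category.dom_ob category.cod_ob)

lemma functor_cat_hom_eqI:
  assumes "s \<in> hom (functor_cat C D) F G" "t \<in> hom (functor_cat C D) F G"
    and "\<And>a. a \<in> Ob C \<Longrightarrow> ncmp s a = ncmp t a"
  shows "s = t"
  using assms by (intro ntrans_eqI[of C D]) (auto simp: functor_cat_hom)

locale two_cats = A: category A + C: category C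
  for A :: "('a, 'b) cat" and C :: "('o, 'm) cat"

lemma (in two_cats) functor_cat_category: "category (functor_cat A C)"
proof -
  have id: "Ident (functor_cat A C) F \<in> hom (functor_cat A C) F F" if "is_functor A C F" for F
    using functor_cat_homI[of A C F F "\<lambda>a. Ident C (fob F a)"] that
    by (simp add: functor_cat_def functor_simps A.category_axioms A.dom_ob A.cod_ob hom_def)
  have cmp: "Cmp (functor_cat A C) g f \<in> hom (functor_cat A C) F H"
    if f: "f \<in> hom (functor_cat A C) F G" and g: "g \<in> hom (functor_cat A C) G H" for f g F G H
  proof -
    have [simp]: "nsrc f = F" "ntgt f = G" "nsrc g = G" "ntgt g = H"
      and F: "is_functor A C F" and G: "is_functor A C G" and H: "is_functor A C H"
      using f g by (auto simp: functor_cat_hom ntrans_simps)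
    have nat: "Cmp C (Cmp C (ncmp g (Cod A u)) (ncmp f (Cod A u))) (far F u) =
               Cmp C (far H u) (Cmp C (ncmp g (Dom A u)) (ncmp f (Dom A u)))" if u: "u \<in> Ar A" for u
    proof -
      note d = A.dom_ob[OF u] A.cod_ob[OF u]
      note h = functor_cat_hom_ncmp[OF f d(1)] functor_cat_hom_ncmp[OF f d(2)]
        functor_cat_hom_ncmp[OF g d(1)] functor_cat_hom_ncmp[OF g d(2)]
        functor_hom[OF F A.ar_hom[OF u]] functor_hom[OF G A.ar_hom[OF u]] functor_hom[OF H A.ar_hom[OF u]]
      have "Cmp C (ncmp g (Cod A u)) (Cmp C (far G u) (ncmp f (Dom A u))) =
          Cmp C (far H u) (Cmp C (ncmp g (Dom A u)) (ncmp f (Dom A u)))"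
        using C.cmp_reassoc[OF functor_cat_hom_nat[OF g u] h(6) h(4) h(3) h(7) h(1)] .
      thus ?thesis using functor_cat_hom_nat[OF f u] h by (simp add: hom_def)
    qed
    show ?thesis
      using functor_cat_homI[OF F H C.cmp_hom[OF functor_cat_hom_ncmp[OF f] functor_cat_hom_ncmp[OF g]] nat
          A.category_axioms] by (simp add: functor_cat_def)
  qed
  show ?thesis
  proof
    fix f g h :: "('a, 'b, 'o, 'm) ntrans" and F G H L
    assume *: "f \<in> hom (functor_cat A C) F G" "g \<in> hom (functor_cat A C) G H" "h \<in> hom (functor_cat A C) H L"
    show "Cmp (functor_cat A C) h (Cmp (functor_cat A C) g f) = Cmp (functor_cat A C) (Cmp (functor_cat A C) h g) f"
    proof (rule functor_cat_hom_eqI)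
      show "Cmp (functor_cat A C) h (Cmp (functor_cat A C) g f) \<in> hom (functor_cat A C) F L"
        by (meson * cmp)
      show "Cmp (functor_cat A C) (Cmp (functor_cat A C) h g) f \<in> hom (functor_cat A C) F L"
        by (meson * cmp)
      fix a assume "a \<in> Ob A"
      thus "ncmp (Cmp (functor_cat A C) h (Cmp (functor_cat A C) g f)) a = ncmp (Cmp (functor_cat A C) (Cmp (functor_cat A C) h g) f) a"
        using C.cmp_assoc[OF functor_cat_hom_ncmp functor_cat_hom_ncmp functor_cat_hom_ncmp, OF *(1) _ *(2) _ *(3)] by simp
    qed
  next
    fix f :: "('a, 'b, 'o, 'm) ntrans" and F G
    assume f: "f \<in> hom (functor_cat A C) F G"
    hence F: "is_functor A C F" and G: "is_functor A C G" by (auto simp: functor_cat_hom ntrans_simps)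
    show "Cmp (functor_cat A C) (Ident (functor_cat A C) G) f = f"
      by (rule functor_cat_hom_eqI[OF cmp[OF f id[OF G]] f])
        (use f in \<open>auto simp: functor_cat_hom ntrans_simps\<close>)
    show "Cmp (functor_cat A C) f (Ident (functor_cat A C) F) = f"
      by (rule functor_cat_hom_eqI[OF cmp[OF id[OF F] f] f])
        (use f in \<open>auto simp: functor_cat_hom ntrans_simps\<close>)
  qed (use id cmp in \<open>auto simp: functor_cat_hom ntrans_simps\<close>)
qed

sublocale two_cats \<subseteq> FC: category "functor_cat A C"
  by (rule functor_cat_category)

text \<open>The inverses of the components are natural: compose the naturality squares of \<open>t\<close> with them on
  both sides.\<close>

lemma (in two_cats) functor_cat_isoI:
  assumes t: "t \<in> hom (functor_cat A C) F G"
    and iso: "\<And>a. a \<in> Ob A \<Longrightarrow> ncmp t a \<in> iso_hom C (fob F a) (fob G a)"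
  shows "t \<in> iso_hom (functor_cat A C) F G"
proof -
  have F: "is_functor A C F" and G: "is_functor A C G" using t by (auto simp: functor_cat_hom ntrans_simps)
  have "\<forall>a \<in> Ob A. \<exists>g \<in> hom C (fob G a) (fob F a).
      Cmp C g (ncmp t a) = Ident C (fob F a) \<and> Cmp C (ncmp t a) g = Ident C (fob G a)"
    using iso by (auto simp: iso_hom_def)
  then obtain g where g: "\<And>a. a \<in> Ob A \<Longrightarrow> g a \<in> hom C (fob G a) (fob F a)"
    "\<And>a. a \<in> Ob A \<Longrightarrow> Cmp C (g a) (ncmp t a) = Ident C (fob F a)"
    "\<And>a. a \<in> Ob A \<Longrightarrow> Cmp C (ncmp t a) (g a) = Ident C (fob G a)" by metis
  define s where "s = \<lparr>nsrc = G, ntgt = F, ncmp = (\<lambda>a \<in> Ob A. g a)\<rparr>"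
  have s: "s \<in> hom (functor_cat A C) G F" unfolding s_def
  proof (rule functor_cat_homI[OF G F g(1) _ A.category_axioms])
    fix u assume u: "u \<in> Ar A"
    note d = A.dom_ob[OF u] A.cod_ob[OF u]
    note h = functor_cat_hom_ncmp[OF t d(1)] functor_cat_hom_ncmp[OF t d(2)] g[OF d(1)] g[OF d(2)]
        functor_hom[OF F A.ar_hom[OF u]] functor_hom[OF G A.ar_hom[OF u]]
    have "Cmp C (g (Cod A u)) (far G u) = Cmp C (g (Cod A u)) (Cmp C (far G u) (Cmp C (ncmp t (Dom A u)) (g (Dom A u))))"
      using h by (simp add: hom_def)
    also have "\<dots> = Cmp C (Cmp C (g (Cod A u)) (Cmp C (ncmp t (Cod A u)) (far F u))) (g (Dom A u))"
      using functor_cat_hom_nat[OF t u] h by (simp add: hom_def)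
    also have "\<dots> = Cmp C (far F u) (g (Dom A u))"
      using C.cmp_cancel[OF g(2)[OF d(2)] h(2) h(6) C.cmp_hom[OF h(3) h(9)]] h by (simp add: hom_def)
    finally show "Cmp C (g (Cod A u)) (far G u) = Cmp C (far F u) (g (Dom A u))" .
  qed
  show ?thesis
  proof (rule FC.iso_homI[OF t s])
    show "Cmp (functor_cat A C) s t = Ident (functor_cat A C) F"
      by (rule functor_cat_hom_eqI[OF FC.cmp_hom[OF t s] FC.ident_hom]) (auto simp: s_def g F)
    show "Cmp (functor_cat A C) t s = Ident (functor_cat A C) G"
      by (rule functor_cat_hom_eqI[OF FC.cmp_hom[OF s t] FC.ident_hom]) (auto simp: s_def g G)
  qed
qed

lemma (in two_cats) functor_cat_iso_ncmp:
  assumes t: "t \<in> iso_hom (functor_cat A C) F G" and a: "a \<in> Ob A"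
  shows "ncmp t a \<in> iso_hom C (fob F a) (fob G a)"
proof -
  obtain s where s: "t \<in> hom (functor_cat A C) F G" "s \<in> hom (functor_cat A C) G F"
    "Cmp (functor_cat A C) s t = Ident (functor_cat A C) F" "Cmp (functor_cat A C) t s = Ident (functor_cat A C) G"
    using t by (auto simp: iso_hom_def)
  show ?thesis
    using C.iso_homI[OF functor_cat_hom_ncmp[OF s(1) a] functor_cat_hom_ncmp[OF s(2) a]]
      arg_cong[OF s(3), of "\<lambda>t. ncmp t a"] arg_cong[OF s(4), of "\<lambda>t. ncmp t a"] a by simp
qed

section \<open>Limits, and limits in functor categories\<close>

lemma limit_cong:
  assumes "is_limit J C D L c" "\<And>j. j \<in> Ob J \<Longrightarrow> c' j = c j" "category J"
  shows "is_limit J C D L c'"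
proof -
  have "is_cone J C D L c'"
    using assms by (auto simp: is_limit_def is_cone_def category.dom_ob category.cod_ob)
  thus ?thesis using assms(1,2) by (simp add: is_limit_def)
qed

lemma limit_lift:
  assumes "is_limit J C D L c" "is_cone J C D X d"
  shows "\<exists>h. h \<in> hom C X L \<and> (\<forall>j \<in> Ob J. Cmp C (c j) h = d j)"
  using assms unfolding is_limit_def by metis

lemma limit_hom: "is_limit J C D L c \<Longrightarrow> j \<in> Ob J \<Longrightarrow> c j \<in> hom C L (fob D j)"
  by (auto simp: is_limit_def is_cone_def)

lemma (in category) cone_cmp:
  assumes J: "category J" and D: "is_functor J C D" and c: "is_cone J C D L c" and h: "h \<in> hom C X L"
  shows "is_cone J C D X (\<lambda>j. Cmp C (c j) h)"
  unfolding is_cone_def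
proof (intro conjI ballI)
  show "X \<in> Ob C" using hom_ob(1)[OF h] .
  show "Cmp C (c j) h \<in> hom C X (fob D j)" if "j \<in> Ob J" for j
    using that c h cmp_hom by (auto simp: is_cone_def)
  fix u assume u: "u \<in> Ar J"
  have "Cmp C (far D u) (Cmp C (c (Dom J u)) h) = Cmp C (Cmp C (far D u) (c (Dom J u))) h"
    using cmp_assoc[OF h _ functor_hom[OF D category.ar_hom[OF J u]]] c category.dom_ob[OF J u]
    by (auto simp: is_cone_def)
  thus "Cmp C (far D u) (Cmp C (c (Dom J u)) h) = Cmp C (c (Cod J u)) h"
    using c u by (auto simp: is_cone_def)
qed

lemma (in category) limit_eqI:
  assumes J: "category J" and D: "is_functor J C D" and L: "is_limit J C D L c"
    and h: "h \<in> hom C X L" "h' \<in> hom C X L" "\<And>j. j \<in> Ob J \<Longrightarrow> Cmp C (c j) h = Cmp C (c j) h'"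
  shows "h = h'"
proof -
  have "is_cone J C D X (\<lambda>j. Cmp C (c j) h)" using cone_cmp[OF J D _ h(1)] L by (auto simp: is_limit_def)
  hence "\<exists>!k. k \<in> hom C X L \<and> (\<forall>j \<in> Ob J. Cmp C (c j) k = Cmp C (c j) h)"
    using L by (auto simp: is_limit_def)
  moreover have "\<forall>j \<in> Ob J. Cmp C (c j) h' = Cmp C (c j) h" using h(3) by simp
  ultimately show ?thesis using h(1,2) by blast
qed

lemma (in category) limit_iso:
  assumes J: "category J" and D: "is_functor J C D"
    and L: "is_limit J C D L c" and L': "is_limit J C D L' c'"
  shows "\<exists>h \<in> iso_hom C L' L. \<forall>j \<in> Ob J. Cmp C (c j) h = c' j"
proof -
  have k: "is_cone J C D L c" "is_cone J C D L' c'" using L L' by (auto simp: is_limit_def)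
  have ob: "L \<in> Ob C" "L' \<in> Ob C" using k by (auto simp: is_cone_def)
  obtain h where h: "h \<in> hom C L' L" "\<And>j. j \<in> Ob J \<Longrightarrow> Cmp C (c j) h = c' j"
    using limit_lift[OF L k(2)] by metis
  obtain g where g: "g \<in> hom C L L'" "\<And>j. j \<in> Ob J \<Longrightarrow> Cmp C (c' j) g = c j"
    using limit_lift[OF L' k(1)] by metis
  have "Cmp C h g = Ident C L"
  proof (rule limit_eqI[OF J D L cmp_hom[OF g(1) h(1)] ident_hom[OF ob(1)]])
    fix j assume j: "j \<in> Ob J"
    show "Cmp C (c j) (Cmp C h g) = Cmp C (c j) (Ident C L)"
      using cmp_assoc[OF g(1) h(1) limit_hom[OF L j]] h(2)[OF j] g(2)[OF j]
        cmp_ident_right[OF limit_hom[OF L j]] by simp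
  qed
  moreover have "Cmp C g h = Ident C L'"
  proof (rule limit_eqI[OF J D L' cmp_hom[OF h(1) g(1)] ident_hom[OF ob(2)]])
    fix j assume j: "j \<in> Ob J"
    show "Cmp C (c' j) (Cmp C g h) = Cmp C (c' j) (Ident C L')"
      using cmp_assoc[OF h(1) g(1) limit_hom[OF L' j]] h(2)[OF j] g(2)[OF j]
        cmp_ident_right[OF limit_hom[OF L' j]] by simp
  qed
  ultimately have "h \<in> iso_hom C L' L" using iso_homI[OF h(1) g(1)] by blast
  thus ?thesis using h(2) by auto
qed

text \<open>Together with \<open>limit_iso\<close> this reduces a claim about an arbitrary limit to one about a limit of
  one's choice.\<close>

lemma (in category) limit_transport:
  assumes J: "category J" and D: "is_functor J C D" and L: "is_limit J C D L c"
    and h: "h \<in> iso_hom C L' L" and c': "\<And>j. j \<in> Ob J \<Longrightarrow> c' j = Cmp C (c j) h"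
  shows "is_limit J C D L' c'"
proof -
  obtain g where g: "h \<in> hom C L' L" "g \<in> hom C L L'" "Cmp C g h = Ident C L'" "Cmp C h g = Ident C L"
    using iso_homE[OF h] by metis
  have "is_limit J C D L' (\<lambda>j. Cmp C (c j) h)"
    unfolding is_limit_def
  proof (intro conjI allI impI)
    show "is_cone J C D L' (\<lambda>j. Cmp C (c j) h)"
      using cone_cmp[OF J D _ g(1)] L by (auto simp: is_limit_def)
    fix X d assume d: "is_cone J C D X d"
    obtain k where k: "k \<in> hom C X L" "\<And>j. j \<in> Ob J \<Longrightarrow> Cmp C (c j) k = d j"
      using limit_lift[OF L d] by metis
    show "\<exists>!k. k \<in> hom C X L' \<and> (\<forall>j\<in>Ob J. Cmp C (Cmp C (c j) h) k = d j)"
    proof (rule ex1I[of _ "Cmp C g k"], intro conjI ballI)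
      show "Cmp C g k \<in> hom C X L'" using cmp_hom k g by blast
      fix j assume j: "j \<in> Ob J"
      have "Cmp C (Cmp C (c j) h) (Cmp C g k) = Cmp C (c j) (Cmp C (Cmp C h g) k)"
        using cmp_assoc[OF cmp_hom[OF k(1) g(2)] g(1) limit_hom[OF L j]] cmp_assoc[OF k(1) g(2) g(1)]
        by simp
      thus "Cmp C (Cmp C (c j) h) (Cmp C g k) = d j"
        using g k j cmp_ident_left[OF k(1)] by simp
    next
      fix k' assume k': "k' \<in> hom C X L' \<and> (\<forall>j\<in>Ob J. Cmp C (Cmp C (c j) h) k' = d j)"
      have "Cmp C h k' = k"
      proof (rule limit_eqI[OF J D L cmp_hom[OF _ g(1)] k(1)])
        fix j assume j: "j \<in> Ob J"
        show "Cmp C (c j) (Cmp C h k') = Cmp C (c j) k"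
          using cmp_assoc[OF _ g(1) limit_hom[OF L j]] k' k j by metis
      qed (use k' in auto)
      thus "k' = Cmp C g k" using cmp_assoc[OF _ g(1) g(2)] g(3) k' cmp_ident_left by metis
    qed
  qed
  thus ?thesis using c' J by (rule limit_cong)
qed

definition eval_at :: "('i, 'j) cat \<Rightarrow> ('i, 'j, ('a, 'b, 'o, 'm) fctr, ('a, 'b, 'o, 'm) ntrans) fctr \<Rightarrow> 'a
    \<Rightarrow> ('i, 'j, 'o, 'm) fctr" where
  "eval_at J D a = \<lparr>fob = (\<lambda>j \<in> Ob J. fob (fob D j) a), far = (\<lambda>u \<in> Ar J. ncmp (far D u) a)\<rparr>"

definition pointwise_limit :: "('i, 'j) cat \<Rightarrow> ('a, 'b) cat \<Rightarrow> ('o, 'm) cat \<Rightarrow>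
    ('i, 'j, ('a, 'b, 'o, 'm) fctr, ('a, 'b, 'o, 'm) ntrans) fctr \<Rightarrow> ('a, 'b, 'o, 'm) fctr \<Rightarrow>
    ('i \<Rightarrow> ('a, 'b, 'o, 'm) ntrans) \<Rightarrow> bool" where
  "pointwise_limit J A C D L c \<longleftrightarrow>
     is_cone J (functor_cat A C) D L c \<and>
     (\<forall>a \<in> Ob A. is_limit J C (eval_at J D a) (fob L a) (\<lambda>j. ncmp (c j) a))"

context two_cats begin

lemma eval_at_functor:
  assumes J: "category J" and D: "is_functor J (functor_cat A C) D" and a: "a \<in> Ob A"
  shows "is_functor J C (eval_at J D a)"
proof (rule is_functorI)
  interpret J: category J by fact
  note [simp] = functor_simps[OF D, simplified]
  show "fob (eval_at J D a) j \<in> Ob C" if "j \<in> Ob J" for j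
    using that a functor_simps(1)[of A C "fob D j" a] by (simp add: eval_at_def)
  show "far (eval_at J D a) f \<in> hom C (fob (eval_at J D a) (Dom J f)) (fob (eval_at J D a) (Cod J f))"
    if "f \<in> Ar J" for f
    using that a functor_cat_hom_ncmp[OF functor_hom[OF D J.ar_hom] a, of f]
    by (simp add: eval_at_def J.dom_ob J.cod_ob)
  show "far (eval_at J D a) (Cmp J g f) = Cmp C (far (eval_at J D a) g) (far (eval_at J D a) f)"
    if "f \<in> Ar J" "g \<in> Ar J" "Cod J f = Dom J g" for f g
    using that a by (simp add: eval_at_def)
  show "far (eval_at J D a) (Ident J j) = Ident C (fob (eval_at J D a) j)" if "j \<in> Ob J" for j
    using that a by (simp add: eval_at_def category.ident_simps(1)[OF J])
qed (auto simp: eval_at_def)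

lemma cone_eval_at:
  assumes J: "category J" and c: "is_cone J (functor_cat A C) D L c" and a: "a \<in> Ob A"
  shows "is_cone J C (eval_at J D a) (fob L a) (\<lambda>j. ncmp (c j) a)"
  unfolding is_cone_def
proof (intro conjI ballI)
  have L: "is_functor A C L" using c by (auto simp: is_cone_def)
  show "fob L a \<in> Ob C" using L a by (simp add: functor_simps)
  fix j assume j: "j \<in> Ob J"
  hence "c j \<in> hom (functor_cat A C) L (fob D j)" using c by (simp add: is_cone_def)
  thus "ncmp (c j) a \<in> hom C (fob L a) (fob (eval_at J D a) j)"
    using functor_cat_hom_ncmp a j by (fastforce simp: eval_at_def)
next
  fix u assume u: "u \<in> Ar J"
  hence "Cmp (functor_cat A C) (far D u) (c (Dom J u)) = c (Cod J u)" using c by (simp add: is_cone_def)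
  hence "ncmp (Cmp (functor_cat A C) (far D u) (c (Dom J u))) a = ncmp (c (Cod J u)) a" by simp
  thus "Cmp C (far (eval_at J D a) u) (ncmp (c (Dom J u)) a) = ncmp (c (Cod J u)) a"
    using a u by (simp add: eval_at_def)
qed

text \<open>The mediating arrow is assembled from those at the objects of \<open>A\<close>. It is natural because the two
  sides of a naturality square agree after composition with the projections of the limit at the
  target.\<close>

lemma pointwise_imp_limit:
  assumes J: "category J" and D: "is_functor J (functor_cat A C) D"
    and L: "pointwise_limit J A C D L c"
  shows "is_limit J (functor_cat A C) D L c"
  unfolding is_limit_def
proof (intro conjI allI impI)
  have c: "is_cone J (functor_cat A C) D L c"
    and lim: "\<And>a. a \<in> Ob A \<Longrightarrow> is_limit J C (eval_at J D a) (fob L a) (\<lambda>j. ncmp (c j) a)"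
    using L by (auto simp: pointwise_limit_def)
  show "is_cone J (functor_cat A C) D L c" by fact
  have cj: "c j \<in> hom (functor_cat A C) L (fob D j)" if "j \<in> Ob J" for j
    using that c by (simp add: is_cone_def)
  have LF: "is_functor A C L" using c by (auto simp: is_cone_def)
  fix X d assume d: "is_cone J (functor_cat A C) D X d"
  have X: "is_functor A C X" using d by (auto simp: is_cone_def)
  have dj: "d j \<in> hom (functor_cat A C) X (fob D j)" if "j \<in> Ob J" for j
    using that d by (simp add: is_cone_def)
  have "\<exists>h. h \<in> hom C (fob X a) (fob L a) \<and> (\<forall>j \<in> Ob J. Cmp C (ncmp (c j) a) h = ncmp (d j) a)"
    if a: "a \<in> Ob A" for a
    using limit_lift[OF lim[OF a] cone_eval_at[OF J d a]] by metis
  then obtain h where h: "\<And>a. a \<in> Ob A \<Longrightarrow> h a \<in> hom C (fob X a) (fob L a)"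
    "\<And>a j. a \<in> Ob A \<Longrightarrow> j \<in> Ob J \<Longrightarrow> Cmp C (ncmp (c j) a) (h a) = ncmp (d j) a" by metis
  define t where "t = \<lparr>nsrc = X, ntgt = L, ncmp = (\<lambda>a \<in> Ob A. h a)\<rparr>"
  have t: "t \<in> hom (functor_cat A C) X L" unfolding t_def
  proof (rule functor_cat_homI[OF X LF h(1) _ A.category_axioms])
    fix u assume u: "u \<in> Ar A"
    let ?a = "Dom A u" and ?b = "Cod A u"
    note ab = A.dom_ob[OF u] A.cod_ob[OF u]
    have hu: "far X u \<in> hom C (fob X ?a) (fob X ?b)" "far L u \<in> hom C (fob L ?a) (fob L ?b)"
      using functor_hom[OF X A.ar_hom[OF u]] functor_hom[OF LF A.ar_hom[OF u]] by auto
    show "Cmp C (h ?b) (far X u) = Cmp C (far L u) (h ?a)"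
    proof (rule C.limit_eqI[OF J eval_at_functor[OF J D ab(2)] lim[OF ab(2)]])
      show "Cmp C (h ?b) (far X u) \<in> hom C (fob X ?a) (fob L ?b)" using hu h(1) ab by (meson C.cmp_hom)
      show "Cmp C (far L u) (h ?a) \<in> hom C (fob X ?a) (fob L ?b)" using hu h(1) ab by (meson C.cmp_hom)
      fix j assume j: "j \<in> Ob J"
      note cd = functor_cat_hom_ncmp[OF cj[OF j] ab(1)] functor_cat_hom_ncmp[OF cj[OF j] ab(2)]
        functor_cat_hom_ncmp[OF dj[OF j] ab(1)] functor_cat_hom_ncmp[OF dj[OF j] ab(2)]
      have Dj: "is_functor A C (fob D j)" using functor_simps(1)[OF D j] by simp
      have fD: "far (fob D j) u \<in> hom C (fob (fob D j) ?a) (fob (fob D j) ?b)"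
        using functor_hom[OF Dj A.ar_hom[OF u]] .
      have "Cmp C (ncmp (c j) ?b) (Cmp C (h ?b) (far X u)) = Cmp C (ncmp (d j) ?b) (far X u)"
        using C.cmp_assoc[OF hu(1) h(1)[OF ab(2)] cd(2)] h(2)[OF ab(2) j] by simp
      also have "\<dots> = Cmp C (far (fob D j) u) (ncmp (d j) ?a)"
        using functor_cat_hom_nat[OF dj[OF j] u] .
      also have "\<dots> = Cmp C (Cmp C (far (fob D j) u) (ncmp (c j) ?a)) (h ?a)"
        using C.cmp_assoc[OF h(1)[OF ab(1)] cd(1) fD] h(2)[OF ab(1) j] by simp
      also have "\<dots> = Cmp C (Cmp C (ncmp (c j) ?b) (far L u)) (h ?a)"
        using functor_cat_hom_nat[OF cj[OF j] u] by simp
      also have "\<dots> = Cmp C (ncmp (c j) ?b) (Cmp C (far L u) (h ?a))"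
        using C.cmp_assoc[OF h(1)[OF ab(1)] hu(2) cd(2)] by simp
      finally show "Cmp C (ncmp (c j) ?b) (Cmp C (h ?b) (far X u)) = Cmp C (ncmp (c j) ?b) (Cmp C (far L u) (h ?a))" .
    qed
  qed
  show "\<exists>!h. h \<in> hom (functor_cat A C) X L \<and> (\<forall>j\<in>Ob J. Cmp (functor_cat A C) (c j) h = d j)"
  proof (rule ex1I[of _ t], intro conjI ballI)
    show "t \<in> hom (functor_cat A C) X L" by fact
    show "Cmp (functor_cat A C) (c j) t = d j" if "j \<in> Ob J" for j
      by (rule functor_cat_hom_eqI[OF FC.cmp_hom[OF t cj[OF that]] dj[OF that]])
        (use that in \<open>simp add: t_def h\<close>)
    fix s assume s: "s \<in> hom (functor_cat A C) X L \<and> (\<forall>j\<in>Ob J. Cmp (functor_cat A C) (c j) s = d j)"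
    show "s = t"
    proof (rule functor_cat_hom_eqI)
      fix a assume a: "a \<in> Ob A"
      show "ncmp s a = ncmp t a"
      proof (rule C.limit_eqI[OF J eval_at_functor[OF J D a] lim[OF a]])
        fix j assume j: "j \<in> Ob J"
        have "Cmp (functor_cat A C) (c j) s = d j" using s j by simp
        hence "ncmp (Cmp (functor_cat A C) (c j) s) a = ncmp (d j) a" by simp
        thus "Cmp C (ncmp (c j) a) (ncmp s a) = Cmp C (ncmp (c j) a) (ncmp t a)"
          using a j h by (simp add: t_def)
      qed (use functor_cat_hom_ncmp[OF conjunct1[OF s] a] functor_cat_hom_ncmp[OF t a] in auto)
    qed (use s t in auto)
  qed
qed

text \<open>An arrow \<open>u : a \<rightarrow> b\<close> of \<open>A\<close> turns the limit at \<open>a\<close> into a cone over the diagram at \<open>b\<close>. Hence limits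
  chosen at all objects form a functor, whatever the choices: functoriality is the uniqueness of
  mediating arrows.\<close>

lemma pointwise_limit_exists:
  assumes J: "category J" and D: "is_functor J (functor_cat A C) D" and U: "has_limits_of_shape J C"
  shows "\<exists>L c. pointwise_limit J A C D L c"
proof -
  have "\<exists>L c. is_limit J C (eval_at J D a) L c" if a: "a \<in> Ob A" for a
    using U eval_at_functor[OF J D a] by (auto simp: has_limits_of_shape_def)
  then obtain l p where lim: "\<And>a. a \<in> Ob A \<Longrightarrow> is_limit J C (eval_at J D a) (l a) (p a)" by metis
  have p: "p a j \<in> hom C (l a) (fob (fob D j) a)" if "a \<in> Ob A" "j \<in> Ob J" for a j
    using limit_hom[OF lim[OF that(1)] that(2)] that by (simp add: eval_at_def)
  have l: "l a \<in> Ob C" if "a \<in> Ob A" for a using lim[OF that] by (auto simp: is_limit_def is_cone_def)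
  have Dj: "is_functor A C (fob D j)" if "j \<in> Ob J" for j using functor_simps(1)[OF D that] by simp
  have cone: "is_cone J C (eval_at J D (Cod A u)) (l (Dom A u)) (\<lambda>j. Cmp C (far (fob D j) u) (p (Dom A u) j))"
    if u: "u \<in> Ar A" for u
    unfolding is_cone_def
  proof (intro conjI ballI)
    note ab = A.dom_ob[OF u] A.cod_ob[OF u]
    show "l (Dom A u) \<in> Ob C" using l ab by simp
    show "Cmp C (far (fob D j) u) (p (Dom A u) j) \<in> hom C (l (Dom A u)) (fob (eval_at J D (Cod A u)) j)"
      if j: "j \<in> Ob J" for j
      using C.cmp_hom[OF p[OF ab(1) j] functor_hom[OF Dj[OF j] A.ar_hom[OF u]]] j by (simp add: eval_at_def)
    fix v assume v: "v \<in> Ar J"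
    note jk = category.dom_ob[OF J v] category.cod_ob[OF J v]
    let ?j = "Dom J v" and ?k = "Cod J v" and ?a = "Dom A u" and ?b = "Cod A u"
    have Dv: "far D v \<in> hom (functor_cat A C) (fob D ?j) (fob D ?k)"
      using functor_hom[OF D category.ar_hom[OF J v]] .
    note n = functor_cat_hom_ncmp[OF Dv ab(1)] functor_cat_hom_ncmp[OF Dv ab(2)]
    note fj = functor_hom[OF Dj[OF jk(1)] A.ar_hom[OF u]] and fk = functor_hom[OF Dj[OF jk(2)] A.ar_hom[OF u]]
    have "Cmp C (ncmp (far D v) ?b) (Cmp C (far (fob D ?j) u) (p ?a ?j)) =
        Cmp C (Cmp C (ncmp (far D v) ?b) (far (fob D ?j) u)) (p ?a ?j)"
      using C.cmp_assoc[OF p[OF ab(1) jk(1)] fj n(2)] .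
    also have "\<dots> = Cmp C (Cmp C (far (fob D ?k) u) (ncmp (far D v) ?a)) (p ?a ?j)"
      using functor_cat_hom_nat[OF Dv u] by simp
    also have "\<dots> = Cmp C (far (fob D ?k) u) (Cmp C (ncmp (far D v) ?a) (p ?a ?j))"
      using C.cmp_assoc[OF p[OF ab(1) jk(1)] n(1) fk] by simp
    also have "Cmp C (ncmp (far D v) ?a) (p ?a ?j) = p ?a ?k"
      using lim[OF ab(1)] v by (simp add: is_limit_def is_cone_def eval_at_def)
    finally show "Cmp C (far (eval_at J D ?b) v) (Cmp C (far (fob D ?j) u) (p ?a ?j)) =
        Cmp C (far (fob D ?k) u) (p ?a ?k)" using v by (simp add: eval_at_def)
  qed
  have "\<exists>h. h \<in> hom C (l (Dom A u)) (l (Cod A u)) \<and>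
      (\<forall>j \<in> Ob J. Cmp C (p (Cod A u) j) h = Cmp C (far (fob D j) u) (p (Dom A u) j))" if u: "u \<in> Ar A" for u
    using limit_lift[OF lim[OF A.cod_ob[OF u]] cone[OF u]] by metis
  then obtain m where m: "\<And>u. u \<in> Ar A \<Longrightarrow> m u \<in> hom C (l (Dom A u)) (l (Cod A u))"
    "\<And>u j. u \<in> Ar A \<Longrightarrow> j \<in> Ob J \<Longrightarrow> Cmp C (p (Cod A u) j) (m u) = Cmp C (far (fob D j) u) (p (Dom A u) j)"
    by metis
  have eqI: "h = h'" if "h \<in> hom C X (l a)" "h' \<in> hom C X (l a)" "a \<in> Ob A"
    "\<And>j. j \<in> Ob J \<Longrightarrow> Cmp C (p a j) h = Cmp C (p a j) h'" for h h' X a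
    using C.limit_eqI[OF J eval_at_functor[OF J D that(3)] lim[OF that(3)] that(1,2,4)] by blast
  define L where "L = \<lparr>fob = (\<lambda>a \<in> Ob A. l a), far = (\<lambda>u \<in> Ar A. m u)\<rparr>"
  have LF: "is_functor A C L"
  proof (rule is_functorI)
    show "far L f \<in> hom C (fob L (Dom A f)) (fob L (Cod A f))" if "f \<in> Ar A" for f
      using m(1)[OF that] that by (simp add: L_def A.dom_ob A.cod_ob)
    show "far L (Ident A a) = Ident C (fob L a)" if a: "a \<in> Ob A" for a
    proof -
      have "m (Ident A a) = Ident C (l a)"
      proof (rule eqI[OF _ C.ident_hom[OF l[OF a]] a])
        show "m (Ident A a) \<in> hom C (l a) (l a)" using m(1)[of "Ident A a"] a by simp
        fix j assume j: "j \<in> Ob J"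
        show "Cmp C (p a j) (m (Ident A a)) = Cmp C (p a j) (Ident C (l a))"
          using m(2)[of "Ident A a" j] a j p[OF a j] functor_simps[OF Dj[OF j]] by (simp add: hom_def)
      qed
      thus ?thesis using a by (simp add: L_def)
    qed
    show "far L (Cmp A g f) = Cmp C (far L g) (far L f)"
      if fg: "f \<in> Ar A" "g \<in> Ar A" "Cod A f = Dom A g" for f g
    proof -
      note ob = A.dom_ob[OF fg(1)] A.cod_ob[OF fg(1)] A.cod_ob[OF fg(2)] A.dom_ob[OF fg(2)]
      have mf: "m f \<in> hom C (l (Dom A f)) (l (Dom A g))" using m(1)[OF fg(1)] fg by simp
      have "m (Cmp A g f) = Cmp C (m g) (m f)"
      proof (rule eqI[OF _ C.cmp_hom[OF mf m(1)[OF fg(2)]] ob(3)])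
        show "m (Cmp A g f) \<in> hom C (l (Dom A f)) (l (Cod A g))" using m(1)[of "Cmp A g f"] fg by simp
        fix j assume j: "j \<in> Ob J"
        note Dfg = functor_hom[OF Dj[OF j] A.ar_hom[OF fg(1)]] functor_hom[OF Dj[OF j] A.ar_hom[OF fg(2)]]
        note h = Dfg p[OF ob(1) j] p[OF ob(3) j] p[OF ob(4) j] mf m(1)[OF fg(2)]
        show "Cmp C (p (Cod A g) j) (m (Cmp A g f)) = Cmp C (p (Cod A g) j) (Cmp C (m g) (m f))"
          using m(2)[of "Cmp A g f" j] m(2)[OF fg(1) j] m(2)[OF fg(2) j] fg j h
            C.cmp_reassoc[OF m(2)[OF fg(2) j] h(7) h(4) h(5) h(2) h(6)]
          by (simp add: functor_simps[OF Dj[OF j]] hom_def)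
      qed
      thus ?thesis using fg by (simp add: L_def)
    qed
  qed (auto simp: L_def l)
  define c where "c j = \<lparr>nsrc = L, ntgt = fob D j, ncmp = (\<lambda>a \<in> Ob A. p a j)\<rparr>" for j
  have c: "c j \<in> hom (functor_cat A C) L (fob D j)" if j: "j \<in> Ob J" for j
    unfolding c_def
    by (rule functor_cat_homI[OF LF Dj[OF j] _ _ A.category_axioms])
      (use p j m(2)[OF _ j] in \<open>auto simp: L_def\<close>)
  have "is_cone J (functor_cat A C) D L c" unfolding is_cone_def
  proof (intro conjI ballI)
    show "L \<in> Ob (functor_cat A C)" using LF by simp
    show "c j \<in> hom (functor_cat A C) L (fob D j)" if "j \<in> Ob J" for j using c[OF that] .
    fix u assume u: "u \<in> Ar J"
    show "Cmp (functor_cat A C) (far D u) (c (Dom J u)) = c (Cod J u)"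
    proof (rule functor_cat_hom_eqI[OF FC.cmp_hom[OF c functor_hom[OF D category.ar_hom[OF J u]]] c])
      fix a assume a: "a \<in> Ob A"
      show "ncmp (Cmp (functor_cat A C) (far D u) (c (Dom J u))) a = ncmp (c (Cod J u)) a"
        using lim[OF a] u a by (simp add: c_def is_limit_def is_cone_def eval_at_def)
    qed (use J u in \<open>auto simp: category.dom_ob category.cod_ob\<close>)
  qed
  moreover have "is_limit J C (eval_at J D a) (fob L a) (\<lambda>j. ncmp (c j) a)" if "a \<in> Ob A" for a
    using lim[OF that] that by (simp add: L_def c_def)
  ultimately show ?thesis by (auto simp: pointwise_limit_def)
qed

text \<open>The limit is isomorphic to a pointwise one, which exists as \<open>C\<close> has limits of this shape.\<close>

lemma limit_imp_pointwise:
  assumes J: "category J" and D: "is_functor J (functor_cat A C) D" and U: "has_limits_of_shape J C"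
    and L: "is_limit J (functor_cat A C) D L c"
  shows "pointwise_limit J A C D L c"
proof -
  obtain L' c' where L': "pointwise_limit J A C D L' c'" using pointwise_limit_exists[OF J D U] by auto
  obtain h where h: "h \<in> iso_hom (functor_cat A C) L L'"
    "\<And>j. j \<in> Ob J \<Longrightarrow> Cmp (functor_cat A C) (c' j) h = c j"
    using FC.limit_iso[OF J D pointwise_imp_limit[OF J D L'] L] by auto
  have "is_limit J C (eval_at J D a) (fob L a) (\<lambda>j. ncmp (c j) a)" if a: "a \<in> Ob A" for a
  proof (rule C.limit_transport[OF J eval_at_functor[OF J D a] _ functor_cat_iso_ncmp[OF h(1) a]])
    show "is_limit J C (eval_at J D a) (fob L' a) (\<lambda>j. ncmp (c' j) a)"
      using L' a by (simp add: pointwise_limit_def)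
    show "ncmp (c j) a = Cmp C (ncmp (c' j) a) (ncmp h a)" if "j \<in> Ob J" for j
      using h(2)[OF that] a by (metis functor_cat_ncmp(1))
  qed
  thus ?thesis using L by (simp add: pointwise_limit_def is_limit_def)
qed

lemma functor_cat_has_limits:
  assumes J: "category J" and U: "has_limits_of_shape J C"
  shows "has_limits_of_shape J (functor_cat A C)"
  unfolding has_limits_of_shape_def
  using pointwise_limit_exists[OF J _ U] pointwise_imp_limit[OF J] by fast

end

section \<open>Powers and products as limits, and small limits\<close>

text \<open>Powers, products and terminal objects are limits over discrete shapes, so that what is known about
  limits applies to them.\<close>

definition disc :: "nat \<Rightarrow> (nat, nat) cat" where
  "disc n = \<lparr>Ob = {..<n}, Ar = {..<n}, Dom = (\<lambda>i. i), Cod = (\<lambda>i. i), Ident = (\<lambda>i. i), Cmp = (\<lambda>g f. f)\<rparr>"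

definition family :: "('o, 'm) cat \<Rightarrow> nat \<Rightarrow> (nat \<Rightarrow> 'o) \<Rightarrow> (nat, nat, 'o, 'm) fctr" where
  "family C n A = \<lparr>fob = (\<lambda>i \<in> {..<n}. A i), far = (\<lambda>i \<in> {..<n}. Ident C (A i))\<rparr>"

lemma finite_shape_disc: "finite_shape (disc n)"
  by (auto simp: finite_shape_def disc_def category_def hom_def)

lemma category_disc: "category (disc n)"
  using finite_shape_disc by (simp add: finite_shape_def)

lemma Ob_disc [simp]: "Ob (disc n) = {..<n}" "Ar (disc n) = {..<n}" "Dom (disc n) i = i" "Cod (disc n) i = i"
  by (simp_all add: disc_def)

context category begin

lemma family_functor:
  assumes "\<And>i. i < n \<Longrightarrow> A i \<in> Ob C"
  shows "is_functor (disc n) C (family C n A)"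
  using assms by (intro is_functorI) (auto simp: family_def disc_def hom_def)

lemma cone_family_iff:
  assumes "\<And>i. i < n \<Longrightarrow> A i \<in> Ob C"
  shows "is_cone (disc n) C (family C n A) L c \<longleftrightarrow> L \<in> Ob C \<and> (\<forall>i<n. c i \<in> hom C L (A i))"
  by (auto simp: is_cone_def family_def hom_def)

lemma limit_family_iff:
  assumes "\<And>i. i < n \<Longrightarrow> A i \<in> Ob C"
  shows "is_limit (disc n) C (family C n A) L c \<longleftrightarrow> L \<in> Ob C \<and> (\<forall>i<n. c i \<in> hom C L (A i)) \<and>
    (\<forall>X \<in> Ob C. \<forall>f. (\<forall>i<n. f i \<in> hom C X (A i)) \<longrightarrow> (\<exists>!h. h \<in> hom C X L \<and> (\<forall>i<n. Cmp C (c i) h = f i)))"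
proof -
  have cone: "is_cone (disc n) C (family C n A) L c \<longleftrightarrow> L \<in> Ob C \<and> (\<forall>i<n. c i \<in> hom C L (A i))" for L c
    using assms by (rule cone_family_iff)
  show ?thesis unfolding is_limit_def cone by (simp add: Ball_def imp_conjL)
qed

lemma is_power_iff_limit:
  "a \<in> Ob C \<Longrightarrow> is_power C a n P p \<longleftrightarrow> is_limit (disc n) C (family C n (\<lambda>_. a)) P p"
  by (simp add: limit_family_iff is_power_def)

lemma is_product_iff_limit:
  assumes "a \<in> Ob C" "b \<in> Ob C"
  shows "is_product C a b P p q \<longleftrightarrow>
    is_limit (disc 2) C (family C 2 (\<lambda>i. if i = 0 then a else b)) P (\<lambda>i. if i = 0 then p else q)"
    (is "?l \<longleftrightarrow> ?r")
proof -
  have all2: "(\<forall>i<2. R i) \<longleftrightarrow> R 0 \<and> R (Suc 0)" for R :: "nat \<Rightarrow> bool"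
    by (auto simp: less_2_cases_iff)
  show ?thesis
  proof
    assume l: ?l
    show ?r using assms l hom_ob
      by (subst limit_family_iff) (auto simp: is_product_def all2)
  next
    assume r: ?r
    hence u: "P \<in> Ob C" "p \<in> hom C P a" "q \<in> hom C P b"
      "\<And>X f. X \<in> Ob C \<Longrightarrow> f 0 \<in> hom C X a \<Longrightarrow> f (Suc 0) \<in> hom C X b \<Longrightarrow>
        (\<exists>!h. h \<in> hom C X P \<and> Cmp C p h = f 0 \<and> Cmp C q h = f (Suc 0))"
      using assms by (subst (asm) limit_family_iff; simp add: all2)+
    show ?l unfolding is_product_def
    proof (intro conjI ballI)
      fix X f g assume "X \<in> Ob C" "f \<in> hom C X a" "g \<in> hom C X b"
      thus "\<exists>!h. h \<in> hom C X P \<and> Cmp C p h = f \<and> Cmp C q h = g"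
        using u(4)[of X "\<lambda>i. if i = 0 then f else g"] by simp
    qed (use u in auto)
  qed
qed

lemma is_terminal_iff_limit: "is_terminal C t \<longleftrightarrow> is_limit (disc 0) C (family C 0 A) t c"
  by (subst limit_family_iff) (auto simp: is_terminal_def)

end

lemma left_exact_shape: "left_exact_cat C \<Longrightarrow> has_limits_of_shape (disc n) C"
  using finite_shape_disc by (auto simp: left_exact_cat_def)

lemma (in category) left_exact_families:
  assumes "left_exact_cat C" "\<And>i. i < n \<Longrightarrow> A i \<in> Ob C"
  shows "\<exists>P p. is_limit (disc n) C (family C n A) P p"
  using left_exact_shape[OF assms(1), of n] family_functor[OF assms(2)]
  by (auto simp: has_limits_of_shape_def)

lemma (in category) left_exact_powers:
  "left_exact_cat C \<Longrightarrow> a \<in> Ob C \<Longrightarrow> \<exists>P p. is_power C a n P p"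
  using left_exact_families[of n "\<lambda>_. a"] by (auto simp: is_power_iff_limit)

lemma (in category) left_exact_products:
  assumes "left_exact_cat C" "a \<in> Ob C" "b \<in> Ob C"
  shows "\<exists>P p q. is_product C a b P p q"
proof -
  have "\<exists>P c. is_limit (disc 2) C (family C 2 (\<lambda>i. if i = 0 then a else b)) P c"
    by (rule left_exact_families[OF assms(1)]) (use assms in auto)
  then obtain P c where c: "is_limit (disc 2) C (family C 2 (\<lambda>i. if i = 0 then a else b)) P c"
    by auto
  have "is_limit (disc 2) C (family C 2 (\<lambda>i. if i = 0 then a else b)) P (\<lambda>i. if i = 0 then c 0 else c (Suc 0))"
    by (rule limit_cong[OF c _ category_disc]) (auto simp: less_2_cases_iff)
  thus ?thesis using is_product_iff_limit[OF assms(2,3)] by blast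
qed

lemma (in category) left_exact_terminal:
  assumes "left_exact_cat C" shows "\<exists>t. is_terminal C t"
  using left_exact_families[OF assms, of 0] is_terminal_iff_limit by blast

text \<open>Powers in a functor category are computed pointwise.\<close>

context two_cats begin

lemma eval_at_family:
  "a \<in> Ob A \<Longrightarrow> eval_at (disc n) (family (functor_cat A C) n F) a = family C n (\<lambda>i. fob (F i) a)"
  by (auto simp: eval_at_def family_def fun_eq_iff)

lemma family_limit_imp_pointwise:
  assumes "left_exact_cat C" "\<And>i. i < n \<Longrightarrow> is_functor A C (F i)" "a \<in> Ob A"
    and "is_limit (disc n) (functor_cat A C) (family (functor_cat A C) n F) P p"
  shows "is_limit (disc n) C (family C n (\<lambda>i. fob (F i) a)) (fob P a) (\<lambda>i. ncmp (p i) a)"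
  using limit_imp_pointwise[OF category_disc FC.family_functor left_exact_shape[OF assms(1)] assms(4)] assms(2,3)
  by (simp add: pointwise_limit_def eval_at_family)

lemma family_limitI:
  assumes "\<And>i. i < n \<Longrightarrow> is_functor A C (F i)" "is_functor A C P"
    "\<And>i. i < n \<Longrightarrow> p i \<in> hom (functor_cat A C) P (F i)"
    and "\<And>a. a \<in> Ob A \<Longrightarrow> is_limit (disc n) C (family C n (\<lambda>i. fob (F i) a)) (fob P a) (\<lambda>i. ncmp (p i) a)"
  shows "is_limit (disc n) (functor_cat A C) (family (functor_cat A C) n F) P p"
  by (rule pointwise_imp_limit[OF category_disc FC.family_functor])
    (use assms in \<open>auto simp: pointwise_limit_def eval_at_family FC.cone_family_iff\<close>)

lemma powerI_pointwise:
  assumes "is_functor A C F" "is_functor A C P" "\<And>i. i < n \<Longrightarrow> p i \<in> hom (functor_cat A C) P F"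
    and "\<And>a. a \<in> Ob A \<Longrightarrow> is_power C (fob F a) n (fob P a) (\<lambda>i. ncmp (p i) a)"
  shows "is_power (functor_cat A C) F n P p"
  using family_limitI[of n "\<lambda>_. F" P p] assms
  by (simp add: FC.is_power_iff_limit C.is_power_iff_limit functor_simps)

lemma product_imp_pointwise:
  assumes "left_exact_cat C" "is_functor A C F" "is_functor A C G" "a \<in> Ob A"
    and "is_product (functor_cat A C) F G P p q"
  shows "is_product C (fob F a) (fob G a) (fob P a) (ncmp p a) (ncmp q a)"
  using family_limit_imp_pointwise[of 2 "\<lambda>i. if i = 0 then F else G" a P "\<lambda>i. if i = 0 then p else q"] assms
  by (simp add: FC.is_product_iff_limit C.is_product_iff_limit functor_simps if_distrib if_distribR cong: if_cong)

end

text \<open>A limit over a small shape may be computed over an isomorphic shape whose objects and arrows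
  are drawn from the index type.\<close>

lemma complete_has_limits:
  fixes J :: "('a, 'b) cat" and C :: "('o, 'm) cat" and e :: "'a \<Rightarrow> 'i" and e' :: "'b \<Rightarrow> 'i"
  assumes J: "category J" and C: "category C" and U: "complete_cat TYPE('i) C"
    and e: "inj_on e (Ob J)" and e': "inj_on e' (Ar J)"
  shows "has_limits_of_shape J C"
  unfolding has_limits_of_shape_def
proof (intro allI impI)
  fix D assume D: "is_functor J C D"
  interpret J: category J by fact
  interpret C: category C by fact
  define o' where "o' = inv_into (Ob J) e"
  define a' where "a' = inv_into (Ar J) e'"
  have o' [simp]: "o' (e x) = x" if "x \<in> Ob J" for x using e that by (simp add: o'_def)
  have a' [simp]: "a' (e' x) = x" if "x \<in> Ar J" for x using e' that by (simp add: a'_def)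
  define K where "K = \<lparr>Ob = e ` Ob J, Ar = e' ` Ar J, Dom = (\<lambda>f. e (Dom J (a' f))), Cod = (\<lambda>f. e (Cod J (a' f))),
     Ident = (\<lambda>x. e' (Ident J (o' x))), Cmp = (\<lambda>g f. e' (Cmp J (a' g) (a' f)))\<rparr>"
  have ee: "e x = e y \<longleftrightarrow> x = y" if "x \<in> Ob J" "y \<in> Ob J" for x y using e that by (auto simp: inj_on_def)
  have ee': "e' x = e' y \<longleftrightarrow> x = y" if "x \<in> Ar J" "y \<in> Ar J" for x y using e' that by (auto simp: inj_on_def)
  have K: "category K"
    by standard (auto simp: K_def hom_def J.dom_ob J.cod_ob ee)
  define D' where "D' = \<lparr>fob = (\<lambda>x \<in> Ob K. fob D (o' x)), far = (\<lambda>f \<in> Ar K. far D (a' f))\<rparr>"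
  have D': "is_functor K C D'"
    by (rule is_functorI)
      (auto simp: D'_def K_def hom_def J.dom_ob J.cod_ob ee ee' functor_simps[OF D])
  obtain L c where L: "is_limit K C D' L c"
    using U K D' unfolding complete_cat_def has_limits_of_shape_def by blast
  have cone: "is_cone J C D X d \<longleftrightarrow> is_cone K C D' X (\<lambda>x. d (o' x))" for X d
    by (auto simp: is_cone_def D'_def K_def J.dom_ob J.cod_ob)
  have "is_limit J C D L (\<lambda>j. c (e j))"
    unfolding is_limit_def
  proof (intro conjI allI impI)
    have "is_cone K C D' L c" using L by (simp add: is_limit_def)
    thus "is_cone J C D L (\<lambda>j. c (e j))"
      by (auto simp: is_cone_def D'_def K_def J.dom_ob J.cod_ob)
    fix X d assume "is_cone J C D X d"
    hence "\<exists>!h. h \<in> hom C X L \<and> (\<forall>x\<in>Ob K. Cmp C (c x) h = d (o' x))"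
      using cone L by (simp add: is_limit_def)
    moreover have "(\<forall>x\<in>Ob K. Cmp C (c x) h = d (o' x)) \<longleftrightarrow> (\<forall>j\<in>Ob J. Cmp C (c (e j)) h = d j)" for h
      by (auto simp: K_def)
    ultimately show "\<exists>!h. h \<in> hom C X L \<and> (\<forall>j\<in>Ob J. Cmp C (c (e j)) h = d j)" by simp
  qed
  thus "\<exists>L c. is_limit J C D L c" by blast
qed

lemma infinite_inj_nat:
  assumes "infinite (UNIV :: 'i set)" shows "\<exists>f :: nat \<Rightarrow> 'i. inj f"
  using infinite_countable_subset[OF assms] by auto

lemma infinite_inj_pair:
  assumes "infinite (UNIV :: 'i set)" shows "\<exists>f :: 'i \<times> 'i \<Rightarrow> 'i. inj f"
proof -
  have "(card_of ((UNIV :: 'i set) \<times> (UNIV :: 'i set)), card_of (UNIV :: 'i set)) \<in> ordLeq"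
    using card_of_Times_same_infinite[OF assms] ordIso_imp_ordLeq by blast
  thus ?thesis by (simp add: card_of_ordLeq[symmetric])
qed

text \<open>By iterated pairing. This is injective on lists of a fixed length only, so the length is recorded
  as well.\<close>

lemma infinite_inj_list:
  assumes "infinite (UNIV :: 'i set)" shows "\<exists>f :: 'i list \<Rightarrow> 'i. inj f"
proof -
  obtain n :: "nat \<Rightarrow> 'i" and p :: "'i \<times> 'i \<Rightarrow> 'i" where n: "inj n" and p: "inj p"
    using infinite_inj_nat[OF assms] infinite_inj_pair[OF assms] by auto
  define g where "g xs = foldr (\<lambda>x y. p (x, y)) xs (n 0)" for xs
  have g: "length xs = length ys \<Longrightarrow> g xs = g ys \<Longrightarrow> xs = ys" for xs ys
    by (induction xs ys rule: list_induct2) (auto simp: g_def dest!: injD[OF p])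
  have "inj (\<lambda>xs. p (n (length xs), g xs))"
    by (rule injI) (auto dest!: injD[OF p] injD[OF n] intro: g)
  thus ?thesis by blast
qed

lemma complete_imp_left_exact:
  assumes "infinite (UNIV :: 'i set)" "category C" "complete_cat TYPE('i) C"
  shows "left_exact_cat C"
proof -
  obtain n :: "nat \<Rightarrow> 'i" where n: "inj n" using infinite_inj_nat[OF assms(1)] by auto
  show ?thesis unfolding left_exact_cat_def finite_shape_def
    using complete_has_limits[OF _ assms(2,3)] inj_on_subset[OF n subset_UNIV] by blast
qed

text \<open>A simultaneous equaliser: the universal family of arrows to objects \<open>X a\<close> which becomes equal
  after composition with each of the pairs of arrows \<open>f b\<close>, \<open>g b\<close>.\<close>

lemma complete_simultaneous_equaliser:
  fixes C :: "('o, 'm) cat" and A :: "'a set" and B :: "'b set" and eA :: "'a \<Rightarrow> 'i" and eB :: "'b \<Rightarrow> 'i"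
  assumes C: "category C" and U: "complete_cat TYPE('i) C" and inf: "infinite (UNIV :: 'i set)"
    and eA: "inj_on eA A" and eB: "inj_on eB B"
    and X: "\<And>a. a \<in> A \<Longrightarrow> X a \<in> Ob C"
    and st: "\<And>b. b \<in> B \<Longrightarrow> s b \<in> A" "\<And>b. b \<in> B \<Longrightarrow> t b \<in> A"
    and fg: "\<And>b. b \<in> B \<Longrightarrow> f b \<in> hom C (X (s b)) (Y b)" "\<And>b. b \<in> B \<Longrightarrow> g b \<in> hom C (X (t b)) (Y b)"
  shows "\<exists>L \<pi>. L \<in> Ob C \<and> (\<forall>a \<in> A. \<pi> a \<in> hom C L (X a)) \<and>
    (\<forall>b \<in> B. Cmp C (f b) (\<pi> (s b)) = Cmp C (g b) (\<pi> (t b))) \<and>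
    (\<forall>Z \<sigma>. Z \<in> Ob C \<longrightarrow> (\<forall>a \<in> A. \<sigma> a \<in> hom C Z (X a)) \<longrightarrow>
      (\<forall>b \<in> B. Cmp C (f b) (\<sigma> (s b)) = Cmp C (g b) (\<sigma> (t b))) \<longrightarrow>
      (\<exists>!h. h \<in> hom C Z L \<and> (\<forall>a \<in> A. Cmp C (\<pi> a) h = \<sigma> a)))"
proof -
  interpret C: category C by fact
  obtain n :: "nat \<Rightarrow> 'i" and p :: "'i \<times> 'i \<Rightarrow> 'i" where n: "inj n" and p: "inj p"
    using infinite_inj_nat[OF inf] infinite_inj_pair[OF inf] by auto
  define O' where "O' = Inl ` A \<union> Inr ` B"
  (* the shape has, besides identities, for each b two arrows s b -> b and t b -> b; no two of
     these are composable *)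
  define J :: "('a + 'b, ('a + 'b) + ('b \<times> bool)) cat" where
    "J = \<lparr>Ob = O', Ar = Inl ` O' \<union> Inr ` (B \<times> UNIV),
      Dom = case_sum (\<lambda>x. x) (\<lambda>(b, i). Inl (if i then s b else t b)),
      Cod = case_sum (\<lambda>x. x) (\<lambda>(b, i). Inr b), Ident = Inl,
      Cmp = (\<lambda>g f. case f of Inl _ \<Rightarrow> g | Inr _ \<Rightarrow> f)\<rparr>"
  have J: "category J"
    by standard (auto simp: J_def O'_def hom_def st split: if_splits)
  define e where "e = case_sum (\<lambda>a. p (n 0, eA a)) (\<lambda>b. p (n 1, eB b))"
  define e' where "e' = case_sum (\<lambda>x. p (n 0, e x)) (\<lambda>(b, i). p (n (if i then 1 else 2), eB b))"
  have e: "inj_on e O'"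
    by (rule inj_onI) (auto simp: e_def O'_def dest!: injD[OF p] injD[OF n] intro: inj_onD[OF eA] inj_onD[OF eB])
  have e': "inj_on e' (Inl ` O' \<union> Inr ` (B \<times> UNIV))"
    by (rule inj_onI)
      (auto simp: e'_def dest!: injD[OF p] injD[OF n] intro: inj_onD[OF e] inj_onD[OF eB] split: if_splits)
  define D where "D = \<lparr>fob = (\<lambda>x \<in> O'. case x of Inl a \<Rightarrow> X a | Inr b \<Rightarrow> Y b),
    far = (\<lambda>u \<in> Ar J. case u of Inl x \<Rightarrow> Ident C (case x of Inl a \<Rightarrow> X a | Inr b \<Rightarrow> Y b)
       | Inr (b, i) \<Rightarrow> if i then f b else g b)\<rparr>"
  have Y: "Y b \<in> Ob C" if "b \<in> B" for b using C.hom_ob(2)[OF fg(1)[OF that]] .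
  have fgs: "f b \<in> Ar C" "Dom C (f b) = X (s b)" "Cod C (f b) = Y b"
    "g b \<in> Ar C" "Dom C (g b) = X (t b)" "Cod C (g b) = Y b" if "b \<in> B" for b
    using fg[OF that] by (auto simp: hom_def)
  have D: "is_functor J C D"
    by (rule is_functorI) (auto simp: D_def J_def O'_def hom_def X Y st fgs split: if_splits)
  obtain L c where L: "is_limit J C D L c"
    using complete_has_limits[OF J C U, of e e'] e e' D
    by (auto simp: J_def has_limits_of_shape_def)
  have cone: "is_cone J C D Z d \<longleftrightarrow> Z \<in> Ob C \<and> (\<forall>a \<in> A. d (Inl a) \<in> hom C Z (X a)) \<and>
    (\<forall>b \<in> B. Cmp C (f b) (d (Inl (s b))) = d (Inr b) \<and> Cmp C (g b) (d (Inl (t b))) = d (Inr b))"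
    (is "?l \<longleftrightarrow> ?r") for Z d
  proof
    assume l: ?l
    have *: "Cmp C (far D u) (d (Dom J u)) = d (Cod J u)" if "u \<in> Ar J" for u
      using l that by (simp add: is_cone_def)
    have "Cmp C (f b) (d (Inl (s b))) = d (Inr b)" "Cmp C (g b) (d (Inl (t b))) = d (Inr b)" if "b \<in> B" for b
      using *[of "Inr (b, True)"] *[of "Inr (b, False)"] that by (simp_all add: J_def D_def)
    moreover have "d (Inl a) \<in> hom C Z (X a)" if "a \<in> A" for a
    proof -
      have "d (Inl a) \<in> hom C Z (fob D (Inl a))" using l that by (simp add: is_cone_def J_def O'_def)
      thus ?thesis using that by (simp add: D_def O'_def)
    qed
    moreover have "Z \<in> Ob C" using l by (simp add: is_cone_def)
    ultimately show ?r by auto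
  next
    assume r: ?r
    have 1: "d (Inl a) \<in> hom C Z (X a)" if "a \<in> A" for a using r that by blast
    have 2: "d (Inr b) \<in> hom C Z (Y b)" if "b \<in> B" for b
      using C.cmp_hom[OF 1[OF st(1)[OF that]] fg(1)[OF that]] r that by auto
    have 3: "Cmp C (f b) (d (Inl (s b))) = d (Inr b)" "Cmp C (g b) (d (Inl (t b))) = d (Inr b)"
      if "b \<in> B" for b using r that by auto
    have "Z \<in> Ob C" using r by blast
    thus ?l using 1 2
      by (auto simp: is_cone_def J_def D_def O'_def 3 C.cmp_ident_left[OF 1] C.cmp_ident_left[OF 2])
  qed
  have "is_cone J C D L c" using L by (simp add: is_limit_def)
  hence c0: "L \<in> Ob C" and c1: "\<And>a. a \<in> A \<Longrightarrow> c (Inl a) \<in> hom C L (X a)"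
    and c2: "\<And>b. b \<in> B \<Longrightarrow> Cmp C (f b) (c (Inl (s b))) = c (Inr b)"
    and c3: "\<And>b. b \<in> B \<Longrightarrow> Cmp C (g b) (c (Inl (t b))) = c (Inr b)"
    unfolding cone by auto
  show ?thesis
  proof (intro exI[of _ L] exI[of _ "\<lambda>a. c (Inl a)"] conjI allI impI)
    show "L \<in> Ob C" "\<forall>a\<in>A. c (Inl a) \<in> hom C L (X a)"
      "\<forall>b\<in>B. Cmp C (f b) (c (Inl (s b))) = Cmp C (g b) (c (Inl (t b)))"
      using c0 c1 c2 c3 by auto
    fix Z \<sigma> assume Z: "Z \<in> Ob C" and \<sigma>: "\<forall>a\<in>A. \<sigma> a \<in> hom C Z (X a)"
      "\<forall>b\<in>B. Cmp C (f b) (\<sigma> (s b)) = Cmp C (g b) (\<sigma> (t b))"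
    let ?d = "case_sum \<sigma> (\<lambda>b. Cmp C (f b) (\<sigma> (s b)))"
    have "is_cone J C D Z ?d" unfolding cone using Z \<sigma> by auto
    hence ex: "\<exists>!h. h \<in> hom C Z L \<and> (\<forall>x\<in>O'. Cmp C (c x) h = ?d x)"
      using L by (simp add: is_limit_def J_def)
    have "h \<in> hom C Z L \<and> (\<forall>x\<in>O'. Cmp C (c x) h = ?d x) \<longleftrightarrow>
        h \<in> hom C Z L \<and> (\<forall>a \<in> A. Cmp C (c (Inl a)) h = \<sigma> a)" for h
    proof (rule conj_cong[OF refl])
      assume h: "h \<in> hom C Z L"
      have "Cmp C (c (Inr b)) h = Cmp C (f b) (Cmp C (c (Inl (s b))) h)" if "b \<in> B" for b
        using c2[OF that] C.cmp_assoc[OF h c1[OF st(1)[OF that]] fg(1)[OF that]] by simp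
      thus "(\<forall>x\<in>O'. Cmp C (c x) h = ?d x) \<longleftrightarrow> (\<forall>a \<in> A. Cmp C (c (Inl a)) h = \<sigma> a)"
        using st by (auto simp: O'_def)
    qed
    thus "\<exists>!h. h \<in> hom C Z L \<and> (\<forall>a\<in>A. Cmp C (c (Inl a)) h = \<sigma> a)" using ex by simp
  qed
qed

section \<open>Commutative algebras on a carrier set\<close>

lemma (in comm_monoid_set) lessThan_times:
  "F h {..<a * b :: nat} = F (\<lambda>i. F (\<lambda>j. h (i * b + j)) {..<b}) {..<a}"
proof -
  have "F h {..<a * b} = F (\<lambda>(i, j). h (i * b + j)) ({..<a} \<times> {..<b})"
  proof (rule reindex_bij_witness[of _ "\<lambda>(i, j). i * b + j" "\<lambda>x. (x div b, x mod b)"])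
    fix x assume "x \<in> {..<a * b}"
    thus "(x div b, x mod b) \<in> {..<a} \<times> {..<b}"
      by (cases "b = 0") (auto simp: less_mult_imp_div_less)
  next
    fix x :: "nat \<times> nat" assume "x \<in> {..<a} \<times> {..<b}"
    then obtain i j where x: "x = (i, j)" "i < a" "j < b" by auto
    have "i * b + j < Suc i * b" using x(3) by simp
    also have "\<dots> \<le> a * b" using x(2) by (intro mult_le_mono1) simp
    finally show "(case x of (i, j) \<Rightarrow> i * b + j) \<in> {..<a * b}" using x by simp
  qed auto
  thus ?thesis by (simp add: cartesian_product)
qed

lemma (in comm_monoid_set) swap3:
  "F (\<lambda>m. F (\<lambda>i. F (\<lambda>j. h m i j) D) C) A = F (\<lambda>i. F (\<lambda>j. F (\<lambda>m. h m i j) A) D) C"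
proof -
  have "F (\<lambda>m. F (\<lambda>i. F (\<lambda>j. h m i j) D) C) A = F (\<lambda>i. F (\<lambda>m. F (\<lambda>j. h m i j) D) A) C"
    by (rule swap)
  also have "\<dots> = F (\<lambda>i. F (\<lambda>j. F (\<lambda>m. h m i j) A) D) C"
    by (rule cong[OF refl], rule swap)
  finally show ?thesis .
qed

lemma (in comm_monoid_set) swap4:
  "F (\<lambda>m. F (\<lambda>k. F (\<lambda>i. F (\<lambda>j. h m k i j) D) C) B) A = F (\<lambda>i. F (\<lambda>j. F (\<lambda>k. F (\<lambda>m. h m k i j) A) B) D) C"
proof -
  have "F (\<lambda>m. F (\<lambda>k. F (\<lambda>i. F (\<lambda>j. h m k i j) D) C) B) A =
      F (\<lambda>m. F (\<lambda>i. F (\<lambda>j. F (\<lambda>k. h m k i j) B) D) C) A"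
    by (rule cong[OF refl], rule swap3)
  also have "\<dots> = F (\<lambda>i. F (\<lambda>j. F (\<lambda>m. F (\<lambda>k. h m k i j) B) A) D) C"
    by (rule swap3)
  also have "\<dots> = F (\<lambda>i. F (\<lambda>j. F (\<lambda>k. F (\<lambda>m. h m k i j) A) B) D) C"
    by (rule cong[OF refl], rule cong[OF refl], rule swap)
  finally show ?thesis .
qed

text \<open>The generalised elements of an algebra object form algebras on hom sets, so the carrier has to be a
  set.\<close>

locale comm_alg =
  fixes S :: "'a set" and add mul :: "'a \<Rightarrow> 'a \<Rightarrow> 'a" and zero one :: 'a and neg :: "'a \<Rightarrow> 'a"
    and scal :: "'k::{comm_ring, comm_monoid_mult} \<Rightarrow> 'a \<Rightarrow> 'a"
  assumes zero_in [simp]: "zero \<in> S" and one_in [simp]: "one \<in> S"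
    and add_in [simp]: "\<lbrakk>x \<in> S; y \<in> S\<rbrakk> \<Longrightarrow> add x y \<in> S"
    and mul_in [simp]: "\<lbrakk>x \<in> S; y \<in> S\<rbrakk> \<Longrightarrow> mul x y \<in> S"
    and neg_in [simp]: "x \<in> S \<Longrightarrow> neg x \<in> S" and scal_in [simp]: "x \<in> S \<Longrightarrow> scal c x \<in> S"
    and add_assoc: "\<lbrakk>x \<in> S; y \<in> S; z \<in> S\<rbrakk> \<Longrightarrow> add (add x y) z = add x (add y z)"
    and add_comm: "\<lbrakk>x \<in> S; y \<in> S\<rbrakk> \<Longrightarrow> add x y = add y x"
    and add_zero [simp]: "x \<in> S \<Longrightarrow> add zero x = x"
    and add_neg [simp]: "x \<in> S \<Longrightarrow> add (neg x) x = zero"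
    and mul_assoc: "\<lbrakk>x \<in> S; y \<in> S; z \<in> S\<rbrakk> \<Longrightarrow> mul (mul x y) z = mul x (mul y z)"
    and mul_comm: "\<lbrakk>x \<in> S; y \<in> S\<rbrakk> \<Longrightarrow> mul x y = mul y x"
    and mul_one [simp]: "x \<in> S \<Longrightarrow> mul one x = x"
    and mul_add: "\<lbrakk>x \<in> S; y \<in> S; z \<in> S\<rbrakk> \<Longrightarrow> mul (add x y) z = add (mul x z) (mul y z)"
    and scal_add: "\<lbrakk>x \<in> S; y \<in> S\<rbrakk> \<Longrightarrow> scal c (add x y) = add (scal c x) (scal c y)"
    and scal_plus: "x \<in> S \<Longrightarrow> scal (c + d) x = add (scal c x) (scal d x)"
    and scal_times: "x \<in> S \<Longrightarrow> scal (c * d) x = scal c (scal d x)"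
    and scal_one [simp]: "x \<in> S \<Longrightarrow> scal 1 x = x"
    and scal_mul: "\<lbrakk>x \<in> S; y \<in> S\<rbrakk> \<Longrightarrow> scal c (mul x y) = mul (scal c x) y"
begin

lemma add_idem_zero: "x \<in> S \<Longrightarrow> add x x = x \<Longrightarrow> x = zero"
  by (metis add_assoc add_neg add_zero neg_in)

lemma scal_zero_left [simp]: "x \<in> S \<Longrightarrow> scal 0 x = zero"
  by (rule add_idem_zero) (simp_all add: scal_plus[symmetric])

lemma scal_zero [simp]: "scal c zero = zero"
  by (rule add_idem_zero) (simp_all add: scal_add[symmetric])

lemma mul_zero [simp]: "x \<in> S \<Longrightarrow> mul zero x = zero"
  by (rule add_idem_zero) (simp_all add: mul_add[symmetric])

lemma mul_zero_right [simp]: "x \<in> S \<Longrightarrow> mul x zero = zero"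
  using mul_comm[of x zero] by simp

lemma scal_mul_right: "\<lbrakk>x \<in> S; y \<in> S\<rbrakk> \<Longrightarrow> scal c (mul x y) = mul x (scal c y)"
  by (metis mul_comm scal_in scal_mul)

lemma mul_add_right: "\<lbrakk>x \<in> S; y \<in> S; z \<in> S\<rbrakk> \<Longrightarrow> mul z (add x y) = add (mul z x) (mul z y)"
  by (metis add_in mul_add mul_comm)

text \<open>The sum of a family over a finite set is a fold of a commutative monoid operation on a whole type.
  This extension of \<open>add\<close> is one: an element outside \<open>S\<close> absorbs those of \<open>S\<close>, and two of them add up
  to a fixed one.\<close>

definition tadd :: "'a \<Rightarrow> 'a \<Rightarrow> 'a" where
  "tadd x y = (if x \<in> S then if y \<in> S then add x y else y else if y \<in> S then x else (SOME z. z \<notin> S))"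

lemma tadd_monoid: "comm_monoid tadd zero"
proof
  have out: "(SOME z. z \<notin> S) \<notin> S" if "a \<notin> S" for a using someI[of "\<lambda>z. z \<notin> S", OF that] .
  fix a b c
  show "tadd (tadd a b) c = tadd a (tadd b c)"
    by (auto simp: tadd_def add_assoc out)
  show "tadd a b = tadd b a" by (auto simp: tadd_def add_comm)
  show "tadd a zero = a" using add_comm[of a zero] by (auto simp: tadd_def)
qed

sublocale ssum: comm_monoid_set tadd zero
  defines ssum = ssum.F
  using tadd_monoid by (rule comm_monoid_set.intro)

lemma tadd_eq: "\<lbrakk>x \<in> S; y \<in> S\<rbrakk> \<Longrightarrow> tadd x y = add x y"
  by (simp add: tadd_def)

lemma ssum_in [simp]: "(\<And>i. i \<in> A \<Longrightarrow> f i \<in> S) \<Longrightarrow> ssum f A \<in> S"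
  by (induction A rule: infinite_finite_induct) (auto simp: tadd_eq)

lemma ssum_lessThan_Suc:
  assumes "\<And>i. i \<le> n \<Longrightarrow> f i \<in> S"
  shows "ssum f {..<Suc n} = add (ssum f {..<n}) (f n)"
proof -
  have "ssum f {..<n} \<in> S" "f n \<in> S" using assms by (auto intro: ssum_in)
  thus ?thesis by (simp add: lessThan_Suc tadd_eq add_comm)
qed

lemma ssum_add:
  assumes "\<And>i. i \<in> A \<Longrightarrow> f i \<in> S" "\<And>i. i \<in> A \<Longrightarrow> g i \<in> S"
  shows "ssum (\<lambda>i. add (f i) (g i)) A = add (ssum f A) (ssum g A)"
  using ssum.distrib[of f g A] assms by (simp add: tadd_eq cong: ssum.cong)

lemma scal_ssum:
  "(\<And>i. i \<in> A \<Longrightarrow> f i \<in> S) \<Longrightarrow> scal c (ssum f A) = ssum (\<lambda>i. scal c (f i)) A"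
  by (induction A rule: infinite_finite_induct) (auto simp: tadd_eq scal_add)

lemma ssum_mul:
  "(\<And>i. i \<in> A \<Longrightarrow> f i \<in> S) \<Longrightarrow> x \<in> S \<Longrightarrow> mul (ssum f A) x = ssum (\<lambda>i. mul (f i) x) A"
  by (induction A rule: infinite_finite_induct) (auto simp: tadd_eq mul_add)

lemma mul_ssum:
  "(\<And>i. i \<in> A \<Longrightarrow> f i \<in> S) \<Longrightarrow> x \<in> S \<Longrightarrow> mul x (ssum f A) = ssum (\<lambda>i. mul x (f i)) A"
  by (induction A rule: infinite_finite_induct) (auto simp: tadd_eq mul_add_right)

lemma ssum_scal: "x \<in> S \<Longrightarrow> ssum (\<lambda>i. scal (c i) x) A = scal (\<Sum>i\<in>A. c i) x"
  by (induction A rule: infinite_finite_induct) (auto simp: tadd_eq scal_plus)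

lemma ssum_delta:
  assumes "finite A" "a \<in> A" "\<And>i. i \<in> A \<Longrightarrow> f i \<in> S"
  shows "ssum (\<lambda>i. scal (if i = a then 1 else 0) (f i)) A = f a"
proof -
  have "ssum (\<lambda>i. scal (if i = a then 1 else 0) (f i)) A = ssum (\<lambda>i. if i = a then f i else zero) A"
    using assms by (intro ssum.cong) auto
  thus ?thesis using assms by (simp add: ssum.delta)
qed

text \<open>Elements of \<open>S \<otimes> W\<close> are given by their coordinates: \<open>tmul\<close> is the multiplication of \<open>S \<otimes> W\<close>, and
  \<open>tlin\<close> is the map that a linear map of free \<open>k\<close>-modules with matrix \<open>m\<close> induces.\<close>

definition tmul :: "'k weil \<Rightarrow> (nat \<Rightarrow> 'a) \<Rightarrow> (nat \<Rightarrow> 'a) \<Rightarrow> nat \<Rightarrow> 'a" where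
  "tmul W x y l = ssum (\<lambda>i. ssum (\<lambda>j. scal (sc W i j l) (mul (x i) (y j))) {..<dim W}) {..<dim W}"

definition tlin :: "nat \<Rightarrow> (nat \<Rightarrow> nat \<Rightarrow> 'k) \<Rightarrow> (nat \<Rightarrow> 'a) \<Rightarrow> nat \<Rightarrow> 'a" where
  "tlin n m x i = ssum (\<lambda>j. scal (m i j) (x j)) {..<n}"

lemma tmul_in [simp]:
  "\<lbrakk>\<And>i. i < dim W \<Longrightarrow> x i \<in> S; \<And>i. i < dim W \<Longrightarrow> y i \<in> S\<rbrakk> \<Longrightarrow> tmul W x y l \<in> S"
  unfolding tmul_def by (intro ssum_in scal_in mul_in) auto

lemma tlin_in [simp]: "(\<And>i. i < n \<Longrightarrow> x i \<in> S) \<Longrightarrow> tlin n m x i \<in> S"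
  unfolding tlin_def by (intro ssum_in scal_in) auto

lemma tmul_comm:
  assumes "\<And>i j. sc W i j l = sc W j i l"
    and "\<And>i. i < dim W \<Longrightarrow> x i \<in> S" "\<And>i. i < dim W \<Longrightarrow> y i \<in> S"
  shows "tmul W x y l = tmul W y x l"
  unfolding tmul_def
proof (subst ssum.swap, intro ssum.cong refl)
  fix i j assume "i \<in> {..<dim W}" "j \<in> {..<dim W}"
  thus "scal (sc W j i l) (mul (x j) (y i)) = scal (sc W i j l) (mul (y i) (x j))"
    using assms(1)[of i j] mul_comm[of "x j" "y i"] assms(2,3) by simp
qed

text \<open>Both sides are sums over \<open>i\<close>, \<open>j\<close>, \<open>k\<close> of the elements \<open>x i * y j * z k\<close>. Their coefficients are
  the two sides of the associativity law for the structure constants.\<close>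

lemma tmul_assoc:
  assumes assoc: "\<And>i j k. \<lbrakk>i < dim W; j < dim W; k < dim W\<rbrakk> \<Longrightarrow>
      (\<Sum>m<dim W. sc W i j m * sc W m k l) = (\<Sum>m<dim W. sc W j k m * sc W i m l)"
    and x: "\<And>i. i < dim W \<Longrightarrow> x i \<in> S" and y: "\<And>i. i < dim W \<Longrightarrow> y i \<in> S" and z: "\<And>i. i < dim W \<Longrightarrow> z i \<in> S"
  shows "tmul W (tmul W x y) z l = tmul W x (tmul W y z) l"
proof -
  let ?N = "{..<dim W}"
  define q where "q i j k = mul (x i) (mul (y j) (z k))" for i j k
  have q [simp]: "i < dim W \<Longrightarrow> j < dim W \<Longrightarrow> k < dim W \<Longrightarrow> q i j k \<in> S" for i j k
    by (simp add: q_def x y z)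
  have "tmul W (tmul W x y) z l =
      ssum (\<lambda>m. ssum (\<lambda>k. ssum (\<lambda>i. ssum (\<lambda>j. scal (sc W i j m * sc W m k l) (q i j k)) ?N) ?N) ?N) ?N"
    unfolding tmul_def
  proof (intro ssum.cong refl)
    fix m k assume mk: "m \<in> ?N" "k \<in> ?N"
    have "scal (sc W m k l) (mul (ssum (\<lambda>i. ssum (\<lambda>j. scal (sc W i j m) (mul (x i) (y j))) ?N) ?N) (z k)) =
      ssum (\<lambda>i. ssum (\<lambda>j. scal (sc W m k l) (mul (scal (sc W i j m) (mul (x i) (y j))) (z k))) ?N) ?N"
      using mk x[folded lessThan_iff] y[folded lessThan_iff] z[folded lessThan_iff] by (simp add: ssum_mul scal_ssum cong: ssum.cong del: lessThan_iff)
    also have "\<dots> = ssum (\<lambda>i. ssum (\<lambda>j. scal (sc W i j m * sc W m k l) (q i j k)) ?N) ?N"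
      using mk x[folded lessThan_iff] y[folded lessThan_iff] z[folded lessThan_iff]
      by (intro ssum.cong refl)
        (simp add: q_def scal_mul[symmetric] mul_assoc scal_times[symmetric] mult.commute del: lessThan_iff)
    finally show "scal (sc W m k l) (mul (ssum (\<lambda>i. ssum (\<lambda>j. scal (sc W i j m) (mul (x i) (y j))) ?N) ?N) (z k)) = \<dots>" .
  qed
  also have "\<dots> = ssum (\<lambda>i. ssum (\<lambda>j. ssum (\<lambda>k. ssum (\<lambda>m. scal (sc W i j m * sc W m k l) (q i j k)) ?N) ?N) ?N) ?N"
    by (rule ssum.swap4)
  also have "\<dots> = ssum (\<lambda>i. ssum (\<lambda>j. ssum (\<lambda>k. ssum (\<lambda>m. scal (sc W j k m * sc W i m l) (q i j k)) ?N) ?N) ?N) ?N"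
    by (rule ssum.cong[OF refl], rule ssum.cong[OF refl], rule ssum.cong[OF refl]) (simp add: ssum_scal assoc)
  also have "\<dots> = ssum (\<lambda>i. ssum (\<lambda>m. ssum (\<lambda>j. ssum (\<lambda>k. scal (sc W j k m * sc W i m l) (q i j k)) ?N) ?N) ?N) ?N"
    by (rule ssum.cong[OF refl], rule ssum.swap3[symmetric])
  also have "\<dots> = tmul W x (tmul W y z) l"
    unfolding tmul_def
  proof (intro ssum.cong refl)
    fix i m assume im: "i \<in> ?N" "m \<in> ?N"
    have "scal (sc W i m l) (mul (x i) (ssum (\<lambda>j. ssum (\<lambda>k. scal (sc W j k m) (mul (y j) (z k))) ?N) ?N)) =
      ssum (\<lambda>j. ssum (\<lambda>k. scal (sc W i m l) (mul (x i) (scal (sc W j k m) (mul (y j) (z k))))) ?N) ?N"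
      using im x[folded lessThan_iff] y[folded lessThan_iff] z[folded lessThan_iff] by (simp add: mul_ssum scal_ssum cong: ssum.cong del: lessThan_iff)
    also have "\<dots> = ssum (\<lambda>j. ssum (\<lambda>k. scal (sc W j k m * sc W i m l) (q i j k)) ?N) ?N"
      using im x[folded lessThan_iff] y[folded lessThan_iff] z[folded lessThan_iff]
      by (intro ssum.cong refl)
        (simp add: q_def scal_mul_right[symmetric] scal_times[symmetric] mult.commute del: lessThan_iff)
    finally show "ssum (\<lambda>j. ssum (\<lambda>k. scal (sc W j k m * sc W i m l) (q i j k)) ?N) ?N =
      scal (sc W i m l) (mul (x i) (ssum (\<lambda>j. ssum (\<lambda>k. scal (sc W j k m) (mul (y j) (z k))) ?N) ?N))" by simp
  qed
  finally show ?thesis .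
qed

lemma tmul_one:
  assumes unit: "\<And>j. j < dim W \<Longrightarrow> sc W 0 j l = (if j = l then 1 else 0)"
    and "l < dim W" and x: "\<And>i. i < dim W \<Longrightarrow> x i \<in> S"
  shows "tmul W (\<lambda>i. if i = 0 then one else zero) x l = x l"
proof -
  let ?N = "{..<dim W}"
  have "tmul W (\<lambda>i. if i = 0 then one else zero) x l =
      ssum (\<lambda>i. if i = 0 then ssum (\<lambda>j. scal (if j = l then 1 else 0) (x j)) ?N else zero) ?N"
    unfolding tmul_def by (rule ssum.cong) (auto simp: x unit intro!: ssum.cong ssum.neutral)
  thus ?thesis using assms(2) x ssum_delta[of ?N l x] by (simp add: ssum.delta)
qed

lemma tmul_add:
  assumes "\<And>i. i < dim W \<Longrightarrow> x i \<in> S" "\<And>i. i < dim W \<Longrightarrow> y i \<in> S" "\<And>i. i < dim W \<Longrightarrow> z i \<in> S"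
  shows "tmul W (\<lambda>i. add (x i) (y i)) z l = add (tmul W x z l) (tmul W y z l)"
  unfolding tmul_def using assms[folded lessThan_iff]
  by (simp add: ssum_add[symmetric] mul_add scal_add cong: ssum.cong del: lessThan_iff)

lemma tmul_scal:
  assumes "\<And>i. i < dim W \<Longrightarrow> x i \<in> S" "\<And>i. i < dim W \<Longrightarrow> y i \<in> S"
  shows "scal c (tmul W x y l) = tmul W (\<lambda>i. scal c (x i)) y l"
  unfolding tmul_def using assms[folded lessThan_iff]
  by (simp add: scal_ssum scal_mul[symmetric] scal_times[symmetric] mult.commute cong: ssum.cong del: lessThan_iff)

lemma tlin_add:
  assumes "\<And>i. i < n \<Longrightarrow> x i \<in> S" "\<And>i. i < n \<Longrightarrow> y i \<in> S"
  shows "tlin n m (\<lambda>i. add (x i) (y i)) i = add (tlin n m x i) (tlin n m y i)"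
  unfolding tlin_def using assms[folded lessThan_iff] by (simp add: ssum_add[symmetric] scal_add cong: ssum.cong del: lessThan_iff)

lemma tlin_scal:
  assumes "\<And>i. i < n \<Longrightarrow> x i \<in> S"
  shows "tlin n m (\<lambda>i. scal c (x i)) i = scal c (tlin n m x i)"
  unfolding tlin_def using assms[folded lessThan_iff]
  by (simp add: scal_ssum scal_times[symmetric] mult.commute cong: ssum.cong del: lessThan_iff)

lemma neg_unique: "x \<in> S \<Longrightarrow> y \<in> S \<Longrightarrow> add y x = zero \<Longrightarrow> y = neg x"
  by (metis add_assoc add_comm add_neg add_zero neg_in)

lemma tlin_zero: "tlin n m (\<lambda>i. zero) i = zero"
  by (simp add: tlin_def ssum.neutral)

lemma tlin_neg:
  assumes "\<And>i. i < n \<Longrightarrow> x i \<in> S"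
  shows "tlin n m (\<lambda>i. neg (x i)) i = neg (tlin n m x i)"
proof (rule neg_unique)
  have "add (tlin n m (\<lambda>i. neg (x i)) i) (tlin n m x i) = tlin n m (\<lambda>i. add (neg (x i)) (x i)) i"
    using assms by (simp add: tlin_add)
  also have "\<dots> = zero" using assms by (simp add: tlin_def ssum.neutral)
  finally show "add (tlin n m (\<lambda>i. neg (x i)) i) (tlin n m x i) = zero" .
qed (use assms in auto)

lemma tlin_comp:
  assumes x: "\<And>i. i < n \<Longrightarrow> x i \<in> S"
  shows "tlin n' m' (tlin n m x) i = tlin n (\<lambda>i l. \<Sum>j<n'. m' i j * m j l) x i"
proof -
  have "tlin n' m' (tlin n m x) i = ssum (\<lambda>j. ssum (\<lambda>l. scal (m' i j * m j l) (x l)) {..<n}) {..<n'}"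
    unfolding tlin_def using x[folded lessThan_iff] by (intro ssum.cong refl) (simp add: scal_ssum scal_times cong: ssum.cong del: lessThan_iff)
  also have "\<dots> = ssum (\<lambda>l. ssum (\<lambda>j. scal (m' i j * m j l) (x l)) {..<n'}) {..<n}"
    by (rule ssum.swap)
  also have "\<dots> = tlin n (\<lambda>i l. \<Sum>j<n'. m' i j * m j l) x i"
    unfolding tlin_def using x[folded lessThan_iff] by (simp add: ssum_scal cong: ssum.cong del: lessThan_iff)
  finally show ?thesis .
qed

lemma tlin_delta:
  assumes "a < n" "\<And>i. i < n \<Longrightarrow> x i \<in> S" "\<And>j. j < n \<Longrightarrow> m i j = (if j = a then 1 else 0)"
  shows "tlin n m x i = x a"
proof -
  have "tlin n m x i = ssum (\<lambda>j. scal (if j = a then 1 else 0) (x j)) {..<n}"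
    unfolding tlin_def using assms(3) by (intro ssum.cong) auto
  thus ?thesis using ssum_delta[of "{..<n}" a x] assms by simp
qed

lemma tlin_one:
  assumes "0 < n" "m i 0 = (if i = 0 then 1 else 0)"
  shows "tlin n m (\<lambda>i. if i = 0 then one else zero) i = (if i = 0 then one else zero)"
proof -
  have "tlin n m (\<lambda>i. if i = 0 then one else zero) i = ssum (\<lambda>j. if j = 0 then scal (m i 0) one else zero) {..<n}"
    unfolding tlin_def by (intro ssum.cong) auto
  thus ?thesis using assms by (simp add: ssum.delta)
qed

text \<open>The hypothesis is multiplicativity of the matrix on basis vectors. Both sides are sums over \<open>i\<close>,
  \<open>j\<close> of the elements \<open>x i * y j\<close>, and the hypothesis equates their coefficients.\<close>

lemma tlin_tmul:
  assumes mult: "\<And>i j. \<lbrakk>i < dim W; j < dim W\<rbrakk> \<Longrightarrow> (\<Sum>k<dim W. m l k * sc W i j k) =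
      (\<Sum>a<dim V. \<Sum>b<dim V. m a i * m b j * sc V a b l)"
    and x: "\<And>i. i < dim W \<Longrightarrow> x i \<in> S" and y: "\<And>i. i < dim W \<Longrightarrow> y i \<in> S"
  shows "tlin (dim W) m (tmul W x y) l = tmul V (tlin (dim W) m x) (tlin (dim W) m y) l"
proof -
  let ?N = "{..<dim W}" and ?M = "{..<dim V}"
  define q where "q i j = mul (x i) (y j)" for i j
  have q [simp]: "i < dim W \<Longrightarrow> j < dim W \<Longrightarrow> q i j \<in> S" for i j by (simp add: q_def x y)
  have "tlin (dim W) m (tmul W x y) l = ssum (\<lambda>k. ssum (\<lambda>i. ssum (\<lambda>j. scal (m l k * sc W i j k) (q i j)) ?N) ?N) ?N"
    unfolding tlin_def tmul_def q_def[symmetric] using q[folded lessThan_iff] by (simp add: scal_ssum scal_times cong: ssum.cong del: lessThan_iff)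
  also have "\<dots> = ssum (\<lambda>i. ssum (\<lambda>k. ssum (\<lambda>j. scal (m l k * sc W i j k) (q i j)) ?N) ?N) ?N"
    by (rule ssum.swap)
  also have "\<dots> = ssum (\<lambda>i. ssum (\<lambda>j. ssum (\<lambda>k. scal (m l k * sc W i j k) (q i j)) ?N) ?N) ?N"
    by (rule ssum.cong[OF refl], rule ssum.swap)
  also have "\<dots> = ssum (\<lambda>i. ssum (\<lambda>j. scal (\<Sum>a<dim V. \<Sum>b<dim V. m a i * m b j * sc V a b l) (q i j)) ?N) ?N"
    by (rule ssum.cong[OF refl], rule ssum.cong[OF refl]) (simp add: ssum_scal mult)
  also have "\<dots> = ssum (\<lambda>i. ssum (\<lambda>j. ssum (\<lambda>a. ssum (\<lambda>b. scal (m a i * m b j * sc V a b l) (q i j)) ?M) ?M) ?N) ?N"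
    by (intro ssum.cong refl) (simp add: ssum_scal)
  also have "\<dots> = ssum (\<lambda>a. ssum (\<lambda>b. ssum (\<lambda>j. ssum (\<lambda>i. scal (m a i * m b j * sc V a b l) (q i j)) ?N) ?N) ?M) ?M"
    by (rule ssum.swap4)
  also have "\<dots> = ssum (\<lambda>a. ssum (\<lambda>b. ssum (\<lambda>i. ssum (\<lambda>j. scal (m a i * m b j * sc V a b l) (q i j)) ?N) ?N) ?M) ?M"
    by (rule ssum.cong[OF refl], rule ssum.cong[OF refl], rule ssum.swap)
  also have "\<dots> = tmul V (tlin (dim W) m x) (tlin (dim W) m y) l"
    unfolding tmul_def
  proof (intro ssum.cong refl)
    fix a b
    have "scal (sc V a b l) (mul (tlin (dim W) m x a) (tlin (dim W) m y b)) =
      ssum (\<lambda>i. ssum (\<lambda>j. scal (sc V a b l) (mul (scal (m a i) (x i)) (scal (m b j) (y j)))) ?N) ?N"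
      unfolding tlin_def using x[folded lessThan_iff] y[folded lessThan_iff] by (simp add: ssum_mul mul_ssum scal_ssum cong: ssum.cong del: lessThan_iff) (rule ssum.swap)
    also have "\<dots> = ssum (\<lambda>i. ssum (\<lambda>j. scal (m a i * m b j * sc V a b l) (q i j)) ?N) ?N"
      using x[folded lessThan_iff] y[folded lessThan_iff]
      by (intro ssum.cong refl)
        (simp add: q_def scal_mul[symmetric] scal_mul_right[symmetric] scal_times[symmetric] ac_simps del: lessThan_iff)
    finally show "ssum (\<lambda>i. ssum (\<lambda>j. scal (m a i * m b j * sc V a b l) (q i j)) ?N) ?N =
      scal (sc V a b l) (mul (tlin (dim W) m x a) (tlin (dim W) m y b))" by simp
  qed
  finally show ?thesis .
qed

text \<open>A family indexed by the tensor basis is a family of families, and \<open>S \<otimes> (V \<otimes> W)\<close> is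
  \<open>(S \<otimes> V) \<otimes> W\<close> as an algebra.\<close>

lemma tmul_tensor:
  assumes x: "\<And>i. i < dim V * dim W \<Longrightarrow> x i \<in> S" and y: "\<And>i. i < dim V * dim W \<Longrightarrow> y i \<in> S"
    and "j < dim W"
  shows "tmul (V \<otimes>\<^sub>W W) x y (i * dim W + j) =
    ssum (\<lambda>p. ssum (\<lambda>q. scal (sc W p q j)
      (tmul V (\<lambda>r. x (r * dim W + p)) (\<lambda>s. y (s * dim W + q)) i)) {..<dim W}) {..<dim W}"
proof -
  let ?N = "{..<dim V}" and ?M = "{..<dim W}"
  have lt: "r * dim W + p < dim V * dim W" if "r < dim V" "p < dim W" for r p
  proof -
    have "r * dim W + p < Suc r * dim W" using that by simp
    also have "\<dots> \<le> dim V * dim W" using that by (intro mult_le_mono1) simp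
    finally show ?thesis .
  qed
  have xy: "x (r * dim W + p) \<in> S" "y (r * dim W + p) \<in> S" if "r \<in> ?N" "p \<in> ?M" for r p
    using that lt x y by auto
  have "tmul (V \<otimes>\<^sub>W W) x y (i * dim W + j) =
    ssum (\<lambda>r. ssum (\<lambda>p. ssum (\<lambda>s. ssum (\<lambda>q. scal (sc V r s i * sc W p q j) (mul (x (r * dim W + p)) (y (s * dim W + q)))) ?M) ?N) ?M) ?N"
    unfolding tmul_def wtens_def using assms(3)
    by (simp add: Let_def ssum.lessThan_times)
  also have "\<dots> = ssum (\<lambda>p. ssum (\<lambda>r. ssum (\<lambda>q. ssum (\<lambda>s. scal (sc V r s i * sc W p q j) (mul (x (r * dim W + p)) (y (s * dim W + q)))) ?N) ?M) ?N) ?M"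
    by (subst ssum.swap) (rule ssum.cong[OF refl], rule ssum.cong[OF refl], rule ssum.swap)
  also have "\<dots> = ssum (\<lambda>p. ssum (\<lambda>q. ssum (\<lambda>r. ssum (\<lambda>s. scal (sc V r s i * sc W p q j) (mul (x (r * dim W + p)) (y (s * dim W + q)))) ?N) ?N) ?M) ?M"
    by (rule ssum.cong[OF refl], rule ssum.swap)
  also have "\<dots> = ssum (\<lambda>p. ssum (\<lambda>q. scal (sc W p q j)
      (tmul V (\<lambda>r. x (r * dim W + p)) (\<lambda>s. y (s * dim W + q)) i)) ?M) ?M"
    unfolding tmul_def using xy
    by (simp add: scal_ssum scal_times[symmetric] mult.commute cong: ssum.cong del: lessThan_iff)
  finally show ?thesis .
qed

end

section \<open>Weil algebras in terms of structure constants\<close>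

text \<open>Since \<open>W = k \<otimes> W\<close>, computations in \<open>W\<close> itself are the case \<open>S = k\<close> of the above.\<close>

interpretation kself: comm_alg "UNIV :: 'k::{comm_ring, comm_monoid_mult} set" "(+)" "(*)" 0 1 uminus "(*)"
  by standard (simp_all add: algebra_simps)

lemma kself_ssum: "(kself.ssum :: ('b \<Rightarrow> 'k::{comm_ring, comm_monoid_mult}) \<Rightarrow> 'b set \<Rightarrow> 'k) = sum"
proof -
  have "(kself.tadd :: 'k \<Rightarrow> 'k \<Rightarrow> 'k) = (+)" by (simp add: fun_eq_iff kself.tadd_eq)
  thus ?thesis by (simp add: kself.ssum_def sum_def)
qed

lemma wmul_eq_tmul: "wmul W x y = kself.tmul W x y"
  by (rule ext) (simp add: wmul_def kself.tmul_def kself_ssum ac_simps)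

lemma wapp_eq_tlin: "wapp \<phi> x = kself.tlin (dim (src \<phi>)) (mat \<phi>) x"
  by (rule ext) (simp add: wapp_def kself.tlin_def kself_ssum)

definition unit_vec :: "nat \<Rightarrow> nat \<Rightarrow> 'k::{comm_ring, comm_monoid_mult}" where
  "unit_vec j = (\<lambda>i. if i = j then 1 else 0)"

lemma wone_eq: "wone = unit_vec 0"
  by (simp add: wone_def unit_vec_def)

lemma sum_unit_vec:
  fixes f :: "nat \<Rightarrow> 'k::{comm_ring, comm_monoid_mult}"
  assumes "j < n"
  shows "(\<Sum>i<n. unit_vec j i * f i) = f j" "(\<Sum>i<n. f i * unit_vec j i) = f j"
proof -
  have *: "(\<Sum>i<n. unit_vec j i * f i) = (\<Sum>i<n. if i = j then f i else 0)"
    by (rule sum.cong) (auto simp: unit_vec_def)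
  thus "(\<Sum>i<n. unit_vec j i * f i) = f j" using assms by (simp add: sum.delta)
  thus "(\<Sum>i<n. f i * unit_vec j i) = f j" by (simp add: mult.commute)
qed

lemma unit_vec_in [simp]: "j < dim W \<Longrightarrow> unit_vec j \<in> wvec W"
  by (auto simp: wvec_def unit_vec_def)

lemma wmul_unit_vec_left: "i < dim W \<Longrightarrow> wmul W (unit_vec i) y l = (\<Sum>j<dim W. y j * sc W i j l)"
  by (simp add: wmul_def mult.assoc sum_distrib_left[symmetric] sum_unit_vec)

lemma wmul_unit_vec_right:
  assumes "j < dim W" shows "wmul W x (unit_vec j) l = (\<Sum>i<dim W. x i * sc W i j l)"
proof -
  have "wmul W x (unit_vec j) l = (\<Sum>i<dim W. x i * (\<Sum>p<dim W. unit_vec j p * sc W i p l))"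
    by (simp add: wmul_def mult.assoc sum_distrib_left)
  thus ?thesis using assms by (simp add: sum_unit_vec)
qed

lemma wmul_unit_vec: "i < dim W \<Longrightarrow> j < dim W \<Longrightarrow> wmul W (unit_vec i) (unit_vec j) l = sc W i j l"
  by (simp add: wmul_unit_vec_left sum_unit_vec)

text \<open>The last condition says that the span of the \<open>e\<^sub>j\<close> with \<open>j > 0\<close> is an ideal.\<close>

definition structure_constants :: "'k::{comm_ring, comm_monoid_mult} weil \<Rightarrow> bool" where
  "structure_constants W \<longleftrightarrow>
     0 < dim W \<and>
     (\<forall>i j l. i \<ge> dim W \<or> j \<ge> dim W \<or> l \<ge> dim W \<longrightarrow> sc W i j l = 0) \<and>
     (\<forall>i j l. sc W i j l = sc W j i l) \<and>
     (\<forall>i j k l. i < dim W \<longrightarrow> j < dim W \<longrightarrow> k < dim W \<longrightarrow>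
        (\<Sum>m<dim W. sc W i j m * sc W m k l) = (\<Sum>m<dim W. sc W j k m * sc W i m l)) \<and>
     (\<forall>j l. j < dim W \<longrightarrow> sc W 0 j l = (if j = l then 1 else 0)) \<and>
     (\<forall>i j. 0 < j \<longrightarrow> sc W i j 0 = 0)"

definition nilpotent :: "'k::{comm_ring, comm_monoid_mult} weil \<Rightarrow> bool" where
  "nilpotent W \<longleftrightarrow>
     (\<exists>N. \<forall>xs. length xs = N \<and> set xs \<subseteq> wmax W \<longrightarrow> foldr (wmul W) xs wone = (\<lambda>_. 0))"

lemma structure_constantsD:
  assumes "structure_constants W"
  shows "0 < dim W" "i \<ge> dim W \<or> j \<ge> dim W \<or> l \<ge> dim W \<Longrightarrow> sc W i j l = 0"
    "sc W i j l = sc W j i l"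
    "\<lbrakk>i < dim W; j < dim W; k < dim W\<rbrakk> \<Longrightarrow>
        (\<Sum>m<dim W. sc W i j m * sc W m k l) = (\<Sum>m<dim W. sc W j k m * sc W i m l)"
    "j < dim W \<Longrightarrow> sc W 0 j l = (if j = l then 1 else 0)"
    "0 < j \<Longrightarrow> sc W i j 0 = 0"
  using assms unfolding structure_constants_def by blast+

lemma wmul_in:
  assumes "\<And>i j l. l \<ge> dim W \<Longrightarrow> sc W i j l = 0" shows "wmul W x y \<in> wvec W"
  by (simp add: wvec_def wmul_def assms)

text \<open>All axioms except nilpotency are multilinear, so they may be tested on basis vectors.\<close>

lemma is_weil_iff: "is_weil W \<longleftrightarrow> structure_constants W \<and> nilpotent W"
proof
  assume W: "is_weil W"
  hence d: "0 < dim W" and rng: "\<And>i j l. i \<ge> dim W \<or> j \<ge> dim W \<or> l \<ge> dim W \<Longrightarrow> sc W i j l = 0"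
    and comm: "\<And>x y. \<lbrakk>x \<in> wvec W; y \<in> wvec W\<rbrakk> \<Longrightarrow> wmul W x y = wmul W y x"
    and assoc: "\<And>x y z. \<lbrakk>x \<in> wvec W; y \<in> wvec W; z \<in> wvec W\<rbrakk> \<Longrightarrow> wmul W (wmul W x y) z = wmul W x (wmul W y z)"
    and one: "\<And>x. x \<in> wvec W \<Longrightarrow> wmul W wone x = x"
    and ideal: "\<And>x y. \<lbrakk>x \<in> wvec W; y \<in> wmax W\<rbrakk> \<Longrightarrow> wmul W x y \<in> wmax W"
    and nil: "nilpotent W"
    by (auto simp: is_weil_def nilpotent_def)
  have "sc W i j l = sc W j i l" for i j l
  proof (cases "i < dim W \<and> j < dim W")
    case True
    thus ?thesis using fun_cong[OF comm[of "unit_vec i" "unit_vec j"], of l] by (simp add: wmul_unit_vec)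
  qed (use rng in auto)
  moreover have "(\<Sum>m<dim W. sc W i j m * sc W m k l) = (\<Sum>m<dim W. sc W j k m * sc W i m l)"
    if "i < dim W" "j < dim W" "k < dim W" for i j k l
    using fun_cong[OF assoc[of "unit_vec i" "unit_vec j" "unit_vec k"], of l] that
    by (simp add: wmul_unit_vec_left[of i] wmul_unit_vec_right[of k] wmul_unit_vec sum_unit_vec)
  moreover have "sc W 0 j l = (if j = l then 1 else 0)" if "j < dim W" for j l
    using fun_cong[OF one[of "unit_vec j"], of l] that d
    by (simp add: wone_eq wmul_unit_vec) (simp add: unit_vec_def)
  moreover have "sc W i j 0 = 0" if "0 < j" for i j
  proof (cases "i < dim W \<and> j < dim W")
    case True
    hence "unit_vec j \<in> wmax W" using that by (simp add: wmax_def) (simp add: unit_vec_def)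
    hence "wmul W (unit_vec i) (unit_vec j) 0 = 0" using ideal[of "unit_vec i"] True by (simp add: wmax_def)
    thus ?thesis using True by (simp add: wmul_unit_vec)
  qed (use rng in auto)
  ultimately show "structure_constants W \<and> nilpotent W"
    using d rng nil unfolding structure_constants_def by blast
next
  assume W: "structure_constants W \<and> nilpotent W"
  note D = structure_constantsD[OF conjunct1[OF W]]
  have in_wvec: "wmul W x y \<in> wvec W" for x y using D(2) by (intro wmul_in) blast
  have eqI: "x = y" if "x \<in> wvec W" "y \<in> wvec W" "\<And>i. i < dim W \<Longrightarrow> x i = y i" for x y :: "nat \<Rightarrow> 'a"
    using that by (auto simp: wvec_def fun_eq_iff) (metis not_le)
  show "is_weil W" unfolding is_weil_def
  proof (intro conjI ballI)
    show "1 \<le> dim W" using D(1) by simp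
    show "\<forall>i j l. dim W \<le> i \<or> dim W \<le> j \<or> dim W \<le> l \<longrightarrow> sc W i j l = 0" using D(2) by blast
    fix x assume x: "x \<in> wvec W"
    show "wmul W wone x = x"
    proof (rule eqI[OF in_wvec x])
      fix i assume "i < dim W"
      thus "wmul W wone x i = x i"
        using kself.tmul_one[of W i x] D(5) by (simp add: wmul_eq_tmul wone_def)
    qed
    fix y
    show "wmul W x y = wmul W y x"
      unfolding wmul_eq_tmul using D(3) by (intro ext kself.tmul_comm) auto
    fix z
    show "wmul W (wmul W x y) z = wmul W x (wmul W y z)"
      unfolding wmul_eq_tmul using D(4) by (intro ext kself.tmul_assoc) auto
  next
    fix x y assume "x \<in> wvec W" and y: "y \<in> wmax W"
    have "wmul W x y 0 = 0" unfolding wmul_def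
    proof (intro sum.neutral ballI)
      fix i j show "x i * y j * sc W i j 0 = 0" using D(6)[of j i] y by (cases "j = 0") (auto simp: wmax_def)
    qed
    thus "wmul W x y \<in> wmax W" using in_wvec by (simp add: wmax_def)
  qed (use W in \<open>simp add: nilpotent_def\<close>)
qed

lemma is_weil_structure: "is_weil W \<Longrightarrow> structure_constants W"
  by (simp add: is_weil_iff)

lemma is_weil_dim: "is_weil W \<Longrightarrow> 0 < dim W"
  by (simp add: is_weil_def)

definition hom_matrix :: "'k::{comm_ring, comm_monoid_mult} wmap \<Rightarrow> bool" where
  "hom_matrix \<phi> \<longleftrightarrow>
     (\<forall>i j. i \<ge> dim (tgt \<phi>) \<or> j \<ge> dim (src \<phi>) \<longrightarrow> mat \<phi> i j = 0) \<and>
     (\<forall>i. mat \<phi> i 0 = (if i = 0 then 1 else 0)) \<and>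
     (\<forall>j < dim (src \<phi>). mat \<phi> 0 j = (if j = 0 then 1 else 0)) \<and>
     (\<forall>i j l. i < dim (src \<phi>) \<longrightarrow> j < dim (src \<phi>) \<longrightarrow>
       (\<Sum>k<dim (src \<phi>). mat \<phi> l k * sc (src \<phi>) i j k) =
       (\<Sum>a<dim (tgt \<phi>). \<Sum>b<dim (tgt \<phi>). mat \<phi> a i * mat \<phi> b j * sc (tgt \<phi>) a b l))"

lemma wapp_unit_vec: "j < dim (src \<phi>) \<Longrightarrow> wapp \<phi> (unit_vec j) i = mat \<phi> i j"
  by (simp add: wapp_def sum_unit_vec)

lemma is_weil_hom_iff: "is_weil_hom \<phi> \<longleftrightarrow> is_weil (src \<phi>) \<and> is_weil (tgt \<phi>) \<and> hom_matrix \<phi>"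
proof
  assume h: "is_weil_hom \<phi>"
  hence w: "is_weil (src \<phi>)" "is_weil (tgt \<phi>)"
    and rng: "\<And>i j. i \<ge> dim (tgt \<phi>) \<or> j \<ge> dim (src \<phi>) \<Longrightarrow> mat \<phi> i j = 0"
    and one: "wapp \<phi> wone = wone"
    and mult: "\<And>x y. \<lbrakk>x \<in> wvec (src \<phi>); y \<in> wvec (src \<phi>)\<rbrakk> \<Longrightarrow>
        wapp \<phi> (wmul (src \<phi>) x y) = wmul (tgt \<phi>) (wapp \<phi> x) (wapp \<phi> y)"
    and aug: "\<And>x. x \<in> wvec (src \<phi>) \<Longrightarrow> wapp \<phi> x 0 = x 0"
    by (auto simp: is_weil_hom_def)
  have "mat \<phi> i 0 = (if i = 0 then 1 else 0)" for i
    using fun_cong[OF one, of i] is_weil_dim[OF w(1)] by (simp add: wone_eq wapp_unit_vec) (simp add: unit_vec_def)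
  moreover have "mat \<phi> 0 j = (if j = 0 then 1 else 0)" if "j < dim (src \<phi>)" for j
    using aug[of "unit_vec j"] that by (simp add: wapp_unit_vec) (simp add: unit_vec_def)
  moreover have "(\<Sum>k<dim (src \<phi>). mat \<phi> l k * sc (src \<phi>) i j k) =
       (\<Sum>a<dim (tgt \<phi>). \<Sum>b<dim (tgt \<phi>). mat \<phi> a i * mat \<phi> b j * sc (tgt \<phi>) a b l)"
    if "i < dim (src \<phi>)" "j < dim (src \<phi>)" for i j l
    using fun_cong[OF mult[of "unit_vec i" "unit_vec j"], of l] that
    by (simp add: wapp_def[of _ "wmul _ _ _"] wmul_unit_vec) (simp add: wmul_def wapp_unit_vec)
  ultimately show "is_weil (src \<phi>) \<and> is_weil (tgt \<phi>) \<and> hom_matrix \<phi>"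
    using w rng unfolding hom_matrix_def by blast
next
  assume h: "is_weil (src \<phi>) \<and> is_weil (tgt \<phi>) \<and> hom_matrix \<phi>"
  hence rng: "\<And>i j. i \<ge> dim (tgt \<phi>) \<or> j \<ge> dim (src \<phi>) \<Longrightarrow> mat \<phi> i j = 0"
    and one: "\<And>i. mat \<phi> i 0 = (if i = 0 then 1 else 0)"
    and aug: "\<And>j. j < dim (src \<phi>) \<Longrightarrow> mat \<phi> 0 j = (if j = 0 then 1 else 0)"
    and mult: "\<And>i j l. \<lbrakk>i < dim (src \<phi>); j < dim (src \<phi>)\<rbrakk> \<Longrightarrow>
       (\<Sum>k<dim (src \<phi>). mat \<phi> l k * sc (src \<phi>) i j k) =
       (\<Sum>a<dim (tgt \<phi>). \<Sum>b<dim (tgt \<phi>). mat \<phi> a i * mat \<phi> b j * sc (tgt \<phi>) a b l)"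
    unfolding hom_matrix_def by blast+
  have d: "0 < dim (src \<phi>)" using h is_weil_dim by blast
  show "is_weil_hom \<phi>" unfolding is_weil_hom_def
  proof (intro conjI ballI)
    show "wapp \<phi> wone = wone" using d by (simp add: wone_eq fun_eq_iff wapp_unit_vec one) (simp add: unit_vec_def)
    fix x :: "nat \<Rightarrow> 'a"
    have "wapp \<phi> x 0 = (\<Sum>j<dim (src \<phi>). unit_vec 0 j * x j)"
      unfolding wapp_def by (rule sum.cong) (auto simp: aug unit_vec_def)
    thus "wapp \<phi> x 0 = x 0" using d by (simp add: sum_unit_vec)
    fix y
    show "wapp \<phi> (wmul (src \<phi>) x y) = wmul (tgt \<phi>) (wapp \<phi> x) (wapp \<phi> y)"
      unfolding wmul_eq_tmul wapp_eq_tlin using mult by (intro ext kself.tlin_tmul) auto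
  qed (use h rng in auto)
qed

lemma is_weil_homD:
  assumes "is_weil_hom \<phi>"
  shows "is_weil (src \<phi>)" "is_weil (tgt \<phi>)"
    and "i \<ge> dim (tgt \<phi>) \<or> j \<ge> dim (src \<phi>) \<Longrightarrow> mat \<phi> i j = 0"
    and "mat \<phi> i 0 = (if i = 0 then 1 else 0)"
    and "\<lbrakk>i < dim (src \<phi>); j < dim (src \<phi>)\<rbrakk> \<Longrightarrow>
       (\<Sum>k<dim (src \<phi>). mat \<phi> l k * sc (src \<phi>) i j k) =
       (\<Sum>a<dim (tgt \<phi>). \<Sum>b<dim (tgt \<phi>). mat \<phi> a i * mat \<phi> b j * sc (tgt \<phi>) a b l)"
  using assms unfolding is_weil_hom_iff hom_matrix_def by blast+

subsection \<open>Nilpotency of tensor products\<close>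

lemma wmul_sum_right:
  "wmul W x (\<lambda>l. \<Sum>i\<in>I. c i * v i l) = (\<lambda>l. \<Sum>i\<in>I. c i * wmul W x (v i) l)"
proof (induction I rule: infinite_finite_induct)
  case (insert a I)
  show ?case
  proof
    fix l
    have "wmul W x (\<lambda>l. \<Sum>i\<in>insert a I. c i * v i l) l = c a * wmul W x (v a) l + wmul W x (\<lambda>l. \<Sum>i\<in>I. c i * v i l) l"
      using insert(1,2)
      by (simp add: wmul_def algebra_simps sum.distrib sum_distrib_left)
    thus "wmul W x (\<lambda>l. \<Sum>i\<in>insert a I. c i * v i l) l = (\<Sum>i\<in>insert a I. c i * wmul W x (v i) l)"
      using insert by simp
  qed
qed (simp_all add: wmul_def)

lemma foldr_wmul_sum:
  "foldr (wmul W) xs (\<lambda>l. \<Sum>i\<in>I. c i * v i l) = (\<lambda>l. \<Sum>i\<in>I. c i * foldr (wmul W) xs (v i) l)"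
  by (induction xs) (simp_all add: wmul_sum_right)

lemma wmul_expand_left:
  "wmul W x y = (\<lambda>l. \<Sum>i<dim W. x i * wmul W (unit_vec i) y l)"
  by (rule ext) (simp add: wmul_unit_vec_left wmul_def[of _ x] sum_distrib_left mult.assoc)

lemma foldr_wmul_zero: "foldr (wmul W) xs (\<lambda>_. 0) = (\<lambda>_. 0)"
  by (induction xs) (simp_all add: wmul_def)

text \<open>By multilinearity it suffices to consider products of basis vectors.\<close>

lemma foldr_wmul_basis:
  assumes "\<And>is. length is = n \<Longrightarrow> set is \<subseteq> {0<..<dim W} \<Longrightarrow> foldr (wmul W) (map unit_vec is) v = (\<lambda>_. 0)"
    and "length xs = n" "set xs \<subseteq> wmax W"
  shows "foldr (wmul W) xs v = (\<lambda>_. 0)"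
  using assms
proof (induction n arbitrary: xs v)
  case 0
  thus ?case using "0.prems"(1)[of "[]"] by simp
next
  case (Suc n)
  then obtain ys x where xs: "xs = ys @ [x]" by (metis length_Suc_conv_rev)
  hence ys: "length ys = n" "set ys \<subseteq> wmax W" and x: "x \<in> wmax W" using Suc.prems by auto
  have "foldr (wmul W) xs v = (\<lambda>l. \<Sum>i<dim W. x i * foldr (wmul W) ys (wmul W (unit_vec i) v) l)"
    by (simp add: xs wmul_expand_left[of W x] foldr_wmul_sum)
  also have "\<dots> = (\<lambda>_. 0)"
  proof (rule ext, rule sum.neutral, rule ballI)
    fix l i assume i: "i \<in> {..<dim W}"
    show "x i * foldr (wmul W) ys (wmul W (unit_vec i) v) l = 0"
    proof (cases "i = 0")
      case True
      thus ?thesis using x by (simp add: wmax_def)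
    next
      case False
      have "foldr (wmul W) ys (wmul W (unit_vec i) v) = (\<lambda>_. 0)"
      proof (rule Suc.IH[OF _ ys])
        fix js assume "length js = n" "set js \<subseteq> {0<..<dim W}"
        thus "foldr (wmul W) (map unit_vec js) (wmul W (unit_vec i) v) = (\<lambda>_. 0)"
          using Suc.prems(1)[of "js @ [i]"] i False by simp
      qed
      thus ?thesis by simp
    qed
  qed
  finally show ?case .
qed

text \<open>Factors \<open>e\<^sub>0\<close> can be omitted from a product, since \<open>e\<^sub>0\<close> is the unit.\<close>

lemma foldr_wmul_unit_vec:
  assumes "is_weil W" "set is \<subseteq> {..<dim W}"
  shows "foldr (wmul W) (map unit_vec is) wone \<in> wvec W \<and>
    foldr (wmul W) (map unit_vec is) wone = foldr (wmul W) (map unit_vec (filter (\<lambda>i. i \<noteq> 0) is)) wone"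
  using assms(2)
proof (induction "is")
  case Nil
  thus ?case using is_weil_dim[OF assms(1)] by (simp add: wone_eq)
next
  case (Cons i "is")
  have "wmul W x y \<in> wvec W" for x y using assms(1) by (intro wmul_in) (simp add: is_weil_def)
  moreover have "wmul W wone y = y" if "y \<in> wvec W" for y
    using assms(1) that unfolding is_weil_def by blast
  hence "wmul W (unit_vec 0) y = y" if "y \<in> wvec W" for y
    using that by (simp add: wone_eq)
  ultimately show ?case using Cons by auto
qed

text \<open>Counting the factors different from \<open>e\<^sub>0\<close> is what tensor products need: \<open>e\<^sub>i \<otimes> e\<^sub>j\<close> belongs to the
  augmentation ideal as soon as one of the two indices is positive.\<close>

lemma nilpotent_unit_vec:
  assumes "is_weil W"
  shows "\<exists>N. \<forall>is. set is \<subseteq> {..<dim W} \<longrightarrow> N \<le> length (filter (\<lambda>i. i \<noteq> 0) is) \<longrightarrow>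
    foldr (wmul W) (map unit_vec is) wone = (\<lambda>_. 0)"
proof -
  obtain N where N: "\<And>xs. length xs = N \<Longrightarrow> set xs \<subseteq> wmax W \<Longrightarrow> foldr (wmul W) xs wone = (\<lambda>_. 0)"
    using assms unfolding is_weil_def by blast
  show ?thesis
  proof (intro exI allI impI)
    fix "is" assume i: "set is \<subseteq> {..<dim W}" "N \<le> length (filter (\<lambda>i. i \<noteq> 0) is)"
    define ks where "ks = map (unit_vec :: nat \<Rightarrow> nat \<Rightarrow> 'a) (filter (\<lambda>i. i \<noteq> 0) is)"
    (* the last N factors already have product 0 *)
    have ks: "set ks \<subseteq> wmax W" using i(1) by (auto simp: ks_def wmax_def) (auto simp: unit_vec_def)
    have "foldr (wmul W) ks wone = foldr (wmul W) (take (length ks - N) ks) (foldr (wmul W) (drop (length ks - N) ks) wone)"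
      by (metis append_take_drop_id foldr_append o_apply)
    also have "foldr (wmul W) (drop (length ks - N) ks) wone = (\<lambda>_. 0)"
    proof (rule N)
      show "length (drop (length ks - N) ks) = N" using i(2) by (simp add: ks_def)
      show "set (drop (length ks - N) ks) \<subseteq> wmax W" using ks set_drop_subset[of "length ks - N" ks] by blast
    qed
    finally show "foldr (wmul W) (map unit_vec is) wone = (\<lambda>_. 0)"
      using foldr_wmul_unit_vec[OF assms i(1)] by (simp add: ks_def foldr_wmul_zero)
  qed
qed

text \<open>Here \<open>n\<close> is the dimension of the second factor.\<close>

definition pure_tensor :: "nat \<Rightarrow> (nat \<Rightarrow> 'k::{comm_ring, comm_monoid_mult}) \<Rightarrow> (nat \<Rightarrow> 'k) \<Rightarrow> nat \<Rightarrow> 'k" where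
  "pure_tensor n x y = (\<lambda>i. x (i div n) * y (i mod n))"

lemma dim_wtens [simp]: "dim (V \<otimes>\<^sub>W W) = dim V * dim W"
  by (simp add: wtens_def Let_def)

lemma sc_wtens: "sc (V \<otimes>\<^sub>W W) i j l =
    sc V (i div dim W) (j div dim W) (l div dim W) * sc W (i mod dim W) (j mod dim W) (l mod dim W)"
  by (simp add: wtens_def Let_def)

lemma sum_tensor:
  fixes f g :: "nat \<Rightarrow> 'k::{comm_ring, comm_monoid_mult}"
  shows "(\<Sum>i<a * b. f (i div b) * g (i mod b)) = (\<Sum>i<a. f i) * (\<Sum>j<b. g j)"
  by (simp add: sum.lessThan_times sum_product)

lemma sum_sum_tensor:
  fixes f g :: "nat \<Rightarrow> nat \<Rightarrow> 'k::{comm_ring, comm_monoid_mult}"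
  shows "(\<Sum>i<a * b. \<Sum>j<c * d. f (i div b) (j div d) * g (i mod b) (j mod d)) =
    (\<Sum>i<a. \<Sum>j<c. f i j) * (\<Sum>i<b. \<Sum>j<d. g i j)"
proof -
  have "(\<Sum>i<a * b. \<Sum>j<c * d. f (i div b) (j div d) * g (i mod b) (j mod d)) =
     (\<Sum>i<a * b. (\<Sum>j<c. f (i div b) j) * (\<Sum>j<d. g (i mod b) j))"
    by (simp add: sum_tensor)
  thus ?thesis by (simp add: sum_tensor[where f = "\<lambda>i. \<Sum>j<c. f i j" and g = "\<lambda>i. \<Sum>j<d. g i j"])
qed

lemma wmul_pure_tensor: "wmul (V \<otimes>\<^sub>W W) (pure_tensor (dim W) x y) (pure_tensor (dim W) x' y') = pure_tensor (dim W) (wmul V x x') (wmul W y y')"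
proof
  fix l
  show "wmul (V \<otimes>\<^sub>W W) (pure_tensor (dim W) x y) (pure_tensor (dim W) x' y') l = pure_tensor (dim W) (wmul V x x') (wmul W y y') l"
    using sum_sum_tensor[of "\<lambda>i j. x i * x' j * sc V i j (l div dim W)" "dim W" "dim W" "\<lambda>i j. y i * y' j * sc W i j (l mod dim W)" "dim V" "dim V"]
    by (simp add: wmul_def pure_tensor_def sc_wtens ac_simps)
qed

lemma div_mod_eq_iff: "(i div n = j div n \<and> i mod n = j mod n) \<longleftrightarrow> i = (j::nat)"
  by (metis div_mult_mod_eq)

lemma unit_vec_pure_tensor: "unit_vec i = pure_tensor n (unit_vec (i div n)) (unit_vec (i mod n))"
  by (rule ext) (auto simp: unit_vec_def pure_tensor_def div_mod_eq_iff[of _ n i, symmetric])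

lemma foldr_wmul_pure_tensor:
  "foldr (wmul (V \<otimes>\<^sub>W W)) (map unit_vec is) wone =
     pure_tensor (dim W) (foldr (wmul V) (map unit_vec (map (\<lambda>i. i div dim W) is)) wone)
       (foldr (wmul W) (map unit_vec (map (\<lambda>i. i mod dim W) is)) wone)"
proof (induction "is")
  case Nil
  show ?case using unit_vec_pure_tensor[of 0 "dim W"] by (simp add: wone_eq)
next
  case (Cons i "is")
  thus ?case by (simp add: unit_vec_pure_tensor[of i "dim W"] wmul_pure_tensor)
qed

lemma div_less_dim: "i < a * b \<Longrightarrow> i div b < (a::nat)"
  by (rule less_mult_imp_div_less)

text \<open>Consider \<open>M + N\<close> vectors \<open>e\<^sub>i \<otimes> e\<^sub>j\<close> of the augmentation ideal. Each has a positive index, so at least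
  \<open>M\<close> of them have \<open>i > 0\<close> or at least \<open>N\<close> of them have \<open>j > 0\<close>. Their product is a pure tensor, and
  one of its two factors vanishes.\<close>

lemma nilpotent_wtens:
  assumes V: "is_weil V" and W: "is_weil W"
  shows "nilpotent (V \<otimes>\<^sub>W W)"
proof -
  obtain M N where
    M: "\<And>is. set is \<subseteq> {..<dim V} \<Longrightarrow> M \<le> length (filter (\<lambda>i. i \<noteq> 0) is) \<Longrightarrow>
      foldr (wmul V) (map unit_vec is) wone = (\<lambda>_. 0)" and
    N: "\<And>is. set is \<subseteq> {..<dim W} \<Longrightarrow> N \<le> length (filter (\<lambda>i. i \<noteq> 0) is) \<Longrightarrow>
      foldr (wmul W) (map unit_vec is) wone = (\<lambda>_. 0)"
    using nilpotent_unit_vec[OF V] nilpotent_unit_vec[OF W] by metis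
  show ?thesis unfolding nilpotent_def
  proof (intro exI allI impI)
    fix xs assume xs: "length xs = M + N \<and> set xs \<subseteq> wmax (V \<otimes>\<^sub>W W)"
    show "foldr (wmul (V \<otimes>\<^sub>W W)) xs wone = (\<lambda>_. 0)"
    proof (rule foldr_wmul_basis[of "M + N"])
      fix "is" assume i: "length is = M + N" "set is \<subseteq> {0<..<dim (V \<otimes>\<^sub>W W)}"
      let ?d = "map (\<lambda>i. i div dim W) is" and ?m = "map (\<lambda>i. i mod dim W) is"
      (* a positive index i has i div dim W > 0 or i mod dim W > 0 *)
      have "length (js :: nat list) \<le> length (filter (\<lambda>i. i \<noteq> 0) (map (\<lambda>i. i div dim W) js)) +
          length (filter (\<lambda>i. i \<noteq> 0) (map (\<lambda>i. i mod dim W) js))" if "0 \<notin> set js" for js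
        using that
      proof (induction js)
        case (Cons j js)
        have "j div dim W \<noteq> 0 \<or> j mod dim W \<noteq> 0" using Cons.prems div_mod_eq_iff[of j "dim W" 0] by auto
        thus ?case using Cons by auto
      qed simp
      from this[of "is"] i have "M \<le> length (filter (\<lambda>i. i \<noteq> 0) ?d) \<or> N \<le> length (filter (\<lambda>i. i \<noteq> 0) ?m)"
        by fastforce
      moreover have "set ?d \<subseteq> {..<dim V}" "set ?m \<subseteq> {..<dim W}"
        using i(2) is_weil_dim[OF W] by (auto dest!: subsetD intro: div_less_dim)
      ultimately have "foldr (wmul V) (map unit_vec ?d) wone = (\<lambda>_. 0) \<or> foldr (wmul W) (map unit_vec ?m) wone = (\<lambda>_. 0)"
        using M N by blast
      thus "foldr (wmul (V \<otimes>\<^sub>W W)) (map unit_vec is) wone = (\<lambda>_. 0)"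
        unfolding foldr_wmul_pure_tensor by (auto simp: pure_tensor_def)
    qed (use xs in auto)
  qed
qed

subsection \<open>The category of Weil algebras\<close>

text \<open>The structure constants of \<open>V \<otimes> W\<close> are products of those of \<open>V\<close> and \<open>W\<close>, so every sum in the axioms
  factors.\<close>

lemma is_weil_wtens:
  assumes V: "is_weil V" and W: "is_weil W"
  shows "is_weil (V \<otimes>\<^sub>W W)"
proof -
  let ?n = "dim W"
  note v = structure_constantsD[OF is_weil_structure[OF V]]
  note w = structure_constantsD[OF is_weil_structure[OF W]]
  have n: "0 < ?n" by (rule w)
  have lt: "i div ?n < dim V" "i mod ?n < ?n" if "i < dim V * ?n" for i using that n by (auto intro: div_less_dim)
  have ge: "dim V \<le> i div ?n" if "dim V * ?n \<le> i" for i using that n by (simp add: less_eq_div_iff_mult_less_eq)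
  have "structure_constants (V \<otimes>\<^sub>W W)" unfolding structure_constants_def
  proof (intro conjI allI impI)
    show "0 < dim (V \<otimes>\<^sub>W W)" using v(1) w(1) by simp
    show "sc (V \<otimes>\<^sub>W W) i j l = 0" if "dim (V \<otimes>\<^sub>W W) \<le> i \<or> dim (V \<otimes>\<^sub>W W) \<le> j \<or> dim (V \<otimes>\<^sub>W W) \<le> l" for i j l
      using that ge v(2)[of "i div ?n" "j div ?n" "l div ?n"] by (auto simp: sc_wtens)
    show "sc (V \<otimes>\<^sub>W W) i j l = sc (V \<otimes>\<^sub>W W) j i l" for i j l
      unfolding sc_wtens using v(3) w(3) by metis
    show "sc (V \<otimes>\<^sub>W W) 0 j l = (if j = l then 1 else 0)" if "j < dim (V \<otimes>\<^sub>W W)" for j l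
      using that lt[of j] v(5)[of "j div ?n"] w(5)[of "j mod ?n"] div_mod_eq_iff[of j ?n l]
      by (auto simp: sc_wtens)
    show "sc (V \<otimes>\<^sub>W W) i j 0 = 0" if "0 < j" for i j
      using that v(6)[of "j div ?n" "i div ?n"] w(6)[of "j mod ?n" "i mod ?n"] div_mod_eq_iff[of j ?n 0]
      by (auto simp: sc_wtens)
    fix i j k l assume ijk: "i < dim (V \<otimes>\<^sub>W W)" "j < dim (V \<otimes>\<^sub>W W)" "k < dim (V \<otimes>\<^sub>W W)"
    have "(\<Sum>m<dim (V \<otimes>\<^sub>W W). sc (V \<otimes>\<^sub>W W) i j m * sc (V \<otimes>\<^sub>W W) m k l) =
      (\<Sum>m<dim V. sc V (i div ?n) (j div ?n) m * sc V m (k div ?n) (l div ?n)) *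
      (\<Sum>m<dim W. sc W (i mod ?n) (j mod ?n) m * sc W m (k mod ?n) (l mod ?n))"
      by (subst sum_tensor[symmetric]) (simp add: sc_wtens ac_simps)
    also have "\<dots> = (\<Sum>m<dim V. sc V (j div ?n) (k div ?n) m * sc V (i div ?n) m (l div ?n)) *
      (\<Sum>m<dim W. sc W (j mod ?n) (k mod ?n) m * sc W (i mod ?n) m (l mod ?n))"
      using ijk lt v(4) w(4) by simp
    also have "\<dots> = (\<Sum>m<dim (V \<otimes>\<^sub>W W). sc (V \<otimes>\<^sub>W W) j k m * sc (V \<otimes>\<^sub>W W) i m l)"
      by (subst sum_tensor[symmetric]) (simp add: sc_wtens ac_simps)
    finally show "(\<Sum>m<dim (V \<otimes>\<^sub>W W). sc (V \<otimes>\<^sub>W W) i j m * sc (V \<otimes>\<^sub>W W) m k l) =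
      (\<Sum>m<dim (V \<otimes>\<^sub>W W). sc (V \<otimes>\<^sub>W W) j k m * sc (V \<otimes>\<^sub>W W) i m l)" .
  qed
  thus ?thesis using nilpotent_wtens[OF V W] by (simp add: is_weil_iff)
qed

lemma is_weil_ground: "is_weil (ground :: 'k::{comm_ring, comm_monoid_mult} weil)"
proof -
  have "structure_constants (ground :: 'k weil)"
    by (auto simp: structure_constants_def ground_def)
  moreover have "nilpotent (ground :: 'k weil)" unfolding nilpotent_def
  proof (intro exI allI impI)
    fix xs :: "(nat \<Rightarrow> 'k) list" assume xs: "length xs = 1 \<and> set xs \<subseteq> wmax ground"
    then obtain x where "xs = [x]" by (metis One_nat_def length_0_conv length_Suc_conv)
    moreover from this xs have "x 0 = 0" by (simp add: wmax_def)
    ultimately show "foldr (wmul ground) xs wone = (\<lambda>_. 0)" by (simp add: wmul_def ground_def fun_eq_iff)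
  qed
  ultimately show ?thesis by (simp add: is_weil_iff)
qed

lemma src_tgt_simps [simp]:
  "src (wid W) = W" "tgt (wid W) = W" "src (wcomp \<psi> \<phi>) = src \<phi>" "tgt (wcomp \<psi> \<phi>) = tgt \<psi>"
  "src (\<phi> \<otimes>\<^sub>M \<psi>) = src \<phi> \<otimes>\<^sub>W src \<psi>" "tgt (\<phi> \<otimes>\<^sub>M \<psi>) = tgt \<phi> \<otimes>\<^sub>W tgt \<psi>"
  "src (wswap V W) = V \<otimes>\<^sub>W W" "tgt (wswap V W) = W \<otimes>\<^sub>W V"
  "src (wcoord W j) = W" "tgt (wcoord W j) = ground"
  by (simp_all add: wid_def wcomp_def mtens_def wswap_def wcoord_def)

lemma Weil_simps [simp]:
  "W \<in> Ob Weil \<longleftrightarrow> is_weil W" "\<phi> \<in> Ar Weil \<longleftrightarrow> is_weil_hom \<phi>" "Dom Weil = src" "Cod Weil = tgt"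
  "Ident Weil = wid" "Cmp Weil = wcomp"
  by (auto simp: Weil_def)

lemma is_weil_hom_wid: "is_weil W \<Longrightarrow> is_weil_hom (wid W)"
proof -
  assume W: "is_weil W"
  have "(\<Sum>k<dim W. mat (wid W) l k * sc W i j k) = sc W i j l" for i j l
  proof (cases "l < dim W")
    case True
    have "(\<Sum>k<dim W. mat (wid W) l k * sc W i j k) = (\<Sum>k<dim W. unit_vec l k * sc W i j k)"
      using True by (intro sum.cong) (auto simp: wid_def unit_vec_def)
    thus ?thesis using True by (simp add: sum_unit_vec)
  next
    case False
    thus ?thesis using structure_constantsD(2)[OF is_weil_structure[OF W], of i j l] by (simp add: wid_def)
  qed
  moreover have "(\<Sum>a<dim W. \<Sum>b<dim W. mat (wid W) a i * mat (wid W) b j * sc W a b l) = sc W i j l"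
    if "i < dim W" "j < dim W" for i j l
  proof -
    have "(\<Sum>a<dim W. \<Sum>b<dim W. mat (wid W) a i * mat (wid W) b j * sc W a b l) =
      (\<Sum>a<dim W. unit_vec i a * (\<Sum>b<dim W. unit_vec j b * sc W a b l))"
      unfolding sum_distrib_left by (intro sum.cong) (auto simp: wid_def unit_vec_def)
    thus ?thesis using that by (simp add: sum_unit_vec)
  qed
  ultimately show "is_weil_hom (wid W)"
    using W is_weil_dim[OF W] by (simp add: is_weil_hom_iff hom_matrix_def) (auto simp: wid_def)
qed

lemma wapp_in: "is_weil_hom \<phi> \<Longrightarrow> wapp \<phi> x \<in> wvec (tgt \<phi>)"
  by (auto simp: is_weil_hom_def wvec_def wapp_def)

lemma wapp_wcomp:
  "tgt \<phi> = src \<psi> \<Longrightarrow> wapp (wcomp \<psi> \<phi>) x = wapp \<psi> (wapp \<phi> x)"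
  by (rule ext) (simp add: wapp_eq_tlin kself.tlin_comp wcomp_def)

lemma is_weil_hom_wcomp:
  assumes "is_weil_hom \<phi>" "is_weil_hom \<psi>" "tgt \<phi> = src \<psi>"
  shows "is_weil_hom (wcomp \<psi> \<phi>)"
proof -
  have "mat (wcomp \<psi> \<phi>) i j = 0" if "dim (tgt \<psi>) \<le> i \<or> dim (src \<phi>) \<le> j" for i j
    using that assms(1,2) by (auto simp: wcomp_def is_weil_hom_def intro!: sum.neutral)
  thus ?thesis
    using assms wapp_in[OF assms(1)] unfolding is_weil_hom_def by (simp add: wapp_wcomp)
qed

lemma wmap_eqI: "src \<phi> = src \<psi> \<Longrightarrow> tgt \<phi> = tgt \<psi> \<Longrightarrow> (\<And>i j. mat \<phi> i j = mat \<psi> i j) \<Longrightarrow> \<phi> = (\<psi> :: 'k wmap)"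
  by (rule wmap.equality) (auto simp: fun_eq_iff)

lemma weil_eqI: "dim V = dim W \<Longrightarrow> (\<And>i j l. sc V i j l = sc W i j l) \<Longrightarrow> V = (W :: 'k weil)"
  by (rule weil.equality) (auto simp: fun_eq_iff)

lemma category_Weil: "category Weil"
proof
  fix \<phi> :: "'a wmap" and V W
  assume "\<phi> \<in> hom Weil V W"
  hence \<phi>: "is_weil_hom \<phi>" "src \<phi> = V" "tgt \<phi> = W" by (auto simp: hom_def)
  show "Cmp Weil (Ident Weil W) \<phi> = \<phi>"
  proof (simp, rule wmap_eqI)
    fix i j
    have "mat (wcomp (wid W) \<phi>) i j = (\<Sum>k<dim W. (if i < dim W then unit_vec i k else 0) * mat \<phi> k j)"
      unfolding wcomp_def by (auto simp: \<phi> wid_def unit_vec_def intro!: sum.cong)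
    thus "mat (wcomp (wid W) \<phi>) i j = mat \<phi> i j"
      using is_weil_homD(3)[OF \<phi>(1), of i j] \<phi> by (cases "i < dim W") (auto simp: sum_unit_vec)
  qed (use \<phi> in auto)
  show "Cmp Weil \<phi> (Ident Weil V) = \<phi>"
  proof (simp, rule wmap_eqI)
    fix i j
    have "mat (wcomp \<phi> (wid V)) i j = (\<Sum>k<dim V. mat \<phi> i k * (if j < dim V then unit_vec j k else 0))"
      unfolding wcomp_def by (auto simp: \<phi> wid_def unit_vec_def intro!: sum.cong)
    thus "mat (wcomp \<phi> (wid V)) i j = mat \<phi> i j"
      using is_weil_homD(3)[OF \<phi>(1), of i j] \<phi> by (cases "j < dim V") (auto simp: sum_unit_vec)
  qed (use \<phi> in auto)
next
  fix f g h :: "'a wmap" and V W X Y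
  assume *: "f \<in> hom Weil V W" "g \<in> hom Weil W X" "h \<in> hom Weil X Y"
  have "mat (wcomp h (wcomp g f)) i j = mat (wcomp (wcomp h g) f) i j" for i j
  proof -
    have "mat (wcomp h (wcomp g f)) i j = (\<Sum>k<dim (tgt g). \<Sum>m<dim (tgt f). mat h i k * mat g k m * mat f m j)"
      by (simp add: wcomp_def sum_distrib_left mult.assoc)
    also have "\<dots> = (\<Sum>m<dim (tgt f). \<Sum>k<dim (tgt g). mat h i k * mat g k m * mat f m j)"
      by (rule sum.swap)
    finally show ?thesis by (simp add: wcomp_def sum_distrib_right)
  qed
  thus "Cmp Weil h (Cmp Weil g f) = Cmp Weil (Cmp Weil h g) f"
    by (simp add: wmap_eqI)
qed (auto simp: hom_def is_weil_homD is_weil_hom_wid is_weil_hom_wcomp)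

lemma is_weil_hom_mtens:
  assumes f: "is_weil_hom \<phi>" and g: "is_weil_hom \<psi>"
  shows "is_weil_hom (\<phi> \<otimes>\<^sub>M \<psi>)"
proof -
  let ?m = "dim (src \<psi>)" and ?n = "dim (tgt \<psi>)"
  note f' = is_weil_homD[OF f] and g' = is_weil_homD[OF g]
  have mn: "0 < ?m" "0 < ?n" using is_weil_dim g' by auto
  have ge: "dim (tgt \<phi>) \<le> i div ?n" if "dim (tgt \<phi>) * ?n \<le> i" for i using that mn by (simp add: less_eq_div_iff_mult_less_eq)
  have ge': "dim (src \<phi>) \<le> i div ?m" if "dim (src \<phi>) * ?m \<le> i" for i using that mn by (simp add: less_eq_div_iff_mult_less_eq)
  have mat: "mat (\<phi> \<otimes>\<^sub>M \<psi>) i j = mat \<phi> (i div ?n) (j div ?m) * mat \<psi> (i mod ?n) (j mod ?m)" for i j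
    by (simp add: mtens_def)
  have "hom_matrix (\<phi> \<otimes>\<^sub>M \<psi>)" unfolding hom_matrix_def
  proof (intro conjI allI impI)
    show "mat (\<phi> \<otimes>\<^sub>M \<psi>) i j = 0" if "dim (tgt (\<phi> \<otimes>\<^sub>M \<psi>)) \<le> i \<or> dim (src (\<phi> \<otimes>\<^sub>M \<psi>)) \<le> j" for i j
      using that ge[of i] ge'[of j] f'(3)[of "i div ?n" "j div ?m"] by (auto simp: mat)
    show "mat (\<phi> \<otimes>\<^sub>M \<psi>) i 0 = (if i = 0 then 1 else 0)" for i
      using f'(4)[of "i div ?n"] g'(4)[of "i mod ?n"] div_mod_eq_iff[of i ?n 0] by (auto simp: mat)
    show "mat (\<phi> \<otimes>\<^sub>M \<psi>) 0 j = (if j = 0 then 1 else 0)" if "j < dim (src (\<phi> \<otimes>\<^sub>M \<psi>))" for j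
    proof -
      have "j div ?m < dim (src \<phi>)" "j mod ?m < ?m" using that mn by (auto intro: div_less_dim)
      hence "mat \<phi> 0 (j div ?m) = (if j div ?m = 0 then 1 else 0)" "mat \<psi> 0 (j mod ?m) = (if j mod ?m = 0 then 1 else 0)"
        using f g unfolding is_weil_hom_iff hom_matrix_def by blast+
      thus ?thesis using div_mod_eq_iff[of j ?m 0] by (auto simp: mat)
    qed
    fix i j l assume ij: "i < dim (src (\<phi> \<otimes>\<^sub>M \<psi>))" "j < dim (src (\<phi> \<otimes>\<^sub>M \<psi>))"
    hence lt: "i div ?m < dim (src \<phi>)" "j div ?m < dim (src \<phi>)" "i mod ?m < ?m" "j mod ?m < ?m"
      using mn by (auto intro: div_less_dim)
    have "(\<Sum>k<dim (src (\<phi> \<otimes>\<^sub>M \<psi>)). mat (\<phi> \<otimes>\<^sub>M \<psi>) l k * sc (src (\<phi> \<otimes>\<^sub>M \<psi>)) i j k) =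
      (\<Sum>k<dim (src \<phi>). mat \<phi> (l div ?n) k * sc (src \<phi>) (i div ?m) (j div ?m) k) *
      (\<Sum>k<?m. mat \<psi> (l mod ?n) k * sc (src \<psi>) (i mod ?m) (j mod ?m) k)"
      by (subst sum_tensor[symmetric]) (simp add: sc_wtens mat ac_simps)
    also have "\<dots> = (\<Sum>a<dim (tgt \<phi>). \<Sum>b<dim (tgt \<phi>). mat \<phi> a (i div ?m) * mat \<phi> b (j div ?m) * sc (tgt \<phi>) a b (l div ?n)) *
      (\<Sum>a<?n. \<Sum>b<?n. mat \<psi> a (i mod ?m) * mat \<psi> b (j mod ?m) * sc (tgt \<psi>) a b (l mod ?n))"
      using f'(5) g'(5) lt by simp
    also have "\<dots> = (\<Sum>a<dim (tgt (\<phi> \<otimes>\<^sub>M \<psi>)). \<Sum>b<dim (tgt (\<phi> \<otimes>\<^sub>M \<psi>)).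
        mat (\<phi> \<otimes>\<^sub>M \<psi>) a i * mat (\<phi> \<otimes>\<^sub>M \<psi>) b j * sc (tgt (\<phi> \<otimes>\<^sub>M \<psi>)) a b l)"
      by (subst sum_sum_tensor[symmetric]) (simp add: sc_wtens mat ac_simps)
    finally show "(\<Sum>k<dim (src (\<phi> \<otimes>\<^sub>M \<psi>)). mat (\<phi> \<otimes>\<^sub>M \<psi>) l k * sc (src (\<phi> \<otimes>\<^sub>M \<psi>)) i j k) =
       (\<Sum>a<dim (tgt (\<phi> \<otimes>\<^sub>M \<psi>)). \<Sum>b<dim (tgt (\<phi> \<otimes>\<^sub>M \<psi>)).
        mat (\<phi> \<otimes>\<^sub>M \<psi>) a i * mat (\<phi> \<otimes>\<^sub>M \<psi>) b j * sc (tgt (\<phi> \<otimes>\<^sub>M \<psi>)) a b l)" .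
  qed
  thus ?thesis using f' g' by (simp add: is_weil_hom_iff is_weil_wtens)
qed

subsection \<open>The tensor product as a strict symmetric monoidal structure\<close>

lemma dim_ground [simp]: "dim ground = 1"
  by (simp add: ground_def)

lemma wtens_ground_right [simp]: "V \<otimes>\<^sub>W ground = V"
  by (rule weil_eqI) (simp_all add: sc_wtens ground_def)

lemma wtens_ground_left [simp]:
  assumes "is_weil W" shows "ground \<otimes>\<^sub>W W = W"
proof (rule weil_eqI)
  show "dim (ground \<otimes>\<^sub>W W) = dim W" by (simp add: ground_def)
  fix i j l
  show "sc (ground \<otimes>\<^sub>W W) i j l = sc W i j l"
  proof (cases "i < dim W \<and> j < dim W \<and> l < dim W")
    case True
    thus ?thesis by (simp add: sc_wtens ground_def)
  next
    case False
    hence "\<not> (i div dim W = 0 \<and> j div dim W = 0 \<and> l div dim W = 0)"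
      using is_weil_dim[OF assms] by (simp add: div_eq_0_iff)
    moreover have "sc W i j l = 0" using False structure_constantsD(2)[OF is_weil_structure[OF assms], of i j l] by auto
    ultimately show ?thesis by (auto simp: sc_wtens ground_def)
  qed
qed

text \<open>With either bracketing, \<open>e\<^sub>i \<otimes> e\<^sub>j \<otimes> e\<^sub>l\<close> has the index \<open>(i * v + j) * w + l\<close>, where \<open>v\<close> and \<open>w\<close> are the
  dimensions of the last two factors. This makes \<open>\<otimes>\<close> strictly associative.\<close>

lemma tensor_index_assoc:
  fixes i v w :: nat
  shows "i div (v * w) = i div w div v" "i mod (v * w) div w = i div w mod v" "i mod (v * w) mod w = i mod w"
proof -
  show "i div (v * w) = i div w div v" by (metis div_mult2_eq mult.commute)
  have *: "i mod (v * w) = w * (i div w mod v) + i mod w" by (metis mod_mult2_eq mult.commute)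
  show "i mod (v * w) mod w = i mod w" by (simp add: mod_mod_cancel)
  show "i mod (v * w) div w = i div w mod v" unfolding * by (cases "w = 0") auto
qed

lemma wtens_assoc: "(U \<otimes>\<^sub>W V) \<otimes>\<^sub>W W = U \<otimes>\<^sub>W (V \<otimes>\<^sub>W W)"
  by (rule weil_eqI) (simp_all add: sc_wtens tensor_index_assoc mult.assoc)

lemma mat_mtens: "mat (\<phi> \<otimes>\<^sub>M \<psi>) i j =
    mat \<phi> (i div dim (tgt \<psi>)) (j div dim (src \<psi>)) * mat \<psi> (i mod dim (tgt \<psi>)) (j mod dim (src \<psi>))"
  by (simp add: mtens_def)

lemma mtens_assoc: "(\<phi> \<otimes>\<^sub>M \<psi>) \<otimes>\<^sub>M \<chi> = \<phi> \<otimes>\<^sub>M (\<psi> \<otimes>\<^sub>M \<chi>)"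
  by (rule wmap_eqI) (simp_all add: mat_mtens wtens_assoc tensor_index_assoc mult.assoc)

lemma mtens_wcomp:
  assumes "tgt \<phi> = src \<psi>" "tgt \<phi>' = src \<psi>'"
  shows "wcomp (\<psi> \<otimes>\<^sub>M \<psi>') (\<phi> \<otimes>\<^sub>M \<phi>') = wcomp \<psi> \<phi> \<otimes>\<^sub>M wcomp \<psi>' \<phi>'"
proof (rule wmap_eqI)
  fix i j
  let ?k = "dim (tgt \<phi>')" and ?m = "dim (tgt \<psi>')" and ?n = "dim (src \<phi>')"
  have "mat (wcomp (\<psi> \<otimes>\<^sub>M \<psi>') (\<phi> \<otimes>\<^sub>M \<phi>')) i j = (\<Sum>l<dim (tgt \<phi>) * ?k.
     (mat \<psi> (i div ?m) (l div ?k) * mat \<phi> (l div ?k) (j div ?n)) *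
     (mat \<psi>' (i mod ?m) (l mod ?k) * mat \<phi>' (l mod ?k) (j mod ?n)))"
    using assms by (simp add: wcomp_def mat_mtens ac_simps)
  thus "mat (wcomp (\<psi> \<otimes>\<^sub>M \<psi>') (\<phi> \<otimes>\<^sub>M \<phi>')) i j = mat (wcomp \<psi> \<phi> \<otimes>\<^sub>M wcomp \<psi>' \<phi>') i j"
    by (subst (asm) sum_tensor) (simp add: wcomp_def mtens_def)
qed simp_all

text \<open>The linear map \<open>e\<^sub>j \<mapsto> e\<^bsub>p j\<^esub>\<close>. Symmetries, identities and their tensor products are of this form, so
  that equations between their composites become equations between functions on indices.\<close>

definition wperm :: "'k::{comm_ring, comm_monoid_mult} weil \<Rightarrow> 'k weil \<Rightarrow> (nat \<Rightarrow> nat) \<Rightarrow> 'k wmap" where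
  "wperm V W p = \<lparr>src = V, tgt = W, mat = (\<lambda>i j. if j < dim V \<and> i = p j then 1 else 0)\<rparr>"

lemma wperm_simps [simp]: "src (wperm V W p) = V" "tgt (wperm V W p) = W"
  "mat (wperm V W p) i j = (if j < dim V \<and> i = p j then 1 else 0)"
  by (simp_all add: wperm_def)

lemma wperm_cong: "(\<And>j. j < dim V \<Longrightarrow> p j = q j) \<Longrightarrow> wperm V W p = wperm V W q"
  by (rule wmap_eqI) auto

lemma wid_eq_wperm: "wid W = wperm W W (\<lambda>i. i)"
  by (rule wmap_eqI) (auto simp: wid_def)

lemma wcomp_wperm:
  assumes "\<And>j. j < dim V \<Longrightarrow> q j < dim W"
  shows "wcomp (wperm W X p) (wperm V W q) = wperm V X (\<lambda>j. p (q j))"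
proof (rule wmap_eqI)
  fix i l
  have "mat (wcomp (wperm W X p) (wperm V W q)) i l =
      (\<Sum>j<dim W. unit_vec (q l) j * (if l < dim V \<and> i = p j then 1 else 0))"
    unfolding wcomp_def by (auto simp: unit_vec_def intro!: sum.cong)
  also have "\<dots> = mat (wperm V X (\<lambda>j. p (q j))) i l"
    using assms by (cases "l < dim V") (auto simp: sum_unit_vec)
  finally show "mat (wcomp (wperm W X p) (wperm V W q)) i l = mat (wperm V X (\<lambda>j. p (q j))) i l" .
qed simp_all

lemma tensor_index_eq_iff: "b < n \<Longrightarrow> r = a * n + b \<longleftrightarrow> r div n = a \<and> r mod n = (b::nat)"
  by (metis div_mult_mod_eq div_mult_self3 div_less add.right_neutral mod_mult_self3 mod_less not_less_zero add.commute)

lemma tensor_index_less: "a < m \<Longrightarrow> b < n \<Longrightarrow> a * n + b < m * (n::nat)"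
proof -
  assume "a < m" "b < n"
  hence "a * n + b < Suc a * n" "Suc a * n \<le> m * n" by (simp_all del: mult_Suc add: mult_le_mono1 Suc_leI) simp
  thus ?thesis by simp
qed

lemma mtens_wperm:
  assumes "0 < dim W" "\<And>j. j < dim W \<Longrightarrow> q j < dim W'"
  shows "wperm V V' p \<otimes>\<^sub>M wperm W W' q =
    wperm (V \<otimes>\<^sub>W W) (V' \<otimes>\<^sub>W W') (\<lambda>j. p (j div dim W) * dim W' + q (j mod dim W))"
proof (rule wmap_eqI)
  fix i j
  have "j div dim W < dim V \<longleftrightarrow> j < dim V * dim W" using assms(1) by (simp add: div_less_iff_less_mult)
  moreover have "j mod dim W < dim W" using assms(1) by simp
  moreover note tensor_index_eq_iff[OF assms(2)[OF this], of i "p (j div dim W)"]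
  ultimately show "mat (wperm V V' p \<otimes>\<^sub>M wperm W W' q) i j =
      mat (wperm (V \<otimes>\<^sub>W W) (V' \<otimes>\<^sub>W W') (\<lambda>j. p (j div dim W) * dim W' + q (j mod dim W))) i j"
    by (auto simp: mat_mtens)
qed simp_all

lemma mtens_wid: "0 < dim W \<Longrightarrow> wid V \<otimes>\<^sub>M wid W = wid (V \<otimes>\<^sub>W W)"
  unfolding wid_eq_wperm by (subst mtens_wperm) auto

lemma mtens_wid_ground [simp]: "\<phi> \<otimes>\<^sub>M wid ground = \<phi>"
  by (rule wmap_eqI) (simp_all add: mat_mtens wid_def)

lemma wswap_eq_wperm:
  assumes "0 < dim V" "0 < dim W"
  shows "wswap V W = wperm (V \<otimes>\<^sub>W W) (W \<otimes>\<^sub>W V) (\<lambda>j. j mod dim W * dim V + j div dim W)"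
proof (rule wmap_eqI)
  fix r c
  have "c div dim W < dim V" if "c < dim V * dim W" using that by (rule div_less_dim)
  moreover have "r < dim W * dim V" if "r div dim V = c mod dim W"
    using that assms by (metis div_less_iff_less_mult mod_less_divisor)
  ultimately show "mat (wswap V W) r c = mat (wperm (V \<otimes>\<^sub>W W) (W \<otimes>\<^sub>W V) (\<lambda>j. j mod dim W * dim V + j div dim W)) r c"
    using tensor_index_eq_iff[of "c div dim W" "dim V" r "c mod dim W"] by (auto simp: wswap_def)
qed simp_all

lemma is_weil_hom_wperm:
  assumes V: "is_weil V" and W: "is_weil W" and p: "bij_betw p {..<dim V} {..<dim W}" "p 0 = 0"
    and sc: "\<And>i j l. \<lbrakk>i < dim V; j < dim V; l < dim V\<rbrakk> \<Longrightarrow> sc W (p i) (p j) (p l) = sc V i j l"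
  shows "is_weil_hom (wperm V W p)"
proof -
  have pW: "p i < dim W" if "i < dim V" for i using p(1) that by (auto simp: bij_betw_def)
  have inj: "p i = p j \<longleftrightarrow> i = j" if "i < dim V" "j < dim V" for i j
    using p(1) that by (auto simp: bij_betw_def inj_on_def)
  have dV: "0 < dim V" using is_weil_dim[OF V] .
  have "hom_matrix (wperm V W p)" unfolding hom_matrix_def
  proof (intro conjI allI impI)
    show "mat (wperm V W p) i j = 0" if "dim (tgt (wperm V W p)) \<le> i \<or> dim (src (wperm V W p)) \<le> j" for i j
      using that pW[of j] by auto
    show "mat (wperm V W p) i 0 = (if i = 0 then 1 else 0)" for i using dV p(2) by simp
    show "mat (wperm V W p) 0 j = (if j = 0 then 1 else 0)" if "j < dim (src (wperm V W p))" for j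
      using inj[OF dV, of j] p(2) that by auto
    fix i j l assume "i < dim (src (wperm V W p))" "j < dim (src (wperm V W p))"
    hence ij: "i < dim V" "j < dim V" by auto
    have "(\<Sum>a<dim W. \<Sum>b<dim W. mat (wperm V W p) a i * mat (wperm V W p) b j * sc W a b l) =
      (\<Sum>a<dim W. unit_vec (p i) a * (\<Sum>b<dim W. unit_vec (p j) b * sc W a b l))"
      unfolding sum_distrib_left using ij by (intro sum.cong) (auto simp: unit_vec_def)
    also have "\<dots> = sc W (p i) (p j) l" using pW ij by (simp add: sum_unit_vec)
    also have "\<dots> = (\<Sum>k<dim V. mat (wperm V W p) l k * sc V i j k)"
    proof (cases "l < dim W")
      case True
      then obtain m where m: "m < dim V" "l = p m" using p(1) by (auto simp: bij_betw_def)
      have "(\<Sum>k<dim V. mat (wperm V W p) l k * sc V i j k) = (\<Sum>k<dim V. unit_vec m k * sc V i j k)"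
        using m inj by (intro sum.cong) (auto simp: unit_vec_def)
      thus ?thesis using m ij sc by (simp add: sum_unit_vec)
    next
      case False
      have "(\<Sum>k<dim V. mat (wperm V W p) l k * sc V i j k) = 0"
        using False pW by (intro sum.neutral) auto
      thus ?thesis using False structure_constantsD(2)[OF is_weil_structure[OF W], of "p i" "p j" l] by simp
    qed
    finally show "(\<Sum>k<dim (src (wperm V W p)). mat (wperm V W p) l k * sc (src (wperm V W p)) i j k) =
       (\<Sum>a<dim (tgt (wperm V W p)). \<Sum>b<dim (tgt (wperm V W p)).
         mat (wperm V W p) a i * mat (wperm V W p) b j * sc (tgt (wperm V W p)) a b l)" by simp
  qed
  thus ?thesis using V W by (simp add: is_weil_hom_iff)
qed

lemma wswap_index:
  fixes c m n :: nat
  assumes "c < m * n"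
  shows "c mod n * m + c div n < n * m" "(c mod n * m + c div n) div m = c mod n"
    "(c mod n * m + c div n) mod m = c div n"
proof -
  have n: "0 < n" using assms by (cases n) auto
  have d: "c div n < m" using assms by (rule div_less_dim)
  show "c mod n * m + c div n < n * m" using d n by (intro tensor_index_less) auto
  show "(c mod n * m + c div n) div m = c mod n" "(c mod n * m + c div n) mod m = c div n"
    using tensor_index_eq_iff[OF d, of "c mod n * m + c div n" "c mod n"] by auto
qed

lemma tensor_index_div: "c < m * n \<Longrightarrow> c div n mod m = c div n" "c < m * n \<Longrightarrow> c div n div m = (0::nat)"
  using div_less_dim[of c m n] by simp_all

lemma wswap_wswap:
  assumes "is_weil V" "is_weil W"
  shows "wcomp (wswap W V) (wswap V W) = wid (V \<otimes>\<^sub>W W)"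
  using is_weil_dim[OF assms(1)] is_weil_dim[OF assms(2)] unfolding wid_eq_wperm
  by (simp add: wswap_eq_wperm, subst wcomp_wperm) (auto simp: wswap_index tensor_index_div intro!: wperm_cong)

lemma is_weil_hom_wswap:
  assumes V: "is_weil V" and W: "is_weil W"
  shows "is_weil_hom (wswap V W)"
proof -
  note d = is_weil_dim[OF V] is_weil_dim[OF W]
  show ?thesis unfolding wswap_eq_wperm[OF d]
  proof (rule is_weil_hom_wperm[OF is_weil_wtens[OF V W] is_weil_wtens[OF W V]])
    let ?p = "\<lambda>j. j mod dim W * dim V + j div dim W"
    show "bij_betw ?p {..<dim (V \<otimes>\<^sub>W W)} {..<dim (W \<otimes>\<^sub>W V)}"
      by (rule bij_betw_byWitness[of _ "\<lambda>j. j mod dim V * dim W + j div dim V"]) (auto simp: wswap_index tensor_index_div)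
    show "sc (W \<otimes>\<^sub>W V) (?p i) (?p j) (?p l) = sc (V \<otimes>\<^sub>W W) i j l"
      if "i < dim (V \<otimes>\<^sub>W W)" "j < dim (V \<otimes>\<^sub>W W)" "l < dim (V \<otimes>\<^sub>W W)" for i j l
      using that by (simp add: sc_wtens wswap_index tensor_index_div) (simp add: mult.commute)
  qed simp
qed

lemma wswap_ground:
  assumes W: "is_weil W"
  shows "wswap W ground = wid W" "wswap ground W = wid W"
proof -
  have d: "0 < dim W" "0 < dim (ground :: 'a weil)" using is_weil_dim[OF W] by (auto simp: ground_def)
  have g: "dim (ground :: 'a weil) = 1" by (simp add: ground_def)
  show "wswap W ground = wid W"
    unfolding wswap_eq_wperm[OF d] wid_eq_wperm by (simp add: W g)
  show "wswap ground W = wid W"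
    unfolding wswap_eq_wperm[OF d(2,1)] wid_eq_wperm by (simp add: W g) (rule wperm_cong, simp)
qed

text \<open>Both composites send \<open>e\<^sub>a \<otimes> e\<^sub>b \<otimes> e\<^sub>c\<close> to \<open>e\<^sub>c \<otimes> e\<^sub>b \<otimes> e\<^sub>a\<close>.\<close>

lemma wswap_hexagon:
  assumes W: "is_weil W\<^sub>1" "is_weil W\<^sub>2" "is_weil W\<^sub>3"
  shows "wcomp (wswap W\<^sub>3 (W\<^sub>1 \<otimes>\<^sub>W W\<^sub>2)) (wid W\<^sub>3 \<otimes>\<^sub>M wswap W\<^sub>2 W\<^sub>1) =
    wcomp (wswap (W\<^sub>2 \<otimes>\<^sub>W W\<^sub>3) W\<^sub>1) (wswap W\<^sub>3 W\<^sub>2 \<otimes>\<^sub>M wid W\<^sub>1)"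
proof -
  note d = is_weil_dim[OF W(1)] is_weil_dim[OF W(2)] is_weil_dim[OF W(3)]
  let ?a = "dim W\<^sub>1" and ?b = "dim W\<^sub>2" and ?c = "dim W\<^sub>3"
  have ab: "0 < ?a * ?b" "0 < ?b * ?c" using d by auto
  have mod: "j mod (?b * ?a) < ?b * ?a" for j using d by simp
  have l1: "j div (?b * ?a) * (?a * ?b) + (j mod (?b * ?a) mod ?a * ?b + j mod (?b * ?a) div ?a) < ?c * (?a * ?b)"
    if "j < ?c * (?b * ?a)" for j
    using tensor_index_less[OF div_less_dim[OF that] wswap_index(1)[OF mod]] .
  have l2: "(j div ?a mod ?b * ?c + j div ?a div ?b) * ?a + j mod ?a < ?b * ?c * ?a"
    if "j < ?c * (?b * ?a)" for j
    by (rule tensor_index_less[OF wswap_index(1)[OF div_less_dim]]) (use d that in \<open>auto simp: mult.assoc\<close>)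
  have "wcomp (wswap W\<^sub>3 (W\<^sub>1 \<otimes>\<^sub>W W\<^sub>2)) (wid W\<^sub>3 \<otimes>\<^sub>M wswap W\<^sub>2 W\<^sub>1) =
    wperm (W\<^sub>3 \<otimes>\<^sub>W W\<^sub>2 \<otimes>\<^sub>W W\<^sub>1) (W\<^sub>1 \<otimes>\<^sub>W W\<^sub>2 \<otimes>\<^sub>W W\<^sub>3) (\<lambda>j. (j mod ?a * ?b + j div ?a mod ?b) * ?c + j div ?a div ?b)"
  proof -
    have "wid W\<^sub>3 \<otimes>\<^sub>M wswap W\<^sub>2 W\<^sub>1 = wperm (W\<^sub>3 \<otimes>\<^sub>W W\<^sub>2 \<otimes>\<^sub>W W\<^sub>1) (W\<^sub>3 \<otimes>\<^sub>W W\<^sub>1 \<otimes>\<^sub>W W\<^sub>2)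
        (\<lambda>j. j div (?b * ?a) * (?a * ?b) + (j mod (?b * ?a) mod ?a * ?b + j mod (?b * ?a) div ?a))"
      unfolding wid_eq_wperm wswap_eq_wperm[OF d(2,1)]
      by (subst mtens_wperm) (use d wswap_index(1)[of _ ?b ?a] in auto)
    moreover have "wswap W\<^sub>3 (W\<^sub>1 \<otimes>\<^sub>W W\<^sub>2) = wperm (W\<^sub>3 \<otimes>\<^sub>W W\<^sub>1 \<otimes>\<^sub>W W\<^sub>2) (W\<^sub>1 \<otimes>\<^sub>W W\<^sub>2 \<otimes>\<^sub>W W\<^sub>3)
        (\<lambda>j. j mod (?a * ?b) * ?c + j div (?a * ?b))"
      using d by (simp add: wswap_eq_wperm wtens_assoc)
    ultimately show ?thesis
    proof (simp only:, subst wcomp_wperm)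
      show "wperm (W\<^sub>3 \<otimes>\<^sub>W W\<^sub>2 \<otimes>\<^sub>W W\<^sub>1) (W\<^sub>1 \<otimes>\<^sub>W W\<^sub>2 \<otimes>\<^sub>W W\<^sub>3)
        (\<lambda>j. (j div (?b * ?a) * (?a * ?b) + (j mod (?b * ?a) mod ?a * ?b + j mod (?b * ?a) div ?a)) mod (?a * ?b) * ?c +
             (j div (?b * ?a) * (?a * ?b) + (j mod (?b * ?a) mod ?a * ?b + j mod (?b * ?a) div ?a)) div (?a * ?b)) =
        wperm (W\<^sub>3 \<otimes>\<^sub>W W\<^sub>2 \<otimes>\<^sub>W W\<^sub>1) (W\<^sub>1 \<otimes>\<^sub>W W\<^sub>2 \<otimes>\<^sub>W W\<^sub>3) (\<lambda>j. (j mod ?a * ?b + j div ?a mod ?b) * ?c + j div ?a div ?b)"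
      proof (rule wperm_cong)
        fix j
        note * = tensor_index_eq_iff[OF wswap_index(1)[OF mod[of j]], THEN iffD1, OF refl, of "j div (?b * ?a)"]
        show "(j div (?b * ?a) * (?a * ?b) + (j mod (?b * ?a) mod ?a * ?b + j mod (?b * ?a) div ?a)) mod (?a * ?b) * ?c +
             (j div (?b * ?a) * (?a * ?b) + (j mod (?b * ?a) mod ?a * ?b + j mod (?b * ?a) div ?a)) div (?a * ?b) =
          (j mod ?a * ?b + j div ?a mod ?b) * ?c + j div ?a div ?b"
          unfolding conjunct1[OF *] conjunct2[OF *] by (simp add: tensor_index_assoc)
      qed
    qed (use l1 in simp)
  qed
  moreover have "wcomp (wswap (W\<^sub>2 \<otimes>\<^sub>W W\<^sub>3) W\<^sub>1) (wswap W\<^sub>3 W\<^sub>2 \<otimes>\<^sub>M wid W\<^sub>1) =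
    wperm (W\<^sub>3 \<otimes>\<^sub>W W\<^sub>2 \<otimes>\<^sub>W W\<^sub>1) (W\<^sub>1 \<otimes>\<^sub>W W\<^sub>2 \<otimes>\<^sub>W W\<^sub>3) (\<lambda>j. (j mod ?a * ?b + j div ?a mod ?b) * ?c + j div ?a div ?b)"
  proof -
    have "wswap W\<^sub>3 W\<^sub>2 \<otimes>\<^sub>M wid W\<^sub>1 = wperm (W\<^sub>3 \<otimes>\<^sub>W W\<^sub>2 \<otimes>\<^sub>W W\<^sub>1) (W\<^sub>2 \<otimes>\<^sub>W W\<^sub>3 \<otimes>\<^sub>W W\<^sub>1)
        (\<lambda>j. (j div ?a mod ?b * ?c + j div ?a div ?b) * ?a + j mod ?a)"
      unfolding wid_eq_wperm wswap_eq_wperm[OF d(3,2)]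
      by (subst mtens_wperm) (use d in \<open>auto simp: wtens_assoc\<close>)
    moreover have "wswap (W\<^sub>2 \<otimes>\<^sub>W W\<^sub>3) W\<^sub>1 = wperm (W\<^sub>2 \<otimes>\<^sub>W W\<^sub>3 \<otimes>\<^sub>W W\<^sub>1) (W\<^sub>1 \<otimes>\<^sub>W W\<^sub>2 \<otimes>\<^sub>W W\<^sub>3)
        (\<lambda>j. j mod ?a * (?b * ?c) + j div ?a)"
      using d by (simp add: wswap_eq_wperm wtens_assoc)
    ultimately show ?thesis
    proof (simp only:, subst wcomp_wperm)
      show "wperm (W\<^sub>3 \<otimes>\<^sub>W W\<^sub>2 \<otimes>\<^sub>W W\<^sub>1) (W\<^sub>1 \<otimes>\<^sub>W W\<^sub>2 \<otimes>\<^sub>W W\<^sub>3)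
        (\<lambda>j. ((j div ?a mod ?b * ?c + j div ?a div ?b) * ?a + j mod ?a) mod ?a * (?b * ?c) +
             ((j div ?a mod ?b * ?c + j div ?a div ?b) * ?a + j mod ?a) div ?a) =
        wperm (W\<^sub>3 \<otimes>\<^sub>W W\<^sub>2 \<otimes>\<^sub>W W\<^sub>1) (W\<^sub>1 \<otimes>\<^sub>W W\<^sub>2 \<otimes>\<^sub>W W\<^sub>3) (\<lambda>j. (j mod ?a * ?b + j div ?a mod ?b) * ?c + j div ?a div ?b)"
        using d by (intro wperm_cong) (simp, simp add: add_mult_distrib mult.assoc)
    qed (use l2 in \<open>simp add: mult.assoc\<close>)
  qed
  ultimately show ?thesis by simp
qed

lemma tens_right_functor:
  assumes W: "is_weil W" shows "is_functor Weil Weil (tens_right W)"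
proof (rule is_functorI)
  note d = is_weil_dim[OF W]
  interpret category Weil by (rule category_Weil)
  show "far (tens_right W) f \<in> hom Weil (fob (tens_right W) (Dom Weil f)) (fob (tens_right W) (Cod Weil f))"
    if "f \<in> Ar Weil" for f
    using that W by (simp add: tens_right_def hom_def is_weil_homD is_weil_hom_mtens is_weil_hom_wid)
  show "far (tens_right W) (Cmp Weil g f) = Cmp Weil (far (tens_right W) g) (far (tens_right W) f)"
    if "f \<in> Ar Weil" "g \<in> Ar Weil" "Cod Weil f = Dom Weil g" for f g
  proof -
    have "wcomp (wid W) (wid W) = wid W" using cmp_ident(1)[of "wid W" W] W by (simp add: is_weil_hom_wid)
    thus ?thesis using that by (simp add: tens_right_def is_weil_hom_wcomp mtens_wcomp)
  qed
qed (use W in \<open>auto simp: tens_right_def is_weil_wtens mtens_wid is_weil_dim is_weil_hom_wid\<close>)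

lemma mtens_interchange:
  assumes "is_weil_hom \<phi>" "is_weil_hom \<psi>"
  shows "wcomp (wid (tgt \<phi>) \<otimes>\<^sub>M \<psi>) (\<phi> \<otimes>\<^sub>M wid (src \<psi>)) = \<phi> \<otimes>\<^sub>M \<psi>"
    "wcomp (\<phi> \<otimes>\<^sub>M wid (tgt \<psi>)) (wid (src \<phi>) \<otimes>\<^sub>M \<psi>) = \<phi> \<otimes>\<^sub>M \<psi>"
proof -
  interpret category Weil by (rule category_Weil)
  have "wcomp (wid (tgt \<phi>)) \<phi> = \<phi>" "wcomp \<psi> (wid (src \<psi>)) = \<psi>" "wcomp \<phi> (wid (src \<phi>)) = \<phi>" "wcomp (wid (tgt \<psi>)) \<psi> = \<psi>"
    using cmp_ident(1)[of \<phi> "tgt \<phi>"] cmp_ident(2)[of \<phi> "src \<phi>"] cmp_ident(1)[of \<psi> "tgt \<psi>"] cmp_ident(2)[of \<psi> "src \<psi>"] assms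
    by simp_all
  thus "wcomp (wid (tgt \<phi>) \<otimes>\<^sub>M \<psi>) (\<phi> \<otimes>\<^sub>M wid (src \<psi>)) = \<phi> \<otimes>\<^sub>M \<psi>"
    "wcomp (\<phi> \<otimes>\<^sub>M wid (tgt \<psi>)) (wid (src \<phi>) \<otimes>\<^sub>M \<psi>) = \<phi> \<otimes>\<^sub>M \<psi>"
    by (simp_all add: mtens_wcomp)
qed

lemma wcoord_index:
  assumes W: "0 < dim W" and "i < dim V" "j < dim W" "c < dim V * dim W"
  shows "mat (wid V \<otimes>\<^sub>M wcoord W j) i c = (if c = i * dim W + j then 1 else 0)"
  using tensor_index_eq_iff[OF assms(3), of c i] assms div_less_dim[OF assms(4)]
  by (auto simp: mat_mtens wid_def wcoord_def ground_def)

subsection \<open>The category of Weil algebras is small\<close>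

text \<open>An arrow is coded by the dimensions and structure constants of its source and target and by the
  entries of its matrix, a finite list of natural numbers and scalars. Structure constants and entries
  outside the range of the basis are \<open>0\<close>, so nothing is lost.\<close>

lemma Weil_small:
  assumes inf: "infinite (UNIV :: 'i set)" and k: "\<exists>e :: 'k::{comm_ring, comm_monoid_mult} \<Rightarrow> 'i. inj e"
  shows "\<exists>e :: 'k wmap \<Rightarrow> 'i. inj_on e (Ar Weil)"
proof -
  obtain e :: "'k \<Rightarrow> 'i" and n :: "nat \<Rightarrow> 'i" and g :: "'i list \<Rightarrow> 'i" where
    e: "inj e" and n: "inj n" and g: "inj g"
    using k infinite_inj_nat[OF inf] infinite_inj_list[OF inf] by auto
  define sc_code where "sc_code W = g (map (\<lambda>(i, j, l). e (sc W i j l))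
    (List.product [0..<dim W] (List.product [0..<dim W] [0..<dim W])))" for W :: "'k weil"
  define mat_code where "mat_code \<phi> = g (map (\<lambda>(i, j). e (mat \<phi> i j))
    (List.product [0..<dim (tgt \<phi>)] [0..<dim (src \<phi>)]))" for \<phi> :: "'k wmap"
  define code where "code \<phi> = g [n (dim (src \<phi>)), n (dim (tgt \<phi>)), sc_code (src \<phi>), sc_code (tgt \<phi>), mat_code \<phi>]"
    for \<phi> :: "'k wmap"
  have sc: "V = W" if "sc_code V = sc_code W" "dim V = dim W" "is_weil V" "is_weil W" for V W :: "'k weil"
  proof (rule weil_eqI[OF that(2)])
    fix i j l
    show "sc V i j l = sc W i j l"
    proof (cases "i < dim W \<and> j < dim W \<and> l < dim W")
      case True
      have "\<forall>(i, j, l) \<in> set (List.product [0..<dim W] (List.product [0..<dim W] [0..<dim W])).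
          e (sc V i j l) = e (sc W i j l)"
        using that(1,2) injD[OF g] unfolding sc_code_def by (fastforce simp: map_eq_conv)
      thus ?thesis using True injD[OF e] by fastforce
    next
      case False
      thus ?thesis
        using structure_constantsD(2)[OF is_weil_structure[OF that(3)], of i j l]
          structure_constantsD(2)[OF is_weil_structure[OF that(4)], of i j l] that(2) by auto
    qed
  qed
  have "inj_on code (Ar Weil)"
  proof (rule inj_onI)
    fix \<phi> \<psi> :: "'k wmap" assume "\<phi> \<in> Ar Weil" "\<psi> \<in> Ar Weil" and c: "code \<phi> = code \<psi>"
    hence h: "is_weil_hom \<phi>" "is_weil_hom \<psi>" by auto
    from c have eq: "dim (src \<phi>) = dim (src \<psi>)" "dim (tgt \<phi>) = dim (tgt \<psi>)" "sc_code (src \<phi>) = sc_code (src \<psi>)"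
      "sc_code (tgt \<phi>) = sc_code (tgt \<psi>)" "mat_code \<phi> = mat_code \<psi>"
      by (auto simp: code_def dest!: injD[OF g] injD[OF n])
    have s: "src \<phi> = src \<psi>" "tgt \<phi> = tgt \<psi>" using sc eq is_weil_homD(1,2) h by metis+
    show "\<phi> = \<psi>"
    proof (rule wmap_eqI[OF s])
      fix i j
      show "mat \<phi> i j = mat \<psi> i j"
      proof (cases "i < dim (tgt \<phi>) \<and> j < dim (src \<phi>)")
        case True
        have "\<forall>(i, j) \<in> set (List.product [0..<dim (tgt \<phi>)] [0..<dim (src \<phi>)]). e (mat \<phi> i j) = e (mat \<psi> i j)"
          using eq(5) injD[OF g] s unfolding mat_code_def by (fastforce simp: map_eq_conv)
        thus ?thesis using True injD[OF e] by fastforce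
      next
        case False
        thus ?thesis using is_weil_homD(3)[OF h(1), of i j] is_weil_homD(3)[OF h(2), of i j] s by auto
      qed
    qed
  qed
  thus ?thesis by blast
qed

section \<open>Generalised elements of algebra objects\<close>

text \<open>An arrow \<open>X \<rightarrow> a\<close> is regarded as an element of \<open>a\<close> at stage \<open>X\<close>. An operation on \<open>a\<close> acts on
  elements, compatibly with change of stage (\<open>ap2_cmp\<close>, \<open>ap0_cmp\<close>), and it is determined by this
  action (\<open>ap2_pr\<close>, \<open>ap0_self\<close>).\<close>

lemma ex1_unique: "\<exists>!x. P x \<Longrightarrow> P a \<Longrightarrow> P b \<Longrightarrow> a = b"
  by blast

locale power_cat = category C for C :: "('o, 'm) cat" +
  assumes powers: "a \<in> Ob C \<Longrightarrow> \<exists>P p. is_power C a n P p"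
begin

lemma pow_is_power: "a \<in> Ob C \<Longrightarrow> is_power C a n (pow_ob C a n) (pow_pr C a n)"
  using someI_ex[of "\<lambda>(P, p). is_power C a n P p"] powers[of a n]
  by (auto simp: pow_ob_def pow_pr_def pow_def case_prod_unfold)

lemma pow_simps [simp]:
  assumes "a \<in> Ob C"
  shows "pow_ob C a n \<in> Ob C"
    "i < n \<Longrightarrow> pow_pr C a n i \<in> Ar C"
    "i < n \<Longrightarrow> Dom C (pow_pr C a n i) = pow_ob C a n"
    "i < n \<Longrightarrow> Cod C (pow_pr C a n i) = a"
  using pow_is_power[OF assms, of n] by (auto simp: is_power_def hom_def)

lemma pr_hom: "a \<in> Ob C \<Longrightarrow> i < n \<Longrightarrow> pow_pr C a n i \<in> hom C (pow_ob C a n) a"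
  by (simp add: hom_def)

lemma is_powerD:
  assumes "is_power C a n P p" "X \<in> Ob C" "\<And>i. i < n \<Longrightarrow> f i \<in> hom C X a"
  shows "\<exists>!h. h \<in> hom C X P \<and> (\<forall>i<n. Cmp C (p i) h = f i)"
  using assms unfolding is_power_def by simp

lemma power_eqI:
  assumes P: "is_power C a n P p" and h: "h \<in> hom C X P" "h' \<in> hom C X P"
    "\<And>i. i < n \<Longrightarrow> Cmp C (p i) h = Cmp C (p i) h'"
  shows "h = h'"
proof -
  have "Cmp C (p i) h' \<in> hom C X a" if "i < n" for i
    using P that cmp_hom[OF h(2)] by (simp add: is_power_def)
  hence u: "\<exists>!k. k \<in> hom C X P \<and> (\<forall>i<n. Cmp C (p i) k = Cmp C (p i) h')"
    by (intro is_powerD[OF P hom_ob(1)[OF h(1)]])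
  have "h \<in> hom C X P \<and> (\<forall>i<n. Cmp C (p i) h = Cmp C (p i) h')" "h' \<in> hom C X P \<and> (\<forall>i<n. Cmp C (p i) h' = Cmp C (p i) h')"
    using h by auto
  thus ?thesis by (rule ex1_unique[OF u])
qed

lemma pow_eqI:
  assumes "a \<in> Ob C" "h \<in> hom C X (pow_ob C a n)" "h' \<in> hom C X (pow_ob C a n)"
    "\<And>i. i < n \<Longrightarrow> Cmp C (pow_pr C a n i) h = Cmp C (pow_pr C a n i) h'"
  shows "h = h'"
  using power_eqI[OF pow_is_power[OF assms(1)] assms(2-4)] .

lemma tup:
  assumes "a \<in> Ob C" "X \<in> Ob C" "\<And>i. i < n \<Longrightarrow> f i \<in> hom C X a"
  shows tup_hom: "tup C a n X f \<in> hom C X (pow_ob C a n)"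
    and pr_tup: "i < n \<Longrightarrow> Cmp C (pow_pr C a n i) (tup C a n X f) = f i"
proof -
  have "\<exists>!h. h \<in> hom C X (pow_ob C a n) \<and> (\<forall>i<n. Cmp C (pow_pr C a n i) h = f i)"
    using is_powerD[OF pow_is_power[OF assms(1)] assms(2,3)] .
  from theI'[OF this] show "tup C a n X f \<in> hom C X (pow_ob C a n)"
    "i < n \<Longrightarrow> Cmp C (pow_pr C a n i) (tup C a n X f) = f i"
    unfolding tup_def by simp_all
qed

lemma tup_eqI:
  assumes "a \<in> Ob C" "h \<in> hom C X (pow_ob C a n)" "\<And>i. i < n \<Longrightarrow> Cmp C (pow_pr C a n i) h = f i"
  shows "tup C a n X f = h"
proof -
  have f: "f i \<in> hom C X a" if "i < n" for i
    using assms(3)[OF that] cmp_hom[OF assms(2) pr_hom[OF assms(1) that]] by simp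
  have X: "X \<in> Ob C" using hom_ob(1)[OF assms(2)] .
  show ?thesis
  proof (rule pow_eqI[OF assms(1) tup_hom assms(2)])
    fix i assume i: "i < n"
    have "Cmp C (pow_pr C a n i) (tup C a n X f) = f i" by (rule pr_tup[OF assms(1) X f i])
    thus "Cmp C (pow_pr C a n i) (tup C a n X f) = Cmp C (pow_pr C a n i) h" using assms(3)[OF i] by simp
  qed (use assms X f in auto)
qed

lemma pair_hom:
  assumes "a \<in> Ob C" "f \<in> hom C X a" "g \<in> hom C X a"
  shows "tup C a 2 X (\<lambda>i. if i = 0 then f else g) \<in> hom C X (pow_ob C a 2)"
    "Cmp C (pow_pr C a 2 0) (tup C a 2 X (\<lambda>i. if i = 0 then f else g)) = f"
    "Cmp C (pow_pr C a 2 1) (tup C a 2 X (\<lambda>i. if i = 0 then f else g)) = g"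
  using tup[of a X 2 "\<lambda>i. if i = 0 then f else g"] assms hom_ob(1)[OF assms(2)] by auto

lemma ap2_char:
  assumes "a \<in> Ob C" "u \<in> hom C X (pow_ob C a 2)" "Cmp C (pow_pr C a 2 0) u = f" "Cmp C (pow_pr C a 2 1) u = g"
  shows "ap2 C a w f g = Cmp C w u"
proof -
  have "f \<in> hom C X a" using cmp_hom[OF assms(2) pr_hom[OF assms(1)], of 0] assms(3) by simp
  moreover have "tup C a 2 X (\<lambda>i. if i = 0 then f else g) = u"
    using assms by (intro tup_eqI) (auto simp: less_2_cases_iff)
  ultimately show ?thesis by (simp add: ap2_def hom_def)
qed

lemma ap2_hom:
  assumes "a \<in> Ob C" "f \<in> hom C X a" "g \<in> hom C X a" "w \<in> hom C (pow_ob C a 2) b"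
  shows "ap2 C a w f g \<in> hom C X b"
  using cmp_hom[OF pair_hom(1)[OF assms(1-3)] assms(4)] assms(2) by (simp add: ap2_def hom_def)

lemma ap2_cmp:
  assumes "a \<in> Ob C" "f \<in> hom C X a" "g \<in> hom C X a" "w \<in> hom C (pow_ob C a 2) b" "t \<in> hom C Y X"
  shows "Cmp C (ap2 C a w f g) t = ap2 C a w (Cmp C f t) (Cmp C g t)"
proof -
  note p = pair_hom[OF assms(1-3)]
  have "ap2 C a w (Cmp C f t) (Cmp C g t) = Cmp C w (Cmp C (tup C a 2 X (\<lambda>i. if i = 0 then f else g)) t)"
  proof (rule ap2_char[OF assms(1) cmp_hom[OF assms(5) p(1)]])
    show "Cmp C (pow_pr C a 2 0) (Cmp C (tup C a 2 X (\<lambda>i. if i = 0 then f else g)) t) = Cmp C f t"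
      using cmp_reassoc1[OF p(2) p(1) pr_hom[OF assms(1)] assms(5)] by simp
    show "Cmp C (pow_pr C a 2 1) (Cmp C (tup C a 2 X (\<lambda>i. if i = 0 then f else g)) t) = Cmp C g t"
      using cmp_reassoc1[OF p(3) p(1) pr_hom[OF assms(1)] assms(5)] by simp
  qed
  also have "\<dots> = Cmp C (ap2 C a w f g) t"
    unfolding ap2_char[OF assms(1) p] using cmp_assoc[OF assms(5) p(1) assms(4)] .
  finally show ?thesis by simp
qed

lemma ap2_pr:
  assumes "a \<in> Ob C" "w \<in> hom C (pow_ob C a 2) b"
  shows "ap2 C a w (pow_pr C a 2 0) (pow_pr C a 2 1) = w"
proof -
  have "ap2 C a w (pow_pr C a 2 0) (pow_pr C a 2 1) = Cmp C w (Ident C (pow_ob C a 2))"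
    using assms(1) by (intro ap2_char[of _ _ "pow_ob C a 2"]) (auto simp: hom_def)
  thus ?thesis using assms(2) by (simp add: cmp_ident_right)
qed

lemma ap0_char:
  assumes "a \<in> Ob C" "u \<in> hom C X (pow_ob C a 0)"
  shows "ap0 C a w X = Cmp C w u"
  using tup_eqI[OF assms, of "\<lambda>_. undefined"] by (simp add: ap0_def)

lemma terminal_hom: "a \<in> Ob C \<Longrightarrow> X \<in> Ob C \<Longrightarrow> tup C a 0 X f \<in> hom C X (pow_ob C a 0)"
  by (rule tup_hom) auto

lemma ap0_hom:
  assumes "a \<in> Ob C" "X \<in> Ob C" "w \<in> hom C (pow_ob C a 0) b"
  shows "ap0 C a w X \<in> hom C X b"
  using cmp_hom[OF terminal_hom[OF assms(1,2)] assms(3)] by (simp add: ap0_def)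

lemma ap0_cmp:
  assumes "a \<in> Ob C" "w \<in> hom C (pow_ob C a 0) b" "t \<in> hom C Y X"
  shows "Cmp C (ap0 C a w X) t = ap0 C a w Y"
proof -
  note p = terminal_hom[OF assms(1) hom_ob(2)[OF assms(3)]]
  show ?thesis
    using ap0_char[OF assms(1) p] ap0_char[OF assms(1) cmp_hom[OF assms(3) p]] cmp_assoc[OF assms(3) p assms(2)]
    by metis
qed

lemma ap0_self:
  assumes "a \<in> Ob C" "w \<in> hom C (pow_ob C a 0) b"
  shows "ap0 C a w (pow_ob C a 0) = w"
  using ap0_char[of a "Ident C (pow_ob C a 0)" "pow_ob C a 0" w] ident_hom[of "pow_ob C a 0"] assms
  by (simp add: cmp_ident_right)

definition hom_alg :: "('k::{comm_ring, comm_monoid_mult}, 'o, 'm) kalg \<Rightarrow> 'o \<Rightarrow> bool" where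
  "hom_alg A X \<longleftrightarrow> comm_alg (hom C X (acar A)) (ap2 C (acar A) (aadd A)) (ap2 C (acar A) (amul A))
     (ap0 C (acar A) (azero A) X) (ap0 C (acar A) (aone A) X) (Cmp C (aneg A)) (\<lambda>c. Cmp C (ascal A c))"

definition alg_ops :: "('k::{comm_ring, comm_monoid_mult}, 'o, 'm) kalg \<Rightarrow> bool" where
  "alg_ops A \<longleftrightarrow> acar A \<in> Ob C \<and>
     aadd A \<in> hom C (pow_ob C (acar A) 2) (acar A) \<and> amul A \<in> hom C (pow_ob C (acar A) 2) (acar A) \<and>
     azero A \<in> hom C (pow_ob C (acar A) 0) (acar A) \<and> aone A \<in> hom C (pow_ob C (acar A) 0) (acar A) \<and>
     aneg A \<in> hom C (acar A) (acar A) \<and> (\<forall>c. ascal A c \<in> hom C (acar A) (acar A))"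

lemma alg_opsD:
  assumes "alg_ops A"
  shows "acar A \<in> Ob C" "aadd A \<in> hom C (pow_ob C (acar A) 2) (acar A)"
    "amul A \<in> hom C (pow_ob C (acar A) 2) (acar A)" "azero A \<in> hom C (pow_ob C (acar A) 0) (acar A)"
    "aone A \<in> hom C (pow_ob C (acar A) 0) (acar A)" "aneg A \<in> hom C (acar A) (acar A)"
    "ascal A c \<in> hom C (acar A) (acar A)"
  using assms by (auto simp: alg_ops_def)

text \<open>The axioms are the algebra laws for the three projections of \<open>A\<^sup>3\<close>. Composing them with the arrow
  \<open>X \<rightarrow> A\<^sup>3\<close> given by three elements yields the laws for these elements.\<close>

lemma kalg_object_imp_hom_alg:
  assumes A: "kalg_object C A" and X: "X \<in> Ob C"
  shows "hom_alg A X"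
proof -
  define a where "a = acar A"
  define P where "P = pow_ob C a 3"
  define p where "p = pow_pr C a 3 0"
  define q where "q = pow_pr C a 3 1"
  define r where "r = pow_pr C a 3 2"
  have ops: "alg_ops A" using A by (simp add: kalg_object_def alg_ops_def Let_def)
  note o = alg_opsD[OF ops, folded a_def]
  have p3: "p \<in> hom C P a" "q \<in> hom C P a" "r \<in> hom C P a"
    using pr_hom[OF o(1), of _ 3] by (auto simp: p_def q_def r_def P_def)
  have PO: "P \<in> Ob C" using o(1) by (simp add: P_def)
  let ?add = "ap2 C a (aadd A)" and ?mul = "ap2 C a (amul A)"
  let ?zero = "\<lambda>X. ap0 C a (azero A) X" and ?one = "\<lambda>X. ap0 C a (aone A) X"
  let ?neg = "Cmp C (aneg A)" and ?scal = "\<lambda>c. Cmp C (ascal A c)"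
  note laws = A[unfolded kalg_object_def Let_def, folded a_def, folded P_def p_def q_def r_def]
  have l1: "?add (?add p q) r = ?add p (?add q r)" using laws by (elim conjE) assumption
  have l2: "?add p q = ?add q p" using laws by (elim conjE) assumption
  have l3: "?add (?zero P) p = p" using laws by (elim conjE) assumption
  have l4: "?add (?neg p) p = ?zero P" using laws by (elim conjE) assumption
  have l5: "?mul (?mul p q) r = ?mul p (?mul q r)" using laws by (elim conjE) assumption
  have l6: "?mul p q = ?mul q p" using laws by (elim conjE) assumption
  have l7: "?mul (?one P) p = p" using laws by (elim conjE) assumption
  have l8: "?mul (?add p q) r = ?add (?mul p r) (?mul q r)" using laws by (elim conjE) assumption
  have l9: "\<forall>c. ?scal c (?add p q) = ?add (?scal c p) (?scal c q)" using laws by (elim conjE) assumption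
  have l10: "\<forall>c d. ?scal (c + d) p = ?add (?scal c p) (?scal d p)" using laws by (elim conjE) assumption
  have l11: "\<forall>c d. ?scal (c * d) p = ?scal c (?scal d p)" using laws by (elim conjE) assumption
  have l12: "?scal 1 p = p" using laws by (elim conjE) assumption
  have l13: "\<forall>c. ?scal c (?mul p q) = ?mul (?scal c p) q" using laws by (elim conjE) assumption
  note in_hom = ap2_hom[OF o(1) _ _ o(2)] ap2_hom[OF o(1) _ _ o(3)] ap0_hom[OF o(1) _ o(4)] ap0_hom[OF o(1) _ o(5)]
    cmp_hom[OF _ o(6)] cmp_hom[OF _ o(7)]
  (* the arrow X -> A^3 through which given generalised elements factor *)
  define t where "t x y z = tup C a 3 X (\<lambda>i. if i = 0 then x else if i = 1 then y else z)" for x y z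
  have t: "t x y z \<in> hom C X P" "Cmp C p (t x y z) = x" "Cmp C q (t x y z) = y" "Cmp C r (t x y z) = z"
    if "x \<in> hom C X a" "y \<in> hom C X a" "z \<in> hom C X a" for x y z
    using tup_hom[of a X 3 "\<lambda>i. if i = 0 then x else if i = 1 then y else z"]
      pr_tup[of a X 3 "\<lambda>i. if i = 0 then x else if i = 1 then y else z"] o(1) X that
    by (auto simp: p_def q_def r_def P_def t_def)
  have push: "Cmp C (?add f g) s = ?add (Cmp C f s) (Cmp C g s)" "Cmp C (?mul f g) s = ?mul (Cmp C f s) (Cmp C g s)"
    if "f \<in> hom C P a" "g \<in> hom C P a" "s \<in> hom C X P" for f g s
    using ap2_cmp[OF o(1) that(1,2) o(2) that(3)] ap2_cmp[OF o(1) that(1,2) o(3) that(3)] .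
  have push0: "Cmp C (?zero P) s = ?zero X" "Cmp C (?one P) s = ?one X" if "s \<in> hom C X P" for s
    using ap0_cmp[OF o(1) o(4) that] ap0_cmp[OF o(1) o(5) that] .
  have push1: "Cmp C (?neg f) s = ?neg (Cmp C f s)" "Cmp C (?scal c f) s = ?scal c (Cmp C f s)"
    if "f \<in> hom C P a" "s \<in> hom C X P" for f s c
    using cmp_assoc[OF that(2,1) o(6)] cmp_assoc[OF that(2,1) o(7)] by simp_all
  note inP = ap2_hom[where X = P, OF o(1) _ _ o(2)] ap2_hom[where X = P, OF o(1) _ _ o(3)] ap0_hom[OF o(1) PO o(4)]
    ap0_hom[OF o(1) PO o(5)] cmp_hom[where a = P, OF _ o(6)] cmp_hom[where a = P, OF _ o(7)]
  have at: "l = r \<Longrightarrow> Cmp C l s = Cmp C r s" for l r s by simp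
  note push_simps = push push0 push1 inP p3 t
  show ?thesis unfolding hom_alg_def a_def[symmetric]
  proof
    show "?zero X \<in> hom C X a" "?one X \<in> hom C X a" using in_hom(3,4) X by auto
    fix x y z c d
    assume x: "x \<in> hom C X a"
    show "?neg x \<in> hom C X a" "?scal c x \<in> hom C X a" using in_hom(5,6) x by auto
    show "?add (?zero X) x = x" using at[OF l3, of "t x x x"] x by (simp add: push_simps)
    show "?add (?neg x) x = ?zero X" using at[OF l4, of "t x x x"] x by (simp add: push_simps)
    show "?mul (?one X) x = x" using at[OF l7, of "t x x x"] x by (simp add: push_simps)
    show "?scal (c + d) x = ?add (?scal c x) (?scal d x)"
      using at[OF l10[rule_format], of c d "t x x x"] x by (simp add: push_simps)
    show "?scal (c * d) x = ?scal c (?scal d x)"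
      using at[OF l11[rule_format], of c d "t x x x"] x by (simp add: push_simps)
    show "?scal 1 x = x" using at[OF l12, of "t x x x"] x by (simp add: push_simps)
    assume y: "y \<in> hom C X a"
    show "?add x y \<in> hom C X a" "?mul x y \<in> hom C X a" using in_hom(1,2) x y by auto
    show "?add x y = ?add y x" using at[OF l2, of "t x y y"] x y by (simp add: push_simps)
    show "?mul x y = ?mul y x" using at[OF l6, of "t x y y"] x y by (simp add: push_simps)
    show "?scal c (?add x y) = ?add (?scal c x) (?scal c y)"
      using at[OF l9[rule_format], of c "t x y y"] x y by (simp add: push_simps)
    show "?scal c (?mul x y) = ?mul (?scal c x) y"
      using at[OF l13[rule_format], of c "t x y y"] x y by (simp add: push_simps)
    assume z: "z \<in> hom C X a"
    show "?add (?add x y) z = ?add x (?add y z)" using at[OF l1, of "t x y z"] x y z by (simp add: push_simps)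
    show "?mul (?mul x y) z = ?mul x (?mul y z)" using at[OF l5, of "t x y z"] x y z by (simp add: push_simps)
    show "?mul (?add x y) z = ?add (?mul x z) (?mul y z)" using at[OF l8, of "t x y z"] x y z by (simp add: push_simps)
  qed
qed

text \<open>The axioms are instances of the algebra laws at the stage \<open>A\<^sup>3\<close>.\<close>

lemma kalg_objectI:
  assumes ops: "alg_ops A" and alg: "\<And>X. X \<in> Ob C \<Longrightarrow> hom_alg A X"
  shows "kalg_object C A"
proof -
  define a where "a = acar A"
  note o = alg_opsD[OF ops, folded a_def]
  have PO: "pow_ob C a 3 \<in> Ob C" using o(1) by simp
  have p3: "pow_pr C a 3 0 \<in> hom C (pow_ob C a 3) a" "pow_pr C a 3 1 \<in> hom C (pow_ob C a 3) a"
    "pow_pr C a 3 2 \<in> hom C (pow_ob C a 3) a"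
    using pr_hom[OF o(1), of _ 3] by auto
  interpret H: comm_alg "hom C (pow_ob C a 3) a" "ap2 C a (aadd A)" "ap2 C a (amul A)"
    "ap0 C a (azero A) (pow_ob C a 3)" "ap0 C a (aone A) (pow_ob C a 3)" "Cmp C (aneg A)" "\<lambda>c. Cmp C (ascal A c)"
    using alg[OF PO] by (simp add: hom_alg_def a_def)
  show ?thesis unfolding kalg_object_def Let_def a_def[symmetric]
    by (intro conjI allI o H.add_assoc H.add_comm H.add_zero H.add_neg H.mul_assoc H.mul_comm H.mul_one
        H.mul_add H.scal_add H.scal_plus H.scal_times H.scal_one H.scal_mul p3)
qed

text \<open>By the Yoneda lemma, an arrow between algebra objects is a homomorphism if it is one on generalised
  elements.\<close>

lemma kalg_homI:
  assumes A: "alg_ops A" and B: "alg_ops B" and f: "f \<in> hom C (acar A) (acar B)"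
    and "\<And>X x y. \<lbrakk>x \<in> hom C X (acar A); y \<in> hom C X (acar A)\<rbrakk> \<Longrightarrow>
      Cmp C f (ap2 C (acar A) (aadd A) x y) = ap2 C (acar B) (aadd B) (Cmp C f x) (Cmp C f y)"
    and "\<And>X x y. \<lbrakk>x \<in> hom C X (acar A); y \<in> hom C X (acar A)\<rbrakk> \<Longrightarrow>
      Cmp C f (ap2 C (acar A) (amul A) x y) = ap2 C (acar B) (amul B) (Cmp C f x) (Cmp C f y)"
    and "\<And>X. X \<in> Ob C \<Longrightarrow> Cmp C f (ap0 C (acar A) (azero A) X) = ap0 C (acar B) (azero B) X"
    and "\<And>X. X \<in> Ob C \<Longrightarrow> Cmp C f (ap0 C (acar A) (aone A) X) = ap0 C (acar B) (aone B) X"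
    and "\<And>X x. x \<in> hom C X (acar A) \<Longrightarrow> Cmp C f (Cmp C (aneg A) x) = Cmp C (aneg B) (Cmp C f x)"
    and "\<And>X x c. x \<in> hom C X (acar A) \<Longrightarrow> Cmp C f (Cmp C (ascal A c) x) = Cmp C (ascal B c) (Cmp C f x)"
  shows "kalg_hom C A B f"
proof -
  note a = alg_opsD[OF A] and b = alg_opsD[OF B]
  note p = pr_hom[OF a(1), of 0 2] pr_hom[OF a(1), of 1 2]
  show ?thesis unfolding kalg_hom_def Let_def
  proof (intro conjI allI)
    show "Cmp C f (aadd A) = ap2 C (acar B) (aadd B) (Cmp C f (pow_pr C (acar A) 2 0)) (Cmp C f (pow_pr C (acar A) 2 1))"
      using assms(4)[OF p(1) p(2)] ap2_pr[OF a(1,2)] by simp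
    show "Cmp C f (amul A) = ap2 C (acar B) (amul B) (Cmp C f (pow_pr C (acar A) 2 0)) (Cmp C f (pow_pr C (acar A) 2 1))"
      using assms(5)[OF p(1) p(2)] ap2_pr[OF a(1,3)] by simp
    show "Cmp C f (azero A) = ap0 C (acar B) (azero B) (pow_ob C (acar A) 0)"
      using assms(6)[of "pow_ob C (acar A) 0"] ap0_self[OF a(1,4)] a(1) by simp
    show "Cmp C f (aone A) = ap0 C (acar B) (aone B) (pow_ob C (acar A) 0)"
      using assms(7)[of "pow_ob C (acar A) 0"] ap0_self[OF a(1,5)] a(1) by simp
    show "Cmp C f (aneg A) = Cmp C (aneg B) f"
      using assms(8)[OF ident_hom[OF a(1)]] a(6) f by (simp add: cmp_ident_right)
    show "Cmp C f (ascal A c) = Cmp C (ascal B c) f" for c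
      using assms(9)[OF ident_hom[OF a(1)]] a(7) f by (metis cmp_ident_right)
  qed fact
qed

end

lemma asum_cong: "(\<And>i. i < n \<Longrightarrow> f i = g i) \<Longrightarrow> asum C A X n f = asum C A X n g"
  by (induction n) simp_all

locale alg_in = power_cat C for C :: "('o, 'm) cat" +
  fixes A :: "('k::{comm_ring, comm_monoid_mult}, 'o, 'm) kalg"
  assumes A: "kalg_object C A"
begin

abbreviation "car \<equiv> acar A"
abbreviation "gadd \<equiv> ap2 C car (aadd A)"
abbreviation "gmul \<equiv> ap2 C car (amul A)"
abbreviation "gzero \<equiv> ap0 C car (azero A)"
abbreviation "gone \<equiv> ap0 C car (aone A)"
abbreviation "gneg \<equiv> Cmp C (aneg A)"
abbreviation "gscal \<equiv> \<lambda>c. Cmp C (ascal A c)"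

lemma ops: "alg_ops A"
  using A by (simp add: kalg_object_def alg_ops_def Let_def)

lemmas op_hom = alg_opsD[OF ops]

lemma hom_comm_alg:
  "X \<in> Ob C \<Longrightarrow> comm_alg (hom C X car) gadd gmul (gzero X) (gone X) gneg gscal"
  using kalg_object_imp_hom_alg[OF A] by (simp add: hom_alg_def)

lemma asum_hom:
  "X \<in> Ob C \<Longrightarrow> (\<And>i. i < n \<Longrightarrow> f i \<in> hom C X car) \<Longrightarrow> asum C A X n f \<in> hom C X car"
  by (induction n) (simp_all add: ap0_hom[OF op_hom(1) _ op_hom(4)] ap2_hom[OF op_hom(1) _ _ op_hom(2)])

lemma asum_eq:
  assumes X: "X \<in> Ob C" and f: "\<And>i. i < n \<Longrightarrow> f i \<in> hom C X car"
  shows "asum C A X n f = comm_alg.ssum (hom C X car) gadd (gzero X) f {..<n}"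
proof -
  interpret H: comm_alg "hom C X car" gadd gmul "gzero X" "gone X" gneg gscal
    by (rule hom_comm_alg[OF X])
  show ?thesis using f
  proof (induction n)
    case (Suc n)
    thus ?case using H.ssum_lessThan_Suc[of n f] by simp
  qed simp
qed

lemma asum_cmp:
  assumes t: "t \<in> hom C Y X" and f: "\<And>i. i < n \<Longrightarrow> f i \<in> hom C X car"
  shows "Cmp C (asum C A X n f) t = asum C A Y n (\<lambda>i. Cmp C (f i) t)"
  using f
proof (induction n)
  case 0
  show ?case using ap0_cmp[OF op_hom(1,4) t] by simp
next
  case (Suc n)
  have "asum C A X n f \<in> hom C X car" using Suc.prems hom_ob(2)[OF t] by (intro asum_hom) auto
  thus ?case using Suc ap2_cmp[OF op_hom(1) _ _ op_hom(2) t] by simp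
qed

definition coord :: "nat \<Rightarrow> 'm \<Rightarrow> nat \<Rightarrow> 'm" where
  "coord n x i = Cmp C (pow_pr C car n i) x"

lemma coord_hom: "x \<in> hom C X (pow_ob C car n) \<Longrightarrow> i < n \<Longrightarrow> coord n x i \<in> hom C X car"
  unfolding coord_def using cmp_hom[OF _ pr_hom[OF op_hom(1)]] by blast

lemma coord_eqI:
  "\<lbrakk>x \<in> hom C X (pow_ob C car n); y \<in> hom C X (pow_ob C car n); \<And>i. i < n \<Longrightarrow> coord n x i = coord n y i\<rbrakk> \<Longrightarrow> x = y"
  unfolding coord_def by (rule pow_eqI[OF op_hom(1)])

lemma coord_cmp:
  "\<lbrakk>x \<in> hom C X (pow_ob C car n); t \<in> hom C Y X; i < n\<rbrakk> \<Longrightarrow> coord n (Cmp C x t) i = Cmp C (coord n x i) t"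
  unfolding coord_def using cmp_assoc[OF _ _ pr_hom[OF op_hom(1)]] by blast

lemma coord_tup:
  "\<lbrakk>X \<in> Ob C; \<And>i. i < n \<Longrightarrow> f i \<in> hom C X car; i < n\<rbrakk> \<Longrightarrow> coord n (tup C car n X f) i = f i"
  unfolding coord_def by (rule pr_tup[OF op_hom(1)])

lemma coord_tup_cmp:
  assumes "\<And>i. i < n \<Longrightarrow> f i \<in> hom C X car" "i < n" "t \<in> hom C Y X"
  shows "coord n (Cmp C (tup C car n X f) t) i = Cmp C (f i) t"
  using coord_cmp[OF tup_hom[OF op_hom(1) hom_ob(2)[OF assms(3)] assms(1)] assms(3,2)]
    coord_tup[OF hom_ob(2)[OF assms(3)] assms(1,2)] by simp

lemma pow_ob_Ob [simp]: "pow_ob C car n \<in> Ob C"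
  using op_hom(1) by simp

subsection \<open>Generalised elements of the tensor product\<close>

abbreviation "talg \<equiv> tensor_alg C A"
abbreviation "tcar W \<equiv> pow_ob C car (dim W)"

lemma acar_talg [simp]: "acar (talg W) = tcar W"
  by (simp add: tensor_alg_def Let_def)

text \<open>The coordinate \<open>l\<close> of the product in \<open>A \<otimes> W\<close>, as an expression in the arrows of \<open>C\<close>. If \<open>C\<close> is a
  category of functors, it can be evaluated at an object, unlike a sum in a hom set.\<close>

definition mul_coord :: "'k weil \<Rightarrow> nat \<Rightarrow> 'o \<Rightarrow> 'm \<Rightarrow> 'm \<Rightarrow> 'm" where
  "mul_coord W l X x y = asum C A X (dim W) (\<lambda>i. asum C A X (dim W) (\<lambda>j.
     gscal (sc W i j l) (gmul (coord (dim W) x i) (coord (dim W) y j))))"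

lemma mul_coord_term_hom:
  assumes "x \<in> hom C X (tcar W)" "y \<in> hom C X (tcar W)" "i < dim W" "j < dim W"
  shows "gscal c (gmul (coord (dim W) x i) (coord (dim W) y j)) \<in> hom C X car"
  by (rule cmp_hom[OF ap2_hom[OF op_hom(1) coord_hom coord_hom op_hom(3)] op_hom(7)]) (use assms in auto)

lemma mul_coord_hom:
  assumes "x \<in> hom C X (tcar W)" "y \<in> hom C X (tcar W)"
  shows "mul_coord W l X x y \<in> hom C X car"
  unfolding mul_coord_def using hom_ob(1)[OF assms(1)] mul_coord_term_hom[OF assms] by (intro asum_hom) auto

lemma mul_coord_cmp:
  assumes x: "x \<in> hom C X (tcar W)" "y \<in> hom C X (tcar W)" and t: "t \<in> hom C Y X"
  shows "Cmp C (mul_coord W l X x y) t = mul_coord W l Y (Cmp C x t) (Cmp C y t)"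
proof -
  have X: "X \<in> Ob C" using hom_ob(1)[OF x(1)] .
  have 1: "Cmp C (gscal c (gmul (coord (dim W) x i) (coord (dim W) y j))) t =
    gscal c (gmul (coord (dim W) (Cmp C x t) i) (coord (dim W) (Cmp C y t) j))" if ij: "i < dim W" "j < dim W" for c i j
  proof -
    note h = coord_hom[OF x(1) ij(1)] coord_hom[OF x(2) ij(2)]
    show ?thesis
      using cmp_assoc[OF t ap2_hom[OF op_hom(1) h op_hom(3)] op_hom(7)] ap2_cmp[OF op_hom(1) h op_hom(3) t]
        coord_cmp[OF x(1) t ij(1)] coord_cmp[OF x(2) t ij(2)] by simp
  qed
  have "Cmp C (mul_coord W l X x y) t = asum C A Y (dim W) (\<lambda>i. Cmp C (asum C A X (dim W) (\<lambda>j.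
     gscal (sc W i j l) (gmul (coord (dim W) x i) (coord (dim W) y j)))) t)"
    unfolding mul_coord_def using mul_coord_term_hom[OF x] X by (intro asum_cmp[OF t] asum_hom) auto
  also have "\<dots> = asum C A Y (dim W) (\<lambda>i. asum C A Y (dim W) (\<lambda>j.
     Cmp C (gscal (sc W i j l) (gmul (coord (dim W) x i) (coord (dim W) y j))) t))"
    using mul_coord_term_hom[OF x] by (intro asum_cong asum_cmp[OF t]) auto
  also have "\<dots> = mul_coord W l Y (Cmp C x t) (Cmp C y t)"
    unfolding mul_coord_def by (intro asum_cong) (simp add: 1)
  finally show ?thesis .
qed

lemma talg_ops_eq:
  shows "aadd (talg W) = tup C car (dim W) (pow_ob C (tcar W) 2)
      (\<lambda>l. gadd (coord (dim W) (pow_pr C (tcar W) 2 0) l) (coord (dim W) (pow_pr C (tcar W) 2 1) l))"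
    and "amul (talg W) = tup C car (dim W) (pow_ob C (tcar W) 2)
      (\<lambda>l. mul_coord W l (pow_ob C (tcar W) 2) (pow_pr C (tcar W) 2 0) (pow_pr C (tcar W) 2 1))"
    and "azero (talg W) = tup C car (dim W) (pow_ob C (tcar W) 0) (\<lambda>l. gzero (pow_ob C (tcar W) 0))"
    and "aone (talg W) = tup C car (dim W) (pow_ob C (tcar W) 0)
      (\<lambda>l. if l = 0 then gone (pow_ob C (tcar W) 0) else gzero (pow_ob C (tcar W) 0))"
    and "aneg (talg W) = tup C car (dim W) (tcar W) (\<lambda>l. gneg (pow_pr C car (dim W) l))"
    and "ascal (talg W) c = tup C car (dim W) (tcar W) (\<lambda>l. gscal c (pow_pr C car (dim W) l))"
  by (simp_all add: tensor_alg_def Let_def coord_def mul_coord_def if_distrib if_distribR cong: if_cong)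

lemma gadd_hom: "\<lbrakk>x \<in> hom C X car; y \<in> hom C X car\<rbrakk> \<Longrightarrow> gadd x y \<in> hom C X car"
  by (rule ap2_hom[OF op_hom(1) _ _ op_hom(2)])

lemma gconst_hom: "X \<in> Ob C \<Longrightarrow> gzero X \<in> hom C X car" "X \<in> Ob C \<Longrightarrow> gone X \<in> hom C X car"
  using ap0_hom[OF op_hom(1)] op_hom by auto

lemma gunary_hom: "x \<in> hom C X car \<Longrightarrow> gneg x \<in> hom C X car" "x \<in> hom C X car \<Longrightarrow> gscal c x \<in> hom C X car"
  using cmp_hom op_hom by blast+

lemma talg_ops: "alg_ops (talg W)"
proof -
  have p: "pow_pr C (tcar W) 2 0 \<in> hom C (pow_ob C (tcar W) 2) (tcar W)"
    "pow_pr C (tcar W) 2 1 \<in> hom C (pow_ob C (tcar W) 2) (tcar W)"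
    by (simp_all add: pr_hom)
  show ?thesis unfolding alg_ops_def acar_talg talg_ops_eq
    using p gconst_hom gunary_hom pr_hom[OF op_hom(1)] coord_hom gadd_hom mul_coord_hom[OF p]
    by (intro conjI allI tup_hom op_hom(1)) (auto intro: gadd_hom gconst_hom gunary_hom coord_hom)
qed

lemmas talg_op_hom = alg_opsD[OF talg_ops, unfolded acar_talg]

text \<open>Elements of \<open>A \<otimes> W\<close> at stage \<open>X\<close> are tuples of elements of the algebra \<open>hom X A\<close>, and the
  operations of \<open>A \<otimes> W\<close> are given by formulas in that algebra.\<close>

lemma coord_add:
  assumes x: "x \<in> hom C X (tcar W)" and y: "y \<in> hom C X (tcar W)" and l: "l < dim W"
  shows "coord (dim W) (ap2 C (tcar W) (aadd (talg W)) x y) l = gadd (coord (dim W) x l) (coord (dim W) y l)"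
proof -
  note u = pair_hom[OF pow_ob_Ob x y]
  note p = pr_hom[OF pow_ob_Ob, of 0 2 "dim W"] pr_hom[OF pow_ob_Ob, of 1 2 "dim W"]
  note q = coord_hom[OF p(1) l] coord_hom[OF p(2) l]
  have "coord (dim W) (ap2 C (tcar W) (aadd (talg W)) x y) l =
     Cmp C (gadd (coord (dim W) (pow_pr C (tcar W) 2 0) l) (coord (dim W) (pow_pr C (tcar W) 2 1) l))
       (tup C (tcar W) 2 X (\<lambda>i. if i = 0 then x else y))"
    unfolding ap2_char[OF pow_ob_Ob u] talg_ops_eq
    by (rule coord_tup_cmp[OF _ l u(1)]) (simp add: gadd_hom coord_hom[OF p(1)] coord_hom[OF p(2), simplified])
  also have "\<dots> = gadd (coord (dim W) x l) (coord (dim W) y l)"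
    using ap2_cmp[OF op_hom(1) q op_hom(2) u(1)] coord_cmp[OF p(1) u(1) l] coord_cmp[OF p(2) u(1) l] u(2,3)
    by simp
  finally show ?thesis .
qed

lemma coord_mul_asum:
  assumes x: "x \<in> hom C X (tcar W)" and y: "y \<in> hom C X (tcar W)" and l: "l < dim W"
  shows "coord (dim W) (ap2 C (tcar W) (amul (talg W)) x y) l = mul_coord W l X x y"
proof -
  note u = pair_hom[OF pow_ob_Ob x y]
  note p = pr_hom[OF pow_ob_Ob, of 0 2 "dim W", simplified] pr_hom[OF pow_ob_Ob, of 1 2 "dim W", simplified]
  have "coord (dim W) (ap2 C (tcar W) (amul (talg W)) x y) l =
     Cmp C (mul_coord W l (pow_ob C (tcar W) 2) (pow_pr C (tcar W) 2 0) (pow_pr C (tcar W) 2 1))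
       (tup C (tcar W) 2 X (\<lambda>i. if i = 0 then x else y))"
    unfolding ap2_char[OF pow_ob_Ob u] talg_ops_eq
    by (rule coord_tup_cmp[OF _ l u(1)]) (simp add: mul_coord_hom[OF p])
  also have "\<dots> = mul_coord W l X x y"
    using mul_coord_cmp[OF p u(1)] u(2,3) by simp
  finally show ?thesis .
qed

lemma asum2_eq:
  assumes X: "X \<in> Ob C" and f: "\<And>i j. i < n \<Longrightarrow> j < m \<Longrightarrow> f i j \<in> hom C X car"
  shows "asum C A X n (\<lambda>i. asum C A X m (f i)) =
    comm_alg.ssum (hom C X car) gadd (gzero X) (\<lambda>i. comm_alg.ssum (hom C X car) gadd (gzero X) (f i) {..<m}) {..<n}"
proof -
  interpret H: comm_alg "hom C X car" gadd gmul "gzero X" "gone X" gneg gscal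
    by (rule hom_comm_alg[OF X])
  have "asum C A X n (\<lambda>i. asum C A X m (f i)) = H.ssum (\<lambda>i. asum C A X m (f i)) {..<n}"
    using f X by (intro asum_eq asum_hom) auto
  also have "\<dots> = H.ssum (\<lambda>i. H.ssum (f i) {..<m}) {..<n}"
    using f X by (intro H.ssum.cong refl asum_eq) auto
  finally show ?thesis .
qed

lemma mul_coord_eq:
  assumes x: "x \<in> hom C X (tcar W)" and y: "y \<in> hom C X (tcar W)"
  shows "mul_coord W l X x y =
    comm_alg.tmul (hom C X car) gadd gmul (gzero X) gscal W (coord (dim W) x) (coord (dim W) y) l"
proof -
  have X: "X \<in> Ob C" using hom_ob(1)[OF x] .
  interpret H: comm_alg "hom C X car" gadd gmul "gzero X" "gone X" gneg gscal
    by (rule hom_comm_alg[OF X])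
  show ?thesis unfolding mul_coord_def H.tmul_def
    by (rule asum2_eq[OF X]) (rule mul_coord_term_hom[OF x y])
qed

lemma coord_mul:
  assumes x: "x \<in> hom C X (tcar W)" and y: "y \<in> hom C X (tcar W)" and l: "l < dim W"
  shows "coord (dim W) (ap2 C (tcar W) (amul (talg W)) x y) l =
    comm_alg.tmul (hom C X car) gadd gmul (gzero X) gscal W (coord (dim W) x) (coord (dim W) y) l"
  unfolding coord_mul_asum[OF x y l] by (rule mul_coord_eq[OF x y])

lemma coord_zero:
  assumes X: "X \<in> Ob C" and l: "l < dim W"
  shows "coord (dim W) (ap0 C (tcar W) (azero (talg W)) X) l = gzero X"
proof -
  note u = terminal_hom[OF pow_ob_Ob X, where n1 = "dim W"]
  show ?thesis
    unfolding ap0_def[of C "tcar W"] talg_ops_eq using gconst_hom ap0_cmp[OF op_hom(1,4) u]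
    by (subst coord_tup_cmp[OF _ l u]) (auto simp: pow_simps)
qed

lemma coord_one:
  assumes X: "X \<in> Ob C" and l: "l < dim W"
  shows "coord (dim W) (ap0 C (tcar W) (aone (talg W)) X) l = (if l = 0 then gone X else gzero X)"
proof -
  note u = terminal_hom[OF pow_ob_Ob X, where n1 = "dim W"]
  show ?thesis
    unfolding ap0_def[of C "tcar W"] talg_ops_eq using gconst_hom ap0_cmp[OF op_hom(1,4) u] ap0_cmp[OF op_hom(1,5) u]
    by (subst coord_tup_cmp[OF _ l u]) (auto simp: pow_simps)
qed

lemma coord_neg:
  assumes x: "x \<in> hom C X (tcar W)" and l: "l < dim W"
  shows "coord (dim W) (Cmp C (aneg (talg W)) x) l = gneg (coord (dim W) x l)"
  unfolding talg_ops_eq using gunary_hom(1)[OF pr_hom[OF op_hom(1)]] cmp_assoc[OF x pr_hom[OF op_hom(1) l] op_hom(6)]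
  by (subst coord_tup_cmp[OF _ l x]) (auto simp: coord_def)

lemma coord_scal:
  assumes x: "x \<in> hom C X (tcar W)" and l: "l < dim W"
  shows "coord (dim W) (Cmp C (ascal (talg W) c) x) l = gscal c (coord (dim W) x l)"
  unfolding talg_ops_eq using gunary_hom(2)[OF pr_hom[OF op_hom(1)]] cmp_assoc[OF x pr_hom[OF op_hom(1) l] op_hom(7)]
  by (subst coord_tup_cmp[OF _ l x]) (auto simp: coord_def)

lemma tmap_arrow_hom:
  assumes x: "x \<in> hom C X (pow_ob C car n)" and j: "j < n"
  shows "gscal c (coord n x j) \<in> hom C X car"
  by (rule gunary_hom(2)[OF coord_hom[OF x j]])

lemma tensor_map_hom: "tensor_map C A \<phi> \<in> hom C (tcar (src \<phi>)) (tcar (tgt \<phi>))"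
  unfolding tensor_map_def Let_def
  by (intro tup_hom asum_hom op_hom(1) pow_ob_Ob gunary_hom pr_hom)

lemma coord_tensor_map_asum:
  assumes x: "x \<in> hom C X (tcar (src \<phi>))" and i: "i < dim (tgt \<phi>)"
  shows "coord (dim (tgt \<phi>)) (Cmp C (tensor_map C A \<phi>) x) i =
    asum C A X (dim (src \<phi>)) (\<lambda>j. gscal (mat \<phi> i j) (coord (dim (src \<phi>)) x j))"
proof -
  let ?n = "dim (src \<phi>)"
  have "coord (dim (tgt \<phi>)) (Cmp C (tensor_map C A \<phi>) x) i =
      Cmp C (asum C A (tcar (src \<phi>)) ?n (\<lambda>j. gscal (mat \<phi> i j) (pow_pr C car ?n j))) x"
    unfolding tensor_map_def Let_def
    by (rule coord_tup_cmp[OF _ i x]) (intro asum_hom pow_ob_Ob gunary_hom pr_hom op_hom(1))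
  also have "\<dots> = asum C A X ?n (\<lambda>j. Cmp C (gscal (mat \<phi> i j) (pow_pr C car ?n j)) x)"
    by (rule asum_cmp[OF x]) (intro gunary_hom pr_hom op_hom(1))
  also have "\<dots> = asum C A X ?n (\<lambda>j. gscal (mat \<phi> i j) (coord ?n x j))"
    by (rule asum_cong) (simp add: coord_def cmp_assoc[OF x pr_hom[OF op_hom(1)] op_hom(7)])
  finally show ?thesis .
qed

lemma coord_tensor_map:
  assumes x: "x \<in> hom C X (tcar (src \<phi>))" and i: "i < dim (tgt \<phi>)"
  shows "coord (dim (tgt \<phi>)) (Cmp C (tensor_map C A \<phi>) x) i =
    comm_alg.tlin (hom C X car) gadd (gzero X) gscal (dim (src \<phi>)) (mat \<phi>) (coord (dim (src \<phi>)) x) i"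
proof -
  have X: "X \<in> Ob C" using hom_ob(1)[OF x] .
  interpret H: comm_alg "hom C X car" gadd gmul "gzero X" "gone X" gneg gscal
    by (rule hom_comm_alg[OF X])
  show ?thesis unfolding coord_tensor_map_asum[OF x i] H.tlin_def
    by (rule asum_eq[OF X]) (rule tmap_arrow_hom[OF x])
qed

end

lemma (in comm_alg) tmul_cong:
  "\<lbrakk>\<And>i. i < dim W \<Longrightarrow> x i = x' i; \<And>i. i < dim W \<Longrightarrow> y i = y' i\<rbrakk> \<Longrightarrow> tmul W x y l = tmul W x' y' l"
  unfolding tmul_def by (intro ssum.cong) auto

lemma (in comm_alg) tlin_cong:
  "(\<And>i. i < n \<Longrightarrow> x i = x' i) \<Longrightarrow> tlin n m x i = tlin n m x' i"
  unfolding tlin_def by (intro ssum.cong) auto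

context alg_in begin

lemma coord_asum:
  assumes X: "X \<in> Ob C" and f: "\<And>i. i < n \<Longrightarrow> f i \<in> hom C X (tcar W)" and l: "l < dim W"
  shows "asum C (talg W) X n f \<in> hom C X (tcar W) \<and>
    coord (dim W) (asum C (talg W) X n f) l = asum C A X n (\<lambda>i. coord (dim W) (f i) l)"
  using f
proof (induction n)
  case 0
  show ?case using ap0_hom[OF pow_ob_Ob X talg_op_hom(4)] coord_zero[OF X l] by simp
next
  case (Suc n)
  have "asum C (talg W) X n f \<in> hom C X (tcar W)" "f n \<in> hom C X (tcar W)" using Suc by auto
  note h = this
  show ?case using Suc ap2_hom[OF pow_ob_Ob h talg_op_hom(2)] coord_add[OF h l] by simp
qed

text \<open>It suffices to consider elements, and these are equal if their coordinates are. In coordinates each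
  law holds by the law of the same name for \<open>hom X A\<close> and the equations between structure
  constants.\<close>

theorem talg_kalg_object:
  assumes W: "structure_constants W"
  shows "kalg_object C (talg W)"
proof (rule kalg_objectI[OF talg_ops])
  fix X assume X: "X \<in> Ob C"
  interpret H: comm_alg "hom C X car" gadd gmul "gzero X" "gone X" gneg gscal
    by (rule hom_comm_alg[OF X])
  let ?n = "dim W"
  note sc = structure_constantsD[OF W]
  note closed [simp] = ap2_hom[where X = X, OF pow_ob_Ob _ _ talg_op_hom(2)] ap2_hom[where X = X, OF pow_ob_Ob _ _ talg_op_hom(3)]
    ap0_hom[OF pow_ob_Ob X talg_op_hom(4)] ap0_hom[OF pow_ob_Ob X talg_op_hom(5)]
    cmp_hom[where a = X, OF _ talg_op_hom(6)] cmp_hom[where a = X, OF _ talg_op_hom(7)]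
  note [simp] = coord_hom[where X = X]
  note comps [simp] = coord_add[where X = X] coord_mul[where X = X] coord_zero[OF X] coord_one[OF X]
    coord_neg[where X = X] coord_scal[where X = X]
  show "hom_alg (talg W) X" unfolding hom_alg_def acar_talg
  proof
    fix x y z c d
    assume x [simp]: "x \<in> hom C X (tcar W)"
    show "ap2 C (tcar W) (aadd (talg W)) (ap0 C (tcar W) (azero (talg W)) X) x = x"
      by (rule coord_eqI[of _ X ?n]) auto
    show "ap2 C (tcar W) (aadd (talg W)) (Cmp C (aneg (talg W)) x) x = ap0 C (tcar W) (azero (talg W)) X"
      by (rule coord_eqI[of _ X ?n]) auto
    show "ap2 C (tcar W) (amul (talg W)) (ap0 C (tcar W) (aone (talg W)) X) x = x"
    proof (rule coord_eqI[of _ X ?n])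
      fix l assume l: "l < ?n"
      have "H.tmul W (coord ?n (ap0 C (tcar W) (aone (talg W)) X)) (coord ?n x) l =
          H.tmul W (\<lambda>i. if i = 0 then gone X else gzero X) (coord ?n x) l"
        by (rule H.tmul_cong) auto
      thus "coord ?n (ap2 C (tcar W) (amul (talg W)) (ap0 C (tcar W) (aone (talg W)) X) x) l = coord ?n x l"
        using l H.tmul_one[of W l "coord ?n x"] sc(5) by simp
    qed auto
    show "Cmp C (ascal (talg W) (c + d)) x = ap2 C (tcar W) (aadd (talg W)) (Cmp C (ascal (talg W) c) x) (Cmp C (ascal (talg W) d) x)"
      by (rule coord_eqI[of _ X ?n]) (auto simp: H.scal_plus)
    show "Cmp C (ascal (talg W) (c * d)) x = Cmp C (ascal (talg W) c) (Cmp C (ascal (talg W) d) x)"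
      by (rule coord_eqI[of _ X ?n]) (auto simp: H.scal_times)
    show "Cmp C (ascal (talg W) 1) x = x"
      by (rule coord_eqI[of _ X ?n]) auto
    assume y [simp]: "y \<in> hom C X (tcar W)"
    show "ap2 C (tcar W) (aadd (talg W)) x y = ap2 C (tcar W) (aadd (talg W)) y x"
      by (rule coord_eqI[of _ X ?n]) (auto simp: H.add_comm)
    show "ap2 C (tcar W) (amul (talg W)) x y = ap2 C (tcar W) (amul (talg W)) y x"
    proof (rule coord_eqI[of _ X ?n])
      fix l assume l: "l < ?n"
      have "H.tmul W (coord ?n x) (coord ?n y) l = H.tmul W (coord ?n y) (coord ?n x) l"
        by (rule H.tmul_comm[OF sc(3)]) auto
      thus "coord ?n (ap2 C (tcar W) (amul (talg W)) x y) l = coord ?n (ap2 C (tcar W) (amul (talg W)) y x) l"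
        using l by simp
    qed auto
    show "Cmp C (ascal (talg W) c) (ap2 C (tcar W) (aadd (talg W)) x y) =
        ap2 C (tcar W) (aadd (talg W)) (Cmp C (ascal (talg W) c) x) (Cmp C (ascal (talg W) c) y)"
      by (rule coord_eqI[of _ X ?n]) (auto simp: H.scal_add)
    show "Cmp C (ascal (talg W) c) (ap2 C (tcar W) (amul (talg W)) x y) =
        ap2 C (tcar W) (amul (talg W)) (Cmp C (ascal (talg W) c) x) y"
    proof (rule coord_eqI[of _ X ?n])
      fix l assume l: "l < ?n"
      have "gscal c (H.tmul W (coord ?n x) (coord ?n y) l) = H.tmul W (\<lambda>i. gscal c (coord ?n x i)) (coord ?n y) l"
        by (rule H.tmul_scal) auto
      also have "\<dots> = H.tmul W (coord ?n (Cmp C (ascal (talg W) c) x)) (coord ?n y) l"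
        by (rule H.tmul_cong) auto
      finally show "coord ?n (Cmp C (ascal (talg W) c) (ap2 C (tcar W) (amul (talg W)) x y)) l =
          coord ?n (ap2 C (tcar W) (amul (talg W)) (Cmp C (ascal (talg W) c) x) y) l" using l by simp
    qed auto
    assume z [simp]: "z \<in> hom C X (tcar W)"
    show "ap2 C (tcar W) (aadd (talg W)) (ap2 C (tcar W) (aadd (talg W)) x y) z =
        ap2 C (tcar W) (aadd (talg W)) x (ap2 C (tcar W) (aadd (talg W)) y z)"
      by (rule coord_eqI[of _ X ?n]) (auto simp: H.add_assoc)
    show "ap2 C (tcar W) (amul (talg W)) (ap2 C (tcar W) (amul (talg W)) x y) z =
        ap2 C (tcar W) (amul (talg W)) x (ap2 C (tcar W) (amul (talg W)) y z)"
    proof (rule coord_eqI[of _ X ?n])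
      fix l assume l: "l < ?n"
      have "H.tmul W (coord ?n (ap2 C (tcar W) (amul (talg W)) x y)) (coord ?n z) l =
          H.tmul W (H.tmul W (coord ?n x) (coord ?n y)) (coord ?n z) l"
        by (rule H.tmul_cong) auto
      also have "\<dots> = H.tmul W (coord ?n x) (H.tmul W (coord ?n y) (coord ?n z)) l"
        by (rule H.tmul_assoc[OF sc(4)]) auto
      also have "\<dots> = H.tmul W (coord ?n x) (coord ?n (ap2 C (tcar W) (amul (talg W)) y z)) l"
        by (rule H.tmul_cong) auto
      finally show "coord ?n (ap2 C (tcar W) (amul (talg W)) (ap2 C (tcar W) (amul (talg W)) x y) z) l =
        coord ?n (ap2 C (tcar W) (amul (talg W)) x (ap2 C (tcar W) (amul (talg W)) y z)) l" using l by simp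
    qed auto
    show "ap2 C (tcar W) (amul (talg W)) (ap2 C (tcar W) (aadd (talg W)) x y) z =
        ap2 C (tcar W) (aadd (talg W)) (ap2 C (tcar W) (amul (talg W)) x z) (ap2 C (tcar W) (amul (talg W)) y z)"
    proof (rule coord_eqI[of _ X ?n])
      fix l assume l: "l < ?n"
      have "H.tmul W (coord ?n (ap2 C (tcar W) (aadd (talg W)) x y)) (coord ?n z) l =
          H.tmul W (\<lambda>i. gadd (coord ?n x i) (coord ?n y i)) (coord ?n z) l"
        by (rule H.tmul_cong) auto
      also have "\<dots> = gadd (H.tmul W (coord ?n x) (coord ?n z) l) (H.tmul W (coord ?n y) (coord ?n z) l)"
        by (rule H.tmul_add) auto
      finally show "coord ?n (ap2 C (tcar W) (amul (talg W)) (ap2 C (tcar W) (aadd (talg W)) x y) z) l =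
        coord ?n (ap2 C (tcar W) (aadd (talg W)) (ap2 C (tcar W) (amul (talg W)) x z) (ap2 C (tcar W) (amul (talg W)) y z)) l"
        using l by simp
    qed auto
  qed auto
qed

subsection \<open>The arrow induced by a linear map\<close>

lemma coord_tensor_map_delta:
  assumes x: "x \<in> hom C X (tcar (src \<phi>))" and "i < dim (tgt \<phi>)" "a < dim (src \<phi>)"
    "\<And>j. j < dim (src \<phi>) \<Longrightarrow> mat \<phi> i j = (if j = a then 1 else 0)"
  shows "coord (dim (tgt \<phi>)) (Cmp C (tensor_map C A \<phi>) x) i = coord (dim (src \<phi>)) x a"
proof -
  interpret H: comm_alg "hom C X car" gadd gmul "gzero X" "gone X" gneg gscal
    by (rule hom_comm_alg[OF hom_ob(1)[OF x]])
  show ?thesis unfolding coord_tensor_map[OF assms(1,2)]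
    using assms by (intro H.tlin_delta) (auto intro: coord_hom)
qed

lemma tensor_map_wid: "tensor_map C A (wid W) = Ident C (tcar W)"
proof (rule coord_eqI[of _ "tcar W" "dim W"])
  show "tensor_map C A (wid W) \<in> hom C (tcar W) (tcar W)" using tensor_map_hom[of "wid W"] by simp
  fix i assume i: "i < dim W"
  have "coord (dim W) (Cmp C (tensor_map C A (wid W)) (Ident C (tcar W))) i = coord (dim W) (Ident C (tcar W)) i"
    using coord_tensor_map_delta[of "Ident C (tcar W)" "tcar W" "wid W" i i] i ident_hom[OF pow_ob_Ob] by (simp add: wid_def)
  thus "coord (dim W) (tensor_map C A (wid W)) i = coord (dim W) (Ident C (tcar W)) i"
    using cmp_ident_right[OF tensor_map_hom[of "wid W"]] by simp
qed (simp add: ident_hom)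

text \<open>Functoriality for arbitrary matrices: the components of \<open>\<theta>\<close> are induced by linear maps that are not
  homomorphisms.\<close>

lemma tensor_map_wcomp:
  assumes "tgt \<phi> = src \<psi>"
  shows "tensor_map C A (wcomp \<psi> \<phi>) = Cmp C (tensor_map C A \<psi>) (tensor_map C A \<phi>)"
proof -
  let ?n = "dim (src \<phi>)" and ?m = "dim (tgt \<phi>)" and ?k = "dim (tgt \<psi>)"
  define x where "x = Ident C (tcar (src \<phi>))"
  have x: "x \<in> hom C (tcar (src \<phi>)) (tcar (src \<phi>))" by (simp add: x_def ident_hom)
  note f = tensor_map_hom[of \<phi>, unfolded assms] and g = tensor_map_hom[of \<psi>]
  have h: "tensor_map C A (wcomp \<psi> \<phi>) \<in> hom C (tcar (src \<phi>)) (tcar (tgt \<psi>))"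
    using tensor_map_hom[of "wcomp \<psi> \<phi>"] by simp
  interpret H: comm_alg "hom C (tcar (src \<phi>)) car" gadd gmul "gzero (tcar (src \<phi>))" "gone (tcar (src \<phi>))" gneg gscal
    by (rule hom_comm_alg[OF pow_ob_Ob])
  show ?thesis
  proof (rule coord_eqI[OF h cmp_hom[OF f g]])
    fix i assume i: "i < ?k"
    have "coord ?k (Cmp C (tensor_map C A \<psi>) (tensor_map C A \<phi>)) i =
        coord ?k (Cmp C (tensor_map C A \<psi>) (Cmp C (tensor_map C A \<phi>) x)) i"
      using f by (simp add: x_def cmp_ident_right)
    also have "\<dots> = H.tlin ?m (mat \<psi>) (coord ?m (Cmp C (tensor_map C A \<phi>) x)) i"
      using coord_tensor_map[OF cmp_hom[OF x f] i] assms by simp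
    also have "\<dots> = H.tlin ?m (mat \<psi>) (H.tlin ?n (mat \<phi>) (coord ?n x)) i"
      by (rule H.tlin_cong) (rule coord_tensor_map[OF x])
    also have "\<dots> = H.tlin ?n (mat (wcomp \<psi> \<phi>)) (coord ?n x) i"
      using H.tlin_comp[OF coord_hom[OF x]] by (simp add: wcomp_def)
    also have "\<dots> = coord ?k (Cmp C (tensor_map C A (wcomp \<psi> \<phi>)) x) i"
      using coord_tensor_map[of x _ "wcomp \<psi> \<phi>" i] x i by simp
    finally show "coord ?k (tensor_map C A (wcomp \<psi> \<phi>)) i = coord ?k (Cmp C (tensor_map C A \<psi>) (tensor_map C A \<phi>)) i"
      using h by (simp add: x_def cmp_ident_right)
  qed
qed

lemma tensor_map_op2:
  assumes \<phi>: "is_weil_hom \<phi>" and x: "x \<in> hom C X (tcar (src \<phi>))" and y: "y \<in> hom C X (tcar (src \<phi>))"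
  shows "Cmp C (tensor_map C A \<phi>) (ap2 C (tcar (src \<phi>)) (aadd (talg (src \<phi>))) x y) =
      ap2 C (tcar (tgt \<phi>)) (aadd (talg (tgt \<phi>))) (Cmp C (tensor_map C A \<phi>) x) (Cmp C (tensor_map C A \<phi>) y)" (is ?add)
    and "Cmp C (tensor_map C A \<phi>) (ap2 C (tcar (src \<phi>)) (amul (talg (src \<phi>))) x y) =
      ap2 C (tcar (tgt \<phi>)) (amul (talg (tgt \<phi>))) (Cmp C (tensor_map C A \<phi>) x) (Cmp C (tensor_map C A \<phi>) y)" (is ?mul)
proof -
  have X: "X \<in> Ob C" using hom_ob(1)[OF x] .
  interpret H: comm_alg "hom C X car" gadd gmul "gzero X" "gone X" gneg gscal
    by (rule hom_comm_alg[OF X])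
  let ?f = "tensor_map C A \<phi>" and ?n = "dim (src \<phi>)" and ?m = "dim (tgt \<phi>)"
  have fx: "Cmp C ?f x \<in> hom C X (tcar (tgt \<phi>))" "Cmp C ?f y \<in> hom C X (tcar (tgt \<phi>))"
    using cmp_hom[OF x tensor_map_hom] cmp_hom[OF y tensor_map_hom] by auto
  note add = ap2_hom[OF pow_ob_Ob x y talg_op_hom(2)] and mul = ap2_hom[OF pow_ob_Ob x y talg_op_hom(3)]
  show ?add
  proof (rule coord_eqI[OF cmp_hom[OF add tensor_map_hom] ap2_hom[OF pow_ob_Ob fx talg_op_hom(2)]])
    fix l assume l: "l < ?m"
    have "coord ?m (Cmp C ?f (ap2 C (tcar (src \<phi>)) (aadd (talg (src \<phi>))) x y)) l =
        H.tlin ?n (mat \<phi>) (\<lambda>i. gadd (coord ?n x i) (coord ?n y i)) l"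
      unfolding coord_tensor_map[OF add l] by (rule H.tlin_cong) (rule coord_add[OF x y])
    also have "\<dots> = gadd (H.tlin ?n (mat \<phi>) (coord ?n x) l) (H.tlin ?n (mat \<phi>) (coord ?n y) l)"
      by (rule H.tlin_add) (auto intro: coord_hom x y)
    finally show "coord ?m (Cmp C ?f (ap2 C (tcar (src \<phi>)) (aadd (talg (src \<phi>))) x y)) l =
      coord ?m (ap2 C (tcar (tgt \<phi>)) (aadd (talg (tgt \<phi>))) (Cmp C ?f x) (Cmp C ?f y)) l"
      unfolding coord_add[OF fx l] coord_tensor_map[OF x l] coord_tensor_map[OF y l] .
  qed
  show ?mul
  proof (rule coord_eqI[OF cmp_hom[OF mul tensor_map_hom] ap2_hom[OF pow_ob_Ob fx talg_op_hom(3)]])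
    fix l assume l: "l < ?m"
    have "coord ?m (Cmp C ?f (ap2 C (tcar (src \<phi>)) (amul (talg (src \<phi>))) x y)) l =
        H.tlin ?n (mat \<phi>) (H.tmul (src \<phi>) (coord ?n x) (coord ?n y)) l"
      unfolding coord_tensor_map[OF mul l] by (rule H.tlin_cong) (rule coord_mul[OF x y])
    also have "\<dots> = H.tmul (tgt \<phi>) (H.tlin ?n (mat \<phi>) (coord ?n x)) (H.tlin ?n (mat \<phi>) (coord ?n y)) l"
      by (rule H.tlin_tmul[OF is_weil_homD(5)[OF \<phi>]]) (auto intro: coord_hom x y)
    also have "\<dots> = H.tmul (tgt \<phi>) (coord ?m (Cmp C ?f x)) (coord ?m (Cmp C ?f y)) l"
      by (rule H.tmul_cong) (auto simp: coord_tensor_map[OF x] coord_tensor_map[OF y])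
    finally show "coord ?m (Cmp C ?f (ap2 C (tcar (src \<phi>)) (amul (talg (src \<phi>))) x y)) l =
      coord ?m (ap2 C (tcar (tgt \<phi>)) (amul (talg (tgt \<phi>))) (Cmp C ?f x) (Cmp C ?f y)) l"
      unfolding coord_mul[OF fx l] .
  qed
qed

lemma tensor_map_op0:
  assumes \<phi>: "is_weil_hom \<phi>" and X: "X \<in> Ob C"
  shows "Cmp C (tensor_map C A \<phi>) (ap0 C (tcar (src \<phi>)) (azero (talg (src \<phi>))) X) =
      ap0 C (tcar (tgt \<phi>)) (azero (talg (tgt \<phi>))) X" (is ?zero)
    and "Cmp C (tensor_map C A \<phi>) (ap0 C (tcar (src \<phi>)) (aone (talg (src \<phi>))) X) =
      ap0 C (tcar (tgt \<phi>)) (aone (talg (tgt \<phi>))) X" (is ?one)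
proof -
  interpret H: comm_alg "hom C X car" gadd gmul "gzero X" "gone X" gneg gscal
    by (rule hom_comm_alg[OF X])
  let ?f = "tensor_map C A \<phi>" and ?n = "dim (src \<phi>)" and ?m = "dim (tgt \<phi>)"
  note z = ap0_hom[OF pow_ob_Ob X talg_op_hom(4)] and o = ap0_hom[OF pow_ob_Ob X talg_op_hom(5)]
  show ?zero
  proof (rule coord_eqI[OF cmp_hom[OF z tensor_map_hom] z])
    fix l assume l: "l < ?m"
    have "H.tlin ?n (mat \<phi>) (coord ?n (ap0 C (tcar (src \<phi>)) (azero (talg (src \<phi>))) X)) l = H.tlin ?n (mat \<phi>) (\<lambda>i. gzero X) l"
      by (rule H.tlin_cong) (rule coord_zero[OF X])
    thus "coord ?m (Cmp C ?f (ap0 C (tcar (src \<phi>)) (azero (talg (src \<phi>))) X)) l =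
        coord ?m (ap0 C (tcar (tgt \<phi>)) (azero (talg (tgt \<phi>))) X) l"
      unfolding coord_tensor_map[OF z l] coord_zero[OF X l] H.tlin_zero .
  qed
  show ?one
  proof (rule coord_eqI[OF cmp_hom[OF o tensor_map_hom] o])
    fix l assume l: "l < ?m"
    have "H.tlin ?n (mat \<phi>) (coord ?n (ap0 C (tcar (src \<phi>)) (aone (talg (src \<phi>))) X)) l =
        H.tlin ?n (mat \<phi>) (\<lambda>i. if i = 0 then gone X else gzero X) l"
      by (rule H.tlin_cong) (rule coord_one[OF X])
    also have "\<dots> = (if l = 0 then gone X else gzero X)"
      by (rule H.tlin_one) (use is_weil_homD[OF \<phi>] is_weil_dim in auto)
    finally show "coord ?m (Cmp C ?f (ap0 C (tcar (src \<phi>)) (aone (talg (src \<phi>))) X)) l =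
        coord ?m (ap0 C (tcar (tgt \<phi>)) (aone (talg (tgt \<phi>))) X) l"
      unfolding coord_tensor_map[OF o l] coord_one[OF X l] .
  qed
qed

lemma tensor_map_op1:
  assumes x: "x \<in> hom C X (tcar (src \<phi>))"
  shows "Cmp C (tensor_map C A \<phi>) (Cmp C (aneg (talg (src \<phi>))) x) =
      Cmp C (aneg (talg (tgt \<phi>))) (Cmp C (tensor_map C A \<phi>) x)" (is ?neg)
    and "Cmp C (tensor_map C A \<phi>) (Cmp C (ascal (talg (src \<phi>)) c) x) =
      Cmp C (ascal (talg (tgt \<phi>)) c) (Cmp C (tensor_map C A \<phi>) x)" (is ?scal)
proof -
  interpret H: comm_alg "hom C X car" gadd gmul "gzero X" "gone X" gneg gscal
    by (rule hom_comm_alg[OF hom_ob(1)[OF x]])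
  let ?f = "tensor_map C A \<phi>" and ?n = "dim (src \<phi>)" and ?m = "dim (tgt \<phi>)"
  note fx = cmp_hom[OF x tensor_map_hom]
  note n = cmp_hom[OF x talg_op_hom(6)] and s = cmp_hom[OF x talg_op_hom(7)]
  show ?neg
  proof (rule coord_eqI[OF cmp_hom[OF n tensor_map_hom] cmp_hom[OF fx talg_op_hom(6)]])
    fix l assume l: "l < ?m"
    have "H.tlin ?n (mat \<phi>) (coord ?n (Cmp C (aneg (talg (src \<phi>))) x)) l = H.tlin ?n (mat \<phi>) (\<lambda>i. gneg (coord ?n x i)) l"
      by (rule H.tlin_cong) (rule coord_neg[OF x])
    also have "\<dots> = gneg (H.tlin ?n (mat \<phi>) (coord ?n x) l)" by (rule H.tlin_neg) (rule coord_hom[OF x])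
    finally show "coord ?m (Cmp C ?f (Cmp C (aneg (talg (src \<phi>))) x)) l = coord ?m (Cmp C (aneg (talg (tgt \<phi>))) (Cmp C ?f x)) l"
      unfolding coord_tensor_map[OF n l] coord_neg[OF fx l] coord_tensor_map[OF x l] .
  qed
  show ?scal
  proof (rule coord_eqI[OF cmp_hom[OF s tensor_map_hom] cmp_hom[OF fx talg_op_hom(7)]])
    fix l assume l: "l < ?m"
    have "H.tlin ?n (mat \<phi>) (coord ?n (Cmp C (ascal (talg (src \<phi>)) c) x)) l = H.tlin ?n (mat \<phi>) (\<lambda>i. gscal c (coord ?n x i)) l"
      by (rule H.tlin_cong) (rule coord_scal[OF x])
    also have "\<dots> = gscal c (H.tlin ?n (mat \<phi>) (coord ?n x) l)" by (rule H.tlin_scal) (rule coord_hom[OF x])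
    finally show "coord ?m (Cmp C ?f (Cmp C (ascal (talg (src \<phi>)) c) x)) l = coord ?m (Cmp C (ascal (talg (tgt \<phi>)) c) (Cmp C ?f x)) l"
      unfolding coord_tensor_map[OF s l] coord_scal[OF fx l] coord_tensor_map[OF x l] .
  qed
qed

end

section \<open>Exponentials in functor categories\<close>

context category begin

lemma product_hom: "is_product C a b P p q \<Longrightarrow> p \<in> hom C P a" "is_product C a b P p q \<Longrightarrow> q \<in> hom C P b"
  by (auto simp: is_product_def)

lemma product_ex1:
  "\<lbrakk>is_product C a b P p q; f \<in> hom C X a; g \<in> hom C X b\<rbrakk> \<Longrightarrow>
    \<exists>!h. h \<in> hom C X P \<and> Cmp C p h = f \<and> Cmp C q h = g"
  using hom_ob(1) unfolding is_product_def by blast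

lemma product_pair:
  assumes "is_product C a b P p q" "f \<in> hom C X a" "g \<in> hom C X b"
  obtains u where "u \<in> hom C X P" "Cmp C p u = f" "Cmp C q u = g"
  using ex1_implies_ex[OF product_ex1[OF assms]] by blast

lemma product_eqI:
  assumes P: "is_product C a b P p q" and u: "u \<in> hom C X P" "u' \<in> hom C X P"
    "Cmp C p u = Cmp C p u'" "Cmp C q u = Cmp C q u'"
  shows "u = u'"
  using product_ex1[OF P cmp_hom[OF u(2) product_hom(1)[OF P]] cmp_hom[OF u(2) product_hom(2)[OF P]]]
  by (rule ex1_unique) (use u in auto)

end

text \<open>Exponentials in terms of generalised elements: \<open>app x s\<close> is the value of \<open>x : X \<rightarrow> b\<^sup>a\<close> at
  \<open>s : X \<rightarrow> a\<close>, and an arrow \<open>X \<rightarrow> b\<^sup>a\<close> amounts to a natural family of maps from the generalised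
  elements of \<open>X\<close> and \<open>a\<close> to those of \<open>b\<close>.\<close>

definition natural_map :: "('o, 'm) cat \<Rightarrow> 'o \<Rightarrow> 'o \<Rightarrow> 'o \<Rightarrow> ('m \<Rightarrow> 'm \<Rightarrow> 'm) \<Rightarrow> bool" where
  "natural_map C X a b \<beta> \<longleftrightarrow>
     (\<forall>Y. \<forall>x \<in> hom C Y X. \<forall>s \<in> hom C Y a. \<beta> x s \<in> hom C Y b \<and>
        (\<forall>Z. \<forall>t \<in> hom C Z Y. Cmp C (\<beta> x s) t = \<beta> (Cmp C x t) (Cmp C s t)))"

definition exponential_app :: "('o, 'm) cat \<Rightarrow> 'o \<Rightarrow> 'o \<Rightarrow> 'o \<Rightarrow> ('m \<Rightarrow> 'm \<Rightarrow> 'm) \<Rightarrow> bool" where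
  "exponential_app C a b E app \<longleftrightarrow> E \<in> Ob C \<and> natural_map C E a b app \<and>
     (\<forall>X \<beta>. X \<in> Ob C \<longrightarrow> natural_map C X a b \<beta> \<longrightarrow>
       (\<exists>!h. h \<in> hom C X E \<and> (\<forall>Y. \<forall>x \<in> hom C Y X. \<forall>s \<in> hom C Y a. app (Cmp C h x) s = \<beta> x s)))"

lemma natural_mapI:
  assumes "\<And>Y x s. \<lbrakk>x \<in> hom C Y X; s \<in> hom C Y a\<rbrakk> \<Longrightarrow> \<beta> x s \<in> hom C Y b"
    and "\<And>Y Z x s t. \<lbrakk>x \<in> hom C Y X; s \<in> hom C Y a; t \<in> hom C Z Y\<rbrakk> \<Longrightarrow>
          Cmp C (\<beta> x s) t = \<beta> (Cmp C x t) (Cmp C s t)"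
  shows "natural_map C X a b \<beta>"
  using assms unfolding natural_map_def by simp

lemma natural_mapD:
  assumes "natural_map C X a b \<beta>" "x \<in> hom C Y X" "s \<in> hom C Y a"
  shows "\<beta> x s \<in> hom C Y b"
    and "t \<in> hom C Z Y \<Longrightarrow> Cmp C (\<beta> x s) t = \<beta> (Cmp C x t) (Cmp C s t)"
  using assms unfolding natural_map_def by simp_all

locale closed_cat = category C for C :: "('o, 'm) cat" +
  fixes E :: "'o \<Rightarrow> 'o \<Rightarrow> 'o" and app :: "'o \<Rightarrow> 'o \<Rightarrow> 'm \<Rightarrow> 'm \<Rightarrow> 'm"
  assumes exponential: "\<lbrakk>a \<in> Ob C; b \<in> Ob C\<rbrakk> \<Longrightarrow> exponential_app C a b (E a b) (app a b)"
begin

lemma E_ob: "\<lbrakk>a \<in> Ob C; b \<in> Ob C\<rbrakk> \<Longrightarrow> E a b \<in> Ob C"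
  using exponential by (simp add: exponential_app_def)

lemma app_natural: "\<lbrakk>a \<in> Ob C; b \<in> Ob C\<rbrakk> \<Longrightarrow> natural_map C (E a b) a b (app a b)"
  using exponential by (simp add: exponential_app_def)

lemmas app_hom = natural_mapD(1)[OF app_natural]
lemmas app_cmp = natural_mapD(2)[OF app_natural]

lemma app_abs:
  "\<lbrakk>a \<in> Ob C; b \<in> Ob C; X \<in> Ob C; natural_map C X a b \<beta>\<rbrakk> \<Longrightarrow>
    \<exists>!h. h \<in> hom C X (E a b) \<and> (\<forall>Y. \<forall>x \<in> hom C Y X. \<forall>s \<in> hom C Y a. app a b (Cmp C h x) s = \<beta> x s)"
  using exponential unfolding exponential_app_def by simp

lemma app_ext:
  assumes ab: "a \<in> Ob C" "b \<in> Ob C" and h: "h \<in> hom C X (E a b)" "h' \<in> hom C X (E a b)"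
    and eq: "\<And>Y x s. \<lbrakk>x \<in> hom C Y X; s \<in> hom C Y a\<rbrakk> \<Longrightarrow> app a b (Cmp C h x) s = app a b (Cmp C h' x) s"
  shows "h = h'"
proof -
  have "\<exists>!k. k \<in> hom C X (E a b) \<and> (\<forall>Y. \<forall>x \<in> hom C Y X. \<forall>s \<in> hom C Y a. app a b (Cmp C k x) s = app a b (Cmp C h' x) s)"
  proof (rule app_abs[OF ab hom_ob(1)[OF h(1)]], rule natural_mapI)
    fix Y x s assume xs: "x \<in> hom C Y X" "s \<in> hom C Y a"
    show "app a b (Cmp C h' x) s \<in> hom C Y b" using app_hom[OF ab cmp_hom[OF xs(1) h(2)] xs(2)] .
  next
    fix Y Z x s t assume xs: "x \<in> hom C Y X" "s \<in> hom C Y a" and t: "t \<in> hom C Z Y"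
    show "Cmp C (app a b (Cmp C h' x) s) t = app a b (Cmp C h' (Cmp C x t)) (Cmp C s t)"
      using app_cmp[OF ab cmp_hom[OF xs(1) h(2)] xs(2) t] cmp_assoc[OF t xs(1) h(2)] by simp
  qed
  thus ?thesis by (rule ex1_unique) (use h eq in auto)
qed

text \<open>Functoriality of \<open>b\<^sup>a\<close> in both arguments, described on elements.\<close>

lemma postcompose_ex:
  assumes ob: "a \<in> Ob C" and u: "u \<in> hom C b b'"
  shows "\<exists>h \<in> hom C (E a b) (E a b'). \<forall>X. \<forall>x \<in> hom C X (E a b). \<forall>s \<in> hom C X a.
    app a b' (Cmp C h x) s = Cmp C u (app a b x s)"
proof -
  have b: "b \<in> Ob C" "b' \<in> Ob C" using hom_ob[OF u] by auto
  have "\<exists>!h. h \<in> hom C (E a b) (E a b') \<and> (\<forall>X. \<forall>x \<in> hom C X (E a b). \<forall>s \<in> hom C X a.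
    app a b' (Cmp C h x) s = Cmp C u (app a b x s))"
  proof (rule app_abs[OF ob b(2) E_ob[OF ob b(1)]], rule natural_mapI)
    fix Y x s assume xs: "x \<in> hom C Y (E a b)" "s \<in> hom C Y a"
    show "Cmp C u (app a b x s) \<in> hom C Y b'" using cmp_hom[OF app_hom[OF ob b(1) xs] u] .
  next
    fix Y Z x s t assume xs: "x \<in> hom C Y (E a b)" "s \<in> hom C Y a" and t: "t \<in> hom C Z Y"
    show "Cmp C (Cmp C u (app a b x s)) t = Cmp C u (app a b (Cmp C x t) (Cmp C s t))"
      using cmp_assoc[OF t app_hom[OF ob b(1) xs] u] app_cmp[OF ob b(1) xs t] by simp
  qed
  from ex1_implies_ex[OF this] show ?thesis by blast
qed

lemma precompose_ex:
  assumes ob: "b \<in> Ob C" and v: "v \<in> hom C a' a"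
  shows "\<exists>h \<in> hom C (E a b) (E a' b). \<forall>X. \<forall>x \<in> hom C X (E a b). \<forall>s \<in> hom C X a'.
    app a' b (Cmp C h x) s = app a b x (Cmp C v s)"
proof -
  have a: "a' \<in> Ob C" "a \<in> Ob C" using hom_ob[OF v] by auto
  have "\<exists>!h. h \<in> hom C (E a b) (E a' b) \<and> (\<forall>X. \<forall>x \<in> hom C X (E a b). \<forall>s \<in> hom C X a'.
    app a' b (Cmp C h x) s = app a b x (Cmp C v s))"
  proof (rule app_abs[OF a(1) ob E_ob[OF a(2) ob]], rule natural_mapI)
    fix Y x s assume xs: "x \<in> hom C Y (E a b)" "s \<in> hom C Y a'"
    show "app a b x (Cmp C v s) \<in> hom C Y b" using app_hom[OF a(2) ob xs(1) cmp_hom[OF xs(2) v]] .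
  next
    fix Y Z x s t assume xs: "x \<in> hom C Y (E a b)" "s \<in> hom C Y a'" and t: "t \<in> hom C Z Y"
    show "Cmp C (app a b x (Cmp C v s)) t = app a b (Cmp C x t) (Cmp C v (Cmp C s t))"
      using app_cmp[OF a(2) ob xs(1) cmp_hom[OF xs(2) v] t] cmp_assoc[OF t xs(2) v] by simp
  qed
  from ex1_implies_ex[OF this] show ?thesis by blast
qed

end

text \<open>An element of \<open>E\<close> and one of \<open>a\<close> form an element of \<open>E \<times> a\<close>, to which \<open>ev\<close> is applied. A natural
  map \<open>\<beta>\<close> is determined by its value at the two projections of \<open>X \<times> a\<close>, an arrow \<open>X \<times> a \<rightarrow> b\<close>, and
  \<open>h\<close> is the transpose of this arrow.\<close>

lemma (in category) exponential_imp_app: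
  assumes prods: "\<And>a b. a \<in> Ob C \<Longrightarrow> b \<in> Ob C \<Longrightarrow> \<exists>P p q. is_product C a b P p q"
    and ab: "a \<in> Ob C" "b \<in> Ob C" and exp: "is_exponential C a b E P p q ev"
  shows "\<exists>app. exponential_app C a b E app"
proof -
  have EO: "E \<in> Ob C" and P: "is_product C E a P p q" and ev: "ev \<in> hom C P b"
    and univ: "\<And>X Q r s g. \<lbrakk>X \<in> Ob C; is_product C X a Q r s; g \<in> hom C Q b\<rbrakk> \<Longrightarrow>
      (\<exists>!h. h \<in> hom C X E \<and> (\<exists>u \<in> hom C Q P. Cmp C p u = Cmp C h r \<and> Cmp C q u = s \<and> Cmp C ev u = g))"
    using exp unfolding is_exponential_def by blast+
  define pr where "pr x s = (THE u. u \<in> hom C (Dom C x) P \<and> Cmp C p u = x \<and> Cmp C q u = s)" for x s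
  have pr: "pr x s \<in> hom C X P \<and> Cmp C p (pr x s) = x \<and> Cmp C q (pr x s) = s"
    if "x \<in> hom C X E" "s \<in> hom C X a" for X x s
  proof -
    have "Dom C x = X" using that by (simp add: hom_def)
    thus ?thesis using theI'[OF product_ex1[OF P that]] by (simp add: pr_def)
  qed
  have pr_eqI: "pr x s = u" if "u \<in> hom C X P" "Cmp C p u = x" "Cmp C q u = s" for u X x s
  proof -
    have xs: "x \<in> hom C X E" "s \<in> hom C X a" using that cmp_hom product_hom[OF P] by blast+
    show ?thesis by (rule product_eqI[OF P]) (use pr[OF xs] that in auto)
  qed
  define app where "app x s = Cmp C ev (pr x s)" for x s
  have pr_cmp: "pr (Cmp C x t) (Cmp C s t) = Cmp C (pr x s) t"
    if x: "x \<in> hom C X E" and s: "s \<in> hom C X a" and t: "t \<in> hom C Y X" for X Y x s t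
  proof (rule pr_eqI[OF cmp_hom[OF t]])
    show "pr x s \<in> hom C X P" using pr[OF x s] by blast
    show "Cmp C p (Cmp C (pr x s) t) = Cmp C x t" "Cmp C q (Cmp C (pr x s) t) = Cmp C s t"
      using pr[OF x s] cmp_assoc[OF t _ product_hom(1)[OF P], of "pr x s"]
        cmp_assoc[OF t _ product_hom(2)[OF P], of "pr x s"] by auto
  qed
  have app_hom: "app x s \<in> hom C X b" if "x \<in> hom C X E" "s \<in> hom C X a" for X x s
    using cmp_hom[OF _ ev] pr[OF that] by (simp add: app_def)
  have app_cmp: "Cmp C (app x s) t = app (Cmp C x t) (Cmp C s t)"
    if "x \<in> hom C X E" "s \<in> hom C X a" "t \<in> hom C Y X" for X Y x s t
    using pr_cmp[OF that] cmp_assoc[OF that(3) _ ev, of "pr x s"] pr[OF that(1,2)] by (simp add: app_def)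
  have app_abs: "\<exists>!h. h \<in> hom C X E \<and> (\<forall>Y. \<forall>x \<in> hom C Y X. \<forall>s \<in> hom C Y a. app (Cmp C h x) s = \<beta> x s)"
    if X: "X \<in> Ob C" and nat: "natural_map C X a b \<beta>" for X \<beta>
  proof -
    obtain Q r s0 where Q: "is_product C X a Q r s0" using prods[OF X ab(1)] by blast
    note rs = product_hom[OF Q]
    have eq: "(\<exists>u \<in> hom C Q P. Cmp C p u = Cmp C h r \<and> Cmp C q u = s0 \<and> Cmp C ev u = \<beta> r s0) \<longleftrightarrow>
      (\<forall>Y. \<forall>x \<in> hom C Y X. \<forall>s \<in> hom C Y a. app (Cmp C h x) s = \<beta> x s)" (is "?l \<longleftrightarrow> ?r")
      if h: "h \<in> hom C X E" for h
    proof
      assume ?l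
      then obtain u where u: "u \<in> hom C Q P" "Cmp C p u = Cmp C h r" "Cmp C q u = s0" "Cmp C ev u = \<beta> r s0" by blast
      hence app: "app (Cmp C h r) s0 = \<beta> r s0" using pr_eqI[OF u(1-3)] by (simp add: app_def)
      show ?r
      proof (intro allI ballI)
        fix Y x s assume xs: "x \<in> hom C Y X" "s \<in> hom C Y a"
        obtain t where t: "t \<in> hom C Y Q" "Cmp C r t = x" "Cmp C s0 t = s" using product_pair[OF Q xs] .
        have "app (Cmp C h x) s = Cmp C (app (Cmp C h r) s0) t"
          using app_cmp[OF cmp_hom[OF rs(1) h] rs(2) t(1)] cmp_assoc[OF t(1) rs(1) h] t by simp
        also have "\<dots> = \<beta> x s" using app natural_mapD(2)[OF nat rs t(1)] t by simp
        finally show "app (Cmp C h x) s = \<beta> x s" .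
      qed
    next
      assume ?r
      hence "app (Cmp C h r) s0 = \<beta> r s0" using rs by blast
      thus ?l using pr[OF cmp_hom[OF rs(1) h] rs(2)] by (auto simp: app_def)
    qed
    have "\<exists>!h. h \<in> hom C X E \<and> (\<exists>u \<in> hom C Q P. Cmp C p u = Cmp C h r \<and> Cmp C q u = s0 \<and> Cmp C ev u = \<beta> r s0)"
      by (rule univ[OF X Q natural_mapD(1)[OF nat rs]])
    thus ?thesis using eq by (simp cong: conj_cong)
  qed
  have "natural_map C E a b app" by (rule natural_mapI) (rule app_hom app_cmp; assumption)+
  thus ?thesis using EO app_abs unfolding exponential_app_def by blast
qed

lemma cartesian_closed_imp_closed_cat:
  assumes C: "category C" and cc: "cartesian_closed C"
  shows "\<exists>E app. closed_cat C E app"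
proof -
  interpret category C by fact
  have prods: "\<exists>P p q. is_product C a b P p q" if "a \<in> Ob C" "b \<in> Ob C" for a b
    using cc that unfolding cartesian_closed_def by blast
  have "\<exists>E app. exponential_app C a b E app" if ab: "a \<in> Ob C" "b \<in> Ob C" for a b
  proof -
    obtain E P p q ev where "is_exponential C a b E P p q ev"
      using cc ab unfolding cartesian_closed_def by blast
    thus ?thesis using exponential_imp_app[OF prods ab] by blast
  qed
  then obtain E app where "\<And>a b. \<lbrakk>a \<in> Ob C; b \<in> Ob C\<rbrakk> \<Longrightarrow> exponential_app C a b (E a b) (app a b)"
    by metis
  hence "closed_cat C E app" by unfold_locales
  thus ?thesis by blast
qed

locale functor_pair = two_cats A C + closed_cat C E app
  for A :: "('a, 'b) cat" and C :: "('o, 'm) cat" and E app +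
  fixes F G :: "('a, 'b, 'o, 'm) fctr"
  assumes F: "is_functor A C F" and G: "is_functor A C G"
begin

abbreviation EE :: "'a \<Rightarrow> 'o" where "EE W \<equiv> E (fob F W) (fob G W)"
abbreviation ap :: "'a \<Rightarrow> 'm \<Rightarrow> 'm \<Rightarrow> 'm" where "ap W \<equiv> app (fob F W) (fob G W)"

lemma FG_ob [simp]: "W \<in> Ob A \<Longrightarrow> fob F W \<in> Ob C" "W \<in> Ob A \<Longrightarrow> fob G W \<in> Ob C"
  using F G by (auto simp: functor_simps)

lemma F_hom: "u \<in> Ar A \<Longrightarrow> far F u \<in> hom C (fob F (Dom A u)) (fob F (Cod A u))"
  and G_hom: "u \<in> Ar A \<Longrightarrow> far G u \<in> hom C (fob G (Dom A u)) (fob G (Cod A u))"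
  using functor_hom[OF F A.ar_hom] functor_hom[OF G A.ar_hom] by auto

lemmas ap_hom = app_hom[OF FG_ob]
lemmas ap_cmp = app_cmp[OF FG_ob]

text \<open>A generalised element of the exponential at \<open>V\<close> is a family of generalised elements of
  \<open>(G W)\<^bsup>F W\<^esup>\<close>, indexed by the arrows \<open>V \<rightarrow> W\<close>, natural in \<open>W\<close>.\<close>

definition dinatural :: "'a \<Rightarrow> 'o \<Rightarrow> ('b \<Rightarrow> 'm) \<Rightarrow> bool" where
  "dinatural V Z \<sigma> \<longleftrightarrow>
     (\<forall>\<phi> \<in> Ar A. Dom A \<phi> = V \<longrightarrow> \<sigma> \<phi> \<in> hom C Z (EE (Cod A \<phi>))) \<and>
     (\<forall>\<phi> \<in> Ar A. \<forall>\<psi> \<in> Ar A. Dom A \<phi> = V \<longrightarrow> Cod A \<phi> = Dom A \<psi> \<longrightarrow>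
       (\<forall>X. \<forall>x \<in> hom C X Z. \<forall>s \<in> hom C X (fob F (Cod A \<phi>)).
         Cmp C (far G \<psi>) (ap (Cod A \<phi>) (Cmp C (\<sigma> \<phi>) x) s) =
         ap (Cod A \<psi>) (Cmp C (\<sigma> (Cmp A \<psi> \<phi>)) x) (Cmp C (far F \<psi>) s)))"

lemma dinaturalD:
  assumes "dinatural V Z \<sigma>" "\<phi> \<in> Ar A" "Dom A \<phi> = V"
  shows "\<sigma> \<phi> \<in> hom C Z (EE (Cod A \<phi>))"
    and "\<lbrakk>\<psi> \<in> Ar A; Cod A \<phi> = Dom A \<psi>; x \<in> hom C X Z; s \<in> hom C X (fob F (Cod A \<phi>))\<rbrakk> \<Longrightarrow>
      Cmp C (far G \<psi>) (ap (Cod A \<phi>) (Cmp C (\<sigma> \<phi>) x) s) =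
      ap (Cod A \<psi>) (Cmp C (\<sigma> (Cmp A \<psi> \<phi>)) x) (Cmp C (far F \<psi>) s)"
  using assms unfolding dinatural_def by blast+

text \<open>Naturality at \<open>\<phi> : V \<rightarrow> W\<close> and \<open>\<psi> : W \<rightarrow> W'\<close> says that two arrows to \<open>(G W')\<^bsup>F W\<^esup>\<close> agree, one
  obtained from \<open>\<sigma> \<phi>\<close> by composition with \<open>G \<psi>\<close>, the other from \<open>\<sigma> (\<psi> \<phi>)\<close> by composition with \<open>F \<psi>\<close>.
  So the universal natural family is a simultaneous equaliser.\<close>

lemma end_exists:
  fixes e :: "'b \<Rightarrow> 'i"
  assumes inf: "infinite (UNIV :: 'i set)" and e: "inj_on e (Ar A)" and U: "complete_cat TYPE('i) C"
    and V: "V \<in> Ob A"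
  shows "\<exists>L \<pi>. L \<in> Ob C \<and> dinatural V L \<pi> \<and>
    (\<forall>Z \<sigma>. Z \<in> Ob C \<longrightarrow> dinatural V Z \<sigma> \<longrightarrow>
      (\<exists>!h. h \<in> hom C Z L \<and> (\<forall>\<phi> \<in> Ar A. Dom A \<phi> = V \<longrightarrow> Cmp C (\<pi> \<phi>) h = \<sigma> \<phi>)))"
proof -
  have "\<exists>po. \<forall>a b. a \<in> Ob A \<longrightarrow> b \<in> Ar A \<longrightarrow> po a b \<in> hom C (E (fob F a) (fob G (Dom A b))) (E (fob F a) (fob G (Cod A b))) \<and>
    (\<forall>X. \<forall>x \<in> hom C X (E (fob F a) (fob G (Dom A b))). \<forall>s \<in> hom C X (fob F a).
      app (fob F a) (fob G (Cod A b)) (Cmp C (po a b) x) s = Cmp C (far G b) (app (fob F a) (fob G (Dom A b)) x s))"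
    using postcompose_ex[OF FG_ob(1) G_hom] by (intro choice allI) metis
  then obtain po where po: "\<And>a \<psi>. \<lbrakk>a \<in> Ob A; \<psi> \<in> Ar A\<rbrakk> \<Longrightarrow>
      po a \<psi> \<in> hom C (E (fob F a) (fob G (Dom A \<psi>))) (E (fob F a) (fob G (Cod A \<psi>)))"
    "\<And>a \<psi> X x s. \<lbrakk>a \<in> Ob A; \<psi> \<in> Ar A; x \<in> hom C X (E (fob F a) (fob G (Dom A \<psi>))); s \<in> hom C X (fob F a)\<rbrakk> \<Longrightarrow>
      app (fob F a) (fob G (Cod A \<psi>)) (Cmp C (po a \<psi>) x) s = Cmp C (far G \<psi>) (app (fob F a) (fob G (Dom A \<psi>)) x s)"
    by blast
  have "\<exists>pr. \<forall>a b. a \<in> Ar A \<longrightarrow> b \<in> Ob A \<longrightarrow> pr a b \<in> hom C (E (fob F (Cod A a)) (fob G b)) (E (fob F (Dom A a)) (fob G b)) \<and>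
    (\<forall>X. \<forall>x \<in> hom C X (E (fob F (Cod A a)) (fob G b)). \<forall>s \<in> hom C X (fob F (Dom A a)).
      app (fob F (Dom A a)) (fob G b) (Cmp C (pr a b) x) s = app (fob F (Cod A a)) (fob G b) x (Cmp C (far F a) s))"
    using precompose_ex[OF FG_ob(2) F_hom] by (intro choice allI) metis
  then obtain pr where pr: "\<And>\<psi> b. \<lbrakk>\<psi> \<in> Ar A; b \<in> Ob A\<rbrakk> \<Longrightarrow>
      pr \<psi> b \<in> hom C (E (fob F (Cod A \<psi>)) (fob G b)) (E (fob F (Dom A \<psi>)) (fob G b))"
    "\<And>\<psi> b X x s. \<lbrakk>\<psi> \<in> Ar A; b \<in> Ob A; x \<in> hom C X (E (fob F (Cod A \<psi>)) (fob G b)); s \<in> hom C X (fob F (Dom A \<psi>))\<rbrakk> \<Longrightarrow>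
      app (fob F (Dom A \<psi>)) (fob G b) (Cmp C (pr \<psi> b) x) s = app (fob F (Cod A \<psi>)) (fob G b) x (Cmp C (far F \<psi>) s)"
    by blast
  (* a family is indexed by I, and there is one naturality condition for each element of B *)
  define I where "I = {\<phi> \<in> Ar A. Dom A \<phi> = V}"
  define B where "B = {(\<phi>, \<psi>). \<phi> \<in> I \<and> \<psi> \<in> Ar A \<and> Cod A \<phi> = Dom A \<psi>}"
  define f where "f = (\<lambda>(\<phi>, \<psi>). po (Cod A \<phi>) \<psi>)"
  define g where "g = (\<lambda>(\<phi> :: 'b, \<psi>). pr \<psi> (Cod A \<psi>))"
  obtain p :: "'i \<times> 'i \<Rightarrow> 'i" where p: "inj p" using infinite_inj_pair[OF inf] by blast
  have eI: "inj_on e I" using e by (rule inj_on_subset) (auto simp: I_def)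
  have eB: "inj_on (\<lambda>(\<phi>, \<psi>). p (e \<phi>, e \<psi>)) B"
    by (rule inj_onI) (auto simp: B_def I_def dest!: injD[OF p] dest: inj_onD[OF e])
  have din: "dinatural V Z \<sigma> \<longleftrightarrow> (\<forall>\<phi> \<in> I. \<sigma> \<phi> \<in> hom C Z (EE (Cod A \<phi>))) \<and>
      (\<forall>b \<in> B. Cmp C (f b) (\<sigma> (fst b)) = Cmp C (g b) (\<sigma> (Cmp A (snd b) (fst b))))" for Z \<sigma>
  proof -
    have "(\<forall>X. \<forall>x \<in> hom C X Z. \<forall>s \<in> hom C X (fob F (Cod A \<phi>)).
         Cmp C (far G \<psi>) (ap (Cod A \<phi>) (Cmp C (\<sigma> \<phi>) x) s) =
         ap (Cod A \<psi>) (Cmp C (\<sigma> (Cmp A \<psi> \<phi>)) x) (Cmp C (far F \<psi>) s)) \<longleftrightarrow>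
      Cmp C (f (\<phi>, \<psi>)) (\<sigma> \<phi>) = Cmp C (g (\<phi>, \<psi>)) (\<sigma> (Cmp A \<psi> \<phi>))" (is "?l \<longleftrightarrow> ?r")
      if \<sigma>: "\<forall>\<phi> \<in> I. \<sigma> \<phi> \<in> hom C Z (EE (Cod A \<phi>))" and b: "(\<phi>, \<psi>) \<in> B" for \<phi> \<psi>
    proof -
      have ar: "\<phi> \<in> Ar A" "\<psi> \<in> Ar A" "Cod A \<phi> = Dom A \<psi>" and I: "\<phi> \<in> I" "Cmp A \<psi> \<phi> \<in> I"
        using b by (auto simp: B_def I_def)
      have ob: "Dom A \<psi> \<in> Ob A" "Cod A \<psi> \<in> Ob A" using A.dom_ob[OF ar(2)] A.cod_ob[OF ar(2)] by auto
      have s: "\<sigma> \<phi> \<in> hom C Z (EE (Dom A \<psi>))" "\<sigma> (Cmp A \<psi> \<phi>) \<in> hom C Z (EE (Cod A \<psi>))"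
        using bspec[OF \<sigma> I(1)] bspec[OF \<sigma> I(2)] ar by auto
      have fg: "f (\<phi>, \<psi>) \<in> hom C (EE (Dom A \<psi>)) (E (fob F (Dom A \<psi>)) (fob G (Cod A \<psi>)))"
        "g (\<phi>, \<psi>) \<in> hom C (EE (Cod A \<psi>)) (E (fob F (Dom A \<psi>)) (fob G (Cod A \<psi>)))"
        using po(1)[OF ob(1) ar(2)] pr(1)[OF ar(2) ob(2)] ar(3) by (auto simp: f_def g_def)
      have eq: "app (fob F (Dom A \<psi>)) (fob G (Cod A \<psi>)) (Cmp C (Cmp C (f (\<phi>, \<psi>)) (\<sigma> \<phi>)) x) t =
            Cmp C (far G \<psi>) (ap (Dom A \<psi>) (Cmp C (\<sigma> \<phi>) x) t)"
        "app (fob F (Dom A \<psi>)) (fob G (Cod A \<psi>)) (Cmp C (Cmp C (g (\<phi>, \<psi>)) (\<sigma> (Cmp A \<psi> \<phi>))) x) t =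
            ap (Cod A \<psi>) (Cmp C (\<sigma> (Cmp A \<psi> \<phi>)) x) (Cmp C (far F \<psi>) t)"
        if xt: "x \<in> hom C X Z" "t \<in> hom C X (fob F (Dom A \<psi>))" for X x t
        using po(2)[OF ob(1) ar(2) C.cmp_hom[OF xt(1) s(1)] xt(2)] pr(2)[OF ar(2) ob(2) C.cmp_hom[OF xt(1) s(2)] xt(2)]
          C.cmp_assoc[OF xt(1) s(1) fg(1)] C.cmp_assoc[OF xt(1) s(2) fg(2)] ar(3)
        by (simp_all add: f_def g_def)
      show ?thesis
      proof
        assume ?r
        thus ?l using eq ar(3) by simp
      next
        assume l: ?l
        show ?r
          by (rule app_ext[OF FG_ob(1)[OF ob(1)] FG_ob(2)[OF ob(2)] C.cmp_hom[OF s(1) fg(1)] C.cmp_hom[OF s(2) fg(2)]])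
            (use l eq ar(3) in simp)
      qed
    qed
    thus ?thesis unfolding dinatural_def B_def I_def by auto
  qed
  have st: "fst b \<in> I" "Cmp A (snd b) (fst b) \<in> I" if "b \<in> B" for b using that by (auto simp: B_def I_def)
  have X: "EE (Cod A \<phi>) \<in> Ob C" if "\<phi> \<in> I" for \<phi> using that by (intro E_ob FG_ob) (auto simp: I_def A.cod_ob)
  have fg: "f b \<in> hom C (EE (Cod A (fst b))) (E (fob F (Cod A (fst b))) (fob G (Cod A (snd b))))"
    "g b \<in> hom C (EE (Cod A (Cmp A (snd b) (fst b)))) (E (fob F (Cod A (fst b))) (fob G (Cod A (snd b))))"
    if "b \<in> B" for b
  proof -
    obtain \<phi> \<psi> where b: "b = (\<phi>, \<psi>)" and ar: "\<phi> \<in> Ar A" "\<psi> \<in> Ar A" "Cod A \<phi> = Dom A \<psi>"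
      using \<open>b \<in> B\<close> by (auto simp: B_def I_def)
    have ob: "Dom A \<psi> \<in> Ob A" "Cod A \<psi> \<in> Ob A" using A.dom_ob[OF ar(2)] A.cod_ob[OF ar(2)] by auto
    show "f b \<in> hom C (EE (Cod A (fst b))) (E (fob F (Cod A (fst b))) (fob G (Cod A (snd b))))"
      "g b \<in> hom C (EE (Cod A (Cmp A (snd b) (fst b)))) (E (fob F (Cod A (fst b))) (fob G (Cod A (snd b))))"
      using po(1)[OF ob(1) ar(2)] pr(1)[OF ar(2) ob(2)] ar by (auto simp: b f_def g_def)
  qed
  have "\<exists>L \<pi>. L \<in> Ob C \<and> (\<forall>a \<in> I. \<pi> a \<in> hom C L (EE (Cod A a))) \<and>
    (\<forall>b \<in> B. Cmp C (f b) (\<pi> (fst b)) = Cmp C (g b) (\<pi> (Cmp A (snd b) (fst b)))) \<and>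
    (\<forall>Z \<sigma>. Z \<in> Ob C \<longrightarrow> (\<forall>a \<in> I. \<sigma> a \<in> hom C Z (EE (Cod A a))) \<longrightarrow>
      (\<forall>b \<in> B. Cmp C (f b) (\<sigma> (fst b)) = Cmp C (g b) (\<sigma> (Cmp A (snd b) (fst b)))) \<longrightarrow>
      (\<exists>!h. h \<in> hom C Z L \<and> (\<forall>a \<in> I. Cmp C (\<pi> a) h = \<sigma> a)))"
    by (rule complete_simultaneous_equaliser[OF C.category_axioms U inf eI eB,
          where Y = "\<lambda>b. E (fob F (Cod A (fst b))) (fob G (Cod A (snd b)))"]) (use X st fg in auto)
  then obtain L \<pi> where "L \<in> Ob C" "\<forall>a \<in> I. \<pi> a \<in> hom C L (EE (Cod A a))"
    "\<forall>b \<in> B. Cmp C (f b) (\<pi> (fst b)) = Cmp C (g b) (\<pi> (Cmp A (snd b) (fst b)))"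
    "\<forall>Z \<sigma>. Z \<in> Ob C \<longrightarrow> (\<forall>a \<in> I. \<sigma> a \<in> hom C Z (EE (Cod A a))) \<longrightarrow>
      (\<forall>b \<in> B. Cmp C (f b) (\<sigma> (fst b)) = Cmp C (g b) (\<sigma> (Cmp A (snd b) (fst b)))) \<longrightarrow>
      (\<exists>!h. h \<in> hom C Z L \<and> (\<forall>a \<in> I. Cmp C (\<pi> a) h = \<sigma> a))"
    by (elim exE conjE)
  moreover have "(\<forall>a \<in> I. R a) \<longleftrightarrow> (\<forall>\<phi> \<in> Ar A. Dom A \<phi> = V \<longrightarrow> R \<phi>)" for R by (auto simp: I_def)
  ultimately show ?thesis using din by (intro exI[of _ L] exI[of _ \<pi>]) auto
qed

end

locale functor_end = functor_pair A C E app F G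
  for A :: "('a, 'b) cat" and C :: "('o, 'm) cat" and E app and F G :: "('a, 'b, 'o, 'm) fctr" +
  fixes L :: "'a \<Rightarrow> 'o" and \<pi> :: "'a \<Rightarrow> 'b \<Rightarrow> 'm"
  assumes L_ob: "V \<in> Ob A \<Longrightarrow> L V \<in> Ob C"
    and \<pi>: "V \<in> Ob A \<Longrightarrow> dinatural V (L V) (\<pi> V)"
    and L_univ: "\<lbrakk>V \<in> Ob A; Z \<in> Ob C; dinatural V Z \<sigma>\<rbrakk> \<Longrightarrow>
      \<exists>!h. h \<in> hom C Z (L V) \<and> (\<forall>\<phi> \<in> Ar A. Dom A \<phi> = V \<longrightarrow> Cmp C (\<pi> V \<phi>) h = \<sigma> \<phi>)"
begin

lemma \<pi>_hom: "\<phi> \<in> Ar A \<Longrightarrow> Dom A \<phi> = V \<Longrightarrow> \<pi> V \<phi> \<in> hom C (L V) (EE (Cod A \<phi>))"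
  using dinaturalD(1)[OF \<pi>] A.dom_ob by blast

lemma \<pi>_nat:
  assumes "\<phi> \<in> Ar A" "Dom A \<phi> = V" "\<psi> \<in> Ar A" "Cod A \<phi> = Dom A \<psi>"
    and "x \<in> hom C X (L V)" "s \<in> hom C X (fob F (Cod A \<phi>))"
  shows "Cmp C (far G \<psi>) (ap (Cod A \<phi>) (Cmp C (\<pi> V \<phi>) x) s) =
    ap (Cod A \<psi>) (Cmp C (\<pi> V (Cmp A \<psi> \<phi>)) x) (Cmp C (far F \<psi>) s)"
  using dinaturalD(2)[OF \<pi> assms(1,2,3,4,5,6)] A.dom_ob[OF assms(1)] assms(2) by blast

lemma dinatural_cmp:
  assumes \<sigma>: "dinatural V Z \<sigma>" and h: "h \<in> hom C Z' Z"
  shows "dinatural V Z' (\<lambda>\<phi>. Cmp C (\<sigma> \<phi>) h)"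
  unfolding dinatural_def
proof (intro conjI ballI impI allI)
  show "Cmp C (\<sigma> \<phi>) h \<in> hom C Z' (EE (Cod A \<phi>))" if "\<phi> \<in> Ar A" "Dom A \<phi> = V" for \<phi>
    using C.cmp_hom[OF h dinaturalD(1)[OF \<sigma> that]] .
  fix \<phi> \<psi> X x s
  assume ar: "\<phi> \<in> Ar A" "\<psi> \<in> Ar A" "Dom A \<phi> = V" "Cod A \<phi> = Dom A \<psi>"
    and xs: "x \<in> hom C X Z'" "s \<in> hom C X (fob F (Cod A \<phi>))"
  have "Cmp A \<psi> \<phi> \<in> Ar A" "Dom A (Cmp A \<psi> \<phi>) = V" using ar by auto
  thus "Cmp C (far G \<psi>) (ap (Cod A \<phi>) (Cmp C (Cmp C (\<sigma> \<phi>) h) x) s) =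
      ap (Cod A \<psi>) (Cmp C (Cmp C (\<sigma> (Cmp A \<psi> \<phi>)) h) x) (Cmp C (far F \<psi>) s)"
    using dinaturalD(2)[OF \<sigma> ar(1,3,2,4) C.cmp_hom[OF xs(1) h] xs(2)]
      C.cmp_assoc[OF xs(1) h dinaturalD(1)[OF \<sigma> ar(1,3)]] C.cmp_assoc[OF xs(1) h dinaturalD(1)[OF \<sigma>]]
    by simp
qed

lemma L_eqI:
  assumes V: "V \<in> Ob A" and h: "h \<in> hom C Z (L V)" "h' \<in> hom C Z (L V)"
    "\<And>\<phi>. \<lbrakk>\<phi> \<in> Ar A; Dom A \<phi> = V\<rbrakk> \<Longrightarrow> Cmp C (\<pi> V \<phi>) h = Cmp C (\<pi> V \<phi>) h'"
  shows "h = h'"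
  using L_univ[OF V C.hom_ob(1)[OF h(1)] dinatural_cmp[OF \<pi>[OF V] h(2)]]
  by (rule ex1_unique) (use h in auto)

lemma dinatural_restrict:
  assumes \<chi>: "\<chi> \<in> Ar A" and V: "Dom A \<chi> = V" and \<sigma>: "dinatural V Z \<sigma>"
  shows "dinatural (Cod A \<chi>) Z (\<lambda>\<phi>. \<sigma> (Cmp A \<phi> \<chi>))"
  unfolding dinatural_def
proof (intro conjI ballI impI allI)
  show "\<sigma> (Cmp A \<phi> \<chi>) \<in> hom C Z (EE (Cod A \<phi>))" if "\<phi> \<in> Ar A" "Dom A \<phi> = Cod A \<chi>" for \<phi>
    using dinaturalD(1)[OF \<sigma>, of "Cmp A \<phi> \<chi>"] that \<chi> V by simp
  fix \<phi> \<psi> X x s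
  assume ar: "\<phi> \<in> Ar A" "\<psi> \<in> Ar A" "Dom A \<phi> = Cod A \<chi>" "Cod A \<phi> = Dom A \<psi>"
    and xs: "x \<in> hom C X Z" "s \<in> hom C X (fob F (Cod A \<phi>))"
  thus "Cmp C (far G \<psi>) (ap (Cod A \<phi>) (Cmp C (\<sigma> (Cmp A \<phi> \<chi>)) x) s) =
      ap (Cod A \<psi>) (Cmp C (\<sigma> (Cmp A (Cmp A \<psi> \<phi>) \<chi>)) x) (Cmp C (far F \<psi>) s)"
    using dinaturalD(2)[OF \<sigma>, of "Cmp A \<phi> \<chi>" \<psi> x X s] \<chi> V by simp
qed

text \<open>The value of the exponential at \<open>\<chi> : V \<rightarrow> V'\<close> restricts a family indexed by the arrows out of \<open>V\<close>
  to the composites \<open>\<phi> \<chi>\<close>.\<close>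

definition exp_arrow :: "'b \<Rightarrow> 'm" where
  "exp_arrow \<chi> = (THE h. h \<in> hom C (L (Dom A \<chi>)) (L (Cod A \<chi>)) \<and>
     (\<forall>\<phi> \<in> Ar A. Dom A \<phi> = Cod A \<chi> \<longrightarrow> Cmp C (\<pi> (Cod A \<chi>) \<phi>) h = \<pi> (Dom A \<chi>) (Cmp A \<phi> \<chi>)))"

lemma exp_arrow:
  assumes \<chi>: "\<chi> \<in> Ar A"
  shows "exp_arrow \<chi> \<in> hom C (L (Dom A \<chi>)) (L (Cod A \<chi>))"
    and "\<lbrakk>\<phi> \<in> Ar A; Dom A \<phi> = Cod A \<chi>\<rbrakk> \<Longrightarrow> Cmp C (\<pi> (Cod A \<chi>) \<phi>) (exp_arrow \<chi>) = \<pi> (Dom A \<chi>) (Cmp A \<phi> \<chi>)"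
proof -
  note V = A.dom_ob[OF \<chi>] A.cod_ob[OF \<chi>]
  from theI'[OF L_univ[OF V(2) L_ob[OF V(1)] dinatural_restrict[OF \<chi> refl \<pi>[OF V(1)]]]]
  show "exp_arrow \<chi> \<in> hom C (L (Dom A \<chi>)) (L (Cod A \<chi>))"
    and "\<lbrakk>\<phi> \<in> Ar A; Dom A \<phi> = Cod A \<chi>\<rbrakk> \<Longrightarrow> Cmp C (\<pi> (Cod A \<chi>) \<phi>) (exp_arrow \<chi>) = \<pi> (Dom A \<chi>) (Cmp A \<phi> \<chi>)"
    unfolding exp_arrow_def by simp_all
qed

definition exp_fctr :: "('a, 'b, 'o, 'm) fctr" where
  "exp_fctr = \<lparr>fob = (\<lambda>V \<in> Ob A. L V), far = (\<lambda>\<chi> \<in> Ar A. exp_arrow \<chi>)\<rparr>"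

lemma exp_fctr_simps [simp]:
  "V \<in> Ob A \<Longrightarrow> fob exp_fctr V = L V" "\<chi> \<in> Ar A \<Longrightarrow> far exp_fctr \<chi> = exp_arrow \<chi>"
  by (simp_all add: exp_fctr_def)

lemma exp_functor: "is_functor A C exp_fctr"
proof (rule is_functorI)
  show "far exp_fctr f \<in> hom C (fob exp_fctr (Dom A f)) (fob exp_fctr (Cod A f))" if "f \<in> Ar A" for f
    using exp_arrow(1)[OF that] that by (simp add: A.dom_ob A.cod_ob)
  show "far exp_fctr (Ident A V) = Ident C (fob exp_fctr V)" if V: "V \<in> Ob A" for V
  proof -
    have "exp_arrow (Ident A V) = Ident C (L V)"
    proof (rule L_eqI[OF V])
      show "exp_arrow (Ident A V) \<in> hom C (L V) (L V)" using exp_arrow(1)[of "Ident A V"] V by simp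
      show "Ident C (L V) \<in> hom C (L V) (L V)" using L_ob[OF V] by (rule C.ident_hom)
      fix \<phi> assume \<phi>: "\<phi> \<in> Ar A" "Dom A \<phi> = V"
      show "Cmp C (\<pi> V \<phi>) (exp_arrow (Ident A V)) = Cmp C (\<pi> V \<phi>) (Ident C (L V))"
        using exp_arrow(2)[of "Ident A V" \<phi>] V \<phi> C.cmp_ident_right[OF \<pi>_hom[OF \<phi>]] by simp
    qed
    thus ?thesis using V by simp
  qed
  show "far exp_fctr (Cmp A g f) = Cmp C (far exp_fctr g) (far exp_fctr f)"
    if fg: "f \<in> Ar A" "g \<in> Ar A" "Cod A f = Dom A g" for f g
  proof -
    have f: "exp_arrow f \<in> hom C (L (Dom A f)) (L (Dom A g))" using exp_arrow(1)[OF fg(1)] fg(3) by simp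
    note g = exp_arrow(1)[OF fg(2)]
    have "exp_arrow (Cmp A g f) = Cmp C (exp_arrow g) (exp_arrow f)"
    proof (rule L_eqI[OF A.cod_ob[OF fg(2)] _ C.cmp_hom[OF f g]])
      show "exp_arrow (Cmp A g f) \<in> hom C (L (Dom A f)) (L (Cod A g))" using exp_arrow(1)[of "Cmp A g f"] fg by simp
      fix \<phi> assume \<phi>: "\<phi> \<in> Ar A" "Dom A \<phi> = Cod A g"
      have "Cmp C (\<pi> (Cod A g) \<phi>) (Cmp C (exp_arrow g) (exp_arrow f)) = Cmp C (\<pi> (Dom A g) (Cmp A \<phi> g)) (exp_arrow f)"
        using C.cmp_assoc[OF f g \<pi>_hom[OF \<phi>]] exp_arrow(2)[OF fg(2) \<phi>] by simp
      also have "\<dots> = \<pi> (Dom A f) (Cmp A (Cmp A \<phi> g) f)"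
        using exp_arrow(2)[OF fg(1), of "Cmp A \<phi> g"] fg \<phi> by simp
      also have "\<dots> = Cmp C (\<pi> (Cod A g) \<phi>) (exp_arrow (Cmp A g f))"
        using exp_arrow(2)[of "Cmp A g f" \<phi>] fg \<phi> by simp
      finally show "Cmp C (\<pi> (Cod A g) \<phi>) (exp_arrow (Cmp A g f)) = Cmp C (\<pi> (Cod A g) \<phi>) (Cmp C (exp_arrow g) (exp_arrow f))" by simp
    qed
    thus ?thesis using fg by simp
  qed
qed (auto simp: exp_fctr_def L_ob)

text \<open>Evaluation at \<open>V\<close> uses the component at the identity of \<open>V\<close>.\<close>

definition eval_el :: "'a \<Rightarrow> 'm \<Rightarrow> 'm \<Rightarrow> 'm" where
  "eval_el V x s = ap V (Cmp C (\<pi> V (Ident A V)) x) s"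

lemma \<pi>_id_hom: "V \<in> Ob A \<Longrightarrow> \<pi> V (Ident A V) \<in> hom C (L V) (EE V)"
  using \<pi>_hom[of "Ident A V" V] by simp

lemma eval_el_hom:
  "\<lbrakk>V \<in> Ob A; x \<in> hom C X (L V); s \<in> hom C X (fob F V)\<rbrakk> \<Longrightarrow> eval_el V x s \<in> hom C X (fob G V)"
  unfolding eval_el_def using ap_hom C.cmp_hom \<pi>_id_hom by blast

lemma eval_el_cmp:
  assumes "V \<in> Ob A" "x \<in> hom C X (L V)" "s \<in> hom C X (fob F V)" "t \<in> hom C Y X"
  shows "Cmp C (eval_el V x s) t = eval_el V (Cmp C x t) (Cmp C s t)"
  unfolding eval_el_def
  using ap_cmp[OF assms(1,1) C.cmp_hom[OF assms(2) \<pi>_id_hom[OF assms(1)]] assms(3,4)]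
    C.cmp_assoc[OF assms(4,2) \<pi>_id_hom[OF assms(1)]] by simp

lemma eval_el_exp_arrow:
  assumes \<chi>: "\<chi> \<in> Ar A" and x: "x \<in> hom C X (L (Dom A \<chi>))"
  shows "eval_el (Cod A \<chi>) (Cmp C (exp_arrow \<chi>) x) s = ap (Cod A \<chi>) (Cmp C (\<pi> (Dom A \<chi>) \<chi>) x) s"
  unfolding eval_el_def
  using C.cmp_assoc[OF x exp_arrow(1)[OF \<chi>] \<pi>_id_hom[OF A.cod_ob[OF \<chi>]]] exp_arrow(2)[OF \<chi>, of "Ident A (Cod A \<chi>)"] \<chi> A.cod_ob[OF \<chi>]
  by simp

lemma eval_el_nat:
  assumes \<chi>: "\<chi> \<in> Ar A" and x: "x \<in> hom C X (L (Dom A \<chi>))" and s: "s \<in> hom C X (fob F (Dom A \<chi>))"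
  shows "eval_el (Cod A \<chi>) (Cmp C (exp_arrow \<chi>) x) (Cmp C (far F \<chi>) s) = Cmp C (far G \<chi>) (eval_el (Dom A \<chi>) x s)"
  unfolding eval_el_exp_arrow[OF \<chi> x]
  using \<pi>_nat[of "Ident A (Dom A \<chi>)" "Dom A \<chi>" \<chi> x X s] \<chi> x s A.dom_ob[OF \<chi>] by (simp add: eval_el_def)

definition eval_trans :: "('a, 'b, 'o, 'm) fctr \<Rightarrow> ('a, 'b, 'o, 'm) ntrans \<Rightarrow> ('a, 'b, 'o, 'm) ntrans \<Rightarrow> ('a, 'b, 'o, 'm) ntrans" where
  "eval_trans P p q = \<lparr>nsrc = P, ntgt = G, ncmp = (\<lambda>V \<in> Ob A. eval_el V (ncmp p V) (ncmp q V))\<rparr>"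

lemma eval_trans_hom:
  assumes p: "p \<in> hom (functor_cat A C) P exp_fctr" and q: "q \<in> hom (functor_cat A C) P F"
  shows "eval_trans P p q \<in> hom (functor_cat A C) P G"
  unfolding eval_trans_def
proof (rule functor_cat_homI[OF _ G _ _ A.category_axioms])
  show P: "is_functor A C P" using p by (auto simp: functor_cat_hom ntrans_simps)
  have pq: "ncmp p V \<in> hom C (fob P V) (L V)" "ncmp q V \<in> hom C (fob P V) (fob F V)" if "V \<in> Ob A" for V
    using functor_cat_hom_ncmp[OF p that] functor_cat_hom_ncmp[OF q that] that by auto
  show "eval_el V (ncmp p V) (ncmp q V) \<in> hom C (fob P V) (fob G V)" if "V \<in> Ob A" for V
    using eval_el_hom[OF that pq[OF that]] .
  fix \<chi> assume \<chi>: "\<chi> \<in> Ar A"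
  note V = A.dom_ob[OF \<chi>] A.cod_ob[OF \<chi>]
  show "Cmp C (eval_el (Cod A \<chi>) (ncmp p (Cod A \<chi>)) (ncmp q (Cod A \<chi>))) (far P \<chi>) =
      Cmp C (far G \<chi>) (eval_el (Dom A \<chi>) (ncmp p (Dom A \<chi>)) (ncmp q (Dom A \<chi>)))"
    using eval_el_cmp[OF V(2) pq[OF V(2)] functor_hom[OF P A.ar_hom[OF \<chi>]]] eval_el_nat[OF \<chi> pq[OF V(1)]]
      functor_cat_hom_nat[OF p \<chi>] functor_cat_hom_nat[OF q \<chi>] \<chi> by simp
qed

text \<open>The transpose of \<open>g\<close> sends an element \<open>x\<close> of \<open>X V\<close> to the family whose component at \<open>\<phi> : V \<rightarrow> W\<close> is
  the map \<open>t \<mapsto> g (X \<phi> x, t)\<close>. It is unique because the component at \<open>\<phi>\<close> of a family is the component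
  at the identity of its restriction along \<open>\<phi>\<close> (\<open>eval_el_exp_arrow\<close>), and evaluation determines the
  latter.\<close>

lemma exp_universal:
  assumes prod: "\<And>V. V \<in> Ob A \<Longrightarrow> is_product C (fob X V) (fob F V) (fob Q V) (ncmp r V) (ncmp s V)"
    and X: "is_functor A C X" and r: "r \<in> hom (functor_cat A C) Q X" and s: "s \<in> hom (functor_cat A C) Q F"
    and g: "g \<in> hom (functor_cat A C) Q G"
  shows "\<exists>!h. h \<in> hom (functor_cat A C) X exp_fctr \<and>
    (\<forall>V \<in> Ob A. eval_el V (Cmp C (ncmp h V) (ncmp r V)) (ncmp s V) = ncmp g V)"
proof -
  have Q: "is_functor A C Q" using r by (auto simp: functor_cat_hom ntrans_simps)
  note rV = functor_cat_hom_ncmp[OF r] and sV = functor_cat_hom_ncmp[OF s] and gV = functor_cat_hom_ncmp[OF g]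
  have Xu: "far X u \<in> hom C (fob X (Dom A u)) (fob X (Cod A u))"
    and Qu: "far Q u \<in> hom C (fob Q (Dom A u)) (fob Q (Cod A u))" if "u \<in> Ar A" for u
    using functor_hom[OF X A.ar_hom[OF that]] functor_hom[OF Q A.ar_hom[OF that]] by auto
  (* g as an operation on generalised elements *)
  define pr where "pr V x t = (THE u. u \<in> hom C (Dom C x) (fob Q V) \<and> Cmp C (ncmp r V) u = x \<and> Cmp C (ncmp s V) u = t)"
    for V x t
  have pr: "pr V x t \<in> hom C Y (fob Q V)" "Cmp C (ncmp r V) (pr V x t) = x" "Cmp C (ncmp s V) (pr V x t) = t"
    if V: "V \<in> Ob A" and xt: "x \<in> hom C Y (fob X V)" "t \<in> hom C Y (fob F V)" for V x t Y
  proof -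
    have "Dom C x = Y" using xt(1) by (simp add: hom_def)
    thus "pr V x t \<in> hom C Y (fob Q V)" "Cmp C (ncmp r V) (pr V x t) = x" "Cmp C (ncmp s V) (pr V x t) = t"
      using theI'[OF C.product_ex1[OF prod[OF V] xt]] by (simp_all add: pr_def)
  qed
  define \<gamma> where "\<gamma> V x t = Cmp C (ncmp g V) (pr V x t)" for V x t
  have \<gamma>_eq: "Cmp C (ncmp g V) u = \<gamma> V (Cmp C (ncmp r V) u) (Cmp C (ncmp s V) u)"
    if V: "V \<in> Ob A" and u: "u \<in> hom C Y (fob Q V)" for V u Y
  proof -
    note h = C.cmp_hom[OF u rV[OF V]] C.cmp_hom[OF u sV[OF V]]
    have "u = pr V (Cmp C (ncmp r V) u) (Cmp C (ncmp s V) u)"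
      by (rule C.product_eqI[OF prod[OF V] u pr(1)[OF V h]]) (simp_all add: pr(2,3)[OF V h])
    thus ?thesis by (simp add: \<gamma>_def)
  qed
  have \<gamma>_hom: "\<gamma> V x t \<in> hom C Y (fob G V)" if "V \<in> Ob A" "x \<in> hom C Y (fob X V)" "t \<in> hom C Y (fob F V)" for V x t Y
    unfolding \<gamma>_def using C.cmp_hom[OF pr(1)[OF that] gV[OF that(1)]] .
  have \<gamma>_cmp: "Cmp C (\<gamma> V x t) u = \<gamma> V (Cmp C x u) (Cmp C t u)"
    if V: "V \<in> Ob A" and xt: "x \<in> hom C Y (fob X V)" "t \<in> hom C Y (fob F V)" and u: "u \<in> hom C Y' Y" for V x t u Y Y'
  proof -
    note p = pr[OF V xt]
    have "Cmp C (\<gamma> V x t) u = Cmp C (ncmp g V) (Cmp C (pr V x t) u)"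
      unfolding \<gamma>_def using C.cmp_assoc[OF u p(1) gV[OF V]] by simp
    also have "\<dots> = \<gamma> V (Cmp C x u) (Cmp C t u)"
      unfolding \<gamma>_eq[OF V C.cmp_hom[OF u p(1)]]
      using C.cmp_assoc[OF u p(1) rV[OF V]] C.cmp_assoc[OF u p(1) sV[OF V]] p(2,3) by simp
    finally show ?thesis .
  qed
  have \<gamma>_nat: "Cmp C (far G u) (\<gamma> (Dom A u) x t) = \<gamma> (Cod A u) (Cmp C (far X u) x) (Cmp C (far F u) t)"
    if u: "u \<in> Ar A" and xt: "x \<in> hom C Y (fob X (Dom A u))" "t \<in> hom C Y (fob F (Dom A u))" for u x t Y
  proof -
    note V = A.dom_ob[OF u] A.cod_ob[OF u]
    note p = pr[OF V(1) xt]
    have "Cmp C (far G u) (\<gamma> (Dom A u) x t) = Cmp C (ncmp g (Cod A u)) (Cmp C (far Q u) (pr (Dom A u) x t))"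
      unfolding \<gamma>_def using C.cmp_reassoc[OF functor_cat_hom_nat[OF g u] Qu[OF u] gV[OF V(2)] gV[OF V(1)] G_hom[OF u] p(1)] by simp
    also have "\<dots> = \<gamma> (Cod A u) (Cmp C (far X u) x) (Cmp C (far F u) t)"
      unfolding \<gamma>_eq[OF V(2) C.cmp_hom[OF p(1) Qu[OF u]]]
      using C.cmp_reassoc[OF functor_cat_hom_nat[OF r u] Qu[OF u] rV[OF V(2)] rV[OF V(1)] Xu[OF u] p(1)]
        C.cmp_reassoc[OF functor_cat_hom_nat[OF s u] Qu[OF u] sV[OF V(2)] sV[OF V(1)] F_hom[OF u] p(1)] p(2,3) by simp
    finally show ?thesis .
  qed
  (* the components of the transpose, as arrows of C *)
  have "\<exists>c. \<forall>\<phi> \<in> Ar A. c \<phi> \<in> hom C (fob X (Dom A \<phi>)) (EE (Cod A \<phi>)) \<and>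
     (\<forall>Y. \<forall>x \<in> hom C Y (fob X (Dom A \<phi>)). \<forall>t \<in> hom C Y (fob F (Cod A \<phi>)).
        ap (Cod A \<phi>) (Cmp C (c \<phi>) x) t = \<gamma> (Cod A \<phi>) (Cmp C (far X \<phi>) x) t)"
  proof (rule bchoice, rule ballI)
    fix \<phi> assume \<phi>: "\<phi> \<in> Ar A"
    note V = A.dom_ob[OF \<phi>] A.cod_ob[OF \<phi>]
    have "\<exists>!c. c \<in> hom C (fob X (Dom A \<phi>)) (EE (Cod A \<phi>)) \<and>
     (\<forall>Y. \<forall>x \<in> hom C Y (fob X (Dom A \<phi>)). \<forall>t \<in> hom C Y (fob F (Cod A \<phi>)).
        ap (Cod A \<phi>) (Cmp C c x) t = \<gamma> (Cod A \<phi>) (Cmp C (far X \<phi>) x) t)"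
    proof (rule app_abs[OF FG_ob(1)[OF V(2)] FG_ob(2)[OF V(2)] functor_simps(1)[OF X V(1)]], rule natural_mapI)
      fix Y x t assume xt: "x \<in> hom C Y (fob X (Dom A \<phi>))" "t \<in> hom C Y (fob F (Cod A \<phi>))"
      note x = C.cmp_hom[OF xt(1) Xu[OF \<phi>]]
      show "\<gamma> (Cod A \<phi>) (Cmp C (far X \<phi>) x) t \<in> hom C Y (fob G (Cod A \<phi>))" using \<gamma>_hom[OF V(2) x xt(2)] .
    next
      fix Y Z x t u assume xt: "x \<in> hom C Y (fob X (Dom A \<phi>))" "t \<in> hom C Y (fob F (Cod A \<phi>))" and u: "u \<in> hom C Z Y"
      show "Cmp C (\<gamma> (Cod A \<phi>) (Cmp C (far X \<phi>) x) t) u = \<gamma> (Cod A \<phi>) (Cmp C (far X \<phi>) (Cmp C x u)) (Cmp C t u)"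
        using \<gamma>_cmp[OF V(2) C.cmp_hom[OF xt(1) Xu[OF \<phi>]] xt(2) u] C.cmp_assoc[OF u xt(1) Xu[OF \<phi>]] by simp
    qed
    from ex1_implies_ex[OF this] show "\<exists>c. c \<in> hom C (fob X (Dom A \<phi>)) (EE (Cod A \<phi>)) \<and>
     (\<forall>Y. \<forall>x \<in> hom C Y (fob X (Dom A \<phi>)). \<forall>t \<in> hom C Y (fob F (Cod A \<phi>)).
        ap (Cod A \<phi>) (Cmp C c x) t = \<gamma> (Cod A \<phi>) (Cmp C (far X \<phi>) x) t)" .
  qed
  then obtain c where c: "\<And>\<phi>. \<phi> \<in> Ar A \<Longrightarrow> c \<phi> \<in> hom C (fob X (Dom A \<phi>)) (EE (Cod A \<phi>))"
    and ap_c: "\<And>\<phi> Y x t. \<lbrakk>\<phi> \<in> Ar A; x \<in> hom C Y (fob X (Dom A \<phi>)); t \<in> hom C Y (fob F (Cod A \<phi>))\<rbrakk> \<Longrightarrow>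
        ap (Cod A \<phi>) (Cmp C (c \<phi>) x) t = \<gamma> (Cod A \<phi>) (Cmp C (far X \<phi>) x) t"
    by blast
  have c_din: "dinatural V (fob X V) c" for V unfolding dinatural_def
  proof (intro conjI ballI impI allI)
    show "c \<phi> \<in> hom C (fob X V) (EE (Cod A \<phi>))" if "\<phi> \<in> Ar A" "Dom A \<phi> = V" for \<phi> using c[OF that(1)] that(2) by simp
    fix \<phi> \<psi> Y x t
    assume ar: "\<phi> \<in> Ar A" "\<psi> \<in> Ar A" "Dom A \<phi> = V" "Cod A \<phi> = Dom A \<psi>"
      and xt: "x \<in> hom C Y (fob X V)" "t \<in> hom C Y (fob F (Cod A \<phi>))"
    have x': "x \<in> hom C Y (fob X (Dom A \<phi>))" using xt(1) ar(3) by simp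
    have Xx: "Cmp C (far X \<phi>) x \<in> hom C Y (fob X (Dom A \<psi>))" using C.cmp_hom[OF x' Xu[OF ar(1)]] ar(4) by simp
    have t': "t \<in> hom C Y (fob F (Dom A \<psi>))" using xt(2) ar(4) by simp
    have Ft: "Cmp C (far F \<psi>) t \<in> hom C Y (fob F (Cod A \<psi>))" using C.cmp_hom[OF t' F_hom[OF ar(2)]] .
    have "Cmp C (far X \<phi>) x \<in> hom C Y (fob X (Dom A \<psi>)) \<and> Cmp C (far X \<psi>) (Cmp C (far X \<phi>) x) = Cmp C (far X (Cmp A \<psi> \<phi>)) x"
      using C.cmp_assoc[OF x' Xu[OF ar(1)], of "far X \<psi>" "fob X (Cod A \<psi>)"] Xu[OF ar(2)] ar Xx
        functor_simps(6)[OF X ar(1,2,4)] by simp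
    thus "Cmp C (far G \<psi>) (ap (Cod A \<phi>) (Cmp C (c \<phi>) x) t) =
        ap (Cod A \<psi>) (Cmp C (c (Cmp A \<psi> \<phi>)) x) (Cmp C (far F \<psi>) t)"
      using ap_c[OF ar(1) x' xt(2)] \<gamma>_nat[OF ar(2) Xx t'] ap_c[of "Cmp A \<psi> \<phi>" x Y "Cmp C (far F \<psi>) t"] ar x' Ft
      by simp
  qed
  have "\<exists>h. h \<in> hom C (fob X V) (L V) \<and> (\<forall>\<phi> \<in> Ar A. Dom A \<phi> = V \<longrightarrow> Cmp C (\<pi> V \<phi>) h = c \<phi>)" if "V \<in> Ob A" for V
    using ex1_implies_ex[OF L_univ[OF that functor_simps(1)[OF X that] c_din]] .
  then obtain h where h: "\<And>V. V \<in> Ob A \<Longrightarrow> h V \<in> hom C (fob X V) (L V)"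
    and \<pi>_h: "\<And>V \<phi>. \<lbrakk>V \<in> Ob A; \<phi> \<in> Ar A; Dom A \<phi> = V\<rbrakk> \<Longrightarrow> Cmp C (\<pi> V \<phi>) (h V) = c \<phi>"
    by metis
  have c_ext: "k = c \<phi>" if \<phi>: "\<phi> \<in> Ar A" and k: "k \<in> hom C (fob X (Dom A \<phi>)) (EE (Cod A \<phi>))"
    and "\<And>Y x t. \<lbrakk>x \<in> hom C Y (fob X (Dom A \<phi>)); t \<in> hom C Y (fob F (Cod A \<phi>))\<rbrakk> \<Longrightarrow>
      ap (Cod A \<phi>) (Cmp C k x) t = \<gamma> (Cod A \<phi>) (Cmp C (far X \<phi>) x) t" for k \<phi>
    by (rule app_ext[OF FG_ob(1)[OF A.cod_ob[OF \<phi>]] FG_ob(2)[OF A.cod_ob[OF \<phi>]] k c[OF \<phi>]])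
      (simp add: that(3) ap_c[OF \<phi>])
  have c_cmp: "Cmp C (c \<phi>) (far X \<chi>) = c (Cmp A \<phi> \<chi>)"
    if ar: "\<chi> \<in> Ar A" "\<phi> \<in> Ar A" "Dom A \<phi> = Cod A \<chi>" for \<phi> \<chi>
  proof (rule c_ext)
    have cX: "c \<phi> \<in> hom C (fob X (Cod A \<chi>)) (EE (Cod A \<phi>))" using c[OF ar(2)] ar(3) by simp
    show "Cmp A \<phi> \<chi> \<in> Ar A" using ar by simp
    show "Cmp C (c \<phi>) (far X \<chi>) \<in> hom C (fob X (Dom A (Cmp A \<phi> \<chi>))) (EE (Cod A (Cmp A \<phi> \<chi>)))"
      using C.cmp_hom[OF Xu[OF ar(1)] cX] ar by simp
    fix Y x t assume "x \<in> hom C Y (fob X (Dom A (Cmp A \<phi> \<chi>)))" "t \<in> hom C Y (fob F (Cod A (Cmp A \<phi> \<chi>)))"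
    hence xt: "x \<in> hom C Y (fob X (Dom A \<chi>))" "t \<in> hom C Y (fob F (Cod A \<phi>))" using ar by auto
    have Xx: "Cmp C (far X \<chi>) x \<in> hom C Y (fob X (Dom A \<phi>))" using C.cmp_hom[OF xt(1) Xu[OF ar(1)]] ar(3) by simp
    show "ap (Cod A (Cmp A \<phi> \<chi>)) (Cmp C (Cmp C (c \<phi>) (far X \<chi>)) x) t = \<gamma> (Cod A (Cmp A \<phi> \<chi>)) (Cmp C (far X (Cmp A \<phi> \<chi>)) x) t"
      using ap_c[OF ar(2) Xx xt(2)] C.cmp_assoc[OF xt(1) Xu[OF ar(1)] cX] ar functor_simps(6)[OF X ar(1,2)]
        C.cmp_assoc[OF xt(1) Xu[OF ar(1)], of "far X \<phi>" "fob X (Cod A \<phi>)"] Xu[OF ar(2)] by simp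
  qed
  define H where "H = \<lparr>nsrc = X, ntgt = exp_fctr, ncmp = (\<lambda>V \<in> Ob A. h V)\<rparr>"
  have H: "H \<in> hom (functor_cat A C) X exp_fctr" unfolding H_def
  proof (rule functor_cat_homI[OF X exp_functor _ _ A.category_axioms])
    show "h V \<in> hom C (fob X V) (fob exp_fctr V)" if "V \<in> Ob A" for V using h[OF that] that by simp
    fix \<chi> assume \<chi>: "\<chi> \<in> Ar A"
    note V = A.dom_ob[OF \<chi>] A.cod_ob[OF \<chi>]
    show "Cmp C (h (Cod A \<chi>)) (far X \<chi>) = Cmp C (far exp_fctr \<chi>) (h (Dom A \<chi>))"
      unfolding exp_fctr_simps(2)[OF \<chi>]
    proof (rule L_eqI[OF V(2) C.cmp_hom[OF Xu[OF \<chi>] h[OF V(2)]] C.cmp_hom[OF h[OF V(1)] exp_arrow(1)[OF \<chi>]]])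
      fix \<phi> assume \<phi>: "\<phi> \<in> Ar A" "Dom A \<phi> = Cod A \<chi>"
      show "Cmp C (\<pi> (Cod A \<chi>) \<phi>) (Cmp C (h (Cod A \<chi>)) (far X \<chi>)) = Cmp C (\<pi> (Cod A \<chi>) \<phi>) (Cmp C (exp_arrow \<chi>) (h (Dom A \<chi>)))"
        using C.cmp_assoc[OF Xu[OF \<chi>] h[OF V(2)] \<pi>_hom[OF \<phi>]] \<pi>_h[OF V(2) \<phi>] c_cmp[OF \<chi> \<phi>]
          C.cmp_assoc[OF h[OF V(1)] exp_arrow(1)[OF \<chi>] \<pi>_hom[OF \<phi>]] exp_arrow(2)[OF \<chi> \<phi>] \<pi>_h[OF V(1), of "Cmp A \<phi> \<chi>"] \<phi> \<chi>
        by simp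
    qed
  qed
  show ?thesis
  proof (rule ex1I[of _ H], intro conjI ballI H)
    fix V assume V: "V \<in> Ob A"
    have "eval_el V (Cmp C (h V) (ncmp r V)) (ncmp s V) = ap V (Cmp C (c (Ident A V)) (ncmp r V)) (ncmp s V)"
      unfolding eval_el_def
      using C.cmp_assoc[OF rV[OF V] h[OF V] \<pi>_id_hom[OF V]] \<pi>_h[OF V, of "Ident A V"] V by simp
    also have "\<dots> = \<gamma> V (ncmp r V) (ncmp s V)"
      using ap_c[of "Ident A V" "ncmp r V" "fob Q V" "ncmp s V"] V rV[OF V] sV[OF V] functor_simps(5)[OF X V]
        C.cmp_ident_left[OF rV[OF V]] by simp
    also have "\<dots> = ncmp g V"
      using \<gamma>_eq[OF V C.ident_hom[OF functor_simps(1)[OF Q V]]] C.cmp_ident_right[OF rV[OF V]]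
        C.cmp_ident_right[OF sV[OF V]] C.cmp_ident_right[OF gV[OF V]] by simp
    finally show "eval_el V (Cmp C (ncmp H V) (ncmp r V)) (ncmp s V) = ncmp g V" using V by (simp add: H_def)
  next
    fix K assume K: "K \<in> hom (functor_cat A C) X exp_fctr \<and>
      (\<forall>V\<in>Ob A. eval_el V (Cmp C (ncmp K V) (ncmp r V)) (ncmp s V) = ncmp g V)"
    have KV: "ncmp K V \<in> hom C (fob X V) (L V)" if "V \<in> Ob A" for V
      using functor_cat_hom_ncmp[OF conjunct1[OF K] that] that by simp
    have \<gamma>_K: "eval_el V (Cmp C (ncmp K V) x) t = \<gamma> V x t"
      if V: "V \<in> Ob A" and xt: "x \<in> hom C Y (fob X V)" "t \<in> hom C Y (fob F V)" for V x t Y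
    proof -
      note p = pr[OF V xt]
      have "eval_el V (Cmp C (ncmp K V) x) t = Cmp C (eval_el V (Cmp C (ncmp K V) (ncmp r V)) (ncmp s V)) (pr V x t)"
        using eval_el_cmp[OF V C.cmp_hom[OF rV[OF V] KV[OF V]] sV[OF V] p(1)] C.cmp_assoc[OF p(1) rV[OF V] KV[OF V]] p(2,3)
        by simp
      thus ?thesis using K V by (simp add: \<gamma>_def)
    qed
    show "K = H"
    proof (rule functor_cat_hom_eqI[OF conjunct1[OF K] H])
      fix V assume V: "V \<in> Ob A"
      have "ncmp K V = h V"
      proof (rule L_eqI[OF V KV[OF V] h[OF V]])
        fix \<phi> assume \<phi>: "\<phi> \<in> Ar A" "Dom A \<phi> = V"
        have "Cmp C (\<pi> V \<phi>) (ncmp K V) = c \<phi>"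
        proof (rule c_ext[OF \<phi>(1)])
          show "Cmp C (\<pi> V \<phi>) (ncmp K V) \<in> hom C (fob X (Dom A \<phi>)) (EE (Cod A \<phi>))"
            using C.cmp_hom[OF KV[OF V] \<pi>_hom[OF \<phi>]] \<phi>(2) by simp
          fix Y x t assume xt: "x \<in> hom C Y (fob X (Dom A \<phi>))" "t \<in> hom C Y (fob F (Cod A \<phi>))"
          note W = A.cod_ob[OF \<phi>(1)]
          have x: "x \<in> hom C Y (fob X V)" using xt(1) \<phi>(2) by simp
          have Kx: "Cmp C (ncmp K V) x \<in> hom C Y (L (Dom A \<phi>))" using C.cmp_hom[OF x KV[OF V]] \<phi>(2) by simp
          have KX: "Cmp C (ncmp K (Cod A \<phi>)) (far X \<phi>) = Cmp C (exp_arrow \<phi>) (ncmp K V)"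
            using functor_cat_hom_nat[OF conjunct1[OF K] \<phi>(1)] \<phi> by simp
          have L\<phi>: "exp_arrow \<phi> \<in> hom C (L V) (L (Cod A \<phi>))" using exp_arrow(1)[OF \<phi>(1)] \<phi>(2) by simp
          have X\<phi>: "far X \<phi> \<in> hom C (fob X V) (fob X (Cod A \<phi>))" using Xu[OF \<phi>(1)] \<phi>(2) by simp
          have "ap (Cod A \<phi>) (Cmp C (Cmp C (\<pi> V \<phi>) (ncmp K V)) x) t =
              eval_el (Cod A \<phi>) (Cmp C (exp_arrow \<phi>) (Cmp C (ncmp K V) x)) t"
            using eval_el_exp_arrow[OF \<phi>(1) Kx] C.cmp_assoc[OF x KV[OF V] \<pi>_hom[OF \<phi>]] \<phi>(2) by simp
          also have "\<dots> = eval_el (Cod A \<phi>) (Cmp C (ncmp K (Cod A \<phi>)) (Cmp C (far X \<phi>) x)) t"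
            using C.cmp_reassoc[OF KX X\<phi> KV[OF W] KV[OF V] L\<phi> x] by simp
          also have "\<dots> = \<gamma> (Cod A \<phi>) (Cmp C (far X \<phi>) x) t"
            by (rule \<gamma>_K[OF W C.cmp_hom[OF x X\<phi>] xt(2)])
          finally show "ap (Cod A \<phi>) (Cmp C (Cmp C (\<pi> V \<phi>) (ncmp K V)) x) t = \<gamma> (Cod A \<phi>) (Cmp C (far X \<phi>) x) t" .
        qed
        thus "Cmp C (\<pi> V \<phi>) (ncmp K V) = Cmp C (\<pi> V \<phi>) (h V)" using \<pi>_h[OF V \<phi>] by simp
      qed
      thus "ncmp K V = ncmp H V" using V by (simp add: H_def)
    qed
  qed
qed

lemma exponential_exists:
  assumes lex: "left_exact_cat C"
  shows "\<exists>P p q. is_exponential (functor_cat A C) F G exp_fctr P p q (eval_trans P p q)"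
proof -
  have lexK: "left_exact_cat (functor_cat A C)"
    using functor_cat_has_limits lex unfolding left_exact_cat_def finite_shape_def by blast
  have ob: "exp_fctr \<in> Ob (functor_cat A C)" "F \<in> Ob (functor_cat A C)" using exp_functor F by auto
  obtain P p q where P: "is_product (functor_cat A C) exp_fctr F P p q"
    using FC.left_exact_products[OF lexK ob] by blast
  note pq = FC.product_hom[OF P]
  have "is_exponential (functor_cat A C) F G exp_fctr P p q (eval_trans P p q)"
    unfolding is_exponential_def
  proof (intro conjI allI impI)
    fix X Q r s g
    assume X: "X \<in> Ob (functor_cat A C)" and Q: "is_product (functor_cat A C) X F Q r s"
      and g: "g \<in> hom (functor_cat A C) Q G"
    have XF: "is_functor A C X" using X by simp
    note rs = FC.product_hom[OF Q]
    have eq: "(\<exists>u\<in>hom (functor_cat A C) Q P. Cmp (functor_cat A C) p u = Cmp (functor_cat A C) h r \<and>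
        Cmp (functor_cat A C) q u = s \<and> Cmp (functor_cat A C) (eval_trans P p q) u = g) \<longleftrightarrow>
      (\<forall>V \<in> Ob A. eval_el V (Cmp C (ncmp h V) (ncmp r V)) (ncmp s V) = ncmp g V)" (is "?l \<longleftrightarrow> ?r")
      if h: "h \<in> hom (functor_cat A C) X exp_fctr" for h
    proof -
      obtain u where u: "u \<in> hom (functor_cat A C) Q P" "Cmp (functor_cat A C) p u = Cmp (functor_cat A C) h r"
        "Cmp (functor_cat A C) q u = s"
        using FC.product_pair[OF P FC.cmp_hom[OF rs(1) h] rs(2)] .
      have ev: "ncmp (Cmp (functor_cat A C) (eval_trans P p q) u) V =
          eval_el V (Cmp C (ncmp h V) (ncmp r V)) (ncmp s V)" if V: "V \<in> Ob A" for V
      proof -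
        have pV: "ncmp p V \<in> hom C (fob P V) (L V)" using functor_cat_hom_ncmp[OF pq(1) V] V by simp
        have "Cmp C (ncmp p V) (ncmp u V) = Cmp C (ncmp h V) (ncmp r V)" "Cmp C (ncmp q V) (ncmp u V) = ncmp s V"
          using arg_cong[OF u(2), of "\<lambda>t. ncmp t V"] arg_cong[OF u(3), of "\<lambda>t. ncmp t V"] V by simp_all
        thus ?thesis
          using eval_el_cmp[OF V pV functor_cat_hom_ncmp[OF pq(2) V] functor_cat_hom_ncmp[OF u(1) V]] V
          by (simp add: eval_trans_def)
      qed
      have "?l \<longleftrightarrow> Cmp (functor_cat A C) (eval_trans P p q) u = g"
      proof
        assume ?l
        then obtain u' where u': "u' \<in> hom (functor_cat A C) Q P" "Cmp (functor_cat A C) p u' = Cmp (functor_cat A C) h r"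
          "Cmp (functor_cat A C) q u' = s" "Cmp (functor_cat A C) (eval_trans P p q) u' = g" by blast
        have "u' = u" by (rule FC.product_eqI[OF P u'(1) u(1)]) (simp_all add: u u')
        thus "Cmp (functor_cat A C) (eval_trans P p q) u = g" using u'(4) by simp
      qed (use u in blast)
      also have "\<dots> \<longleftrightarrow> ?r"
      proof
        assume "Cmp (functor_cat A C) (eval_trans P p q) u = g"
        thus ?r using ev by auto
      next
        assume ?r
        thus "Cmp (functor_cat A C) (eval_trans P p q) u = g"
          using ev by (intro functor_cat_hom_eqI[OF FC.cmp_hom[OF u(1) eval_trans_hom[OF pq]] g]) auto
      qed
      finally show ?thesis .
    qed
    have "\<exists>!h. h \<in> hom (functor_cat A C) X exp_fctr \<and>
      (\<forall>V \<in> Ob A. eval_el V (Cmp C (ncmp h V) (ncmp r V)) (ncmp s V) = ncmp g V)"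
      by (rule exp_universal[OF product_imp_pointwise[OF lex XF F _ Q] XF rs g])
    thus "\<exists>!h. h \<in> hom (functor_cat A C) X exp_fctr \<and>
      (\<exists>u\<in>hom (functor_cat A C) Q P. Cmp (functor_cat A C) p u = Cmp (functor_cat A C) h r \<and>
        Cmp (functor_cat A C) q u = s \<and> Cmp (functor_cat A C) (eval_trans P p q) u = g)"
      using eq by (simp cong: conj_cong)
  qed (use ob P eval_trans_hom[OF pq] in auto)
  thus ?thesis by blast
qed

end

theorem functor_cat_cartesian_closed:
  fixes A :: "('a, 'b) cat" and C :: "('o, 'm) cat" and e :: "'b \<Rightarrow> 'i"
  assumes A: "category A" and C: "category C" and inf: "infinite (UNIV :: 'i set)" and e: "inj_on e (Ar A)"
    and U: "complete_cat TYPE('i) C" and cc: "cartesian_closed C"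
  shows "cartesian_closed (functor_cat A C)"
proof -
  interpret two_cats A C using A C by (simp add: two_cats_def)
  have lex: "left_exact_cat C" by (rule complete_imp_left_exact[OF inf C U])
  have lexK: "left_exact_cat (functor_cat A C)"
    using functor_cat_has_limits lex unfolding left_exact_cat_def finite_shape_def by blast
  obtain E app where "closed_cat C E app" using cartesian_closed_imp_closed_cat[OF C cc] by blast
  then interpret closed_cat C E app .
  have "\<exists>H P p q ev. is_exponential (functor_cat A C) F G H P p q ev"
    if "F \<in> Ob (functor_cat A C)" "G \<in> Ob (functor_cat A C)" for F G
  proof -
    interpret functor_pair A C E app F G
      using that by unfold_locales auto
    obtain L \<pi> where "functor_end A C E app F G L \<pi>"
    proof -
      have "\<forall>V. \<exists>L \<pi>. V \<in> Ob A \<longrightarrow> L \<in> Ob C \<and> dinatural V L \<pi> \<and>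
        (\<forall>Z \<sigma>. Z \<in> Ob C \<longrightarrow> dinatural V Z \<sigma> \<longrightarrow>
          (\<exists>!h. h \<in> hom C Z L \<and> (\<forall>\<phi> \<in> Ar A. Dom A \<phi> = V \<longrightarrow> Cmp C (\<pi> \<phi>) h = \<sigma> \<phi>)))"
        using end_exists[OF inf e U] by blast
      from choice[OF this] obtain L where "\<forall>V. \<exists>\<pi>. V \<in> Ob A \<longrightarrow> L V \<in> Ob C \<and> dinatural V (L V) \<pi> \<and>
        (\<forall>Z \<sigma>. Z \<in> Ob C \<longrightarrow> dinatural V Z \<sigma> \<longrightarrow>
          (\<exists>!h. h \<in> hom C Z (L V) \<and> (\<forall>\<phi> \<in> Ar A. Dom A \<phi> = V \<longrightarrow> Cmp C (\<pi> \<phi>) h = \<sigma> \<phi>)))" by blast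
      from choice[OF this] obtain \<pi> where *: "\<forall>V. V \<in> Ob A \<longrightarrow> L V \<in> Ob C \<and> dinatural V (L V) (\<pi> V) \<and>
        (\<forall>Z \<sigma>. Z \<in> Ob C \<longrightarrow> dinatural V Z \<sigma> \<longrightarrow>
          (\<exists>!h. h \<in> hom C Z (L V) \<and> (\<forall>\<phi> \<in> Ar A. Dom A \<phi> = V \<longrightarrow> Cmp C (\<pi> V \<phi>) h = \<sigma> \<phi>)))" by blast
      have "functor_end A C E app F G L \<pi>" by unfold_locales (use * in simp_all)
      thus thesis by (rule that)
    qed
    then interpret functor_end A C E app F G L \<pi> .
    show ?thesis using exponential_exists[OF lex] by blast
  qed
  thus ?thesis unfolding cartesian_closed_def
    using FC.left_exact_terminal[OF lexK] FC.left_exact_products[OF lexK] by blast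
qed

section \<open>The algebra object \<open>R \<otimes> _\<close> in the functor category\<close>

locale weil_functors = two_cats "Weil :: ('k weil, 'k wmap) cat" U + alg_in U R
  for U :: "('o, 'm) cat" and R :: "('k::{comm_ring, comm_monoid_mult}, 'o, 'm) kalg" +
  assumes left_exact: "left_exact_cat U"
begin

abbreviation "K \<equiv> functor_cat (Weil :: ('k weil, 'k wmap) cat) U"
abbreviation "RF \<equiv> RU_functor U R"

lemma K_left_exact: "left_exact_cat K"
  using functor_cat_has_limits left_exact unfolding left_exact_cat_def finite_shape_def by blast

lemma K_power_cat: "power_cat K"
  by unfold_locales (rule FC.left_exact_powers[OF K_left_exact])

sublocale KP: power_cat K by (rule K_power_cat)

lemma RF_simps [simp]:
  "is_weil W \<Longrightarrow> fob RF W = tcar W" "is_weil_hom \<phi> \<Longrightarrow> far RF \<phi> = tensor_map U R \<phi>"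
  by (simp_all add: RU_functor_def)

lemma RF_functor: "is_functor Weil U RF"
proof (rule is_functorI)
  show "far RF \<phi> \<in> hom U (fob RF (Dom Weil \<phi>)) (fob RF (Cod Weil \<phi>))" if "\<phi> \<in> Ar Weil" for \<phi>
    using that tensor_map_hom[of \<phi>] by (simp add: is_weil_homD)
  show "far RF (Ident Weil W) = Ident U (fob RF W)" if "W \<in> Ob Weil" for W
    using that by (simp add: is_weil_hom_wid tensor_map_wid)
  show "far RF (Cmp Weil \<psi> \<phi>) = Cmp U (far RF \<psi>) (far RF \<phi>)"
    if "\<phi> \<in> Ar Weil" "\<psi> \<in> Ar Weil" "Cod Weil \<phi> = Dom Weil \<psi>" for \<phi> \<psi>
    using that by (simp add: is_weil_hom_wcomp tensor_map_wcomp)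
qed (simp_all add: RU_functor_def op_hom(1))

lemma RF_Ob: "RF \<in> Ob K"
  using RF_functor by simp

definition op2 :: "(('k, 'o, 'm) kalg \<Rightarrow> 'm) \<Rightarrow> ('k, 'o, 'm) wntrans" where
  "op2 w = \<lparr>nsrc = pow_ob K RF 2, ntgt = RF, ncmp = (\<lambda>W \<in> Ob Weil.
     ap2 U (fob RF W) (w (talg W)) (ncmp (pow_pr K RF 2 0) W) (ncmp (pow_pr K RF 2 1) W))\<rparr>"

definition op1 :: "(('k, 'o, 'm) kalg \<Rightarrow> 'm) \<Rightarrow> ('k, 'o, 'm) wntrans" where
  "op1 w = \<lparr>nsrc = RF, ntgt = RF, ncmp = (\<lambda>W \<in> Ob Weil. w (talg W))\<rparr>"

definition op0 :: "(('k, 'o, 'm) kalg \<Rightarrow> 'm) \<Rightarrow> ('k, 'o, 'm) wntrans" where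
  "op0 w = \<lparr>nsrc = pow_ob K RF 0, ntgt = RF, ncmp = (\<lambda>W \<in> Ob Weil.
     ap0 U (fob RF W) (w (talg W)) (fob (pow_ob K RF 0) W))\<rparr>"

lemma RU_simps [simp]:
  "acar (RU U R) = RF" "aadd (RU U R) = op2 aadd" "amul (RU U R) = op2 amul"
  "azero (RU U R) = op0 azero" "aone (RU U R) = op0 aone" "aneg (RU U R) = op1 aneg"
  "ascal (RU U R) c = op1 (\<lambda>B. ascal B c)"
  by (simp_all add: RU_def Let_def KU_def op2_def op1_def op0_def)

text \<open>The selector \<open>w\<close> picks an operation of each algebra \<open>R \<otimes> W\<close>; it is natural if the homomorphisms
  \<open>R \<otimes> \<phi>\<close> commute with it.\<close>

definition natural_op2 :: "(('k, 'o, 'm) kalg \<Rightarrow> 'm) \<Rightarrow> bool" where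
  "natural_op2 w \<longleftrightarrow> (\<forall>W. is_weil W \<longrightarrow> w (talg W) \<in> hom U (pow_ob U (tcar W) 2) (tcar W)) \<and>
     (\<forall>\<phi> X x y. is_weil_hom \<phi> \<longrightarrow> x \<in> hom U X (tcar (src \<phi>)) \<longrightarrow> y \<in> hom U X (tcar (src \<phi>)) \<longrightarrow>
       Cmp U (tensor_map U R \<phi>) (ap2 U (tcar (src \<phi>)) (w (talg (src \<phi>))) x y) =
       ap2 U (tcar (tgt \<phi>)) (w (talg (tgt \<phi>))) (Cmp U (tensor_map U R \<phi>) x) (Cmp U (tensor_map U R \<phi>) y))"

definition natural_op1 :: "(('k, 'o, 'm) kalg \<Rightarrow> 'm) \<Rightarrow> bool" where
  "natural_op1 w \<longleftrightarrow> (\<forall>W. is_weil W \<longrightarrow> w (talg W) \<in> hom U (tcar W) (tcar W)) \<and>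
     (\<forall>\<phi> X x. is_weil_hom \<phi> \<longrightarrow> x \<in> hom U X (tcar (src \<phi>)) \<longrightarrow>
       Cmp U (tensor_map U R \<phi>) (Cmp U (w (talg (src \<phi>))) x) =
       Cmp U (w (talg (tgt \<phi>))) (Cmp U (tensor_map U R \<phi>) x))"

definition natural_op0 :: "(('k, 'o, 'm) kalg \<Rightarrow> 'm) \<Rightarrow> bool" where
  "natural_op0 w \<longleftrightarrow> (\<forall>W. is_weil W \<longrightarrow> w (talg W) \<in> hom U (pow_ob U (tcar W) 0) (tcar W)) \<and>
     (\<forall>\<phi> X. is_weil_hom \<phi> \<longrightarrow> X \<in> Ob U \<longrightarrow>
       Cmp U (tensor_map U R \<phi>) (ap0 U (tcar (src \<phi>)) (w (talg (src \<phi>))) X) =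
       ap0 U (tcar (tgt \<phi>)) (w (talg (tgt \<phi>))) X)"

lemma natural_ops:
  "natural_op2 aadd" "natural_op2 amul" "natural_op0 azero" "natural_op0 aone" "natural_op1 aneg"
  "natural_op1 (\<lambda>B. ascal B c)"
  unfolding natural_op2_def natural_op1_def natural_op0_def
  using talg_op_hom tensor_map_op2 tensor_map_op1 tensor_map_op0 by simp_all

lemma pr_K: "i < n \<Longrightarrow> pow_pr K RF n i \<in> hom K (pow_ob K RF n) RF"
  by (rule KP.pr_hom[OF RF_Ob])

lemma pow_K_functor: "is_functor Weil U (pow_ob K RF n)"
  using KP.pow_simps(1)[OF RF_Ob, of n] by simp

lemma K_hom_ncmp: "t \<in> hom K M N \<Longrightarrow> is_weil V \<Longrightarrow> ncmp t V \<in> hom U (fob M V) (fob N V)"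
  using functor_cat_hom_ncmp[of t Weil U M N V] by simp

lemma K_hom_RF: "t \<in> hom K M RF \<Longrightarrow> is_weil V \<Longrightarrow> ncmp t V \<in> hom U (fob M V) (tcar V)"
  using K_hom_ncmp[of t M RF V] by simp

lemma K_eqI:
  "\<lbrakk>s \<in> hom K M N; t \<in> hom K M N; \<And>V. is_weil V \<Longrightarrow> ncmp s V = ncmp t V\<rbrakk> \<Longrightarrow> s = t"
  by (rule functor_cat_hom_eqI) auto

lemma K_hom_nat: "t \<in> hom K M N \<Longrightarrow> is_weil_hom \<phi> \<Longrightarrow>
    Cmp U (ncmp t (tgt \<phi>)) (far M \<phi>) = Cmp U (far N \<phi>) (ncmp t (src \<phi>))"
  using functor_cat_hom_nat[of t Weil U M N \<phi>] by simp

lemma K_functor_hom: "is_functor Weil U (M :: ('k, 'o, 'm) wfctr) \<Longrightarrow> is_weil_hom \<phi> \<Longrightarrow> far M \<phi> \<in> hom U (fob M (src \<phi>)) (fob M (tgt \<phi>))"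
  using functor_hom[OF _ A.ar_hom, of U M \<phi>] by simp

lemma K_homI:
  assumes "is_functor Weil U M" "is_functor Weil U N"
    and "\<And>V. is_weil V \<Longrightarrow> c V \<in> hom U (fob M V) (fob N V)"
    and "\<And>\<phi>. is_weil_hom \<phi> \<Longrightarrow> Cmp U (c (tgt \<phi>)) (far M \<phi>) = Cmp U (far N \<phi>) (c (src \<phi>))"
  shows "\<lparr>nsrc = M, ntgt = N, ncmp = (\<lambda>V \<in> Ob Weil. c V)\<rparr> \<in> hom K M N"
  by (rule functor_cat_homI[OF assms(1,2) _ _ category_Weil]) (use assms(3,4) in auto)

lemma op2_hom:
  assumes w: "natural_op2 w" shows "op2 w \<in> hom K (pow_ob K RF 2) RF"
  unfolding op2_def
proof (rule K_homI[OF pow_K_functor RF_functor])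
  have p: "pow_pr K RF 2 0 \<in> hom K (pow_ob K RF 2) RF" "pow_pr K RF 2 1 \<in> hom K (pow_ob K RF 2) RF"
    by (simp_all add: pr_K)
  fix V :: "'k weil" assume V: "is_weil V"
  show "ap2 U (fob RF V) (w (talg V)) (ncmp (pow_pr K RF 2 0) V) (ncmp (pow_pr K RF 2 1) V)
      \<in> hom U (fob (pow_ob K RF 2) V) (fob RF V)"
    using ap2_hom[OF pow_ob_Ob K_hom_RF[OF p(1) V] K_hom_RF[OF p(2) V]] w V by (simp add: natural_op2_def)
next
  have p: "pow_pr K RF 2 0 \<in> hom K (pow_ob K RF 2) RF" "pow_pr K RF 2 1 \<in> hom K (pow_ob K RF 2) RF"
    by (simp_all add: pr_K)
  fix \<phi> :: "'k wmap" assume \<phi>: "is_weil_hom \<phi>"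
  note V = is_weil_homD(1,2)[OF \<phi>]
  show "Cmp U (ap2 U (fob RF (tgt \<phi>)) (w (talg (tgt \<phi>))) (ncmp (pow_pr K RF 2 0) (tgt \<phi>)) (ncmp (pow_pr K RF 2 1) (tgt \<phi>))) (far (pow_ob K RF 2) \<phi>) =
    Cmp U (far RF \<phi>) (ap2 U (fob RF (src \<phi>)) (w (talg (src \<phi>))) (ncmp (pow_pr K RF 2 0) (src \<phi>)) (ncmp (pow_pr K RF 2 1) (src \<phi>)))"
    using ap2_cmp[OF pow_ob_Ob K_hom_RF[OF p(1) V(2)] K_hom_RF[OF p(2) V(2)] _ K_functor_hom[OF pow_K_functor \<phi>], of "w (talg (tgt \<phi>))" "tcar (tgt \<phi>)"]
      w \<phi> V K_hom_nat[OF p(1) \<phi>] K_hom_nat[OF p(2) \<phi>] K_hom_RF[OF p(1) V(1)] K_hom_RF[OF p(2) V(1)]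
    by (simp add: natural_op2_def)
qed

lemma op1_hom:
  assumes w: "natural_op1 w" shows "op1 w \<in> hom K RF RF"
  unfolding op1_def
proof (rule K_homI[OF RF_functor RF_functor])
  show "w (talg V) \<in> hom U (fob RF V) (fob RF V)" if "is_weil V" for V :: "'k weil"
    using w that by (simp add: natural_op1_def)
  fix \<phi> :: "'k wmap" assume \<phi>: "is_weil_hom \<phi>"
  note V = is_weil_homD(1,2)[OF \<phi>]
  have i: "Ident U (tcar (src \<phi>)) \<in> hom U (tcar (src \<phi>)) (tcar (src \<phi>))" by (simp add: C.ident_hom)
  show "Cmp U (w (talg (tgt \<phi>))) (far RF \<phi>) = Cmp U (far RF \<phi>) (w (talg (src \<phi>)))"
    using w \<phi> V i C.cmp_ident_right[OF tensor_map_hom[of \<phi>]] C.cmp_ident_right[of "w (talg (src \<phi>))" "tcar (src \<phi>)" "tcar (src \<phi>)"]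
    unfolding natural_op1_def by (metis RF_simps(2))
qed

lemma op0_hom:
  assumes w: "natural_op0 w" shows "op0 w \<in> hom K (pow_ob K RF 0) RF"
  unfolding op0_def
proof (rule K_homI[OF pow_K_functor RF_functor])
  have PO: "fob (pow_ob K RF 0) V \<in> Ob U" if "is_weil V" for V using functor_simps(1)[OF pow_K_functor, of V 0] that by simp
  show "ap0 U (fob RF V) (w (talg V)) (fob (pow_ob K RF 0) V) \<in> hom U (fob (pow_ob K RF 0) V) (fob RF V)"
    if "is_weil V" for V :: "'k weil"
    using ap0_hom[OF pow_ob_Ob PO[OF that]] w that by (simp add: natural_op0_def)
  fix \<phi> :: "'k wmap" assume \<phi>: "is_weil_hom \<phi>"
  note V = is_weil_homD(1,2)[OF \<phi>]
  show "Cmp U (ap0 U (fob RF (tgt \<phi>)) (w (talg (tgt \<phi>))) (fob (pow_ob K RF 0) (tgt \<phi>))) (far (pow_ob K RF 0) \<phi>) =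
    Cmp U (far RF \<phi>) (ap0 U (fob RF (src \<phi>)) (w (talg (src \<phi>))) (fob (pow_ob K RF 0) (src \<phi>)))"
    using ap0_cmp[OF pow_ob_Ob _ K_functor_hom[OF pow_K_functor \<phi>], of "w (talg (tgt \<phi>))" "dim (tgt \<phi>)" "tcar (tgt \<phi>)"]
      w \<phi> V PO by (simp add: natural_op0_def)
qed

text \<open>The operations on generalised elements are computed at each Weil algebra separately.\<close>

lemma ncmp_op2_cmp:
  assumes w: "natural_op2 w" and V: "is_weil V" and u: "u \<in> hom U X (fob (pow_ob K RF 2) V)"
  shows "Cmp U (ncmp (op2 w) V) u = ap2 U (tcar V) (w (talg V))
    (Cmp U (ncmp (pow_pr K RF 2 0) V) u) (Cmp U (ncmp (pow_pr K RF 2 1) V) u)"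
proof -
  have p: "pow_pr K RF 2 0 \<in> hom K (pow_ob K RF 2) RF" "pow_pr K RF 2 1 \<in> hom K (pow_ob K RF 2) RF"
    by (simp_all add: pr_K)
  show ?thesis
    using ap2_cmp[OF pow_ob_Ob K_hom_RF[OF p(1) V] K_hom_RF[OF p(2) V] _ u, of "w (talg V)" "tcar V"] w V
    by (simp add: op2_def natural_op2_def)
qed

lemma ncmp_op0_cmp:
  assumes w: "natural_op0 w" and V: "is_weil V" and u: "u \<in> hom U X (fob (pow_ob K RF 0) V)"
  shows "Cmp U (ncmp (op0 w) V) u = ap0 U (tcar V) (w (talg V)) X"
  using ap0_cmp[OF pow_ob_Ob _ u, of "w (talg V)" "dim V" "tcar V"] w V by (simp add: op0_def natural_op0_def)

lemma ncmp_op1: "is_weil V \<Longrightarrow> ncmp (op1 w) V = w (talg V)"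
  by (simp add: op1_def)

lemma ncmp_ap2:
  assumes w: "natural_op2 w" and f: "f \<in> hom K X RF" and g: "g \<in> hom K X RF" and V: "is_weil V"
  shows "ncmp (ap2 K RF (op2 w) f g) V = ap2 U (tcar V) (w (talg V)) (ncmp f V) (ncmp g V)"
proof -
  let ?u = "tup K RF 2 X (\<lambda>i. if i = 0 then f else g)"
  note u = KP.pair_hom[OF RF_Ob f g]
  have uV: "Cmp U (ncmp (pow_pr K RF 2 0) V) (ncmp ?u V) = ncmp f V" "Cmp U (ncmp (pow_pr K RF 2 1) V) (ncmp ?u V) = ncmp g V"
    using arg_cong[OF u(2), of "\<lambda>t. ncmp t V"] arg_cong[OF u(3), of "\<lambda>t. ncmp t V"] V by simp_all
  show ?thesis
    unfolding KP.ap2_char[OF RF_Ob u] using ncmp_op2_cmp[OF w V K_hom_ncmp[OF u(1) V]] uV V by simp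
qed

lemma ncmp_ap0:
  assumes w: "natural_op0 w" and X: "X \<in> Ob K" and V: "is_weil V"
  shows "ncmp (ap0 K RF (op0 w) X) V = ap0 U (tcar V) (w (talg V)) (fob X V)"
  unfolding ap0_def[of K] using ncmp_op0_cmp[OF w V K_hom_ncmp[OF KP.terminal_hom[OF RF_Ob X] V]] V by simp

lemma RU_alg_ops: "KP.alg_ops (RU U R)"
  unfolding KP.alg_ops_def RU_simps using RF_Ob natural_ops op2_hom op1_hom op0_hom by blast

lemmas RU_op_hom = KP.alg_opsD[OF RU_alg_ops, unfolded RU_simps]

text \<open>Elements of \<open>R \<otimes> _\<close> at stage \<open>X\<close> are equal if their components at all \<open>V\<close> are, and there the laws
  are those of the algebra object \<open>R \<otimes> V\<close>.\<close>

theorem RU_kalg_object: "kalg_object K (RU U R)"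
proof (rule KP.kalg_objectI[OF RU_alg_ops])
  fix X assume X: "X \<in> Ob K"
  have H: "comm_alg (hom U (fob X V) (tcar V)) (ap2 U (tcar V) (aadd (talg V))) (ap2 U (tcar V) (amul (talg V)))
     (ap0 U (tcar V) (azero (talg V)) (fob X V)) (ap0 U (tcar V) (aone (talg V)) (fob X V))
     (Cmp U (aneg (talg V))) (\<lambda>c. Cmp U (ascal (talg V) c))" if V: "is_weil V" for V
  proof -
    have "hom_alg (talg V) (fob X V)"
      by (rule kalg_object_imp_hom_alg[OF talg_kalg_object[OF is_weil_structure[OF V]]])
        (use functor_simps(1)[of Weil U X V] X V in simp)
    thus ?thesis by (simp add: hom_alg_def)
  qed
  note closed [simp] = KP.ap2_hom[where X = X, OF RF_Ob _ _ RU_op_hom(2)] KP.ap2_hom[where X = X, OF RF_Ob _ _ RU_op_hom(3)]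
    KP.ap0_hom[OF RF_Ob X RU_op_hom(4)] KP.ap0_hom[OF RF_Ob X RU_op_hom(5)]
    FC.cmp_hom[where a = X, OF _ RU_op_hom(6)] FC.cmp_hom[where a = X, OF _ RU_op_hom(7)]
  note [simp] = K_hom_RF[where M = X] ncmp_ap2[where X = X] ncmp_ap0[OF _ X] ncmp_op1 natural_ops
  show "KP.hom_alg (RU U R) X" unfolding KP.hom_alg_def RU_simps
  proof
    fix x y z c d
    show "ap0 K RF (op0 azero) X \<in> hom K X RF" "ap0 K RF (op0 aone) X \<in> hom K X RF" by simp_all
    assume x [simp]: "x \<in> hom K X RF"
    show "Cmp K (op1 aneg) x \<in> hom K X RF" "Cmp K (op1 (\<lambda>B. ascal B c)) x \<in> hom K X RF" by simp_all
    show "ap2 K RF (op2 aadd) (ap0 K RF (op0 azero) X) x = x"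
      by (rule K_eqI[of _ X RF]) (simp_all add: comm_alg.add_zero[OF H])
    show "ap2 K RF (op2 aadd) (Cmp K (op1 aneg) x) x = ap0 K RF (op0 azero) X"
      by (rule K_eqI[of _ X RF]) (simp_all add: comm_alg.add_neg[OF H])
    show "ap2 K RF (op2 amul) (ap0 K RF (op0 aone) X) x = x"
      by (rule K_eqI[of _ X RF]) (simp_all add: comm_alg.mul_one[OF H])
    show "Cmp K (op1 (\<lambda>B. ascal B (c + d))) x =
        ap2 K RF (op2 aadd) (Cmp K (op1 (\<lambda>B. ascal B c)) x) (Cmp K (op1 (\<lambda>B. ascal B d)) x)"
      by (rule K_eqI[of _ X RF]) (simp_all add: comm_alg.scal_plus[OF H])
    show "Cmp K (op1 (\<lambda>B. ascal B (c * d))) x = Cmp K (op1 (\<lambda>B. ascal B c)) (Cmp K (op1 (\<lambda>B. ascal B d)) x)"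
      by (rule K_eqI[of _ X RF]) (simp_all add: comm_alg.scal_times[OF H])
    show "Cmp K (op1 (\<lambda>B. ascal B 1)) x = x"
      by (rule K_eqI[of _ X RF]) (simp_all add: comm_alg.scal_one[OF H])
    assume y [simp]: "y \<in> hom K X RF"
    show "ap2 K RF (op2 aadd) x y \<in> hom K X RF" "ap2 K RF (op2 amul) x y \<in> hom K X RF" by simp_all
    show "ap2 K RF (op2 aadd) x y = ap2 K RF (op2 aadd) y x"
      by (rule K_eqI[of _ X RF]) (simp_all add: comm_alg.add_comm[OF H, of _ "ncmp x _"])
    show "ap2 K RF (op2 amul) x y = ap2 K RF (op2 amul) y x"
      by (rule K_eqI[of _ X RF]) (simp_all add: comm_alg.mul_comm[OF H, of _ "ncmp x _"])
    show "Cmp K (op1 (\<lambda>B. ascal B c)) (ap2 K RF (op2 aadd) x y) =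
        ap2 K RF (op2 aadd) (Cmp K (op1 (\<lambda>B. ascal B c)) x) (Cmp K (op1 (\<lambda>B. ascal B c)) y)"
      by (rule K_eqI[of _ X RF]) (simp_all add: comm_alg.scal_add[OF H])
    show "Cmp K (op1 (\<lambda>B. ascal B c)) (ap2 K RF (op2 amul) x y) =
        ap2 K RF (op2 amul) (Cmp K (op1 (\<lambda>B. ascal B c)) x) y"
      by (rule K_eqI[of _ X RF]) (simp_all add: comm_alg.scal_mul[OF H])
    assume z [simp]: "z \<in> hom K X RF"
    show "ap2 K RF (op2 aadd) (ap2 K RF (op2 aadd) x y) z = ap2 K RF (op2 aadd) x (ap2 K RF (op2 aadd) y z)"
      by (rule K_eqI[of _ X RF]) (simp_all add: comm_alg.add_assoc[OF H])
    show "ap2 K RF (op2 amul) (ap2 K RF (op2 amul) x y) z = ap2 K RF (op2 amul) x (ap2 K RF (op2 amul) y z)"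
      by (rule K_eqI[of _ X RF]) (simp_all add: comm_alg.mul_assoc[OF H])
    show "ap2 K RF (op2 amul) (ap2 K RF (op2 aadd) x y) z =
        ap2 K RF (op2 aadd) (ap2 K RF (op2 amul) x z) (ap2 K RF (op2 amul) y z)"
      by (rule K_eqI[of _ X RF]) (simp_all add: comm_alg.mul_add[OF H])
  qed
qed

sublocale KA: alg_in K "RU U R"
  by unfold_locales (rule RU_kalg_object)

lemma ncmp_asum:
  assumes X: "X \<in> Ob K" and f: "\<And>i. i < n \<Longrightarrow> f i \<in> hom K X RF" and V: "is_weil V"
  shows "ncmp (asum K (RU U R) X n f) V = asum U (talg V) (fob X V) n (\<lambda>i. ncmp (f i) V)"
  using f
proof (induction n)
  case 0
  show ?case using ncmp_ap0[OF natural_ops(3) X V] by simp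
next
  case (Suc n)
  have "asum K (RU U R) X n f \<in> hom K X RF" using KA.asum_hom[OF X, of n f] Suc.prems by simp
  thus ?case using Suc ncmp_ap2[OF natural_ops(1) _ _ V] by simp
qed

end

section \<open>The functors \<open>T\<^sup>W\<close>, the transformations \<open>\<alpha>\<close> and the coherence isomorphisms\<close>

context weil_functors begin

abbreviation T :: "'k weil \<Rightarrow>
    (('k, 'o, 'm) wfctr, ('k, 'o, 'm) wntrans, ('k, 'o, 'm) wfctr, ('k, 'o, 'm) wntrans) fctr"
  where "T \<equiv> TU U"

lemma fob_tens_right [simp]: "is_weil V \<Longrightarrow> fob (tens_right W) V = V \<otimes>\<^sub>W W"
  and far_tens_right [simp]: "is_weil_hom \<phi> \<Longrightarrow> far (tens_right W) \<phi> = \<phi> \<otimes>\<^sub>M wid W"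
  by (simp_all add: tens_right_def)

lemma fob_T: "is_functor Weil U M \<Longrightarrow> fob (T W) M = fcomp Weil M (tens_right W)"
  by (simp add: TU_def KU_def)

lemma far_T: "is_ntrans Weil U t \<Longrightarrow> far (T W) t =
    \<lparr>nsrc = fob (T W) (nsrc t), ntgt = fob (T W) (ntgt t), ncmp = (\<lambda>V \<in> Ob Weil. ncmp t (V \<otimes>\<^sub>W W))\<rparr>"
  by (simp add: TU_def KU_def ntrans_simps)

lemma T_simps [simp]:
  assumes "is_functor Weil U M"
  shows "is_weil V \<Longrightarrow> fob (fob (T W) M) V = fob M (V \<otimes>\<^sub>W W)"
    and "is_weil_hom \<phi> \<Longrightarrow> far (fob (T W) M) \<phi> = far M (\<phi> \<otimes>\<^sub>M wid W)"
  using assms by (simp_all add: fob_T)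

lemma T_functor_ob [simp]: "is_weil W \<Longrightarrow> is_functor Weil U M \<Longrightarrow> is_functor Weil U (fob (T W) M)"
  unfolding fob_T by (rule fcomp_functor[OF category_Weil tens_right_functor])

lemma ncmp_far_T [simp]: "is_ntrans Weil U t \<Longrightarrow> is_weil V \<Longrightarrow> ncmp (far (T W) t) V = ncmp t (V \<otimes>\<^sub>W W)"
  by (simp add: far_T)

lemma far_T_hom:
  assumes W: "is_weil W" and t: "t \<in> hom K M N"
  shows "far (T W) t \<in> hom K (fob (T W) M) (fob (T W) N)"
proof -
  have nt: "is_ntrans Weil U t" "nsrc t = M" "ntgt t = N" using t by (auto simp: functor_cat_hom)
  have M: "is_functor Weil U M" "is_functor Weil U N" using ntrans_simps(1,2)[OF nt(1)] nt by auto
  show ?thesis unfolding far_T[OF nt(1)] nt(2,3)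
  proof (rule K_homI)
    show "ncmp t (V \<otimes>\<^sub>W W) \<in> hom U (fob (fob (T W) M) V) (fob (fob (T W) N) V)" if "is_weil V" for V
      using K_hom_ncmp[OF t is_weil_wtens[OF that W]] that M by simp
    fix \<phi> :: "'k wmap" assume \<phi>: "is_weil_hom \<phi>"
    show "Cmp U (ncmp t (tgt \<phi> \<otimes>\<^sub>W W)) (far (fob (T W) M) \<phi>) = Cmp U (far (fob (T W) N) \<phi>) (ncmp t (src \<phi> \<otimes>\<^sub>W W))"
      using K_hom_nat[OF t is_weil_hom_mtens[OF \<phi> is_weil_hom_wid[OF W]]] M \<phi> by simp
  qed (use M W in auto)
qed

lemma T_functor:
  assumes W: "is_weil W" shows "is_functor K K (T W)"
proof (rule is_functorI)
  show "fob (T W) \<in> extensional (Ob K)" "far (T W) \<in> extensional (Ar K)" by (simp_all add: TU_def KU_def)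
  show "fob (T W) M \<in> Ob K" if "M \<in> Ob K" for M using that W by simp
  show "far (T W) t \<in> hom K (fob (T W) (Dom K t)) (fob (T W) (Cod K t))" if "t \<in> Ar K" for t
    by (rule far_T_hom[OF W FC.ar_hom[OF that]])
  show "far (T W) (Ident K M) = Ident K (fob (T W) M)" if M: "M \<in> Ob K" for M
  proof (rule K_eqI[OF far_T_hom[OF W FC.ident_hom[OF M]] FC.ident_hom])
    show "fob (T W) M \<in> Ob K" using W M by simp
    fix V :: "'k weil" assume V: "is_weil V"
    have "is_ntrans Weil U (Ident K M)" using FC.ident_simps(1)[OF M] by simp
    thus "ncmp (far (T W) (Ident K M)) V = ncmp (Ident K (fob (T W) M)) V"
      using V W M by (simp add: is_weil_wtens)
  qed
  show "far (T W) (Cmp K t s) = Cmp K (far (T W) t) (far (T W) s)"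
    if st: "s \<in> Ar K" "t \<in> Ar K" "Cod K s = Dom K t" for s t
  proof -
    have s: "s \<in> hom K (nsrc s) (nsrc t)" and t: "t \<in> hom K (nsrc t) (ntgt t)" using st by (auto simp: functor_cat_hom)
    note ts = FC.cmp_hom[OF s t]
    have nt: "is_ntrans Weil U (Cmp K t s)" "is_ntrans Weil U t" "is_ntrans Weil U s" using ts s t by (simp_all add: functor_cat_hom)
    show ?thesis
      by (rule K_eqI[OF far_T_hom[OF W ts] FC.cmp_hom[OF far_T_hom[OF W s] far_T_hom[OF W t]]])
        (use nt W in \<open>simp add: is_weil_wtens\<close>)
  qed
qed

text \<open>Limits in \<open>K\<close> are pointwise, and the value of \<open>T\<^sup>W \<circ> D\<close> at \<open>V\<close> is that of \<open>D\<close> at \<open>V \<otimes> W\<close>.\<close>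

lemma T_limit:
  assumes W: "is_weil W" and J: "category J" "has_limits_of_shape J U" and D: "is_functor J K D"
    and L: "is_limit J K D L c"
  shows "is_limit J K (fcomp J (T W) D) (fob (T W) L) (\<lambda>j. far (T W) (c j))"
proof -
  note TW = T_functor[OF W]
  have pw: "pointwise_limit J Weil U D L c" by (rule limit_imp_pointwise[OF J(1) D J(2) L])
  hence cone: "is_cone J K D L c" by (simp add: pointwise_limit_def)
  have LF: "is_functor Weil U L" using cone by (simp add: is_cone_def)
  have c: "c j \<in> hom K L (fob D j)" if "j \<in> Ob J" for j using cone that by (simp add: is_cone_def)
  show ?thesis
  proof (rule pointwise_imp_limit[OF J(1) fcomp_functor[OF J(1) D TW]])
    have "is_cone J K (fcomp J (T W) D) (fob (T W) L) (\<lambda>j. far (T W) (c j))"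
      unfolding is_cone_def
    proof (intro conjI ballI)
      show "fob (T W) L \<in> Ob K" using W LF by simp
      show "far (T W) (c j) \<in> hom K (fob (T W) L) (fob (fcomp J (T W) D) j)" if "j \<in> Ob J" for j
        using far_T_hom[OF W c[OF that]] that by simp
      fix u assume u: "u \<in> Ar J"
      note d = category.dom_ob[OF J(1) u]
      show "Cmp K (far (fcomp J (T W) D) u) (far (T W) (c (Dom J u))) = far (T W) (c (Cod J u))"
        using functor_cmp[OF TW c[OF d] functor_hom[OF D category.ar_hom[OF J(1) u]]] cone u by (simp add: is_cone_def)
    qed
    moreover have "is_limit J U (eval_at J (fcomp J (T W) D) V) (fob (fob (T W) L) V) (\<lambda>j. ncmp (far (T W) (c j)) V)"
      if V: "is_weil V" for V
    proof -
      have "eval_at J (fcomp J (T W) D) V = eval_at J D (V \<otimes>\<^sub>W W)"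
        using functor_simps(1,2)[OF D] V by (auto simp: eval_at_def fun_eq_iff)
      moreover have "is_limit J U (eval_at J D (V \<otimes>\<^sub>W W)) (fob L (V \<otimes>\<^sub>W W)) (\<lambda>j. ncmp (c j) (V \<otimes>\<^sub>W W))"
        using pw is_weil_wtens[OF V W] by (simp add: pointwise_limit_def)
      ultimately have "is_limit J U (eval_at J (fcomp J (T W) D) V) (fob (fob (T W) L) V) (\<lambda>j. ncmp (c j) (V \<otimes>\<^sub>W W))"
        using LF V by simp
      thus ?thesis
        by (rule limit_cong) (use c V J in \<open>auto simp: functor_cat_hom\<close>)
    qed
    ultimately show "pointwise_limit J Weil U (fcomp J (T W) D) (fob (T W) L) (\<lambda>j. far (T W) (c j))"
      by (simp add: pointwise_limit_def)
  qed
qed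

lemma T_left_exact: "is_weil W \<Longrightarrow> left_exact_functor K K (T W)"
  unfolding left_exact_functor_def
  by (intro conjI allI impI T_functor T_limit)
    (use left_exact in \<open>auto simp: finite_shape_def left_exact_cat_def\<close>)

lemma T_power:
  assumes W: "is_weil W" and M: "M \<in> Ob K" and P: "is_power K M n P p"
  shows "is_power K (fob (T W) M) n (fob (T W) P) (\<lambda>i. far (T W) (p i))"
proof -
  have TM: "fob (T W) M \<in> Ob K" using W M by simp
  note J = category_disc[of n] left_exact_shape[OF left_exact, of n]
  have D: "is_functor (disc n) K (family K n (\<lambda>_. M))" using M by (rule FC.family_functor)
  have "fcomp (disc n) (T W) (family K n (\<lambda>_. M)) = family K n (\<lambda>_. fob (T W) M)"
    using functor_simps(5)[OF T_functor[OF W] M] by (auto simp: fcomp_def family_def fun_eq_iff)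
  thus ?thesis
    using T_limit[OF W J D] P unfolding FC.is_power_iff_limit[OF M] FC.is_power_iff_limit[OF TM] by simp
qed

sublocale KK: two_cats K K
  by unfold_locales

text \<open>Both \<open>\<alpha>\<^sub>\<phi>\<close> and the comparison of \<open>T\<^bsup>W\<^sub>2\<^esup> \<circ> T\<^bsup>W\<^sub>1\<^esup>\<close> with \<open>T\<^bsup>W\<^sub>1 \<otimes> W\<^sub>2\<^esup>\<close> arise by applying functors \<open>M\<close> to
  the homomorphisms \<open>V \<otimes> \<tau>\<close>, for a fixed \<open>\<tau>\<close>. Naturality in \<open>V\<close> is the interchange law for \<open>\<otimes>\<close>,
  naturality in \<open>M\<close> is naturality of the arrows of \<open>K\<close> at \<open>V \<otimes> \<tau>\<close>. The functors \<open>S\<close> and \<open>S'\<close> are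
  given by their values in order to cover composites.\<close>

lemma apply_natural_hom:
  assumes S: "is_functor K K S" and S': "is_functor K K S'" and \<tau>: "is_weil_hom \<tau>"
    and fobS: "\<And>M V. \<lbrakk>is_functor Weil U M; is_weil V\<rbrakk> \<Longrightarrow> fob (fob S M) V = fob M (V \<otimes>\<^sub>W src \<tau>)"
    and fobS': "\<And>M V. \<lbrakk>is_functor Weil U M; is_weil V\<rbrakk> \<Longrightarrow> fob (fob S' M) V = fob M (V \<otimes>\<^sub>W tgt \<tau>)"
    and farS: "\<And>M \<phi>. \<lbrakk>is_functor Weil U M; is_weil_hom \<phi>\<rbrakk> \<Longrightarrow> far (fob S M) \<phi> = far M (\<phi> \<otimes>\<^sub>M wid (src \<tau>))"
    and farS': "\<And>M \<phi>. \<lbrakk>is_functor Weil U M; is_weil_hom \<phi>\<rbrakk> \<Longrightarrow> far (fob S' M) \<phi> = far M (\<phi> \<otimes>\<^sub>M wid (tgt \<tau>))"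
    and ncmpS: "\<And>t V. \<lbrakk>is_ntrans Weil U t; is_weil V\<rbrakk> \<Longrightarrow> ncmp (far S t) V = ncmp t (V \<otimes>\<^sub>W src \<tau>)"
    and ncmpS': "\<And>t V. \<lbrakk>is_ntrans Weil U t; is_weil V\<rbrakk> \<Longrightarrow> ncmp (far S' t) V = ncmp t (V \<otimes>\<^sub>W tgt \<tau>)"
  shows "\<lparr>nsrc = S, ntgt = S', ncmp = (\<lambda>M \<in> Ob K. \<lparr>nsrc = fob S M, ntgt = fob S' M,
     ncmp = (\<lambda>V \<in> Ob Weil. far M (wid V \<otimes>\<^sub>M \<tau>))\<rparr>)\<rparr> \<in> hom (functor_cat K K) S S'"
proof (rule functor_cat_homI[OF S S' _ _ FC.category_axioms])
  have \<tau>V: "is_weil_hom (wid V \<otimes>\<^sub>M \<tau>)" if "is_weil V" for V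
    using is_weil_hom_mtens[OF is_weil_hom_wid[OF that] \<tau>] .
  show c: "\<lparr>nsrc = fob S M, ntgt = fob S' M, ncmp = (\<lambda>V \<in> Ob Weil. far M (wid V \<otimes>\<^sub>M \<tau>))\<rparr> \<in> hom K (fob S M) (fob S' M)"
    if "M \<in> Ob K" for M
  proof (rule K_homI)
    have M: "is_functor Weil U M" using that by simp
    show "is_functor Weil U (fob S M)" "is_functor Weil U (fob S' M)"
      using functor_simps(1)[OF S that] functor_simps(1)[OF S' that] by simp_all
    show "far M (wid V \<otimes>\<^sub>M \<tau>) \<in> hom U (fob (fob S M) V) (fob (fob S' M) V)" if "is_weil V" for V
      using K_functor_hom[OF M \<tau>V[OF that]] that M by (simp add: fobS fobS')
    fix \<phi> :: "'k wmap" assume \<phi>: "is_weil_hom \<phi>"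
    note V = is_weil_homD(1,2)[OF \<phi>]
    have 1: "is_weil_hom (\<phi> \<otimes>\<^sub>M wid (src \<tau>))" "is_weil_hom (\<phi> \<otimes>\<^sub>M wid (tgt \<tau>))"
      using is_weil_hom_mtens[OF \<phi> is_weil_hom_wid] is_weil_homD(1,2)[OF \<tau>] by auto
    show "Cmp U (far M (wid (tgt \<phi>) \<otimes>\<^sub>M \<tau>)) (far (fob S M) \<phi>) = Cmp U (far (fob S' M) \<phi>) (far M (wid (src \<phi>) \<otimes>\<^sub>M \<tau>))"
      using functor_simps(6)[OF M, of "\<phi> \<otimes>\<^sub>M wid (src \<tau>)" "wid (tgt \<phi>) \<otimes>\<^sub>M \<tau>"]
        functor_simps(6)[OF M, of "wid (src \<phi>) \<otimes>\<^sub>M \<tau>" "\<phi> \<otimes>\<^sub>M wid (tgt \<tau>)"]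
        mtens_interchange[OF \<phi> \<tau>] 1 \<tau>V[OF V(1)] \<tau>V[OF V(2)] M \<phi> by (simp add: farS farS')
  qed
  fix t assume "t \<in> Ar K"
  hence nt: "is_ntrans Weil U t" by simp
  note MN = ntrans_simps(1,2)[OF nt]
  have t: "t \<in> hom K (nsrc t) (ntgt t)" using nt by (simp add: functor_cat_hom)
  note ch = c[of "nsrc t"] c[of "ntgt t"]
  show "Cmp K \<lparr>nsrc = fob S (Cod K t), ntgt = fob S' (Cod K t), ncmp = (\<lambda>V \<in> Ob Weil. far (Cod K t) (wid V \<otimes>\<^sub>M \<tau>))\<rparr> (far S t) =
    Cmp K (far S' t) \<lparr>nsrc = fob S (Dom K t), ntgt = fob S' (Dom K t), ncmp = (\<lambda>V \<in> Ob Weil. far (Dom K t) (wid V \<otimes>\<^sub>M \<tau>))\<rparr>"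
    unfolding functor_cat_simps
  proof (rule K_eqI[OF FC.cmp_hom[OF functor_hom[OF S t] ch(2)] FC.cmp_hom[OF ch(1) functor_hom[OF S' t]]])
    fix V :: "'k weil" assume V: "is_weil V"
    show "ncmp (Cmp K \<lparr>nsrc = fob S (ntgt t), ntgt = fob S' (ntgt t), ncmp = (\<lambda>V \<in> Ob Weil. far (ntgt t) (wid V \<otimes>\<^sub>M \<tau>))\<rparr> (far S t)) V =
      ncmp (Cmp K (far S' t) \<lparr>nsrc = fob S (nsrc t), ntgt = fob S' (nsrc t), ncmp = (\<lambda>V \<in> Ob Weil. far (nsrc t) (wid V \<otimes>\<^sub>M \<tau>))\<rparr>) V"
      using K_hom_nat[OF t \<tau>V[OF V]] V nt by (simp add: ncmpS ncmpS')
  qed (use MN in auto)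
qed

subsection \<open>The transformations \<open>\<alpha>\<close>\<close>

lemma alpha_hom:
  assumes \<phi>: "is_weil_hom \<phi>"
  shows "alphaU U \<phi> \<in> hom (functor_cat K K) (T (src \<phi>)) (T (tgt \<phi>))"
proof -
  note W = is_weil_homD(1,2)[OF \<phi>]
  show ?thesis unfolding alphaU_def KU_def
    by (rule apply_natural_hom[OF T_functor[OF W(1)] T_functor[OF W(2)] \<phi>]) simp_all
qed

lemma alpha_ncmp [simp]:
  "is_functor Weil U M \<Longrightarrow> is_weil V \<Longrightarrow> ncmp (ncmp (alphaU U \<phi>) M) V = far M (wid V \<otimes>\<^sub>M \<phi>)"
  by (simp add: alphaU_def KU_def)

lemma KK_eqI:
  assumes s: "s \<in> hom (functor_cat K K) S S'" and t: "t \<in> hom (functor_cat K K) S S'"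
    and eq: "\<And>M V. \<lbrakk>is_functor Weil U M; is_weil V\<rbrakk> \<Longrightarrow> ncmp (ncmp s M) V = ncmp (ncmp t M) V"
  shows "s = t"
proof (rule functor_cat_hom_eqI[OF s t])
  fix M assume "M \<in> Ob K"
  thus "ncmp s M = ncmp t M"
    using functor_cat_hom_ncmp[OF s] functor_cat_hom_ncmp[OF t] eq by (intro K_eqI) auto
qed

lemma alpha_comp:
  assumes \<phi>: "is_weil_hom \<phi>" and \<psi>: "is_weil_hom \<psi>" and eq: "tgt \<phi> = src \<psi>"
  shows "Cmp (functor_cat K K) (alphaU U \<psi>) (alphaU U \<phi>) = alphaU U (wcomp \<psi> \<phi>)"
proof (rule KK_eqI)
  show "Cmp (functor_cat K K) (alphaU U \<psi>) (alphaU U \<phi>) \<in> hom (functor_cat K K) (T (src \<phi>)) (T (tgt \<psi>))"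
    using KK.FC.cmp_hom[OF alpha_hom[OF \<phi>, unfolded eq] alpha_hom[OF \<psi>]] .
  show "alphaU U (wcomp \<psi> \<phi>) \<in> hom (functor_cat K K) (T (src \<phi>)) (T (tgt \<psi>))"
    using alpha_hom[OF is_weil_hom_wcomp[OF \<phi> \<psi> eq]] by simp
  fix M :: "('k, 'o, 'm) wfctr" and V assume M: "is_functor Weil U M" and V: "is_weil (V :: 'k weil)"
  have "wcomp (wid V) (wid V) = wid V" using A.cmp_ident(1)[of "wid V" V] is_weil_hom_wid[OF V] by simp
  thus "ncmp (ncmp (Cmp (functor_cat K K) (alphaU U \<psi>) (alphaU U \<phi>)) M) V = ncmp (ncmp (alphaU U (wcomp \<psi> \<phi>)) M) V"
    using functor_simps(6)[OF M, of "wid V \<otimes>\<^sub>M \<phi>" "wid V \<otimes>\<^sub>M \<psi>"] mtens_wcomp[of "wid V" "wid V" \<phi> \<psi>] M V \<phi> \<psi> eq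
    by (simp add: is_weil_hom_mtens is_weil_hom_wid)
qed

lemma alpha_id:
  assumes W: "is_weil W"
  shows "alphaU U (wid W) = Ident (functor_cat K K) (T W)"
proof (rule KK_eqI)
  show "alphaU U (wid W) \<in> hom (functor_cat K K) (T W) (T W)" using alpha_hom[OF is_weil_hom_wid[OF W]] by simp
  show "Ident (functor_cat K K) (T W) \<in> hom (functor_cat K K) (T W) (T W)"
    using T_functor[OF W] by (intro KK.FC.ident_hom) simp
  fix M :: "('k, 'o, 'm) wfctr" and V assume M: "is_functor Weil U M" and V: "is_weil (V :: 'k weil)"
  show "ncmp (ncmp (alphaU U (wid W)) M) V = ncmp (ncmp (Ident (functor_cat K K) (T W)) M) V"
    using M V W functor_simps(5)[OF M, of "V \<otimes>\<^sub>W W"] by (simp add: mtens_wid is_weil_dim is_weil_wtens)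
qed

subsection \<open>The identifications of the composites\<close>

lemma T_ground: "T ground = fid K"
proof (rule functor_eqI[OF T_functor[OF is_weil_ground] fid_functor[OF FC.category_axioms]])
  have ob: "fob (T ground) M = M" if "is_functor Weil U M" for M
    by (rule functor_eqI[OF T_functor_ob[OF is_weil_ground that] that]) (use that in auto)
  show "fob (T ground) M = fob (fid K) M" if "M \<in> Ob K" for M using ob that by simp
  show "far (T ground) t = far (fid K) t" if t: "t \<in> Ar K" for t
  proof -
    have nt: "is_ntrans Weil U t" using t by simp
    have h: "t \<in> hom K (nsrc t) (ntgt t)" using nt by (simp add: functor_cat_hom)
    have "far (T ground) t \<in> hom K (nsrc t) (ntgt t)"
      using far_T_hom[OF is_weil_ground h] ob ntrans_simps(1,2)[OF nt] by simp
    hence "far (T ground) t = t" by (rule K_eqI[OF _ h]) (use nt in simp)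
    thus ?thesis using t by simp
  qed
qed

lemma upsilon_iso: "upsilonU U \<in> iso_hom (functor_cat K K) (T ground) (fid K)"
  unfolding upsilonU_def KU_def T_ground
  by (rule KK.FC.iso_ident) (simp add: fid_functor FC.category_axioms)

lemma upsilon_ncmp: "M \<in> Ob K \<Longrightarrow> ncmp (upsilonU U) M = Ident K M"
  by (simp add: upsilonU_def KU_def)

lemma mu_ncmp [simp]:
  "is_functor Weil U M \<Longrightarrow> is_weil V \<Longrightarrow> ncmp (ncmp (muU U W\<^sub>1 W\<^sub>2) M) V = far M (wid V \<otimes>\<^sub>M wswap W\<^sub>2 W\<^sub>1)"
  by (simp add: muU_def KU_def)

lemma mu_hom:
  assumes W: "is_weil W\<^sub>1" "is_weil W\<^sub>2"
  shows "muU U W\<^sub>1 W\<^sub>2 \<in> hom (functor_cat K K) (fcomp K (T W\<^sub>2) (T W\<^sub>1)) (T (W\<^sub>1 \<otimes>\<^sub>W W\<^sub>2))"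
proof -
  have fc: "is_functor K K (fcomp K (T W\<^sub>2) (T W\<^sub>1))"
    by (rule fcomp_functor[OF FC.category_axioms T_functor[OF W(1)] T_functor[OF W(2)]])
  have far: "is_ntrans Weil U (far (T W\<^sub>1) t)" if "is_ntrans Weil U t" for t
    using functor_simps(2)[OF T_functor[OF W(1)], of t] that by simp
  have d: "wid W\<^sub>2 \<otimes>\<^sub>M wid W\<^sub>1 = wid (W\<^sub>2 \<otimes>\<^sub>W W\<^sub>1)" using is_weil_dim[OF W(1)] by (rule mtens_wid)
  have eq: "muU U W\<^sub>1 W\<^sub>2 = \<lparr>nsrc = fcomp K (T W\<^sub>2) (T W\<^sub>1), ntgt = T (W\<^sub>1 \<otimes>\<^sub>W W\<^sub>2),
     ncmp = (\<lambda>M \<in> Ob K. \<lparr>nsrc = fob (fcomp K (T W\<^sub>2) (T W\<^sub>1)) M, ntgt = fob (T (W\<^sub>1 \<otimes>\<^sub>W W\<^sub>2)) M,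
       ncmp = (\<lambda>V \<in> Ob Weil. far M (wid V \<otimes>\<^sub>M wswap W\<^sub>2 W\<^sub>1))\<rparr>)\<rparr>"
    by (simp add: muU_def KU_def fun_eq_iff restrict_def)
  show ?thesis unfolding eq
    by (rule apply_natural_hom[OF fc T_functor[OF is_weil_wtens[OF W]] is_weil_hom_wswap[OF W(2,1)]])
      (use W far in \<open>simp_all add: is_weil_wtens wtens_assoc mtens_assoc d is_weil_hom_mtens is_weil_hom_wid\<close>)
qed

lemma functor_iso:
  assumes M: "is_functor Weil U (M :: ('k, 'o, 'm) wfctr)" and \<phi>: "is_weil_hom \<phi>" "is_weil_hom \<psi>"
    and "wcomp \<psi> \<phi> = wid (src \<phi>)" "wcomp \<phi> \<psi> = wid (tgt \<phi>)" "src \<psi> = tgt \<phi>" "tgt \<psi> = src \<phi>"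
  shows "far M \<phi> \<in> iso_hom U (fob M (src \<phi>)) (fob M (tgt \<phi>))"
proof (rule C.iso_homI[OF K_functor_hom[OF M \<phi>(1)]])
  show "far M \<psi> \<in> hom U (fob M (tgt \<phi>)) (fob M (src \<phi>))" using K_functor_hom[OF M \<phi>(2)] assms by simp
  show "Cmp U (far M \<psi>) (far M \<phi>) = Ident U (fob M (src \<phi>))"
    using functor_simps(6)[OF M, of \<phi> \<psi>] functor_simps(5)[OF M, of "src \<phi>"] assms is_weil_homD(1)[OF \<phi>(1)] by simp
  show "Cmp U (far M \<phi>) (far M \<psi>) = Ident U (fob M (tgt \<phi>))"
    using functor_simps(6)[OF M, of \<psi> \<phi>] functor_simps(5)[OF M, of "tgt \<phi>"] assms is_weil_homD(2)[OF \<phi>(1)] by simp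
qed

lemma wid_wswap_inverse:
  assumes "is_weil (V :: 'k weil)" "is_weil W\<^sub>1" "is_weil W\<^sub>2"
  shows "wcomp (wid V \<otimes>\<^sub>M wswap W\<^sub>1 W\<^sub>2) (wid V \<otimes>\<^sub>M wswap W\<^sub>2 W\<^sub>1) = wid (V \<otimes>\<^sub>W W\<^sub>2 \<otimes>\<^sub>W W\<^sub>1)"
proof -
  have "wcomp (wid V) (wid V) = wid V" using A.cmp_ident(1)[of "wid V" V] is_weil_hom_wid[OF assms(1)] by simp
  thus ?thesis using assms by (simp add: mtens_wcomp wswap_wswap mtens_wid is_weil_dim)
qed

lemma mu_iso:
  assumes W: "is_weil W\<^sub>1" "is_weil W\<^sub>2"
  shows "muU U W\<^sub>1 W\<^sub>2 \<in> iso_hom (functor_cat K K) (fcomp K (T W\<^sub>2) (T W\<^sub>1)) (T (W\<^sub>1 \<otimes>\<^sub>W W\<^sub>2))"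
proof (rule KK.functor_cat_isoI[OF mu_hom[OF W]])
  fix M assume M: "M \<in> Ob K"
  hence MF: "is_functor Weil U M" by simp
  show "ncmp (muU U W\<^sub>1 W\<^sub>2) M \<in> iso_hom K (fob (fcomp K (T W\<^sub>2) (T W\<^sub>1)) M) (fob (T (W\<^sub>1 \<otimes>\<^sub>W W\<^sub>2)) M)"
  proof (rule functor_cat_isoI[OF functor_cat_hom_ncmp[OF mu_hom[OF W] M]])
    fix V :: "'k weil" assume "V \<in> Ob Weil"
    hence V: "is_weil V" by simp
    have "far M (wid V \<otimes>\<^sub>M wswap W\<^sub>2 W\<^sub>1) \<in> iso_hom U (fob M (src (wid V \<otimes>\<^sub>M wswap W\<^sub>2 W\<^sub>1))) (fob M (tgt (wid V \<otimes>\<^sub>M wswap W\<^sub>2 W\<^sub>1)))"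
      by (rule functor_iso[OF MF, of _ "wid V \<otimes>\<^sub>M wswap W\<^sub>1 W\<^sub>2"])
        (use V W in \<open>simp_all add: is_weil_hom_mtens is_weil_hom_wid is_weil_hom_wswap wid_wswap_inverse\<close>)
    thus "ncmp (ncmp (muU U W\<^sub>1 W\<^sub>2) M) V \<in> iso_hom U (fob (fob (fcomp K (T W\<^sub>2) (T W\<^sub>1)) M) V) (fob (fob (T (W\<^sub>1 \<otimes>\<^sub>W W\<^sub>2)) M) V)"
      using MF V W by (simp add: wtens_assoc is_weil_wtens)
  qed
qed

lemma mu_ncmp_hom:
  assumes W: "is_weil W\<^sub>1" "is_weil W\<^sub>2" and M: "M \<in> Ob K"
  shows "ncmp (muU U W\<^sub>1 W\<^sub>2) M \<in> hom K (fob (T W\<^sub>2) (fob (T W\<^sub>1) M)) (fob (T (W\<^sub>1 \<otimes>\<^sub>W W\<^sub>2)) M)"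
  using functor_cat_hom_ncmp[OF mu_hom[OF W] M] fcomp_simps(1)[OF M] by metis

subsection \<open>Coherence\<close>

lemma mu_ground:
  assumes W: "is_weil W" and M: "M \<in> Ob K"
  shows "ncmp (muU U ground W) M = far (T W) (ncmp (upsilonU U) M)"
    and "ncmp (muU U W ground) M = ncmp (upsilonU U) (fob (T W) M)"
proof -
  have MF: "is_functor Weil U M" using M by simp
  have TM: "fob (T W) M \<in> Ob K" using W M by simp
  have g: "fob (T ground) N = N" if "N \<in> Ob K" for N using that by (simp add: T_ground)
  have id: "far (T W) (Ident K M) = Ident K (fob (T W) M)" by (rule functor_simps(5)[OF T_functor[OF W] M])
  note i = FC.ident_hom[OF TM]
  have dW: "0 < dim W" "0 < dim (ground :: 'k weil)" using is_weil_dim[OF W] by auto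
  have F: "far M (wid (V \<otimes>\<^sub>W W)) = Ident U (fob M (V \<otimes>\<^sub>W W))" if "is_weil V" for V
    using functor_simps(5)[OF MF, of "V \<otimes>\<^sub>W W"] is_weil_wtens[OF that W] by simp
  have "ncmp (muU U ground W) M = Ident K (fob (T W) M)"
    by (rule K_eqI[OF _ i])
      (use mu_ncmp_hom[OF is_weil_ground W M] g M MF W dW F in \<open>simp_all add: wswap_ground mtens_wid\<close>)
  thus "ncmp (muU U ground W) M = far (T W) (ncmp (upsilonU U) M)" using upsilon_ncmp[OF M] id by simp
  have "ncmp (muU U W ground) M = Ident K (fob (T W) M)"
    by (rule K_eqI[OF _ i])
      (use mu_ncmp_hom[OF W is_weil_ground M] g[OF TM] M MF W dW F in \<open>simp_all add: wswap_ground mtens_wid\<close>)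
  thus "ncmp (muU U W ground) M = ncmp (upsilonU U) (fob (T W) M)" using upsilon_ncmp[OF TM] by simp
qed

text \<open>At \<open>V\<close>, the two sides are \<open>M\<close> applied to the tensor products of \<open>V\<close> with the two composites of
  \<open>wswap_hexagon\<close>.\<close>

lemma mu_assoc:
  assumes W: "is_weil W\<^sub>1" "is_weil W\<^sub>2" "is_weil W\<^sub>3" and M: "M \<in> Ob K"
  shows "Cmp K (ncmp (muU U (W\<^sub>1 \<otimes>\<^sub>W W\<^sub>2) W\<^sub>3) M) (far (T W\<^sub>3) (ncmp (muU U W\<^sub>1 W\<^sub>2) M)) =
    Cmp K (ncmp (muU U W\<^sub>1 (W\<^sub>2 \<otimes>\<^sub>W W\<^sub>3)) M) (ncmp (muU U W\<^sub>2 W\<^sub>3) (fob (T W\<^sub>1) M))"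
proof -
  have MF: "is_functor Weil U M" using M by simp
  have TM: "fob (T W\<^sub>1) M \<in> Ob K" "is_functor Weil U (fob (T W\<^sub>1) M)" using W M by simp_all
  note W12 = is_weil_wtens[OF W(1,2)] and W23 = is_weil_wtens[OF W(2,3)]
  note m12 = mu_ncmp_hom[OF W(1,2) M] and m23 = mu_ncmp_hom[OF W(2,3) TM(1)]
  have nt: "is_ntrans Weil U (ncmp (muU U W\<^sub>1 W\<^sub>2) M)" using m12 by (simp add: functor_cat_hom)
  show ?thesis
  proof (rule K_eqI)
    show "Cmp K (ncmp (muU U (W\<^sub>1 \<otimes>\<^sub>W W\<^sub>2) W\<^sub>3) M) (far (T W\<^sub>3) (ncmp (muU U W\<^sub>1 W\<^sub>2) M)) \<in>
        hom K (fob (T W\<^sub>3) (fob (T W\<^sub>2) (fob (T W\<^sub>1) M))) (fob (T (W\<^sub>1 \<otimes>\<^sub>W W\<^sub>2 \<otimes>\<^sub>W W\<^sub>3)) M)"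
      using FC.cmp_hom[OF far_T_hom[OF W(3) m12] mu_ncmp_hom[OF W12 W(3) M]] by (simp add: wtens_assoc)
    show "Cmp K (ncmp (muU U W\<^sub>1 (W\<^sub>2 \<otimes>\<^sub>W W\<^sub>3)) M) (ncmp (muU U W\<^sub>2 W\<^sub>3) (fob (T W\<^sub>1) M)) \<in>
        hom K (fob (T W\<^sub>3) (fob (T W\<^sub>2) (fob (T W\<^sub>1) M))) (fob (T (W\<^sub>1 \<otimes>\<^sub>W W\<^sub>2 \<otimes>\<^sub>W W\<^sub>3)) M)"
      using FC.cmp_hom[OF m23 mu_ncmp_hom[OF W(1) W23 M]] .
    fix V :: "'k weil" assume V: "is_weil V"
    have vv: "wcomp (wid V) (wid V) = wid V" using A.cmp_ident(1)[of "wid V" V] is_weil_hom_wid[OF V] by simp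
    have h: "is_weil_hom (wid V \<otimes>\<^sub>M wswap W\<^sub>3 (W\<^sub>1 \<otimes>\<^sub>W W\<^sub>2))" "is_weil_hom (wid (V \<otimes>\<^sub>W W\<^sub>3) \<otimes>\<^sub>M wswap W\<^sub>2 W\<^sub>1)"
      "is_weil_hom (wid V \<otimes>\<^sub>M wswap (W\<^sub>2 \<otimes>\<^sub>W W\<^sub>3) W\<^sub>1)" "is_weil_hom (wid V \<otimes>\<^sub>M wswap W\<^sub>3 W\<^sub>2)"
      "is_weil_hom ((wid V \<otimes>\<^sub>M wswap W\<^sub>3 W\<^sub>2) \<otimes>\<^sub>M wid W\<^sub>1)"
      using V W W12 W23 by (simp_all add: is_weil_hom_mtens is_weil_hom_wid is_weil_hom_wswap is_weil_wtens)
    have v3: "wid (V \<otimes>\<^sub>W W\<^sub>3) = wid V \<otimes>\<^sub>M wid W\<^sub>3" using mtens_wid[OF is_weil_dim[OF W(3)]] by metis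
    have "wcomp (wid V \<otimes>\<^sub>M wswap W\<^sub>3 (W\<^sub>1 \<otimes>\<^sub>W W\<^sub>2)) (wid (V \<otimes>\<^sub>W W\<^sub>3) \<otimes>\<^sub>M wswap W\<^sub>2 W\<^sub>1) =
        wid V \<otimes>\<^sub>M wcomp (wswap W\<^sub>3 (W\<^sub>1 \<otimes>\<^sub>W W\<^sub>2)) (wid W\<^sub>3 \<otimes>\<^sub>M wswap W\<^sub>2 W\<^sub>1)"
      unfolding v3 mtens_assoc by (subst mtens_wcomp) (simp_all add: vv)
    also have "\<dots> = wid V \<otimes>\<^sub>M wcomp (wswap (W\<^sub>2 \<otimes>\<^sub>W W\<^sub>3) W\<^sub>1) (wswap W\<^sub>3 W\<^sub>2 \<otimes>\<^sub>M wid W\<^sub>1)"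
      using wswap_hexagon[OF W] by simp
    also have "\<dots> = wcomp (wid V \<otimes>\<^sub>M wswap (W\<^sub>2 \<otimes>\<^sub>W W\<^sub>3) W\<^sub>1) ((wid V \<otimes>\<^sub>M wswap W\<^sub>3 W\<^sub>2) \<otimes>\<^sub>M wid W\<^sub>1)"
      unfolding mtens_assoc by (subst mtens_wcomp) (simp_all add: vv wtens_assoc)
    finally have eq: "wcomp (wid V \<otimes>\<^sub>M wswap W\<^sub>3 (W\<^sub>1 \<otimes>\<^sub>W W\<^sub>2)) (wid (V \<otimes>\<^sub>W W\<^sub>3) \<otimes>\<^sub>M wswap W\<^sub>2 W\<^sub>1) =
      wcomp (wid V \<otimes>\<^sub>M wswap (W\<^sub>2 \<otimes>\<^sub>W W\<^sub>3) W\<^sub>1) ((wid V \<otimes>\<^sub>M wswap W\<^sub>3 W\<^sub>2) \<otimes>\<^sub>M wid W\<^sub>1)" .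
    have "ncmp (Cmp K (ncmp (muU U (W\<^sub>1 \<otimes>\<^sub>W W\<^sub>2) W\<^sub>3) M) (far (T W\<^sub>3) (ncmp (muU U W\<^sub>1 W\<^sub>2) M))) V =
      Cmp U (far M (wid V \<otimes>\<^sub>M wswap W\<^sub>3 (W\<^sub>1 \<otimes>\<^sub>W W\<^sub>2))) (far M (wid (V \<otimes>\<^sub>W W\<^sub>3) \<otimes>\<^sub>M wswap W\<^sub>2 W\<^sub>1))"
      using V nt MF is_weil_wtens[OF V W(3)] by simp
    also have "\<dots> = Cmp U (far M (wid V \<otimes>\<^sub>M wswap (W\<^sub>2 \<otimes>\<^sub>W W\<^sub>3) W\<^sub>1)) (far M ((wid V \<otimes>\<^sub>M wswap W\<^sub>3 W\<^sub>2) \<otimes>\<^sub>M wid W\<^sub>1))"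
      using functor_simps(6)[OF MF, of "wid (V \<otimes>\<^sub>W W\<^sub>3) \<otimes>\<^sub>M wswap W\<^sub>2 W\<^sub>1" "wid V \<otimes>\<^sub>M wswap W\<^sub>3 (W\<^sub>1 \<otimes>\<^sub>W W\<^sub>2)"]
        functor_simps(6)[OF MF, of "(wid V \<otimes>\<^sub>M wswap W\<^sub>3 W\<^sub>2) \<otimes>\<^sub>M wid W\<^sub>1" "wid V \<otimes>\<^sub>M wswap (W\<^sub>2 \<otimes>\<^sub>W W\<^sub>3) W\<^sub>1"] h eq
      by (simp add: wtens_assoc)
    also have "\<dots> = ncmp (Cmp K (ncmp (muU U W\<^sub>1 (W\<^sub>2 \<otimes>\<^sub>W W\<^sub>3)) M) (ncmp (muU U W\<^sub>2 W\<^sub>3) (fob (T W\<^sub>1) M))) V"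
      using V MF TM h by simp
    finally show "ncmp (Cmp K (ncmp (muU U (W\<^sub>1 \<otimes>\<^sub>W W\<^sub>2) W\<^sub>3) M) (far (T W\<^sub>3) (ncmp (muU U W\<^sub>1 W\<^sub>2) M))) V =
      ncmp (Cmp K (ncmp (muU U W\<^sub>1 (W\<^sub>2 \<otimes>\<^sub>W W\<^sub>3)) M) (ncmp (muU U W\<^sub>2 W\<^sub>3) (fob (T W\<^sub>1) M))) V" .
  qed
qed

end

section \<open>The isomorphism \<open>\<theta>\<close>\<close>

lemma (in power_cat) tup_power_iso:
  assumes a: "a \<in> Ob C" and P: "is_power C a n P p"
  shows "tup C a n P p \<in> iso_hom C P (pow_ob C a n)"
proof -
  have PO: "P \<in> Ob C" and p: "\<And>i. i < n \<Longrightarrow> p i \<in> hom C P a" using P by (auto simp: is_power_def)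
  note L = pow_is_power[OF a, of n, unfolded is_power_iff_limit[OF a]] and L' = P[unfolded is_power_iff_limit[OF a]]
  obtain h where h: "h \<in> iso_hom C P (pow_ob C a n)" "\<forall>i \<in> Ob (disc n). Cmp C (pow_pr C a n i) h = p i"
    using limit_iso[OF category_disc family_functor L L'] a by blast
  hence "h \<in> hom C P (pow_ob C a n)" by (simp add: iso_hom_def)
  hence "tup C a n P p = h" using h(2) by (intro tup_eqI[OF a]) auto
  thus ?thesis using h(1) by simp
qed

text \<open>The matrix of \<open>V \<otimes> \<phi>\<close> is block diagonal, with blocks \<open>\<phi>\<close>.\<close>

lemma (in comm_alg) tlin_wid_tensor:
  assumes i: "i < dim V" and j: "j < dim (tgt \<phi>)" and x: "\<And>c. c < dim V * dim (src \<phi>) \<Longrightarrow> x c \<in> S"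
  shows "tlin (dim V * dim (src \<phi>)) (mat (wid V \<otimes>\<^sub>M \<phi>)) x (i * dim (tgt \<phi>) + j) =
    ssum (\<lambda>l. scal (mat \<phi> j l) (x (i * dim (src \<phi>) + l))) {..<dim (src \<phi>)}"
proof -
  let ?n = "dim (src \<phi>)" and ?k = "dim (tgt \<phi>)"
  have m: "mat (wid V \<otimes>\<^sub>M \<phi>) (i * ?k + j) (r * ?n + l) = (if r = i then mat \<phi> j l else 0)" if "l < ?n" for r l
    using tensor_index_eq_iff[OF j, of "i * ?k + j" i] tensor_index_eq_iff[OF that, of "r * ?n + l" r] i
    by (auto simp: mat_mtens wid_def)
  have xS: "x (r * ?n + l) \<in> S" if "r < dim V" "l < ?n" for r l
    using x[OF tensor_index_less[OF that]] .
  have "tlin (dim V * ?n) (mat (wid V \<otimes>\<^sub>M \<phi>)) x (i * ?k + j) =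
      ssum (\<lambda>r. ssum (\<lambda>l. scal (mat (wid V \<otimes>\<^sub>M \<phi>) (i * ?k + j) (r * ?n + l)) (x (r * ?n + l))) {..<?n}) {..<dim V}"
    unfolding tlin_def by (rule ssum.lessThan_times)
  also have "\<dots> = ssum (\<lambda>r. if r = i then ssum (\<lambda>l. scal (mat \<phi> j l) (x (i * ?n + l))) {..<?n} else zero) {..<dim V}"
    by (rule ssum.cong[OF refl]) (auto simp: m xS intro!: ssum.cong ssum.neutral)
  also have "\<dots> = ssum (\<lambda>l. scal (mat \<phi> j l) (x (i * ?n + l))) {..<?n}"
    using i by (simp add: ssum.delta)
  finally show ?thesis .
qed

text \<open>A coordinate function is in general not an arrow of \<open>Weil\<close>, so the laws for composition with
  identities do not cover it.\<close>

lemma wcomp_wcoord: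
  assumes "j < dim W"
  shows "wcomp (wcoord W j) (wid W) = wcoord W j" "wcomp (wid ground) (wcoord W j) = wcoord W j"
proof -
  show "wcomp (wcoord W j) (wid W) = wcoord W j"
  proof (rule wmap_eqI)
    fix r c
    have "mat (wcomp (wcoord W j) (wid W)) r c = (\<Sum>k<dim W. unit_vec j k * (if r = 0 \<and> k = c then 1 else 0))"
      unfolding wcomp_def by (auto simp: wcoord_def wid_def unit_vec_def intro!: sum.cong)
    thus "mat (wcomp (wcoord W j) (wid W)) r c = mat (wcoord W j) r c"
      using assms by (simp add: sum_unit_vec) (auto simp: wcoord_def)
  qed simp_all
  show "wcomp (wid ground) (wcoord W j) = wcoord W j"
    by (rule wmap_eqI) (simp_all add: wcomp_def wid_def wcoord_def)
qed

lemma wcoord_ground: "wcoord ground 0 = wid ground"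
  by (rule wmap_eqI) (auto simp: wcoord_def wid_def)

context weil_functors begin

definition theta_coord :: "'k weil \<Rightarrow> nat \<Rightarrow> ('k, 'o, 'm) wntrans" where
  "theta_coord W j = \<lparr>nsrc = fob (T W) RF, ntgt = RF,
     ncmp = (\<lambda>V \<in> Ob Weil. tensor_map U R (wid V \<otimes>\<^sub>M wcoord W j))\<rparr>"

lemma theta_eq_tup: "thetaU U R W = tup K RF (dim W) (fob (T W) RF) (theta_coord W)"
  by (simp add: thetaU_def Let_def KU_def theta_coord_def[abs_def])

lemma ncmp_theta_coord: "is_weil V \<Longrightarrow> ncmp (theta_coord W j) V = tensor_map U R (wid V \<otimes>\<^sub>M wcoord W j)"
  by (simp add: theta_coord_def)

lemma theta_coord_hom:
  assumes W: "is_weil W" and j: "j < dim W"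
  shows "theta_coord W j \<in> hom K (fob (T W) RF) RF"
  unfolding theta_coord_def
proof (rule K_homI[OF T_functor_ob[OF W RF_functor] RF_functor])
  show "tensor_map U R (wid V \<otimes>\<^sub>M wcoord W j) \<in> hom U (fob (fob (T W) RF) V) (fob RF V)" if "is_weil V" for V :: "'k weil"
    using tensor_map_hom[of "wid V \<otimes>\<^sub>M wcoord W j"] that W by (simp add: RF_functor is_weil_wtens)
  fix \<phi> :: "'k wmap" assume \<phi>: "is_weil_hom \<phi>"
  have \<phi>W: "is_weil_hom (\<phi> \<otimes>\<^sub>M wid W)" using is_weil_hom_mtens[OF \<phi> is_weil_hom_wid[OF W]] .
  have id: "wcomp (wid (tgt \<phi>)) \<phi> = \<phi>" "wcomp \<phi> (wid (src \<phi>)) = \<phi>"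
    using A.cmp_ident(1)[of \<phi> "tgt \<phi>"] A.cmp_ident(2)[of \<phi> "src \<phi>"] \<phi> by simp_all
  have "wcomp (wid (tgt \<phi>) \<otimes>\<^sub>M wcoord W j) (\<phi> \<otimes>\<^sub>M wid W) = \<phi> \<otimes>\<^sub>M wcoord W j"
    by (simp add: mtens_wcomp id wcomp_wcoord j)
  also have "\<dots> = wcomp (\<phi> \<otimes>\<^sub>M wid ground) (wid (src \<phi>) \<otimes>\<^sub>M wcoord W j)"
    by (subst mtens_wcomp) (simp_all add: id wcomp_wcoord j)
  finally show "Cmp U (tensor_map U R (wid (tgt \<phi>) \<otimes>\<^sub>M wcoord W j)) (far (fob (T W) RF) \<phi>) =
      Cmp U (far RF \<phi>) (tensor_map U R (wid (src \<phi>) \<otimes>\<^sub>M wcoord W j))"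
    using tensor_map_wcomp[of "\<phi> \<otimes>\<^sub>M wid W" "wid (tgt \<phi>) \<otimes>\<^sub>M wcoord W j"] tensor_map_wcomp[of "wid (src \<phi>) \<otimes>\<^sub>M wcoord W j" \<phi>]
      \<phi> \<phi>W RF_functor by simp
qed

lemma coord_theta_coord:
  assumes W: "is_weil W" and V: "is_weil V" and ij: "i < dim V" "j < dim W" and x: "x \<in> hom U X (tcar (V \<otimes>\<^sub>W W))"
  shows "coord (dim V) (Cmp U (ncmp (theta_coord W j) V) x) i = coord (dim V * dim W) x (i * dim W + j)"
proof -
  have "coord (dim (tgt (wid V \<otimes>\<^sub>M wcoord W j))) (Cmp U (tensor_map U R (wid V \<otimes>\<^sub>M wcoord W j)) x) i =
     coord (dim (src (wid V \<otimes>\<^sub>M wcoord W j))) x (i * dim W + j)"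
    by (rule coord_tensor_map_delta)
      (use x ij tensor_index_less[OF ij] wcoord_index[OF is_weil_dim[OF W] ij] in auto)
  thus ?thesis using V by (simp add: ncmp_theta_coord)
qed

lemma T_RF_Ob: "is_weil W \<Longrightarrow> fob (T W) RF \<in> Ob K"
  using RF_functor by simp

lemma fob_T_RF [simp]: "is_weil W \<Longrightarrow> is_weil V \<Longrightarrow> fob (fob (T W) RF) V = pow_ob U car (dim V * dim W)"
  using RF_functor by (simp add: is_weil_wtens)

text \<open>The coordinates of an element of \<open>R \<otimes> (V \<otimes> W)\<close> are indexed by pairs \<open>(i, j)\<close>. For fixed \<open>j\<close> they are
  the coordinates of an element of \<open>R \<otimes> V\<close>, the component \<open>j\<close> of the tuple.\<close>

lemma theta_power:
  assumes W: "is_weil W"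
  shows "is_power K RF (dim W) (fob (T W) RF) (theta_coord W)"
proof (rule powerI_pointwise[OF RF_functor T_functor_ob[OF W RF_functor] theta_coord_hom[OF W]])
  fix V :: "'k weil" assume "V \<in> Ob Weil"
  hence V: "is_weil V" by simp
  let ?m = "dim V" and ?n = "dim W"
  have n: "0 < ?n" using is_weil_dim[OF W] .
  have t: "ncmp (theta_coord W j) V \<in> hom U (tcar (V \<otimes>\<^sub>W W)) (tcar V)" if "j < ?n" for j
    using K_hom_RF[OF theta_coord_hom[OF W that] V] V W by simp
  have "is_power U (tcar V) ?n (tcar (V \<otimes>\<^sub>W W)) (\<lambda>j. ncmp (theta_coord W j) V)"
    unfolding is_power_def
  proof (intro conjI ballI allI impI)
    show "tcar (V \<otimes>\<^sub>W W) \<in> Ob U" by simp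
    show "ncmp (theta_coord W j) V \<in> hom U (tcar (V \<otimes>\<^sub>W W)) (tcar V)" if "j < ?n" for j using t[OF that] .
    fix X f assume X: "X \<in> Ob U" and f: "\<forall>j<?n. f j \<in> hom U X (tcar V)"
    (* c is the index of the pair (c div ?n, c mod ?n) *)
    define h where "h = tup U car (?m * ?n) X (\<lambda>c. coord ?m (f (c mod ?n)) (c div ?n))"
    have fc: "coord ?m (f (c mod ?n)) (c div ?n) \<in> hom U X car" if "c < ?m * ?n" for c
      using f n div_less_dim[OF that] by (intro coord_hom) auto
    have h: "h \<in> hom U X (tcar (V \<otimes>\<^sub>W W))" unfolding h_def dim_wtens by (rule tup_hom[OF op_hom(1) X fc])
    have hc: "coord (?m * ?n) h c = coord ?m (f (c mod ?n)) (c div ?n)" if "c < ?m * ?n" for c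
      unfolding h_def by (rule coord_tup[OF X fc that])
    show "\<exists>!h. h \<in> hom U X (tcar (V \<otimes>\<^sub>W W)) \<and> (\<forall>j<?n. Cmp U (ncmp (theta_coord W j) V) h = f j)"
    proof (rule ex1I[of _ h], intro conjI allI impI h)
      fix j assume j: "j < ?n"
      show "Cmp U (ncmp (theta_coord W j) V) h = f j"
      proof (rule coord_eqI[OF C.cmp_hom[OF h t[OF j]]])
        show "f j \<in> hom U X (tcar V)" using f j by simp
        fix i assume i: "i < ?m"
        show "coord ?m (Cmp U (ncmp (theta_coord W j) V) h) i = coord ?m (f j) i"
          unfolding coord_theta_coord[OF W V i j h] hc[OF tensor_index_less[OF i j]] using j by simp
      qed
    next
      fix h' assume h': "h' \<in> hom U X (tcar (V \<otimes>\<^sub>W W)) \<and> (\<forall>j<?n. Cmp U (ncmp (theta_coord W j) V) h' = f j)"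
      show "h' = h"
      proof (rule coord_eqI[of _ X "?m * ?n"])
        show "h' \<in> hom U X (pow_ob U car (?m * ?n))" "h \<in> hom U X (pow_ob U car (?m * ?n))" using h h' by simp_all
        fix c assume c: "c < ?m * ?n"
        have ij: "c div ?n < ?m" "c mod ?n < ?n" using div_less_dim[OF c] n by auto
        have "coord (?m * ?n) h' c = coord ?m (Cmp U (ncmp (theta_coord W (c mod ?n)) V) h') (c div ?n)"
          using coord_theta_coord[OF W V ij conjunct1[OF h']] by simp
        thus "coord (?m * ?n) h' c = coord (?m * ?n) h c" using h' ij hc[OF c] by simp
      qed
    qed
  qed
  thus "is_power U (fob RF V) ?n (fob (fob (T W) RF) V) (\<lambda>j. ncmp (theta_coord W j) V)"
    using V W by simp
qed simp_all

lemma theta_iso: "is_weil W \<Longrightarrow> thetaU U R W \<in> iso_hom K (fob (T W) RF) (pow_ob K RF (dim W))"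
  unfolding theta_eq_tup by (rule KP.tup_power_iso[OF RF_Ob theta_power])

lemma theta_hom: "is_weil W \<Longrightarrow> thetaU U R W \<in> hom K (fob (T W) RF) (pow_ob K RF (dim W))"
  using theta_iso by (simp add: iso_hom_def)

lemma pr_theta:
  assumes W: "is_weil W" and j: "j < dim W"
  shows "Cmp K (pow_pr K RF (dim W) j) (thetaU U R W) = theta_coord W j"
  unfolding theta_eq_tup using theta_coord_hom[OF W] by (intro KP.pr_tup[OF RF_Ob T_RF_Ob[OF W]] j) auto

lemma K_coord_theta:
  assumes W: "is_weil W" and j: "j < dim W" and z: "z \<in> hom K X (fob (T W) RF)"
  shows "KA.coord (dim W) (Cmp K (thetaU U R W) z) j = Cmp K (theta_coord W j) z"
  using FC.cmp_assoc[OF z theta_hom[OF W] pr_K[OF j]] pr_theta[OF W j] by (simp add: KA.coord_def)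

lemma coord_theta:
  assumes W: "is_weil W" and V: "is_weil V" and ij: "i < dim V" "j < dim W" and z: "z \<in> hom K X (fob (T W) RF)"
  shows "coord (dim V) (ncmp (KA.coord (dim W) (Cmp K (thetaU U R W) z) j) V) i = coord (dim V * dim W) (ncmp z V) (i * dim W + j)"
proof -
  have "ncmp z V \<in> hom U (fob X V) (tcar (V \<otimes>\<^sub>W W))" using K_hom_ncmp[OF z V] W V by simp
  from coord_theta_coord[OF W V ij this] show ?thesis using K_coord_theta[OF W ij(2) z] V by simp
qed

lemma K_pow_eqI:
  assumes "s \<in> hom K X (pow_ob K RF n)" "t \<in> hom K X (pow_ob K RF n)"
    and eq: "\<And>V i j. \<lbrakk>is_weil V; i < dim V; j < n\<rbrakk> \<Longrightarrow>
      coord (dim V) (ncmp (KA.coord n s j) V) i = coord (dim V) (ncmp (KA.coord n t j) V) i"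
  shows "s = t"
proof (rule KA.coord_eqI[of s X n t])
  show "s \<in> hom K X (pow_ob K (acar (RU U R)) n)" "t \<in> hom K X (pow_ob K (acar (RU U R)) n)" using assms by simp_all
  fix j assume j: "j < n"
  have c: "KA.coord n s j \<in> hom K X RF" "KA.coord n t j \<in> hom K X RF"
    using KA.coord_hom[of s X n j] KA.coord_hom[of t X n j] assms(1,2) j by simp_all
  show "KA.coord n s j = KA.coord n t j"
  proof (rule K_eqI[OF c])
    fix V :: "'k weil" assume V: "is_weil V"
    show "ncmp (KA.coord n s j) V = ncmp (KA.coord n t j) V"
      by (rule coord_eqI[OF K_hom_RF[OF c(1) V] K_hom_RF[OF c(2) V]]) (rule eq[OF V _ j])
  qed
qed

subsection \<open>The algebra structure of \<open>T\<^sup>W (R \<otimes> _)\<close>\<close>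

abbreviation "pcmp W n \<equiv> pow_cmp K K (T W) RF n"
abbreviation "TRF W \<equiv> fob (T W) RF"
abbreviation "TRU W \<equiv> map_kalg K K (T W) (RU U R)"

text \<open>The arrow that \<open>pow_cmp\<close> describes exists uniquely because \<open>T\<^sup>W\<close> preserves powers.\<close>

lemma pcmp:
  assumes W: "is_weil W"
  shows "pcmp W n \<in> hom K (pow_ob K (TRF W) n) (fob (T W) (pow_ob K RF n))"
    and "i < n \<Longrightarrow> Cmp K (far (T W) (pow_pr K RF n i)) (pcmp W n) = pow_pr K (TRF W) n i"
proof -
  have "\<exists>!h. h \<in> hom K (pow_ob K (TRF W) n) (fob (T W) (pow_ob K RF n)) \<and>
      (\<forall>i<n. Cmp K (far (T W) (pow_pr K RF n i)) h = pow_pr K (TRF W) n i)"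
    by (rule KP.is_powerD[OF T_power[OF W RF_Ob KP.pow_is_power[OF RF_Ob]]])
      (simp_all add: KP.pow_simps[OF T_RF_Ob[OF W], simplified] KP.pr_hom[OF T_RF_Ob[OF W]])
  from theI'[OF this] show "pcmp W n \<in> hom K (pow_ob K (TRF W) n) (fob (T W) (pow_ob K RF n))"
    "i < n \<Longrightarrow> Cmp K (far (T W) (pow_pr K RF n i)) (pcmp W n) = pow_pr K (TRF W) n i"
    unfolding pow_cmp_def by simp_all
qed

lemma TRU_simps [simp]:
  "acar (TRU W) = TRF W" "aadd (TRU W) = Cmp K (far (T W) (op2 aadd)) (pcmp W 2)"
  "amul (TRU W) = Cmp K (far (T W) (op2 amul)) (pcmp W 2)" "azero (TRU W) = Cmp K (far (T W) (op0 azero)) (pcmp W 0)"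
  "aone (TRU W) = Cmp K (far (T W) (op0 aone)) (pcmp W 0)" "aneg (TRU W) = far (T W) (op1 aneg)"
  "ascal (TRU W) c = far (T W) (op1 (\<lambda>B. ascal B c))"
  by (simp_all add: map_kalg_def Let_def)

lemma TRU_alg_ops:
  assumes W: "is_weil W" shows "KP.alg_ops (TRU W)"
  unfolding KP.alg_ops_def TRU_simps
  using T_RF_Ob[OF W] FC.cmp_hom[OF pcmp(1)[OF W] far_T_hom[OF W]] far_T_hom[OF W] op2_hom op1_hom op0_hom natural_ops
  by blast

text \<open>At \<open>V\<close>, the algebra \<open>T\<^sup>W (R \<otimes> _)\<close> is \<open>R \<otimes> (V \<otimes> W)\<close>.\<close>

lemma ncmp_TRU_op2:
  assumes w: "natural_op2 w" and W: "is_weil W" and V: "is_weil V"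
    and x: "x \<in> hom K X (TRF W)" and y: "y \<in> hom K X (TRF W)"
  shows "ncmp (ap2 K (TRF W) (Cmp K (far (T W) (op2 w)) (pcmp W 2)) x y) V =
    ap2 U (tcar (V \<otimes>\<^sub>W W)) (w (talg (V \<otimes>\<^sub>W W))) (ncmp x V) (ncmp y V)"
proof -
  let ?t = "tup K (TRF W) 2 X (\<lambda>i. if i = 0 then x else y)"
  note t = KP.pair_hom[OF T_RF_Ob[OF W] x y]
  note VW = is_weil_wtens[OF V W]
  define u where "u = Cmp U (ncmp (pcmp W 2) V) (ncmp ?t V)"
  note c = K_hom_ncmp[OF pcmp(1)[OF W] V, of 2] and tV = K_hom_ncmp[OF t(1) V]
  have P: "fob (fob (T W) (pow_ob K RF 2)) V = fob (pow_ob K RF 2) (V \<otimes>\<^sub>W W)"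
    using pow_K_functor V by simp
  have u: "u \<in> hom U (fob X V) (fob (pow_ob K RF 2) (V \<otimes>\<^sub>W W))" using C.cmp_hom[OF tV c] P by (simp add: u_def)
  have nt: "is_ntrans Weil U (op2 w)" "is_ntrans Weil U (pow_pr K RF 2 0)" "is_ntrans Weil U (pow_pr K RF 2 1)"
    using op2_hom[OF w] pr_K[of 0 2] pr_K[of 1 2] by (simp_all add: functor_cat_hom)
  have pr: "Cmp U (ncmp (pow_pr K RF 2 i) (V \<otimes>\<^sub>W W)) u = Cmp U (ncmp (pow_pr K (TRF W) 2 i) V) (ncmp ?t V)" if "i < 2" for i
  proof -
    have n: "is_ntrans Weil U (pow_pr K RF 2 i)" using pr_K[OF that] by (simp add: functor_cat_hom)
    have "ncmp (Cmp K (far (T W) (pow_pr K RF 2 i)) (pcmp W 2)) V = ncmp (pow_pr K (TRF W) 2 i) V"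
      using pcmp(2)[OF W that] by simp
    hence e: "Cmp U (ncmp (pow_pr K RF 2 i) (V \<otimes>\<^sub>W W)) (ncmp (pcmp W 2) V) = ncmp (pow_pr K (TRF W) 2 i) V"
      using n V by simp
    show ?thesis unfolding u_def
      using C.cmp_reassoc1[OF e c _ tV] K_hom_ncmp[OF pr_K[OF that] VW] P by simp
  qed
  have xy: "Cmp U (ncmp (pow_pr K (TRF W) 2 0) V) (ncmp ?t V) = ncmp x V" "Cmp U (ncmp (pow_pr K (TRF W) 2 1) V) (ncmp ?t V) = ncmp y V"
    using arg_cong[OF t(2), of "\<lambda>t. ncmp t V"] arg_cong[OF t(3), of "\<lambda>t. ncmp t V"] V by simp_all
  have "ncmp (ap2 K (TRF W) (Cmp K (far (T W) (op2 w)) (pcmp W 2)) x y) V = Cmp U (ncmp (op2 w) (V \<otimes>\<^sub>W W)) u"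
    unfolding KP.ap2_char[OF T_RF_Ob[OF W] t] u_def
    using C.cmp_assoc[OF tV c, of "ncmp (op2 w) (V \<otimes>\<^sub>W W)" "tcar (V \<otimes>\<^sub>W W)"] K_hom_RF[OF op2_hom[OF w] VW] nt V P by simp
  also have "\<dots> = ap2 U (tcar (V \<otimes>\<^sub>W W)) (w (talg (V \<otimes>\<^sub>W W))) (ncmp x V) (ncmp y V)"
    unfolding ncmp_op2_cmp[OF w VW u] using pr[of 0] pr[of 1] xy by simp
  finally show ?thesis .
qed

lemma ncmp_TRU_op0:
  assumes w: "natural_op0 w" and W: "is_weil W" and V: "is_weil V" and X: "X \<in> Ob K"
  shows "ncmp (ap0 K (TRF W) (Cmp K (far (T W) (op0 w)) (pcmp W 0)) X) V =
    ap0 U (tcar (V \<otimes>\<^sub>W W)) (w (talg (V \<otimes>\<^sub>W W))) (fob X V)"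
proof -
  note VW = is_weil_wtens[OF V W]
  let ?t = "tup K (TRF W) 0 X (\<lambda>_. undefined)"
  note t = KP.terminal_hom[OF T_RF_Ob[OF W] X, of "\<lambda>_. undefined"]
  note c = K_hom_ncmp[OF pcmp(1)[OF W] V, of 0] and tV = K_hom_ncmp[OF t(1) V]
  have P: "fob (fob (T W) (pow_ob K RF 0)) V = fob (pow_ob K RF 0) (V \<otimes>\<^sub>W W)"
    using pow_K_functor V by simp
  have nt: "is_ntrans Weil U (op0 w)" using op0_hom[OF w] by (simp add: functor_cat_hom)
  have "ncmp (ap0 K (TRF W) (Cmp K (far (T W) (op0 w)) (pcmp W 0)) X) V =
      Cmp U (ncmp (op0 w) (V \<otimes>\<^sub>W W)) (Cmp U (ncmp (pcmp W 0) V) (ncmp ?t V))"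
    unfolding ap0_def[of K]
    using C.cmp_assoc[OF tV c, of "ncmp (op0 w) (V \<otimes>\<^sub>W W)" "tcar (V \<otimes>\<^sub>W W)"] K_hom_RF[OF op0_hom[OF w] VW] nt V P by simp
  thus ?thesis using ncmp_op0_cmp[OF w VW, of _ "fob X V"] C.cmp_hom[OF tV c] P by simp
qed

lemma ncmp_TRU_op1:
  assumes "natural_op1 w" "is_weil W" "is_weil V"
  shows "ncmp (far (T W) (op1 w)) V = w (talg (V \<otimes>\<^sub>W W))"
  using op1_hom[OF assms(1)] assms(2,3) by (simp add: functor_cat_hom ncmp_op1 is_weil_wtens)

text \<open>Elements are compared at each \<open>V\<close> by their coordinates \<open>(i, j)\<close>. The sum, the constants, negation and
  multiplication by scalars are computed in each coordinate separately, \<open>(0, 0)\<close> being the coordinate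
  \<open>0\<close> of \<open>V \<otimes> W\<close>. On the side of \<open>(R \<otimes> V) \<otimes> W\<close>, the component \<open>j\<close> of a product is a sum of
  products in \<open>R \<otimes> V\<close> with structure constants of \<open>W\<close> as coefficients; by \<open>tmul_tensor\<close> its coordinate
  \<open>i\<close> is the coordinate \<open>(i, j)\<close> of the product in \<open>R \<otimes> (V \<otimes> W)\<close>.\<close>

lemma theta_kalg_hom:
  assumes W: "is_weil W"
  shows "kalg_hom K (TRU W) (tensor_alg K (RU U R) W) (thetaU U R W)"
proof -
  let ?n = "dim W" and ?\<theta> = "thetaU U R W" and ?B = "tensor_alg K (RU U R) W" and ?P = "pow_ob K RF (dim W)"
  note ob = KP.pow_simps(1)[OF RF_Ob, of ?n]
  note \<theta> = theta_hom[OF W]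
  note tB = KA.talg_op_hom[where W = W, unfolded RU_simps]
  note tT = KP.alg_opsD[OF TRU_alg_ops[OF W]]
  have acar: "acar ?B = ?P" using KA.acar_talg[of W] by simp
  have c: "KA.coord ?n (Cmp K ?\<theta> z) j \<in> hom K X RF" if "z \<in> hom K X (TRF W)" "j < ?n" for z X j
    using KA.coord_hom[of "Cmp K ?\<theta> z" X ?n j] FC.cmp_hom[OF that(1) \<theta>] that(2) by simp
  have zV: "ncmp z V \<in> hom U (fob X V) (tcar (V \<otimes>\<^sub>W W))" if "z \<in> hom K X (TRF W)" "is_weil V" for z X V
    using K_hom_ncmp[OF that] W that by simp
  have cV: "ncmp (KA.coord ?n (Cmp K ?\<theta> z) j) V \<in> hom U (fob X V) (tcar V)" if "z \<in> hom K X (TRF W)" "j < ?n" "is_weil V" for z X j V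
    using K_hom_RF[OF c[OF that(1,2)] that(3)] .
  show ?thesis
  proof (rule KP.kalg_homI[OF TRU_alg_ops[OF W] KA.talg_ops], unfold acar TRU_simps(1))
    show "?\<theta> \<in> hom K (TRF W) ?P" by (rule \<theta>)
  next
    fix X x y assume x: "x \<in> hom K X (TRF W)" and y: "y \<in> hom K X (TRF W)"
    note \<theta>x = FC.cmp_hom[OF x \<theta>] and \<theta>y = FC.cmp_hom[OF y \<theta>]
    note s = KP.ap2_hom[OF T_RF_Ob[OF W] x y tT(2)[unfolded TRU_simps(1)]]
    show "Cmp K ?\<theta> (ap2 K (TRF W) (aadd (TRU W)) x y) = ap2 K ?P (aadd ?B) (Cmp K ?\<theta> x) (Cmp K ?\<theta> y)"
    proof (rule K_pow_eqI[OF FC.cmp_hom[OF s \<theta>] KP.ap2_hom[OF ob \<theta>x \<theta>y tB(2)]])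
      fix V :: "'k weil" and i j assume V: "is_weil V" and ij: "i < dim V" "j < ?n"
      have lt: "i * ?n + j < dim (V \<otimes>\<^sub>W W)" using tensor_index_less[OF ij] by simp
      have "coord (dim V) (ncmp (KA.coord ?n (Cmp K ?\<theta> (ap2 K (TRF W) (aadd (TRU W)) x y)) j) V) i =
        gadd (coord (dim V * ?n) (ncmp x V) (i * ?n + j)) (coord (dim V * ?n) (ncmp y V) (i * ?n + j))"
        using coord_theta[OF W V ij s] ncmp_TRU_op2[OF natural_ops(1) W V x y] coord_add[OF zV[OF x V] zV[OF y V] lt] by simp
      also have "\<dots> = coord (dim V) (ap2 U (tcar V) (aadd (talg V)) (ncmp (KA.coord ?n (Cmp K ?\<theta> x) j) V) (ncmp (KA.coord ?n (Cmp K ?\<theta> y) j) V)) i"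
        using coord_add[OF cV[OF x ij(2) V] cV[OF y ij(2) V] ij(1)] coord_theta[OF W V ij x] coord_theta[OF W V ij y] by simp
      also have "\<dots> = coord (dim V) (ncmp (KA.coord ?n (ap2 K ?P (aadd ?B) (Cmp K ?\<theta> x) (Cmp K ?\<theta> y)) j) V) i"
        using KA.coord_add[of "Cmp K ?\<theta> x" X W "Cmp K ?\<theta> y" j] \<theta>x \<theta>y ij(2) ncmp_ap2[OF natural_ops(1) c[OF x ij(2)] c[OF y ij(2)] V]
        by simp
      finally show "coord (dim V) (ncmp (KA.coord ?n (Cmp K ?\<theta> (ap2 K (TRF W) (aadd (TRU W)) x y)) j) V) i =
        coord (dim V) (ncmp (KA.coord ?n (ap2 K ?P (aadd ?B) (Cmp K ?\<theta> x) (Cmp K ?\<theta> y)) j) V) i" .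
    qed
  next
    fix X x y assume x: "x \<in> hom K X (TRF W)" and y: "y \<in> hom K X (TRF W)"
    note \<theta>x = FC.cmp_hom[OF x \<theta>] and \<theta>y = FC.cmp_hom[OF y \<theta>]
    note s = KP.ap2_hom[OF T_RF_Ob[OF W] x y tT(3)[unfolded TRU_simps(1)]]
    have X: "X \<in> Ob K" using FC.hom_ob(1)[OF x] .
    show "Cmp K ?\<theta> (ap2 K (TRF W) (amul (TRU W)) x y) = ap2 K ?P (amul ?B) (Cmp K ?\<theta> x) (Cmp K ?\<theta> y)"
    proof (rule K_pow_eqI[OF FC.cmp_hom[OF s \<theta>] KP.ap2_hom[OF ob \<theta>x \<theta>y tB(3)]])
      fix V :: "'k weil" and i j assume V: "is_weil V" and ij: "i < dim V" "j < ?n"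
      have lt: "i * ?n + j < dim (V \<otimes>\<^sub>W W)" using tensor_index_less[OF ij] by simp
      have XV: "fob X V \<in> Ob U" using functor_simps(1)[of Weil U X V] X V by simp
      interpret H: comm_alg "hom U (fob X V) car" gadd gmul "gzero (fob X V)" "gone (fob X V)" gneg gscal
        by (rule hom_comm_alg[OF XV])
      let ?x = "\<lambda>p. ncmp (KA.coord ?n (Cmp K ?\<theta> x) p) V" and ?y = "\<lambda>p. ncmp (KA.coord ?n (Cmp K ?\<theta> y) p) V"
      let ?trm = "\<lambda>p q. Cmp K (op1 (\<lambda>B. ascal B (sc W p q j)))
          (ap2 K RF (op2 amul) (KA.coord ?n (Cmp K ?\<theta> x) p) (KA.coord ?n (Cmp K ?\<theta> y) q))"
      let ?tV = "\<lambda>p q. Cmp U (ascal (talg V) (sc W p q j)) (ap2 U (tcar V) (amul (talg V)) (?x p) (?y q))"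
      have trm: "?trm p q \<in> hom K X RF" "ncmp (?trm p q) V = ?tV p q" if "p < ?n" "q < ?n" for p q
        using FC.cmp_hom[OF KP.ap2_hom[OF RF_Ob c[OF x that(1)] c[OF y that(2)] RU_op_hom(3)] RU_op_hom(7)]
          ncmp_ap2[OF natural_ops(2) c[OF x that(1)] c[OF y that(2)] V] V by (simp_all add: ncmp_op1)
      have mul: "ap2 U (tcar V) (amul (talg V)) (?x p) (?y q) \<in> hom U (fob X V) (tcar V)" if "p < ?n" "q < ?n" for p q
        by (rule ap2_hom[OF pow_ob_Ob cV[OF x that(1) V] cV[OF y that(2) V] talg_op_hom(3)])
      have tV: "?tV p q \<in> hom U (fob X V) (tcar V)" if "p < ?n" "q < ?n" for p q
        by (rule C.cmp_hom[OF mul[OF that] talg_op_hom(7)])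
      have ic: "asum U (talg V) (fob X V) ?n (?tV p) \<in> hom U (fob X V) (tcar V) \<and>
          coord (dim V) (asum U (talg V) (fob X V) ?n (?tV p)) i = asum U R (fob X V) ?n (\<lambda>q. coord (dim V) (?tV p q) i)"
        if "p < ?n" for p
        by (rule coord_asum[OF XV _ ij(1)]) (rule tV[OF that])
      have inner: "asum K (RU U R) X ?n (?trm p) \<in> hom K X RF" if "p < ?n" for p
        using KA.asum_hom[OF X, of ?n "?trm p"] trm(1)[OF that] by simp
      have arrow: "KA.coord ?n (ap2 K ?P (amul ?B) (Cmp K ?\<theta> x) (Cmp K ?\<theta> y)) j =
          asum K (RU U R) X ?n (\<lambda>p. asum K (RU U R) X ?n (?trm p))"
        using KA.coord_mul_asum[of "Cmp K ?\<theta> x" X W "Cmp K ?\<theta> y" j] \<theta>x \<theta>y ij(2) by (simp add: KA.mul_coord_def)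
      have tc: "coord (dim V) (?tV p q) i = gscal (sc W p q j) (H.tmul V (\<lambda>r. coord (dim V * ?n) (ncmp x V) (r * ?n + p))
          (\<lambda>s. coord (dim V * ?n) (ncmp y V) (s * ?n + q)) i)" if pq: "p < ?n" "q < ?n" for p q
      proof -
        have "H.tmul V (coord (dim V) (?x p)) (coord (dim V) (?y q)) i =
          H.tmul V (\<lambda>r. coord (dim V * ?n) (ncmp x V) (r * ?n + p)) (\<lambda>s. coord (dim V * ?n) (ncmp y V) (s * ?n + q)) i"
          by (rule H.tmul_cong) (simp_all add: coord_theta[OF W V _ pq(1) x] coord_theta[OF W V _ pq(2) y])
        thus ?thesis
          using coord_scal[OF mul[OF pq] ij(1)] coord_mul[OF cV[OF x pq(1) V] cV[OF y pq(2) V] ij(1)] by simp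
      qed
      have "coord (dim V) (ncmp (KA.coord ?n (ap2 K ?P (amul ?B) (Cmp K ?\<theta> x) (Cmp K ?\<theta> y)) j) V) i =
          coord (dim V) (asum U (talg V) (fob X V) ?n (\<lambda>p. ncmp (asum K (RU U R) X ?n (?trm p)) V)) i"
        unfolding arrow using ncmp_asum[OF X inner V, of ?n] by simp
      also have "\<dots> = coord (dim V) (asum U (talg V) (fob X V) ?n (\<lambda>p. asum U (talg V) (fob X V) ?n (?tV p))) i"
      proof (rule arg_cong[where f = "\<lambda>z. coord (dim V) z i"], rule asum_cong)
        fix p assume p: "p < ?n"
        have "ncmp (asum K (RU U R) X ?n (?trm p)) V = asum U (talg V) (fob X V) ?n (\<lambda>q. ncmp (?trm p q) V)"
          by (rule ncmp_asum[OF X trm(1)[OF p] V])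
        also have "\<dots> = asum U (talg V) (fob X V) ?n (?tV p)" by (rule asum_cong) (rule trm(2)[OF p])
        finally show "ncmp (asum K (RU U R) X ?n (?trm p)) V = asum U (talg V) (fob X V) ?n (?tV p)" .
      qed
      also have "\<dots> = asum U R (fob X V) ?n (\<lambda>p. coord (dim V) (asum U (talg V) (fob X V) ?n (?tV p)) i)"
        by (rule conjunct2[OF coord_asum[OF XV _ ij(1)]]) (rule conjunct1[OF ic])
      also have "\<dots> = asum U R (fob X V) ?n (\<lambda>p. asum U R (fob X V) ?n (\<lambda>q. coord (dim V) (?tV p q) i))"
        by (rule asum_cong) (rule conjunct2[OF ic])
      also have "\<dots> = H.ssum (\<lambda>p. H.ssum (\<lambda>q. coord (dim V) (?tV p q) i) {..<?n}) {..<?n}"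
        by (rule asum2_eq[OF XV]) (rule coord_hom[OF tV ij(1)])
      also have "\<dots> = H.ssum (\<lambda>p. H.ssum (\<lambda>q. gscal (sc W p q j) (H.tmul V (\<lambda>r. coord (dim V * ?n) (ncmp x V) (r * ?n + p))
          (\<lambda>s. coord (dim V * ?n) (ncmp y V) (s * ?n + q)) i)) {..<?n}) {..<?n}"
        by (intro H.ssum.cong refl) (simp add: tc)
      also have "\<dots> = H.tmul (V \<otimes>\<^sub>W W) (coord (dim V * ?n) (ncmp x V)) (coord (dim V * ?n) (ncmp y V)) (i * ?n + j)"
        by (rule H.tmul_tensor[symmetric]) (use coord_hom[OF zV[OF x V]] coord_hom[OF zV[OF y V]] ij in auto)
      also have "\<dots> = coord (dim V * ?n) (ncmp (ap2 K (TRF W) (amul (TRU W)) x y) V) (i * ?n + j)"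
        using ncmp_TRU_op2[OF natural_ops(2) W V x y] coord_mul[OF zV[OF x V] zV[OF y V] lt] by simp
      also have "\<dots> = coord (dim V) (ncmp (KA.coord ?n (Cmp K ?\<theta> (ap2 K (TRF W) (amul (TRU W)) x y)) j) V) i"
        using coord_theta[OF W V ij s] by simp
      finally show "coord (dim V) (ncmp (KA.coord ?n (Cmp K ?\<theta> (ap2 K (TRF W) (amul (TRU W)) x y)) j) V) i =
        coord (dim V) (ncmp (KA.coord ?n (ap2 K ?P (amul ?B) (Cmp K ?\<theta> x) (Cmp K ?\<theta> y)) j) V) i" by simp
    qed
  next
    fix X assume X: "X \<in> Ob K"
    note s = KP.ap0_hom[OF T_RF_Ob[OF W] X tT(4)[unfolded TRU_simps(1)]]
    show "Cmp K ?\<theta> (ap0 K (TRF W) (azero (TRU W)) X) = ap0 K ?P (azero ?B) X"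
    proof (rule K_pow_eqI[OF FC.cmp_hom[OF s \<theta>] KP.ap0_hom[OF ob X tB(4)]])
      fix V :: "'k weil" and i j assume V: "is_weil V" and ij: "i < dim V" "j < ?n"
      have lt: "i * ?n + j < dim (V \<otimes>\<^sub>W W)" using tensor_index_less[OF ij] by simp
      have XV: "fob X V \<in> Ob U" using functor_simps(1)[of Weil U X V] X V by simp
      show "coord (dim V) (ncmp (KA.coord ?n (Cmp K ?\<theta> (ap0 K (TRF W) (azero (TRU W)) X)) j) V) i =
        coord (dim V) (ncmp (KA.coord ?n (ap0 K ?P (azero ?B) X) j) V) i"
        using coord_theta[OF W V ij s] ncmp_TRU_op0[OF natural_ops(3) W V X] coord_zero[OF XV lt]
          KA.coord_zero[OF X ij(2)] ncmp_ap0[OF natural_ops(3) X V] coord_zero[OF XV ij(1)] by simp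
    qed
  next
    fix X assume X: "X \<in> Ob K"
    note s = KP.ap0_hom[OF T_RF_Ob[OF W] X tT(5)[unfolded TRU_simps(1)]]
    show "Cmp K ?\<theta> (ap0 K (TRF W) (aone (TRU W)) X) = ap0 K ?P (aone ?B) X"
    proof (rule K_pow_eqI[OF FC.cmp_hom[OF s \<theta>] KP.ap0_hom[OF ob X tB(5)]])
      fix V :: "'k weil" and i j assume V: "is_weil V" and ij: "i < dim V" "j < ?n"
      have lt: "i * ?n + j < dim (V \<otimes>\<^sub>W W)" using tensor_index_less[OF ij] by simp
      have XV: "fob X V \<in> Ob U" using functor_simps(1)[of Weil U X V] X V by simp
      have "i * ?n + j = 0 \<longleftrightarrow> i = 0 \<and> j = 0" using is_weil_dim[OF W] by auto
      thus "coord (dim V) (ncmp (KA.coord ?n (Cmp K ?\<theta> (ap0 K (TRF W) (aone (TRU W)) X)) j) V) i =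
        coord (dim V) (ncmp (KA.coord ?n (ap0 K ?P (aone ?B) X) j) V) i"
        using coord_theta[OF W V ij s] ncmp_TRU_op0[OF natural_ops(4) W V X] coord_one[OF XV lt]
          KA.coord_one[OF X ij(2)] ncmp_ap0[OF natural_ops(3) X V] ncmp_ap0[OF natural_ops(4) X V]
          coord_zero[OF XV ij(1)] coord_one[OF XV ij(1)] by auto
    qed
  next
    fix X x assume x: "x \<in> hom K X (TRF W)"
    note \<theta>x = FC.cmp_hom[OF x \<theta>]
    note s = FC.cmp_hom[OF x tT(6)[unfolded TRU_simps(1)]]
    show "Cmp K ?\<theta> (Cmp K (aneg (TRU W)) x) = Cmp K (aneg ?B) (Cmp K ?\<theta> x)"
    proof (rule K_pow_eqI[OF FC.cmp_hom[OF s \<theta>] FC.cmp_hom[OF \<theta>x tB(6)]])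
      fix V :: "'k weil" and i j assume V: "is_weil V" and ij: "i < dim V" "j < ?n"
      have lt: "i * ?n + j < dim (V \<otimes>\<^sub>W W)" using tensor_index_less[OF ij] by simp
      show "coord (dim V) (ncmp (KA.coord ?n (Cmp K ?\<theta> (Cmp K (aneg (TRU W)) x)) j) V) i =
        coord (dim V) (ncmp (KA.coord ?n (Cmp K (aneg ?B) (Cmp K ?\<theta> x)) j) V) i"
        using coord_theta[OF W V ij s] ncmp_TRU_op1[OF natural_ops(5) W V] coord_neg[OF zV[OF x V] lt] V
          KA.coord_neg[of "Cmp K ?\<theta> x" X W j] \<theta>x ij(2) coord_neg[OF cV[OF x ij(2) V] ij(1)] coord_theta[OF W V ij x]
        by (simp add: ncmp_op1)
    qed
  next
    fix X x a assume x: "x \<in> hom K X (TRF W)"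
    note \<theta>x = FC.cmp_hom[OF x \<theta>]
    note s = FC.cmp_hom[OF x tT(7)[of a, unfolded TRU_simps(1)]]
    show "Cmp K ?\<theta> (Cmp K (ascal (TRU W) a) x) = Cmp K (ascal ?B a) (Cmp K ?\<theta> x)"
    proof (rule K_pow_eqI[OF FC.cmp_hom[OF s \<theta>] FC.cmp_hom[OF \<theta>x tB(7)]])
      fix V :: "'k weil" and i j assume V: "is_weil V" and ij: "i < dim V" "j < ?n"
      have lt: "i * ?n + j < dim (V \<otimes>\<^sub>W W)" using tensor_index_less[OF ij] by simp
      show "coord (dim V) (ncmp (KA.coord ?n (Cmp K ?\<theta> (Cmp K (ascal (TRU W) a) x)) j) V) i =
        coord (dim V) (ncmp (KA.coord ?n (Cmp K (ascal ?B a) (Cmp K ?\<theta> x)) j) V) i"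
        using coord_theta[OF W V ij s] ncmp_TRU_op1[OF natural_ops(6) W V, of a] coord_scal[OF zV[OF x V] lt, of a] V
          KA.coord_scal[of "Cmp K ?\<theta> x" X W j a] \<theta>x ij(2) coord_scal[OF cV[OF x ij(2) V] ij(1), of a] coord_theta[OF W V ij x]
        by (simp add: ncmp_op1)
    qed
  qed
qed

lemma theta_kalg_iso: "is_weil W \<Longrightarrow> kalg_iso K (TRU W) (tensor_alg K (RU U R) W) (thetaU U R W)"
  using theta_kalg_hom[of W] theta_iso[of W] KA.acar_talg[of W] by (simp add: kalg_iso_def)

subsection \<open>Compatibility with \<open>\<alpha>\<close> and \<open>\<mu>\<close>\<close>

text \<open>In the coordinates \<open>(i, j)\<close> at \<open>V\<close>, the map induced by \<open>V \<otimes> \<phi>\<close> acts on the index \<open>j\<close> alone, by the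
  matrix of \<open>\<phi>\<close>, and this is also the action of \<open>\<phi>\<close> on the components \<open>j\<close> of a tuple.\<close>

lemma theta_natural:
  assumes \<phi>: "is_weil_hom \<phi>"
  shows "Cmp K (thetaU U R (tgt \<phi>)) (ncmp (alphaU U \<phi>) RF) = Cmp K (tensor_map K (RU U R) \<phi>) (thetaU U R (src \<phi>))"
proof -
  let ?n = "dim (src \<phi>)" and ?k = "dim (tgt \<phi>)" and ?X = "TRF (src \<phi>)"
  note W = is_weil_homD(1,2)[OF \<phi>]
  note X = T_RF_Ob[OF W(1)]
  have a: "ncmp (alphaU U \<phi>) RF \<in> hom K ?X (TRF (tgt \<phi>))"
    using functor_cat_hom_ncmp[OF alpha_hom[OF \<phi>] RF_Ob] .
  have t: "tensor_map K (RU U R) \<phi> \<in> hom K (pow_ob K RF ?n) (pow_ob K RF ?k)"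
    using KA.tensor_map_hom[of \<phi>] by simp
  note \<theta> = theta_hom[OF W(1)]
  show ?thesis
  proof (rule K_pow_eqI[OF FC.cmp_hom[OF a theta_hom[OF W(2)]] FC.cmp_hom[OF \<theta> t]])
    fix V :: "'k weil" and i j assume V: "is_weil V" and ij: "i < dim V" "j < ?k"
    let ?XV = "tcar (V \<otimes>\<^sub>W src \<phi>)"
    have XV: "fob ?X V = ?XV" using V W(1) by simp
    (* the generic element: the matrix acts on coordinates of elements, here those of the identity *)
    define x where "x = Ident U ?XV"
    have x: "x \<in> hom U ?XV ?XV" by (simp add: x_def C.ident_hom)
    interpret H: comm_alg "hom U ?XV car" gadd gmul "gzero ?XV" "gone ?XV" gneg gscal
      by (rule hom_comm_alg[OF pow_ob_Ob])
    have xc: "coord (dim V * ?n) x c \<in> hom U ?XV car" if "c < dim V * ?n" for c using coord_hom[OF x, of c] that by simp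
    have lt: "i * ?k + j < dim V * ?k" by (rule tensor_index_less[OF ij])
    have "coord (dim V) (ncmp (KA.coord ?k (Cmp K (thetaU U R (tgt \<phi>)) (ncmp (alphaU U \<phi>) RF)) j) V) i =
        coord (dim V * ?k) (tensor_map U R (wid V \<otimes>\<^sub>M \<phi>)) (i * ?k + j)"
      using coord_theta[OF W(2) V ij a] V RF_functor \<phi> by (simp add: is_weil_hom_mtens is_weil_hom_wid)
    also have "\<dots> = coord (dim V * ?k) (Cmp U (tensor_map U R (wid V \<otimes>\<^sub>M \<phi>)) x) (i * ?k + j)"
      using C.cmp_ident_right[OF tensor_map_hom[of "wid V \<otimes>\<^sub>M \<phi>"]] by (simp add: x_def)
    also have "\<dots> = H.tlin (dim V * ?n) (mat (wid V \<otimes>\<^sub>M \<phi>)) (coord (dim V * ?n) x) (i * ?k + j)"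
      using coord_tensor_map[of x ?XV "wid V \<otimes>\<^sub>M \<phi>" "i * ?k + j"] x lt by simp
    also have "\<dots> = H.ssum (\<lambda>l. gscal (mat \<phi> j l) (coord (dim V * ?n) x (i * ?n + l))) {..<?n}"
      by (rule H.tlin_wid_tensor[OF ij xc])
    also have "\<dots> = asum U R ?XV ?n (\<lambda>l. gscal (mat \<phi> j l) (coord (dim V * ?n) x (i * ?n + l)))"
      by (rule asum_eq[symmetric, OF pow_ob_Ob]) (rule gunary_hom(2)[OF xc[OF tensor_index_less[OF ij(1)]]])
    finally have l: "coord (dim V) (ncmp (KA.coord ?k (Cmp K (thetaU U R (tgt \<phi>)) (ncmp (alphaU U \<phi>) RF)) j) V) i = \<dots>" .
    have c: "KA.coord ?n (thetaU U R (src \<phi>)) l \<in> hom K ?X RF" if "l < ?n" for l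
      using KA.coord_hom[of "thetaU U R (src \<phi>)" ?X ?n l] \<theta> that by simp
    have \<theta>c: "coord (dim V) (ncmp (KA.coord ?n (thetaU U R (src \<phi>)) l) V) i = coord (dim V * ?n) x (i * ?n + l)" if l: "l < ?n" for l
      using coord_theta[OF W(1) V ij(1) l FC.ident_hom[OF X]] FC.cmp_ident_right[OF \<theta>] V W(1) by (simp add: x_def)
    let ?s = "\<lambda>l. Cmp K (op1 (\<lambda>B. ascal B (mat \<phi> j l))) (KA.coord ?n (thetaU U R (src \<phi>)) l)"
    let ?sV = "\<lambda>l. Cmp U (ascal (talg V) (mat \<phi> j l)) (ncmp (KA.coord ?n (thetaU U R (src \<phi>)) l) V)"
    have s: "?s l \<in> hom K ?X RF" if "l < ?n" for l by (rule FC.cmp_hom[OF c[OF that] RU_op_hom(7)])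
    have cV: "ncmp (KA.coord ?n (thetaU U R (src \<phi>)) l) V \<in> hom U ?XV (tcar V)" if "l < ?n" for l
      using K_hom_RF[OF c[OF that] V] XV by simp
    have "ncmp (KA.coord ?k (Cmp K (tensor_map K (RU U R) \<phi>) (thetaU U R (src \<phi>))) j) V =
        ncmp (asum K (RU U R) ?X ?n ?s) V"
      using KA.coord_tensor_map_asum[of "thetaU U R (src \<phi>)" ?X \<phi> j] \<theta> ij(2) by simp
    also have "\<dots> = asum U (talg V) ?XV ?n (\<lambda>l. ncmp (?s l) V)" using ncmp_asum[OF X s V] XV by simp
    also have "\<dots> = asum U (talg V) ?XV ?n ?sV" by (rule asum_cong) (use V in \<open>simp add: ncmp_op1\<close>)
    finally have "coord (dim V) (ncmp (KA.coord ?k (Cmp K (tensor_map K (RU U R) \<phi>) (thetaU U R (src \<phi>))) j) V) i =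
        coord (dim V) (asum U (talg V) ?XV ?n ?sV) i" by simp
    also have "\<dots> = asum U R ?XV ?n (\<lambda>l. coord (dim V) (?sV l) i)"
      by (rule conjunct2[OF coord_asum[OF pow_ob_Ob _ ij(1)]]) (rule C.cmp_hom[OF cV talg_op_hom(7)])
    also have "\<dots> = asum U R ?XV ?n (\<lambda>l. gscal (mat \<phi> j l) (coord (dim V * ?n) x (i * ?n + l)))"
      by (rule asum_cong) (simp add: coord_scal[OF cV ij(1)] \<theta>c)
    finally show "coord (dim V) (ncmp (KA.coord ?k (Cmp K (thetaU U R (tgt \<phi>)) (ncmp (alphaU U \<phi>) RF)) j) V) i =
      coord (dim V) (ncmp (KA.coord ?k (Cmp K (tensor_map K (RU U R) \<phi>) (thetaU U R (src \<phi>))) j) V) i"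
      using l by simp
  qed
qed

lemma theta_ground: "Cmp K (pow_pr K RF 1 0) (thetaU U R ground) = ncmp (upsilonU U) RF"
proof -
  have T: "TRF ground = RF" using RF_Ob by (simp add: T_ground)
  have "theta_coord ground 0 = Ident K RF"
  proof (rule K_eqI[OF _ FC.ident_hom[OF RF_Ob]])
    show "theta_coord ground 0 \<in> hom K RF RF" using theta_coord_hom[OF is_weil_ground, of 0] T by simp
    fix V :: "'k weil" assume V: "is_weil V"
    show "ncmp (theta_coord ground 0) V = ncmp (Ident K RF) V"
      using V by (simp add: ncmp_theta_coord wcoord_ground tensor_map_wid)
  qed
  thus ?thesis using pr_theta[OF is_weil_ground, of 0] upsilon_ncmp[OF RF_Ob] by simp
qed

text \<open>The coordinate \<open>(a, i, j)\<close> after \<open>V \<otimes> \<sigma>\<close> is the coordinate \<open>(a, j, i)\<close> before.\<close>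

lemma mat_wid_wswap:
  assumes a: "a < dim V" and W: "is_weil W\<^sub>1" "is_weil W\<^sub>2" and ij: "i < dim W\<^sub>1" "j < dim W\<^sub>2"
    and c: "c < dim V * (dim W\<^sub>2 * dim W\<^sub>1)"
  shows "mat (wid V \<otimes>\<^sub>M wswap W\<^sub>2 W\<^sub>1) (a * (dim W\<^sub>1 * dim W\<^sub>2) + (i * dim W\<^sub>2 + j)) c =
    (if c = a * (dim W\<^sub>2 * dim W\<^sub>1) + (j * dim W\<^sub>1 + i) then 1 else 0)"
proof -
  note d = is_weil_dim[OF W(1)] is_weil_dim[OF W(2)]
  let ?p = "c mod (dim W\<^sub>2 * dim W\<^sub>1)" and ?q = "c div (dim W\<^sub>2 * dim W\<^sub>1)"
  have p: "?p < dim W\<^sub>2 * dim W\<^sub>1" and q: "?q < dim V" using d div_less_dim[OF c] by auto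
  have lt: "i * dim W\<^sub>2 + j < dim W\<^sub>1 * dim W\<^sub>2" "j * dim W\<^sub>1 + i < dim W\<^sub>2 * dim W\<^sub>1"
    using tensor_index_less ij by auto
  have "mat (wid V \<otimes>\<^sub>M wswap W\<^sub>2 W\<^sub>1) (a * (dim W\<^sub>1 * dim W\<^sub>2) + (i * dim W\<^sub>2 + j)) c =
      (if a = ?q \<and> i * dim W\<^sub>2 + j = ?p mod dim W\<^sub>1 * dim W\<^sub>2 + ?p div dim W\<^sub>1 then 1 else 0)"
    using tensor_index_eq_iff[OF lt(1), of "a * (dim W\<^sub>1 * dim W\<^sub>2) + (i * dim W\<^sub>2 + j)" a] a p
    by (auto simp: mat_mtens wid_def wswap_eq_wperm[OF d(2,1)])
  moreover have "i * dim W\<^sub>2 + j = ?p mod dim W\<^sub>1 * dim W\<^sub>2 + ?p div dim W\<^sub>1 \<longleftrightarrow> ?p div dim W\<^sub>1 = j \<and> ?p mod dim W\<^sub>1 = i"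
    using tensor_index_eq_iff[OF div_less_dim[OF p], of "i * dim W\<^sub>2 + j" "?p mod dim W\<^sub>1"]
      tensor_index_eq_iff[OF ij(2), of "i * dim W\<^sub>2 + j" i] by auto
  moreover have "\<dots> \<longleftrightarrow> ?p = j * dim W\<^sub>1 + i" using tensor_index_eq_iff[OF ij(1), of ?p j] by simp
  moreover have "a = ?q \<and> ?p = j * dim W\<^sub>1 + i \<longleftrightarrow> c = a * (dim W\<^sub>2 * dim W\<^sub>1) + (j * dim W\<^sub>1 + i)"
    using tensor_index_eq_iff[OF lt(2), of c a] by auto
  ultimately show ?thesis by simp
qed

text \<open>At \<open>V\<close> and in the coordinate \<open>a\<close> of \<open>R \<otimes> V\<close>, both sides select the coordinate \<open>(a, j, i)\<close> of an
  element of \<open>R \<otimes> (V \<otimes> W\<^sub>2 \<otimes> W\<^sub>1)\<close>.\<close>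

lemma theta_tensor:
  assumes W: "is_weil W\<^sub>1" "is_weil W\<^sub>2" and ij: "i < dim W\<^sub>1" "j < dim W\<^sub>2"
  shows "Cmp K (Cmp K (pow_pr K RF (dim (W\<^sub>1 \<otimes>\<^sub>W W\<^sub>2)) (i * dim W\<^sub>2 + j)) (thetaU U R (W\<^sub>1 \<otimes>\<^sub>W W\<^sub>2))) (ncmp (muU U W\<^sub>1 W\<^sub>2) RF) =
    Cmp K (Cmp K (pow_pr K RF (dim W\<^sub>2) j) (thetaU U R W\<^sub>2)) (far (T W\<^sub>2) (Cmp K (pow_pr K RF (dim W\<^sub>1) i) (thetaU U R W\<^sub>1)))"
proof -
  let ?ij = "i * dim W\<^sub>2 + j"
  have lt: "?ij < dim (W\<^sub>1 \<otimes>\<^sub>W W\<^sub>2)" using tensor_index_less[OF ij] by simp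
  note W12 = is_weil_wtens[OF W]
  note c12 = theta_coord_hom[OF W12 lt] and c1 = theta_coord_hom[OF W(1) ij(1)] and c2 = theta_coord_hom[OF W(2) ij(2)]
  note m = mu_ncmp_hom[OF W RF_Ob] and Tc = far_T_hom[OF W(2) c1]
  have nt: "is_ntrans Weil U (theta_coord W\<^sub>1 i)" using c1 by (simp add: functor_cat_hom)
  show ?thesis unfolding pr_theta[OF W12 lt] pr_theta[OF W(1) ij(1)] pr_theta[OF W(2) ij(2)]
  proof (rule K_eqI[OF FC.cmp_hom[OF m c12] FC.cmp_hom[OF Tc c2]])
    fix V :: "'k weil" assume V: "is_weil V"
    let ?X = "tcar (V \<otimes>\<^sub>W W\<^sub>2 \<otimes>\<^sub>W W\<^sub>1)"
    have X: "fob (fob (T W\<^sub>2) (TRF W\<^sub>1)) V = ?X"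
      using V W RF_functor by (simp add: is_weil_wtens mult.assoc)
    have XV: "?X = tcar ((V \<otimes>\<^sub>W W\<^sub>2) \<otimes>\<^sub>W W\<^sub>1)" by (simp add: wtens_assoc)
    note h = K_hom_RF[OF FC.cmp_hom[OF m c12] V, unfolded X] K_hom_RF[OF FC.cmp_hom[OF Tc c2] V, unfolded X]
    show "ncmp (Cmp K (theta_coord (W\<^sub>1 \<otimes>\<^sub>W W\<^sub>2) ?ij) (ncmp (muU U W\<^sub>1 W\<^sub>2) RF)) V =
      ncmp (Cmp K (theta_coord W\<^sub>2 j) (far (T W\<^sub>2) (theta_coord W\<^sub>1 i))) V"
    proof (rule coord_eqI[OF h])
      fix a assume a: "a < dim V"
      let ?s = "wid V \<otimes>\<^sub>M wswap W\<^sub>2 W\<^sub>1"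
      define x where "x = Ident U ?X"
      have x: "x \<in> hom U ?X ?X" "x \<in> hom U ?X (tcar ((V \<otimes>\<^sub>W W\<^sub>2) \<otimes>\<^sub>W W\<^sub>1))"
        using C.ident_hom[of ?X] XV by (simp_all add: x_def)
      have s: "is_weil_hom ?s" using V W by (simp add: is_weil_hom_mtens is_weil_hom_wid is_weil_hom_wswap)
      have sh: "tensor_map U R ?s \<in> hom U ?X (tcar (V \<otimes>\<^sub>W W\<^sub>1 \<otimes>\<^sub>W W\<^sub>2))" using tensor_map_hom[of ?s] by simp
      have col: "a * (dim W\<^sub>2 * dim W\<^sub>1) + (j * dim W\<^sub>1 + i) < dim V * (dim W\<^sub>2 * dim W\<^sub>1)"
        by (rule tensor_index_less[OF a tensor_index_less[OF ij(2,1)]])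
      have row: "a * (dim W\<^sub>1 * dim W\<^sub>2) + ?ij < dim V * (dim W\<^sub>1 * dim W\<^sub>2)"
        using tensor_index_less[OF a lt] by simp
      have "coord (dim V) (ncmp (Cmp K (theta_coord (W\<^sub>1 \<otimes>\<^sub>W W\<^sub>2) ?ij) (ncmp (muU U W\<^sub>1 W\<^sub>2) RF)) V) a =
          coord (dim V * (dim W\<^sub>1 * dim W\<^sub>2)) (tensor_map U R ?s) (a * (dim W\<^sub>1 * dim W\<^sub>2) + ?ij)"
        using coord_theta_coord[OF W12 V a lt sh] V RF_functor s by simp
      also have "\<dots> = coord (dim (tgt ?s)) (Cmp U (tensor_map U R ?s) x) (a * (dim W\<^sub>1 * dim W\<^sub>2) + ?ij)"
        using C.cmp_ident_right[OF sh] by (simp add: x_def)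
      also have "\<dots> = coord (dim (src ?s)) x (a * (dim W\<^sub>2 * dim W\<^sub>1) + (j * dim W\<^sub>1 + i))"
        by (rule coord_tensor_map_delta) (use x(1) row col mat_wid_wswap[OF a W ij] in auto)
      also have "\<dots> = coord (dim (V \<otimes>\<^sub>W W\<^sub>2) * dim W\<^sub>1) x ((a * dim W\<^sub>2 + j) * dim W\<^sub>1 + i)"
        by (simp add: algebra_simps)
      also have "\<dots> = coord (dim (V \<otimes>\<^sub>W W\<^sub>2)) (Cmp U (ncmp (theta_coord W\<^sub>1 i) (V \<otimes>\<^sub>W W\<^sub>2)) x) (a * dim W\<^sub>2 + j)"
        by (rule coord_theta_coord[symmetric, OF W(1) is_weil_wtens[OF V W(2)] _ ij(1) x(2)])
          (use tensor_index_less[OF a ij(2)] in simp)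
      also have "\<dots> = coord (dim V) (Cmp U (ncmp (theta_coord W\<^sub>2 j) V) (Cmp U (ncmp (theta_coord W\<^sub>1 i) (V \<otimes>\<^sub>W W\<^sub>2)) x)) a"
      proof -
        have "Cmp U (ncmp (theta_coord W\<^sub>1 i) (V \<otimes>\<^sub>W W\<^sub>2)) x \<in> hom U ?X (tcar (V \<otimes>\<^sub>W W\<^sub>2))"
          using C.cmp_hom[OF x(2), of "ncmp (theta_coord W\<^sub>1 i) (V \<otimes>\<^sub>W W\<^sub>2)" "tcar (V \<otimes>\<^sub>W W\<^sub>2)"]
            K_hom_RF[OF c1 is_weil_wtens[OF V W(2)]] V W by (simp add: is_weil_wtens mult.assoc)
        from coord_theta_coord[OF W(2) V a ij(2) this] show ?thesis by simp
      qed
      also have "Cmp U (ncmp (theta_coord W\<^sub>1 i) (V \<otimes>\<^sub>W W\<^sub>2)) x = ncmp (theta_coord W\<^sub>1 i) (V \<otimes>\<^sub>W W\<^sub>2)"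
        using C.cmp_ident_right[OF K_hom_RF[OF c1 is_weil_wtens[OF V W(2)]]] V W by (simp add: x_def is_weil_wtens mult.assoc)
      finally show "coord (dim V) (ncmp (Cmp K (theta_coord (W\<^sub>1 \<otimes>\<^sub>W W\<^sub>2) ?ij) (ncmp (muU U W\<^sub>1 W\<^sub>2) RF)) V) a =
        coord (dim V) (ncmp (Cmp K (theta_coord W\<^sub>2 j) (far (T W\<^sub>2) (theta_coord W\<^sub>1 i))) V) a"
        using V nt by simp
    qed
  qed
qed

end

theorem theorem13:
  fixes U :: "('o, 'm) cat"
    and R :: "('k::{comm_ring, comm_monoid_mult}, 'o, 'm) kalg"
  assumes small_index: "infinite (UNIV :: 'i set)"
    and small_k: "\<exists>e :: 'k \<Rightarrow> 'i. inj e"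
    and "category U"
    and "complete_cat TYPE('i) U"
    and "cartesian_closed U"
    and "kalg_object U R"
  shows "dg_category (KU U) (RU U R) (TU U) (alphaU U) (upsilonU U) (muU U) (thetaU U R)"
proof -
  interpret U: category U by fact
  have lex: "left_exact_cat U" by (rule complete_imp_left_exact[OF assms(1,3,4)])
  interpret weil_functors U R
    by (intro weil_functors.intro two_cats.intro alg_in.intro power_cat.intro alg_in_axioms.intro
        power_cat_axioms.intro weil_functors_axioms.intro category_Weil assms(3,6) lex)
      (rule U.left_exact_powers[OF lex])
  obtain e :: "'k wmap \<Rightarrow> 'i" where e: "inj_on e (Ar Weil)" using Weil_small[OF small_index small_k] by blast
  have closed: "cartesian_closed K"
    by (rule functor_cat_cartesian_closed[OF category_Weil assms(3,1) e assms(4,5)])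
  show ?thesis unfolding KU_def
  proof (rule dg_category.intro)
    show "category K" by (rule FC.category_axioms)
    show "left_exact_cat K" by (rule K_left_exact)
    show "cartesian_closed K" by (rule closed)
    show "kalg_object K (RU U R)" by (rule RU_kalg_object)
    show "upsilonU U \<in> iso_hom (functor_cat K K) (T ground) (fid K)" by (rule upsilon_iso)
    show "Cmp K (pow_pr K (acar (RU U R)) 1 0) (thetaU U R ground) = ncmp (upsilonU U) (acar (RU U R))"
      unfolding RU_simps by (rule theta_ground)
  next
    fix W :: "'k weil" assume W: "is_weil W"
    show "left_exact_functor K K (T W)" by (rule T_left_exact[OF W])
    show "kalg_iso K (TRU W) (tensor_alg K (RU U R) W) (thetaU U R W)" by (rule theta_kalg_iso[OF W])
    show "alphaU U (wid W) = Ident (functor_cat K K) (T W)" by (rule alpha_id[OF W])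
    fix M assume M: "M \<in> Ob K"
    show "ncmp (muU U ground W) M = far (T W) (ncmp (upsilonU U) M)"
      "ncmp (muU U W ground) M = ncmp (upsilonU U) (fob (T W) M)"
      by (rule mu_ground[OF W M])+
  next
    fix W\<^sub>1 W\<^sub>2 :: "'k weil" assume W: "is_weil W\<^sub>1" "is_weil W\<^sub>2"
    show "muU U W\<^sub>1 W\<^sub>2 \<in> iso_hom (functor_cat K K) (fcomp K (T W\<^sub>2) (T W\<^sub>1)) (T (W\<^sub>1 \<otimes>\<^sub>W W\<^sub>2))"
      by (rule mu_iso[OF W])
    fix i j assume ij: "i < dim W\<^sub>1" "j < dim W\<^sub>2"
    show "Cmp K (Cmp K (pow_pr K (acar (RU U R)) (dim (W\<^sub>1 \<otimes>\<^sub>W W\<^sub>2)) (i * dim W\<^sub>2 + j)) (thetaU U R (W\<^sub>1 \<otimes>\<^sub>W W\<^sub>2)))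
        (ncmp (muU U W\<^sub>1 W\<^sub>2) (acar (RU U R))) =
      Cmp K (Cmp K (pow_pr K (acar (RU U R)) (dim W\<^sub>2) j) (thetaU U R W\<^sub>2))
        (far (T W\<^sub>2) (Cmp K (pow_pr K (acar (RU U R)) (dim W\<^sub>1) i) (thetaU U R W\<^sub>1)))"
      unfolding RU_simps by (rule theta_tensor[OF W ij])
  next
    fix \<phi> :: "'k wmap" assume \<phi>: "is_weil_hom \<phi>"
    show "alphaU U \<phi> \<in> hom (functor_cat K K) (T (src \<phi>)) (T (tgt \<phi>))" by (rule alpha_hom[OF \<phi>])
    show "Cmp K (thetaU U R (tgt \<phi>)) (ncmp (alphaU U \<phi>) (acar (RU U R))) =
        Cmp K (tensor_map K (RU U R) \<phi>) (thetaU U R (src \<phi>))"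
      unfolding RU_simps by (rule theta_natural[OF \<phi>])
    fix \<psi> :: "'k wmap" assume "is_weil_hom \<psi>" "tgt \<phi> = src \<psi>"
    thus "Cmp (functor_cat K K) (alphaU U \<psi>) (alphaU U \<phi>) = alphaU U (wcomp \<psi> \<phi>)" by (rule alpha_comp[OF \<phi>])
  next
    fix W\<^sub>1 W\<^sub>2 W\<^sub>3 :: "'k weil" and M assume W: "is_weil W\<^sub>1" "is_weil W\<^sub>2" "is_weil W\<^sub>3" and M: "M \<in> Ob K"
    show "Cmp K (ncmp (muU U (W\<^sub>1 \<otimes>\<^sub>W W\<^sub>2) W\<^sub>3) M) (far (T W\<^sub>3) (ncmp (muU U W\<^sub>1 W\<^sub>2) M)) =
      Cmp K (ncmp (muU U W\<^sub>1 (W\<^sub>2 \<otimes>\<^sub>W W\<^sub>3)) M) (ncmp (muU U W\<^sub>2 W\<^sub>3) (fob (T W\<^sub>1) M))"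
      by (rule mu_assoc[OF W M])
  qed
qed

end
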